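(* Let $\mathbf W$ be the ANWGN channel (defined below) with input cost constraint $\frac1n(x_1^2+\cdots+x_n^2)\le P$, $P>0$. Then for all $\varepsilon,\delta,\mu,\lambda\ge0$ with $\varepsilon<1$, $\mu+\lambda<1$, $\delta<1$, $$C_s(\varepsilon,P|\mathbf W)=D(\mu,\lambda,P|\mathbf W)=S(\delta,P|\mathbf W)=C_s(P|\mathbf W)=\frac1{4\pi}\int_{-\pi}^{\pi}\log\left(1+\frac{f(\lambda)}{g(\lambda)}\right)d\lambda.$$
   Context: ANWGN channel: $\mathbf Z=(Z_1,Z_2,\dots)$ is a stationary zero-mean Gaussian process which is purely nondeterministic (regular in the sense of prediction theory). Its autocorrelations are $\gamma_k=E(Z_iZ_{i+k})$ for $k\ge0$ and $\gamma_k=\gamma_{-k}$ for $k<0$; $V_n$ is the $n\times n$ matrix with $(i,j)$ entry $\gamma_{j-i}$. The channel has input/output alphabets $\mathbb R$ and $Y_i^{(n)}=X_i^{(n)}+Z_i$ with $(Z_1,\dots,Z_n)$ independent of the input, i.e. $W^n(\mathbf y|\mathbf x)=((2\pi)^n\det V_n)^{-1/2}\exp[-\frac12(\mathbf y-\mathbf x)V_n^{-1}(\mathbf y-\mathbf x)^T]$. The cost is $c_n(\mathbf x)=\sum x_i^2$ and $\mathcal X^n(P)=\{\mathbf x:\frac1nc_n(\mathbf x)\le P\}$. The spectral density is $g(\lambda)=\frac1{2\pi}\sum_{k=-\infty}^\infty\gamma_ke^{-ik\lambda}$, $-\pi\le\lambda\le\pi$; $f(\lambda)=\max[\alpha_P-g(\lambda),0]$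 where $\alpha_P>0$ is determined by $\int_{-\pi}^\pi f(\lambda)d\lambda=P$. $\mathcal S_P$ is the set of input processes $\mathbf X=\{X^n\}$ with $\Pr\{X^n\in\mathcal X^n(P)\}=1$ for all $n$; $Y^n$ is the output for input $X^n$; $QW^n(B)=\int W^n(B|\mathbf x)Q(d\mathbf x)$. Transmission codes: an $(n,M_n,\varepsilon_n,P)$ code is an encoder $\varphi_n:\{1,\dots,M_n\}\to\mathcal X^n(P)$ and a decoder $\psi_n:\mathbb R^n\to\{1,\dots,M_n\}$, with $\varepsilon_n=\frac1{M_n}\sum_iW^n(\mathcal D_i^c|\varphi_n(i))$, $\mathcal D_i=\psi_n^{-1}(i)$. $R$ is $(\varepsilon,P)$-achievable if such codes exist with $\limsup\varepsilon_n\le\varepsilon$, $\liminf\frac1n\log M_n\ge R$; $C_s(\varepsilon,P|\mathbf W)$ is the supremum of such $R$; $C_s(P|\mathbf W)=C_s(0,P|\mathbf W)$. Identification codes: an $(n,N_n,\mu_n,\lambda_n,P)$ code consists of distributions $Q_1,\dots,Q_{N_n}$ with $Q_i(\mathcal X^n(P))=1$ and (not necessarily disjoint) sets $\mathcal D_1,\dots,\mathcal D_{N_n}\subset\mathbb R^n$, with $\mu_n=\max_iQ_iW^n(\mathcal D_i^c)$, $\lambda_n=\max_{i\ne j}Q_jW^n(\mathcal D_i)$. $R$ is $(\mu,\lambda,P)$-achievable if such codes exist with $\limsup\mu_n\le\mu$, $\limsup\lambda_n\le\lambda$, $\liminf\frac1n\log\log N_n\ge R$; $D(\mu,\lambda,P|\mathbf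 W)$ is the supremum of such $R$. Resolvability: $d(P_1,P_2)=2\sup_B|P_1(B)-P_2(B)|$; $U_M$ uniform on $\{1,\dots,M\}$. For $\mathbf X\in\mathcal S_P$, $R$ is $(\delta,P)$-achievable for $\mathbf X$ if there are $M_n$ and maps $\varphi_n:\{1,\dots,M_n\}\to\mathcal X^n(P)$ such that, with $\tilde Y^n$ the output for input $\varphi_n(U_{M_n})$, $\limsup d(P_{Y^n},P_{\tilde Y^n})\le\delta$ and $\limsup\frac1n\log M_n\le R$. $R$ is $(\delta,P)$-achievable if so for all $\mathbf X\in\mathcal S_P$; $S(\delta,P|\mathbf W)$ is the infimum of such $R$. *)

theory Defs
  imports "HOL-Probability.Probability" "Jordan_Normal_Form.Gauss_Jordan_Elimination" "Jordan_Normal_Form.Determinant"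
begin

text \<open>Vectors of length n are functions nat => real on the index set {..<n}
  (index i corresponds to coordinate i+1 of the paper); R^n carries the
  product Borel structure.\<close>

definition Rn :: "nat \<Rightarrow> (nat \<Rightarrow> real) measure" where
  "Rn n = PiM {..<n} (\<lambda>_. lborel)"

definition var_comb :: "(int \<Rightarrow> real) \<Rightarrow> nat \<Rightarrow> (nat \<Rightarrow> real) \<Rightarrow> real" where
  "var_comb \<gamma> N c = (\<Sum>i<N. \<Sum>j<N. c i * c j * \<gamma> (int j - int i))"

definition in_closed_span_from :: "'a measure \<Rightarrow> (nat \<Rightarrow> 'a \<Rightarrow> real) \<Rightarrow> nat \<Rightarrow> ('a \<Rightarrow> real) \<Rightarrow> bool" where
  "in_closed_span_from M Z n Y \<longleftrightarrow>
     (\<forall>e>0. \<exists>N c. (\<integral>\<omega>. (Y \<omega> - (\<Sum>k\<in>{n..<N}. c k * Z k \<omega>))\<^sup>2 \<partial>M) < e)"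

definition purely_nondeterministic :: "'a measure \<Rightarrow> (nat \<Rightarrow> 'a \<Rightarrow> real) \<Rightarrow> bool" where
  "purely_nondeterministic M Z \<longleftrightarrow>
     (\<forall>Y. Y \<in> borel_measurable M \<and> integrable M (\<lambda>\<omega>. (Y \<omega>)\<^sup>2) \<and>
          (\<forall>n. in_closed_span_from M Z n Y) \<longrightarrow> (\<integral>\<omega>. (Y \<omega>)\<^sup>2 \<partial>M) = 0)"

text \<open>Z = (Z_1, Z_2, ...) (here Z 0, Z 1, ...) is a stationary zero-mean Gaussian
  process with autocorrelations E(Z_i Z_(i+k)) = gamma k, purely nondeterministic.
  Gaussianity: every finite linear combination is centered normal with the variance
  prescribed by gamma (a combination of variance 0 is a.s. 0 automatically).
  Together with the covariance condition this makes Z strictly stationary.\<close>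

definition ANWGN_noise :: "'a measure \<Rightarrow> (nat \<Rightarrow> 'a \<Rightarrow> real) \<Rightarrow> (int \<Rightarrow> real) \<Rightarrow> bool" where
  "ANWGN_noise M Z \<gamma> \<longleftrightarrow>
     prob_space M \<and>
     (\<forall>k. Z k \<in> borel_measurable M) \<and>
     (\<forall>k. integrable M (\<lambda>\<omega>. (Z k \<omega>)\<^sup>2)) \<and>
     (\<forall>k. (\<integral>\<omega>. Z k \<omega> \<partial>M) = 0) \<and>
     (\<forall>i j. (\<integral>\<omega>. Z i \<omega> * Z j \<omega> \<partial>M) = \<gamma> (int j - int i)) \<and>
     (\<forall>N c. var_comb \<gamma> N c > 0 \<longrightarrow>
        distributed M lborel (\<lambda>\<omega>. \<Sum>k<N. c k * Z k \<omega>)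
          (\<lambda>x. ennreal (normal_density 0 (sqrt (var_comb \<gamma> N c)) x))) \<and>
     purely_nondeterministic M Z"

text \<open>g is the spectral density of gamma: gamma k = int_{-pi}^{pi} e^{i k l} g(l) dl,
  i.e. g(l) = (1/2pi) sum_k gamma_k e^{-ikl}.\<close>

definition spectral_density :: "(int \<Rightarrow> real) \<Rightarrow> (real \<Rightarrow> real) \<Rightarrow> bool" where
  "spectral_density \<gamma> g \<longleftrightarrow>
     g \<in> borel_measurable lborel \<and> (\<forall>l\<in>{-pi..pi}. 0 \<le> g l) \<and>
     set_integrable lborel {-pi..pi} g \<and>
     (\<forall>k. complex_of_real (\<gamma> k) =
        (CLBINT l=-pi..pi. cis (real_of_int k * l) * complex_of_real (g l)))"

definition alpha_P :: "(real \<Rightarrow> real) \<Rightarrow> real \<Rightarrow> real" where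
  "alpha_P g P = (THE a. a > 0 \<and> (LBINT l=-pi..pi. max (a - g l) 0) = P)"

definition wf :: "(real \<Rightarrow> real) \<Rightarrow> real \<Rightarrow> real \<Rightarrow> real" where
  "wf g P l = max (alpha_P g P - g l) 0"

definition Vmat :: "(int \<Rightarrow> real) \<Rightarrow> nat \<Rightarrow> real mat" where
  "Vmat \<gamma> n = mat n n (\<lambda>(i, j). \<gamma> (int j - int i))"

definition Vinv :: "(int \<Rightarrow> real) \<Rightarrow> nat \<Rightarrow> real mat" where
  "Vinv \<gamma> n = the (mat_inverse (Vmat \<gamma> n))"

definition gdens :: "(int \<Rightarrow> real) \<Rightarrow> nat \<Rightarrow> (nat \<Rightarrow> real) \<Rightarrow> real" where
  "gdens \<gamma> n z =
     exp (- (1/2) * (\<Sum>i<n. \<Sum>j<n. z i * (Vinv \<gamma> n $$ (i, j)) * z j))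
       / sqrt ((2 * pi) ^ n * Determinant.det (Vmat \<gamma> n))"

definition W :: "(int \<Rightarrow> real) \<Rightarrow> nat \<Rightarrow> (nat \<Rightarrow> real) \<Rightarrow> (nat \<Rightarrow> real) measure" where
  "W \<gamma> n x = density (Rn n) (\<lambda>y. ennreal (gdens \<gamma> n (\<lambda>i. y i - x i)))"

definition costset :: "nat \<Rightarrow> real \<Rightarrow> (nat \<Rightarrow> real) set" where
  "costset n P = {x \<in> space (Rn n). (\<Sum>i<n. (x i)\<^sup>2) / real n \<le> P}"

definition outp :: "(int \<Rightarrow> real) \<Rightarrow> nat \<Rightarrow> (nat \<Rightarrow> real) measure \<Rightarrow> (nat \<Rightarrow> real) set \<Rightarrow> real" where
  "outp \<gamma> n Q B = (\<integral>x. measure (W \<gamma> n x) B \<partial>Q)"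

definition admissible_input :: "nat \<Rightarrow> real \<Rightarrow> (nat \<Rightarrow> real) measure \<Rightarrow> bool" where
  "admissible_input n P Q \<longleftrightarrow>
     prob_space Q \<and> sets Q = sets (Rn n) \<and> emeasure Q (costset n P) = 1"

definition tcode :: "nat \<Rightarrow> nat \<Rightarrow> real \<Rightarrow> (nat \<Rightarrow> nat \<Rightarrow> real) \<Rightarrow> ((nat \<Rightarrow> real) \<Rightarrow> nat) \<Rightarrow> bool" where
  "tcode n Mn P \<phi> \<psi> \<longleftrightarrow> 1 \<le> Mn \<and>
     (\<forall>i\<in>{1..Mn}. \<phi> i \<in> costset n P) \<and>
     (\<forall>y\<in>space (Rn n). \<psi> y \<in> {1..Mn}) \<and>
     (\<forall>i\<in>{1..Mn}. \<psi> -` {i} \<inter> space (Rn n) \<in> sets (Rn n))"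

definition terr :: "(int \<Rightarrow> real) \<Rightarrow> nat \<Rightarrow> nat \<Rightarrow> (nat \<Rightarrow> nat \<Rightarrow> real) \<Rightarrow> ((nat \<Rightarrow> real) \<Rightarrow> nat) \<Rightarrow> real" where
  "terr \<gamma> n Mn \<phi> \<psi> =
     (\<Sum>i\<in>{1..Mn}. measure (W \<gamma> n (\<phi> i)) (space (Rn n) - \<psi> -` {i})) / real Mn"

definition t_achievable :: "(int \<Rightarrow> real) \<Rightarrow> real \<Rightarrow> real \<Rightarrow> real \<Rightarrow> bool" where
  "t_achievable \<gamma> \<epsilon> P R \<longleftrightarrow>
     (\<exists>Ms \<phi> \<psi>. (\<forall>n. tcode n (Ms n) P (\<phi> n) (\<psi> n)) \<and>
        limsup (\<lambda>n. ereal (terr \<gamma> n (Ms n) (\<phi> n) (\<psi> n))) \<le> ereal \<epsilon> \<and>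
        ereal R \<le> liminf (\<lambda>n. ereal (ln (real (Ms n)) / real n)))"

definition Cs :: "(int \<Rightarrow> real) \<Rightarrow> real \<Rightarrow> real \<Rightarrow> ereal" where
  "Cs \<gamma> \<epsilon> P = (SUP R\<in>{R. t_achievable \<gamma> \<epsilon> P R}. ereal R)"

definition idcode :: "nat \<Rightarrow> nat \<Rightarrow> real \<Rightarrow> (nat \<Rightarrow> (nat \<Rightarrow> real) measure) \<Rightarrow> (nat \<Rightarrow> (nat \<Rightarrow> real) set) \<Rightarrow> bool" where
  "idcode n Nn P Q D \<longleftrightarrow> 1 \<le> Nn \<and>
     (\<forall>i\<in>{1..Nn}. admissible_input n P (Q i) \<and> D i \<in> sets (Rn n))"

definition id_mu :: "(int \<Rightarrow> real) \<Rightarrow> nat \<Rightarrow> nat \<Rightarrow> (nat \<Rightarrow> (nat \<Rightarrow> real) measure) \<Rightarrow> (nat \<Rightarrow> (nat \<Rightarrow> real) set) \<Rightarrow> real" where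
  "id_mu \<gamma> n Nn Q D = Max ((\<lambda>i. outp \<gamma> n (Q i) (space (Rn n) - D i)) ` {1..Nn})"

text \<open>max over i ~= j; for a single message (no such pair) it is taken to be 0.\<close>
definition id_lam :: "(int \<Rightarrow> real) \<Rightarrow> nat \<Rightarrow> nat \<Rightarrow> (nat \<Rightarrow> (nat \<Rightarrow> real) measure) \<Rightarrow> (nat \<Rightarrow> (nat \<Rightarrow> real) set) \<Rightarrow> real" where
  "id_lam \<gamma> n Nn Q D =
     Max (insert 0 ((\<lambda>(i, j). outp \<gamma> n (Q j) (D i)) ` {(i, j). i \<in> {1..Nn} \<and> j \<in> {1..Nn} \<and> i \<noteq> j}))"

definition id_achievable :: "(int \<Rightarrow> real) \<Rightarrow> real \<Rightarrow> real \<Rightarrow> real \<Rightarrow> real \<Rightarrow> bool" where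
  "id_achievable \<gamma> \<mu> lam P R \<longleftrightarrow>
     (\<exists>Ns Q D. (\<forall>n. idcode n (Ns n) P (Q n) (D n)) \<and>
        limsup (\<lambda>n. ereal (id_mu \<gamma> n (Ns n) (Q n) (D n))) \<le> ereal \<mu> \<and>
        limsup (\<lambda>n. ereal (id_lam \<gamma> n (Ns n) (Q n) (D n))) \<le> ereal lam \<and>
        ereal R \<le> liminf (\<lambda>n. ereal (ln (ln (real (Ns n))) / real n)))"

definition Did :: "(int \<Rightarrow> real) \<Rightarrow> real \<Rightarrow> real \<Rightarrow> real \<Rightarrow> ereal" where
  "Did \<gamma> \<mu> lam P = (SUP R\<in>{R. id_achievable \<gamma> \<mu> lam P R}. ereal R)"

text \<open>d(P_{Y^n}, P_{tilde Y^n}) where tilde Y^n is the output for input phi(U_M).\<close>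
definition res_dist :: "(int \<Rightarrow> real) \<Rightarrow> nat \<Rightarrow> (nat \<Rightarrow> real) measure \<Rightarrow> nat \<Rightarrow> (nat \<Rightarrow> nat \<Rightarrow> real) \<Rightarrow> real" where
  "res_dist \<gamma> n Q Mn \<phi> =
     2 * (SUP B\<in>sets (Rn n).
            \<bar>outp \<gamma> n Q B - (\<Sum>i\<in>{1..Mn}. measure (W \<gamma> n (\<phi> i)) B) / real Mn\<bar>)"

text \<open>Input processes in S_P: sequences of distributions of X^n.\<close>
definition S_P :: "real \<Rightarrow> (nat \<Rightarrow> (nat \<Rightarrow> real) measure) set" where
  "S_P P = {X. \<forall>n. admissible_input n P (X n)}"

definition res_achievable_for :: "(int \<Rightarrow> real) \<Rightarrow> real \<Rightarrow> real \<Rightarrow> (nat \<Rightarrow> (nat \<Rightarrow> real) measure) \<Rightarrow> real \<Rightarrow> bool" where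
  "res_achievable_for \<gamma> \<delta> P X R \<longleftrightarrow>
     (\<exists>Ms \<phi>. (\<forall>n. 1 \<le> Ms n \<and> (\<forall>i\<in>{1..Ms n}. \<phi> n i \<in> costset n P)) \<and>
        limsup (\<lambda>n. ereal (res_dist \<gamma> n (X n) (Ms n) (\<phi> n))) \<le> ereal \<delta> \<and>
        limsup (\<lambda>n. ereal (ln (real (Ms n)) / real n)) \<le> ereal R)"

definition Sres :: "(int \<Rightarrow> real) \<Rightarrow> real \<Rightarrow> real \<Rightarrow> ereal" where
  "Sres \<gamma> \<delta> P = (INF R\<in>{R. \<forall>X\<in>S_P P. res_achievable_for \<gamma> \<delta> P X R}. ereal R)"

end

theory Submission
  imports Defs
begin

text \<open>Folding the spectral density to a weight G on the circle, regularity of the noise becomes, by Szego's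
  theorem, integrability of ln G, and exp of its mean is a lower bound for all one-step prediction errors.
  A Cholesky factor L of the noise covariance turns the channel into y = x + L u with u standard Gaussian,
  and log determinants of covariances and variances of quadratic forms in u are controlled through
  polynomials that nearly whiten the spectrum.

  Water filling compares the densities of W(.|x) with the single density q of a stationary Gaussian
  process with spectrum max(G, theta), theta the water level. For every admissible x the information
  density is at most n (C + o(1)) outside an event of small probability, by Chebyshev's inequality. This
  upper bound on the information spectrum, uniform in x, yields the strong converse for transmission and,
  since it makes every output law resolvable by exp(n (C + o(1))) inputs, the upper bound for resolvability.
  Feinstein's lemma with Gaussian inputs of spectrum just below max(theta - G, 0) gives codes at rate C, and
  concatenating such a code with a Gilbert code gives doubly exponentially many identification messages.
  Finally an identification rate never exceeds a resolvability rate: after quantising the input space,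
  two messages whose resolving codebooks agree have nearly equal output laws, and there are only
  exp(exp(n (R + o(1)))) codebooks.\<close>

section \<open>Real polynomials on the circle\<close>

text \<open>\<open>U\<close> lives on the half circle because real covariances see only the even
  part of a spectrum. The obstacle is that the weight \<open>G\<close> is merely integrable with
  integrable logarithm: it may be unbounded and come close to 0, so covariance matrices have no
  uniform spectral bounds. Two facts replace such bounds. The norm of an n-dimensional covariance is
  o(n), enough for Chebyshev at deviations of order n, where variances are o(n) times n. And the
  diagonal of a Cholesky factor consists of finite-past prediction errors, so log determinants
  follow from Szego's theorem without eigenvalue asymptotics. The converse is uniform over inputs
  because the inverse of max(G, \<theta>) is at most 1/\<theta>: an input of admissible energy
  contributes at most n P/\<theta> to the exponent, the noise n times the mean of G/max(G,
  \<theta>), and the choice of the water level makes these add up to n. The comparison density is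
  autoregressive: its whitening matrix is a truncated multiplication by a polynomial with constant
  coefficient 1, so its determinant is explicit at every n.\<close>

definition U :: "real measure" where
  "U = density lborel (\<lambda>x. ennreal (indicator {0<..<pi} x / pi))"

lemma sets_U[measurable_cong, simp]: "sets U = sets borel"
  by (simp add: U_def)

lemma space_U[simp]: "space U = UNIV"
  by (simp add: U_def)

lemma AE_U_I: "(AE x in lborel. x \<in> {0<..<pi} \<longrightarrow> P x) \<Longrightarrow> (AE x in U. P x)"
  unfolding U_def by (subst AE_density) (auto simp: indicator_def)

lemma AE_U_in: "AE x in U. x \<in> {0<..<pi}"
  by (rule AE_U_I) simp

interpretation U: prob_space U
proof
  have "emeasure U (space U) = (\<integral>\<^sup>+x. ennreal (1/pi) * indicator {0<..<pi} x \<partial>lborel)"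
    unfolding U_def
    by (simp add: emeasure_density ennreal_indicator[symmetric] del: ennreal_indicator)
       (auto intro!: nn_integral_cong simp: indicator_def)
  also have "\<dots> = 1"
    by (subst nn_integral_cmult_indicator) (auto simp: ennreal_mult[symmetric])
  finally show "emeasure U (space U) = 1" .
qed

lemma integral_U:
  fixes f :: "real \<Rightarrow> real"
  assumes [measurable]: "f \<in> borel_measurable borel"
  shows "(\<integral>x. f x \<partial>U) = (LBINT x=0..pi. f x) / pi"
proof -
  have "(\<integral>x. f x \<partial>U) = (\<integral>x. (indicator {0<..<pi} x / pi) *\<^sub>R f x \<partial>lborel)"
    unfolding U_def by (rule integral_density) auto
  also have "\<dots> = (\<integral>x. (indicator {0<..<pi} x *\<^sub>R f x) / pi \<partial>lborel)"
    by (rule Bochner_Integration.integral_cong) auto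
  also have "\<dots> = (LBINT x=0..pi. f x) / pi"
    by (simp add: interval_lebesgue_integral_def set_lebesgue_integral_def zero_ereal_def)
  finally show ?thesis .
qed

lemma prob_U_UNIV[simp]: "measure U UNIV = 1"
  using U.prob_space by simp

lemma integrable_U:
  fixes f :: "real \<Rightarrow> real"
  assumes [measurable]: "f \<in> borel_measurable borel"
  shows "integrable U f \<longleftrightarrow> set_integrable lborel {0<..<pi} f"
proof -
  have "integrable U f \<longleftrightarrow> integrable lborel (\<lambda>x. (indicator {0<..<pi} x / pi) *\<^sub>R f x)"
    unfolding U_def by (rule integrable_density) auto
  also have "\<dots> \<longleftrightarrow> integrable lborel (\<lambda>x. (1/pi) * (indicator {0<..<pi} x *\<^sub>R f x))"
    by (intro arg_cong[where f="integrable lborel"]) auto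
  also have "\<dots> \<longleftrightarrow> set_integrable lborel {0<..<pi} f"
    unfolding set_integrable_def by (subst integrable_mult_left_iff) auto
  finally show ?thesis .
qed

lemma U_integrable_bounded:
  fixes f :: "real \<Rightarrow> real"
  assumes "f \<in> borel_measurable borel" "\<And>x. \<bar>f x\<bar> \<le> B"
  shows "integrable U f"
  by (rule U.integrable_const_bound[where B=B]) (use assms in auto)

lemma U_integrable_mult_bounded:
  fixes f :: "real \<Rightarrow> real"
  assumes [measurable]: "f \<in> borel_measurable borel" "integrable U G" and "\<And>x. \<bar>f x\<bar> \<le> B"
  shows "integrable U (\<lambda>x. f x * G x)"
proof (rule Bochner_Integration.integrable_bound[of U "\<lambda>x. B * \<bar>G x\<bar>"])
  show "AE x in U. norm (f x * G x) \<le> norm (B * \<bar>G x\<bar>)"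
    using assms(3) by (auto simp: abs_mult intro!: mult_right_mono order_trans[OF assms(3) abs_ge_self])
qed (use assms in auto)

lemma integral_cos_U: "(\<integral>x. cos (real_of_int k * x) \<partial>U) = (if k = 0 then 1 else 0)"
proof (cases "k = 0")
  case True then show ?thesis by simp
next
  case False
  have "(LBINT x=0..pi. cos (real_of_int k * x)) = sin (real_of_int k * pi) / real_of_int k - sin (real_of_int k * 0) / real_of_int k"
    unfolding zero_ereal_def using False
    by (intro interval_integral_FTC_finite)
       (auto intro!: continuous_intros derivative_eq_intros simp flip: has_real_derivative_iff_has_vector_derivative)
  also have "\<dots> = 0" using sin_integer_2pi by (simp add: sin_times_pi_eq_0)
  finally show ?thesis using False by (subst integral_U) auto
qed

text \<open>The value of \<open>p\<close> at the point exp(i l) of the unit circle. Coefficients are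
  real, so the value at -l is the complex conjugate and the half circle carries all moduli.\<close>

definition ev :: "real poly \<Rightarrow> real \<Rightarrow> complex" where
  "ev p l = poly (map_poly complex_of_real p) (cis l)"

lemma ev_pCons: "ev (pCons a p) l = of_real a + cis l * ev p l"
  by (simp add: ev_def map_poly_pCons)

lemma ev_0[simp]: "ev 0 l = 0"
  by (simp add: ev_def)

lemma ev_add: "ev (p + q) l = ev p l + ev q l"
  by (induction p q rule: poly_induct2) (simp_all add: ev_pCons algebra_simps)

lemma ev_smult: "ev (Polynomial.smult c p) l = of_real c * ev p l"
  by (induction p) (simp_all add: ev_pCons algebra_simps)

lemma ev_mult: "ev (p * q) l = ev p l * ev q l"
  by (induction p) (simp_all add: ev_pCons ev_add ev_smult algebra_simps)

lemma ev_const: "ev [:c:] l = of_real c"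
  by (simp add: ev_pCons)

lemma ev_power: "ev (p ^ n) l = ev p l ^ n"
  by (induction n) (simp_all add: ev_mult ev_const one_pCons)

lemma ev_sum: "ev (\<Sum>i\<in>A. p i) l = (\<Sum>i\<in>A. ev (p i) l)"
  by (induction A rule: infinite_finite_induct) (simp_all add: ev_add)

lemma ev_monom: "ev (monom c n) l = of_real c * cis (real n * l)"
  by (induction n) (simp_all add: monom_0 monom_Suc ev_pCons cis_mult algebra_simps)

lemma ev_eq:
  assumes "\<And>i. i \<ge> n \<Longrightarrow> coeff p i = 0"
  shows "ev p l = (\<Sum>i<n. of_real (coeff p i) * cis (real i * l))"
proof -
  have "p = (\<Sum>i<n. monom (coeff p i) i)"
    by (rule poly_eqI) (use assms in \<open>force simp: coeff_sum if_distrib cong: if_cong\<close>)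
  then have "ev p l = ev (\<Sum>i<n. monom (coeff p i) i) l" by simp
  then show ?thesis by (simp add: ev_sum ev_monom)
qed

lemma cmod_trig_sum:
  "(cmod (\<Sum>i<n. of_real (c i) * cis (real i * l)))\<^sup>2 = (\<Sum>i<n. \<Sum>j<n. c i * c j * cos (real_of_int (int j - int i) * l))"
proof -
  let ?s = "\<Sum>i<n. of_real (c i) * cis (real i * l)"
  have "(cmod ?s)\<^sup>2 = (\<Sum>i<n. c i * cos (real i * l))\<^sup>2 + (\<Sum>i<n. c i * sin (real i * l))\<^sup>2"
    by (simp add: cmod_power2)
  also have "\<dots> = (\<Sum>i<n. \<Sum>j<n. c i * c j * cos (real_of_int (int j - int i) * l))"
    unfolding power2_eq_square sum_product sum.distrib[symmetric]
    by (intro sum.cong refl) (simp add: left_diff_distrib cos_diff algebra_simps)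
  finally show ?thesis .
qed

definition polyn :: "nat \<Rightarrow> (nat \<Rightarrow> real) \<Rightarrow> real poly" where
  "polyn n c = (\<Sum>i<n. monom (c i) i)"

lemma coeff_polyn: "coeff (polyn n c) i = (if i < n then c i else 0)"
  by (auto simp: polyn_def coeff_sum if_distrib cong: if_cong)

lemma cmod_ev_polyn: "(cmod (ev (polyn n c) l))\<^sup>2 = (\<Sum>i<n. \<Sum>j<n. c i * c j * cos (real_of_int (int j - int i) * l))"
proof -
  have "ev (polyn n c) l = (\<Sum>i<n. of_real (c i) * cis (real i * l))"
    by (subst ev_eq[of n]) (auto simp: coeff_polyn intro!: sum.cong)
  then show ?thesis by (simp only: cmod_trig_sum)
qed

lemma polyn_coeff: "degree p < n \<Longrightarrow> polyn n (coeff p) = p"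
  by (rule poly_eqI) (auto simp: coeff_polyn coeff_eq_0)

lemma ev_measurable[measurable]: "ev p \<in> borel_measurable borel"
proof -
  have "ev p = (\<lambda>l. \<Sum>i<Suc (degree p). of_real (coeff p i) * cis (real i * l))"
    by (rule ext, rule ev_eq) (simp add: coeff_eq_0)
  then show ?thesis
    by (simp only:) (intro borel_measurable_continuous_onI continuous_intros)
qed

lemma cmod_ev_bounded: "\<exists>B\<ge>0. \<forall>l. cmod (ev p l) \<le> B"
proof (intro exI conjI allI)
  fix l
  have "cmod (ev p l) \<le> (\<Sum>i<Suc (degree p). cmod (of_real (coeff p i) * cis (real i * l)))"
    by (subst ev_eq[of "Suc (degree p)"]) (auto intro: coeff_eq_0 norm_sum simp del: sum.lessThan_Suc)
  also have "\<dots> = (\<Sum>i<Suc (degree p). \<bar>coeff p i\<bar>)"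
    by (simp add: norm_mult)
  finally show "cmod (ev p l) \<le> (\<Sum>i<Suc (degree p). \<bar>coeff p i\<bar>)" .
qed (auto intro: sum_nonneg)

lemma integrable_cmod_ev:
  assumes "integrable U G" shows "integrable U (\<lambda>l. (cmod (ev p l))\<^sup>2 * G l)"
proof -
  obtain B where "\<And>l. cmod (ev p l) \<le> B" using cmod_ev_bounded by blast
  then show ?thesis
    by (intro U_integrable_mult_bounded[where B="B\<^sup>2"]) (use assms in \<open>auto intro: power_mono\<close>)
qed

text \<open>Dictionary between linear algebra and the circle: expanding the squared modulus produces
  the Toeplitz matrix of cosines, so stationary quadratic forms are squared norms of polynomials in
  L2 with weight \<open>G\<close>. Bounds on covariance matrices become bounds on weighted
  polynomial norms.\<close>

lemma qform_integral:
  assumes "integrable U G" and \<gamma>: "\<And>k. \<gamma> k = (\<integral>l. cos (real_of_int k * l) * G l \<partial>U)"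
  shows "(\<Sum>i<n. \<Sum>j<n. c i * c j * \<gamma> (int j - int i)) = (\<integral>l. (cmod (ev (polyn n c) l))\<^sup>2 * G l \<partial>U)"
proof -
  have I: "integrable U (\<lambda>l. cos (real_of_int k * l) * G l)" for k
    by (intro U_integrable_mult_bounded[where B=1]) (use assms in auto)
  have "(\<integral>l. (cmod (ev (polyn n c) l))\<^sup>2 * G l \<partial>U) = (\<integral>l. (\<Sum>i<n. \<Sum>j<n. c i * c j * (cos (real_of_int (int j - int i) * l) * G l)) \<partial>U)"
    by (simp only: cmod_ev_polyn sum_distrib_right mult.assoc)
  also have "\<dots> = (\<Sum>i<n. \<Sum>j<n. c i * c j * (\<integral>l. cos (real_of_int (int j - int i) * l) * G l \<partial>U))"
    using I by (subst Bochner_Integration.integral_sum)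
      (auto intro!: Bochner_Integration.integrable_sum sum.cong simp: Bochner_Integration.integral_sum simp del: of_int_diff)
  finally show ?thesis by (simp only: \<gamma>)
qed

lemma parseval_polyn: "(\<integral>l. (cmod (ev (polyn n c) l))\<^sup>2 \<partial>U) = (\<Sum>i<n. (c i)\<^sup>2)"
proof -
  have "(\<integral>l. (cmod (ev (polyn n c) l))\<^sup>2 * 1 \<partial>U) = (\<Sum>i<n. \<Sum>j<n. c i * c j * (if int j - int i = 0 then 1 else 0))"
    by (rule qform_integral[symmetric]) (auto simp: integral_cos_U simp del: of_int_diff)
  also have "\<dots> = (\<Sum>i<n. \<Sum>j<n. if j = i then c i * c j else 0)"
    by (intro sum.cong) auto
  finally show ?thesis by (simp add: power2_eq_square)
qed

lemma parseval: "degree p < n \<Longrightarrow> (\<integral>l. (cmod (ev p l))\<^sup>2 \<partial>U) = (\<Sum>i<n. (coeff p i)\<^sup>2)"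
  using parseval_polyn[of n "coeff p"] by (simp add: polyn_coeff)

lemma ev_continuous: "continuous_on S (ev p)"
proof -
  have "ev p = (\<lambda>l. \<Sum>i<Suc (degree p). of_real (coeff p i) * cis (real i * l))"
    by (rule ext, rule ev_eq) (simp add: coeff_eq_0)
  then show ?thesis
    by (simp only:) (intro continuous_intros)
qed

lemma Re_ev: "Re (ev p l) = (\<Sum>i<Suc (degree p). coeff p i * cos (real i * l))"
  by (subst ev_eq[of "Suc (degree p)"]) (auto simp: coeff_eq_0 simp del: sum.lessThan_Suc)

text \<open>All nonconstant cosines have mean 0 under \<open>U\<close>. This mean value property is
  what ties the constant coefficient of a polynomial to an integral in Szego's theorem.\<close>

lemma integral_Re_ev: "(\<integral>l. Re (ev p l) \<partial>U) = coeff p 0"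
proof -
  have "(\<integral>l. Re (ev p l) \<partial>U) = (\<Sum>i<Suc (degree p). \<integral>l. coeff p i * cos (real i * l) \<partial>U)"
    unfolding Re_ev
    by (intro Bochner_Integration.integral_sum integrable_mult_right U_integrable_bounded[where B=1]) auto
  also have "\<dots> = (\<Sum>i<Suc (degree p). coeff p i * (if i = 0 then 1 else 0))"
    using integral_cos_U[of "int i" for i] by (intro sum.cong refl) auto
  also have "\<dots> = coeff p 0"
    by (subst sum.lessThan_Suc_shift) simp
  finally show ?thesis .
qed

text \<open>The product-to-sum formula makes the cosine polynomials an algebra, so that
  Stone--Weierstrass applies to them.\<close>

lemma cosine_poly_mult: "\<exists>r. \<forall>l. Re (ev p l) * Re (ev q l) = Re (ev r l)"
proof -
  define r where "r = (\<Sum>i<Suc (degree p). \<Sum>j<Suc (degree q).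
     Polynomial.smult (coeff p i * coeff q j / 2) (monom 1 (i + j) + monom 1 (if i \<le> j then j - i else i - j)))"
  have "Re (ev p l) * Re (ev q l) = Re (ev r l)" for l
  proof -
    show ?thesis
      unfolding Re_ev sum_product r_def ev_sum ev_smult ev_add ev_monom Re_sum
      by (intro sum.cong refl) (auto simp: of_nat_diff left_diff_distrib distrib_right cos_add cos_diff field_simps)
  qed
  then show ?thesis by blast
qed

lemma cosine_poly_dense:
  assumes "continuous_on {0..pi} f" "e > 0"
  shows "\<exists>p. \<forall>l\<in>{0..pi}. \<bar>f l - Re (ev p l)\<bar> < e"
proof -
  have "\<exists>T. (\<exists>p. T = (\<lambda>l. Re (ev p l))) \<and> (\<forall>l\<in>{0..pi}. \<bar>f l - T l\<bar> < e)"
  proof (rule Stone_Weierstrass_HOL[of "{0..pi}" "\<lambda>T. \<exists>p. T = (\<lambda>l. Re (ev p l))"])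
    fix c :: real
    show "\<exists>p. (\<lambda>x::real. c) = (\<lambda>l. Re (ev p l))"
      by (rule exI[of _ "[:c:]"]) (simp add: ev_const)
  next
    fix f g :: "real \<Rightarrow> real" assume "(\<exists>p. f = (\<lambda>l. Re (ev p l))) \<and> (\<exists>p. g = (\<lambda>l. Re (ev p l)))"
    then obtain p q where "f = (\<lambda>l. Re (ev p l))" "g = (\<lambda>l. Re (ev q l))" by blast
    then show "\<exists>p. (\<lambda>x. f x + g x) = (\<lambda>l. Re (ev p l))"
      by (intro exI[of _ "p + q"]) (simp add: ev_add)
  next
    fix f g :: "real \<Rightarrow> real" assume "(\<exists>p. f = (\<lambda>l. Re (ev p l))) \<and> (\<exists>p. g = (\<lambda>l. Re (ev p l)))"
    then obtain p q where "f = (\<lambda>l. Re (ev p l))" "g = (\<lambda>l. Re (ev q l))" by blast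
    then show "\<exists>p. (\<lambda>x. f x * g x) = (\<lambda>l. Re (ev p l))"
      using cosine_poly_mult[of p q] by auto
  next
    fix x y :: real assume xy: "x \<in> {0..pi} \<and> y \<in> {0..pi} \<and> x \<noteq> y"
    then have "cos x \<noteq> cos y" using cos_inj_pi by auto
    then show "\<exists>f. (\<exists>p. f = (\<lambda>l. Re (ev p l))) \<and> f x \<noteq> f y"
      by (intro exI[of _ cos] conjI exI[of _ "monom 1 1"]) (auto simp: ev_monom)
  qed (use assms ev_continuous in \<open>auto intro: continuous_intros\<close>)
  then show ?thesis by blast
qed

text \<open>Truncating the exponential of the analytic half of a cosine polynomial gives
  a real polynomial with prescribed modulus on the circle.\<close>

lemma poly_modulus_approx:
  assumes "e > 0"
  shows "\<exists>a. coeff a 0 = 1 \<and> (\<forall>l. \<bar>exp (coeff p 0) * (cmod (ev a l))\<^sup>2 - exp (Re (ev p l))\<bar> < e)"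
proof -
  \<comment> \<open>Half of \<open>p\<close> without its constant term: exp of the real part of
    \<open>p\<close> is then \<open>exp (coeff p 0)\<close> times the squared modulus of exp of
    \<open>\<phi>\<close>, and the Taylor polynomials of exp in \<open>\<phi>\<close> have constant
    coefficient 1.\<close>
  define \<phi> where "\<phi> = Polynomial.smult (1/2) (p - [:coeff p 0:])"
  have \<phi>0: "coeff \<phi> 0 = 0" by (simp add: \<phi>_def)
  have Re\<phi>: "Re (ev p l) = coeff p 0 + 2 * Re (ev \<phi> l)" for l
  proof -
    have "ev p l = ev ([:coeff p 0:] + (p - [:coeff p 0:])) l" by simp
    also have "\<dots> = of_real (coeff p 0) + ev (p - [:coeff p 0:]) l" by (simp only: ev_add ev_const)
    finally show ?thesis by (simp add: \<phi>_def ev_smult)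
  qed
  define a where "a R = (\<Sum>r<R. Polynomial.smult (1 / fact r) (\<phi> ^ r))" for R
  have eva: "ev (a R) l = (\<Sum>r<R. ev \<phi> l ^ r /\<^sub>R fact r)" for R l
    by (simp add: a_def ev_sum ev_smult ev_power scaleR_conv_of_real divide_inverse)
  obtain B where B: "B \<ge> 0" "\<And>l. cmod (ev \<phi> l) \<le> B" using cmod_ev_bounded by blast
  have "uniform_limit UNIV (\<lambda>R l. \<Sum>r<R. ev \<phi> l ^ r /\<^sub>R fact r) (\<lambda>l. suminf (\<lambda>r. ev \<phi> l ^ r /\<^sub>R fact r)) sequentially"
  proof (rule Weierstrass_m_test)
    show "norm (ev \<phi> l ^ r /\<^sub>R fact r) \<le> B ^ r /\<^sub>R fact r" for r l
      using B by (auto simp: norm_power field_simps intro!: mult_left_mono power_mono)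
    show "summable (\<lambda>r. B ^ r /\<^sub>R fact r)" by (rule summable_exp_generic)
  qed
  then have lim: "uniform_limit UNIV (\<lambda>R l. ev (a R) l) (\<lambda>l. exp (ev \<phi> l)) sequentially"
    by (simp add: eva exp_def)
  define Y where "Y = exp B"
  \<comment> \<open>If two moduli differ by less than \<open>d\<close>, with \<open>d\<close> at
    most 1, their squares differ by at most \<open>d * (2 * Y + 1)\<close>; after multiplication by
    \<open>exp (coeff p 0)\<close> the second entry of the minimum leaves e/2.\<close>
  define d where "d = min 1 (e / (2 * exp (coeff p 0) * (2 * Y + 1)))"
  have Y: "Y > 0" "\<And>l. cmod (exp (ev \<phi> l)) \<le> Y"
    using B unfolding Y_def by (auto intro: order_trans[OF complex_Re_le_cmod])
  have d: "d > 0" using assms Y unfolding d_def by (auto intro!: divide_pos_pos mult_pos_pos add_pos_pos)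
  from uniform_limitD[OF lim d] obtain R0 where R0: "\<And>R l. R \<ge> R0 \<Longrightarrow> dist (ev (a R) l) (exp (ev \<phi> l)) < d"
    unfolding eventually_sequentially by auto
  define R where "R = Suc R0"
  have "coeff (a R) 0 = 1"
  proof -
    have "coeff (a R) 0 = (\<Sum>r<R. (1 / fact r) * 0 ^ r)"
      using \<phi>0 by (simp add: a_def poly_0_coeff_0[symmetric] poly_sum poly_power)
    also have "\<dots> = (\<Sum>r<R. if r = 0 then 1 else 0)" by (intro sum.cong) auto
    finally show ?thesis by (simp add: R_def del: sum.lessThan_Suc)
  qed
  moreover have "\<bar>exp (coeff p 0) * (cmod (ev (a R) l))\<^sup>2 - exp (Re (ev p l))\<bar> < e" for l
  proof -
    let ?x = "cmod (ev (a R) l)" and ?y = "cmod (exp (ev \<phi> l))"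
    have xy: "\<bar>?x - ?y\<bar> < d"
      using R0[of R l] norm_triangle_ineq3[of "ev (a R) l" "exp (ev \<phi> l)"] by (auto simp: R_def dist_norm)
    have "exp (Re (ev p l)) = exp (coeff p 0) * ?y\<^sup>2"
      by (simp add: Re\<phi> exp_add exp_double norm_exp_eq_Re)
    moreover have "exp (coeff p 0) * ?x\<^sup>2 - exp (coeff p 0) * ?y\<^sup>2 = exp (coeff p 0) * ((?x - ?y) * (?x + ?y))"
      by (simp add: power2_eq_square algebra_simps)
    ultimately have "\<bar>exp (coeff p 0) * ?x\<^sup>2 - exp (Re (ev p l))\<bar> = exp (coeff p 0) * (\<bar>?x - ?y\<bar> * (?x + ?y))"
      by (simp only: abs_mult) simp
    also have "\<dots> \<le> exp (coeff p 0) * (d * (2 * Y + 1))"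
    proof (intro mult_left_mono mult_mono)
      show "?x + ?y \<le> 2 * Y + 1" using xy Y(2)[of l] unfolding d_def by linarith
    qed (use xy d in auto)
    also have "\<dots> \<le> exp (coeff p 0) * (e / (2 * exp (coeff p 0) * (2 * Y + 1)) * (2 * Y + 1))"
      using Y by (intro mult_left_mono mult_right_mono) (auto simp: d_def)
    also have "\<dots> = e / 2"
    proof -
      have "c * (e / (2 * c * z) * z) = e / 2" if "c \<noteq> 0" "z \<noteq> 0" for c z :: real
        using that by (simp add: field_simps)
      from this[of "exp (coeff p 0)" "2 * Y + 1"] Y(1) show ?thesis by simp
    qed
    also have "\<dots> < e" using assms by simp
    finally show ?thesis .
  qed
  ultimately show ?thesis by blast
qed

text \<open>Measurability provides continuous functions converging almost everywhere. Clamping them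
  to [A, B] and approximating each within 1/(n+1) by a cosine polynomial keeps the limit and makes
  the approximants uniformly bounded, as dominated convergence requires.\<close>

lemma bounded_ae_limit_cosine_polys:
  assumes t[measurable]: "t \<in> borel_measurable borel" and tb: "\<And>l. A \<le> t l" "\<And>l. t l \<le> B"
  shows "\<exists>T. (\<forall>n. \<forall>l\<in>{0..pi}. A - 1 / Suc n \<le> Re (ev (T n) l) \<and> Re (ev (T n) l) \<le> B + 1 / Suc n)
     \<and> (AE l in U. (\<lambda>n. Re (ev (T n) l)) \<longlonglongrightarrow> t l)"
proof -
  have "t measurable_on UNIV"
    by (rule lebesgue_measurable_imp_measurable_on[OF measurable_completion]) auto
  then obtain N c where c: "negligible N" "\<And>n. continuous_on UNIV (c n)" "\<And>x. x \<notin> N \<Longrightarrow> (\<lambda>n. c n x) \<longlonglongrightarrow> t x"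
    unfolding measurable_on_def by auto
  define d where "d n x = max A (min B (c n x))" for n x
  have dc: "continuous_on {0..pi} (d n)" for n
    unfolding d_def by (intro continuous_intros continuous_on_subset[OF c(2)]) auto
  have "\<forall>n. \<exists>p. \<forall>l\<in>{0..pi}. \<bar>d n l - Re (ev p l)\<bar> < 1 / Suc n"
    using cosine_poly_dense[OF dc] by simp
  then obtain T where T: "\<And>n l. l \<in> {0..pi} \<Longrightarrow> \<bar>d n l - Re (ev (T n) l)\<bar> < 1 / Suc n" by metis
  have AB: "A \<le> B" using tb[of 0] by linarith
  have db: "A \<le> d n l" "d n l \<le> B" for n l using AB by (auto simp: d_def)
  have "(\<lambda>n. Re (ev (T n) x)) \<longlonglongrightarrow> t x" if x: "x \<notin> N" "x \<in> {0<..<pi}" for x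
  proof -
    have "(\<lambda>n. d n x) \<longlonglongrightarrow> max A (min B (t x))"
      unfolding d_def by (intro tendsto_intros c x)
    then have 1: "(\<lambda>n. d n x) \<longlonglongrightarrow> t x" using tb[of x] by simp
    have "(\<lambda>n. d n x - Re (ev (T n) x)) \<longlonglongrightarrow> 0"
    proof (rule tendsto_rabs_zero_cancel, rule tendsto_sandwich[OF _ _ tendsto_const lim_1_over_n[THEN LIMSEQ_Suc]])
    qed (use T[of x] x in \<open>auto intro!: always_eventually less_imp_le simp del: of_nat_Suc\<close>)
    from tendsto_diff[OF 1 this] show ?thesis by simp
  qed
  moreover have "AE x in lborel. x \<notin> N"
    using c(1) by (metis AE_not_in AE_completion_iff negligible_iff_null_sets)
  ultimately have "AE x in U. (\<lambda>n. Re (ev (T n) x)) \<longlonglongrightarrow> t x"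
    by (intro AE_U_I) auto
  moreover have "A - 1 / Suc n \<le> Re (ev (T n) l) \<and> Re (ev (T n) l) \<le> B + 1 / Suc n" if "l \<in> {0..pi}" for n l
    using T[OF that, of n] db[of n l] by linarith
  ultimately show ?thesis by blast
qed

text \<open>The constant coefficient of a cosine polynomial is its mean, so \<open>s\<close> follows
  the mean of \<open>t\<close> when exp(t) is replaced by exp(s) times a squared modulus. Two kinds
  of control are delivered at once: a pointwise upper bound, which later bounds operator norms, and
  closeness after integration against \<open>G\<close>, which has to come from dominated convergence
  because \<open>t\<close> is only measurable.\<close>

lemma poly_approx:
  assumes t[measurable]: "t \<in> borel_measurable borel" and tb: "\<And>l. A \<le> t l" "\<And>l. t l \<le> B"
    and G: "integrable U G" "\<And>l. 0 \<le> G l" and e: "e > 0"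
  obtains p s where "coeff p 0 = (1::real)" "\<bar>s - (\<integral>l. t l \<partial>U)\<bar> < e"
    "\<And>l. l \<in> {0..pi} \<Longrightarrow> exp s * (cmod (ev p l))\<^sup>2 \<le> exp B + e"
    "\<bar>exp s * (\<integral>l. (cmod (ev p l))\<^sup>2 * G l \<partial>U) - (\<integral>l. exp (t l) * G l \<partial>U)\<bar> < e"
proof -
  have [measurable]: "G \<in> borel_measurable borel" using G(1) by (auto dest: borel_measurable_integrable)
  obtain T where T: "\<And>n l. l\<in>{0..pi} \<Longrightarrow> A - 1 / Suc n \<le> Re (ev (T n) l)"
     "\<And>n l. l\<in>{0..pi} \<Longrightarrow> Re (ev (T n) l) \<le> B + 1 / Suc n"
     and Tlim: "AE l in U. (\<lambda>n. Re (ev (T n) l)) \<longlonglongrightarrow> t l"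
    using bounded_ae_limit_cosine_polys[OF t tb] by blast
  define K where "K = \<bar>A\<bar> + \<bar>B\<bar> + 1"
  have T': "\<bar>Re (ev (T n) l)\<bar> \<le> K" if "l \<in> {0<..<pi}" for n l
  proof -
    have "1 / real (Suc n) \<le> 1" "l \<in> {0..pi}" using that by simp_all
    then show ?thesis using T(1)[of l n] T(2)[of l n] unfolding K_def by linarith
  qed
  have T'': "AE l in U. norm (Re (ev (T n) l)) \<le> K" for n
    using AE_U_in by eventually_elim (use T' in auto)
  have lim1: "(\<lambda>n. \<integral>l. Re (ev (T n) l) \<partial>U) \<longlonglongrightarrow> (\<integral>l. t l \<partial>U)"
    by (rule integral_dominated_convergence[where w="\<lambda>_. K"])
       (use Tlim T'' in auto)
  have lim2: "(\<lambda>n. \<integral>l. exp (Re (ev (T n) l)) * G l \<partial>U) \<longlonglongrightarrow> (\<integral>l. exp (t l) * G l \<partial>U)"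
  proof (rule integral_dominated_convergence[where w="\<lambda>l. exp K * G l"])
    show "AE l in U. (\<lambda>n. exp (Re (ev (T n) l)) * G l) \<longlonglongrightarrow> exp (t l) * G l"
      using Tlim by eventually_elim (intro tendsto_intros)
    show "AE l in U. norm (exp (Re (ev (T n) l)) * G l) \<le> exp K * G l" for n
      using AE_U_in
    proof eventually_elim
      case (elim l)
      have "exp (Re (ev (T n) l)) \<le> exp K" using T'[OF elim, of n] by simp
      then show ?case using G(2)[of l] by (simp add: abs_mult mult_right_mono)
    qed
  qed (use G in auto)
  have lim3: "(\<lambda>n. exp (B + 1 / Suc n)) \<longlonglongrightarrow> exp (B + 0)"
    by (intro tendsto_intros lim_1_over_n[THEN LIMSEQ_Suc])
  have "eventually (\<lambda>n. \<bar>(\<integral>l. Re (ev (T n) l) \<partial>U) - (\<integral>l. t l \<partial>U)\<bar> < e \<and>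
     \<bar>(\<integral>l. exp (Re (ev (T n) l)) * G l \<partial>U) - (\<integral>l. exp (t l) * G l \<partial>U)\<bar> < e/2 \<and> exp (B + 1 / Suc n) < exp B + e/2) sequentially"
    using tendstoD[OF lim1 e] tendstoD[OF lim2, of "e/2"] order_tendstoD(2)[OF lim3, of "exp B + e/2"] e
    by (auto simp: dist_real_def elim: eventually_elim2 intro!: eventually_conj simp del: of_nat_Suc)
  then obtain n where n: "\<bar>(\<integral>l. Re (ev (T n) l) \<partial>U) - (\<integral>l. t l \<partial>U)\<bar> < e"
     "\<bar>(\<integral>l. exp (Re (ev (T n) l)) * G l \<partial>U) - (\<integral>l. exp (t l) * G l \<partial>U)\<bar> < e/2" "exp (B + 1 / Suc n) < exp B + e/2"
    unfolding eventually_sequentially by blast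
  define I where "I = (\<integral>l. G l \<partial>U)"
  have I: "I \<ge> 0" unfolding I_def by (rule integral_nonneg_AE) (use G in auto)
  \<comment> \<open>One tolerance for both estimates: it is at most e/2 pointwise, and times the
    mass \<open>I\<close> of \<open>G\<close> it is below e/2; adding 1 to \<open>I\<close> avoids
    division by 0.\<close>
  define \<eta> where "\<eta> = e / (2 * (I + 1))"
  have \<eta>: "\<eta> > 0" "\<eta> \<le> e / 2" "\<eta> * I < e / 2" using e I by (auto simp: \<eta>_def field_simps)
  obtain a where a: "coeff a 0 = 1" "\<And>l. \<bar>exp (coeff (T n) 0) * (cmod (ev a l))\<^sup>2 - exp (Re (ev (T n) l))\<bar> < \<eta>"
    using poly_modulus_approx[OF \<eta>(1), of "T n"] by blast
  define s where "s = coeff (T n) 0"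
  show ?thesis
  proof (rule that[of a s])
    show "\<bar>s - (\<integral>l. t l \<partial>U)\<bar> < e" using n(1) by (simp add: integral_Re_ev s_def)
    show "exp s * (cmod (ev a l))\<^sup>2 \<le> exp B + e" if l: "l \<in> {0..pi}" for l
    proof -
      have "exp (Re (ev (T n) l)) \<le> exp (B + 1 / Suc n)" using T(2)[OF l] by simp
      then show ?thesis using a(2)[of l] n(3) \<eta> unfolding s_def by linarith
    qed
    have i1: "integrable U (\<lambda>l. (cmod (ev a l))\<^sup>2 * G l)" by (rule integrable_cmod_ev[OF G(1)])
    obtain Bp where Bp: "\<And>l. cmod (ev (T n) l) \<le> Bp" using cmod_ev_bounded by blast
    have i2: "integrable U (\<lambda>l. exp (Re (ev (T n) l)) * G l)"
      by (rule U_integrable_mult_bounded[where B="exp Bp"]) (use G Bp in \<open>auto intro: order_trans[OF complex_Re_le_cmod]\<close>)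
    have "\<bar>exp s * (\<integral>l. (cmod (ev a l))\<^sup>2 * G l \<partial>U) - (\<integral>l. exp (Re (ev (T n) l)) * G l \<partial>U)\<bar>
      = \<bar>\<integral>l. (exp s * (cmod (ev a l))\<^sup>2 - exp (Re (ev (T n) l))) * G l \<partial>U\<bar>"
      using i1 i2 by (simp add: left_diff_distrib mult.assoc)
    also have "\<dots> \<le> (\<integral>l. \<bar>(exp s * (cmod (ev a l))\<^sup>2 - exp (Re (ev (T n) l))) * G l\<bar> \<partial>U)"
      by (rule integral_abs_bound)
    also have "\<dots> \<le> (\<integral>l. \<eta> * G l \<partial>U)"
    proof (rule integral_mono)
      show "integrable U (\<lambda>l. \<bar>(exp s * (cmod (ev a l))\<^sup>2 - exp (Re (ev (T n) l))) * G l\<bar>)"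
        using i1 i2 by (intro integrable_abs) (simp add: left_diff_distrib mult.assoc)
      show "\<bar>(exp s * (cmod (ev a l))\<^sup>2 - exp (Re (ev (T n) l))) * G l\<bar> \<le> \<eta> * G l" for l
        unfolding abs_mult using a(2)[of l] G(2)[of l] by (auto simp: s_def intro!: mult_right_mono)
    qed (use G in auto)
    also have "\<dots> = \<eta> * I" by (simp add: I_def)
    finally show "\<bar>exp s * (\<integral>l. (cmod (ev a l))\<^sup>2 * G l \<partial>U) - (\<integral>l. exp (t l) * G l \<partial>U)\<bar> < e"
      using \<eta>(3) n(2) by linarith
  qed (use a in auto)
qed

section \<open>The prediction theorem of Szego\<close>

lemma integrable_ln_shift:
  fixes G :: "real \<Rightarrow> real"
  assumes G: "integrable U G" and h: "\<And>l. \<theta> \<le> G l" "\<theta> > 0"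
  shows "integrable U (\<lambda>l. ln (G l))"
proof (rule Bochner_Integration.integrable_bound[of U "\<lambda>l. \<bar>ln \<theta>\<bar> + G l"])
  show "AE l in U. norm (ln (G l)) \<le> norm (\<bar>ln \<theta>\<bar> + G l)"
  proof (rule AE_I2)
    fix l
    have "ln \<theta> \<le> ln (G l)" "ln (G l) \<le> G l - 1" "G l > 0"
      using h(1)[of l] h(2) by (auto intro!: ln_le_minus_one)
    then show "norm (ln (G l)) \<le> norm (\<bar>ln \<theta>\<bar> + G l)" by auto
  qed
qed (use G in auto)

text \<open>Cauchy--Schwarz applied to the constant coefficient of the product of p with
  an almost optimal predictor b for the weight 1/G.\<close>

lemma szego_lower_aux:
  assumes G: "integrable U G" and h: "\<And>l. \<theta> \<le> G l" "\<theta> > 0" and p: "coeff p 0 = 1" and K: "K \<ge> \<theta>"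
  shows "exp (\<integral>l. ln (min (G l) K) \<partial>U) \<le> (\<integral>l. (cmod (ev p l))\<^sup>2 * G l \<partial>U)"
proof -
  have [measurable]: "G \<in> borel_measurable borel" using G(1) by (auto dest: borel_measurable_integrable)
  have Gpos: "G l > 0" for l using h(1)[of l] h(2) by linarith
  define X where "X = (\<integral>l. (cmod (ev p l))\<^sup>2 * G l \<partial>U)"
  define m where "m = (\<integral>l. ln (min (G l) K) \<partial>U)"
  have iH: "integrable U (\<lambda>l. 1 / G l)"
  proof (rule U_integrable_bounded[where B="1/\<theta>"])
    show "\<bar>1 / G l\<bar> \<le> 1 / \<theta>" for l using h(1)[of l] h(2) Gpos[of l] by (simp add: frac_le)
  qed auto
  have main: "exp (m - e) / (1 + e) \<le> X" if e: "e > 0" for e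
  proof -
    \<comment> \<open>exp(s) times the squared modulus of \<open>b\<close> imitates min(G, K),
      tested against the weight 1/G. The resulting integral is close to the mean of min(G, K)/G,
      which is at most 1.\<close>
    obtain b s where b: "coeff b 0 = 1" "\<bar>s - m\<bar> < e"
      "\<bar>exp s * (\<integral>l. (cmod (ev b l))\<^sup>2 * (1 / G l) \<partial>U) - (\<integral>l. exp (ln (min (G l) K)) * (1 / G l) \<partial>U)\<bar> < e"
      unfolding m_def
    proof (rule poly_approx[where t="\<lambda>l. ln (min (G l) K)" and A="ln \<theta>" and B="ln K" and G="\<lambda>l. 1 / G l" and e=e])
      show "ln \<theta> \<le> ln (min (G l) K)" "ln (min (G l) K) \<le> ln K" for l
        using h(1)[of l] h(2) K by (auto simp: min_def)
    qed (use iH e Gpos in \<open>auto intro: less_imp_le\<close>)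
    define Y where "Y = (\<integral>l. (cmod (ev b l))\<^sup>2 * (1 / G l) \<partial>U)"
    have "(\<integral>l. exp (ln (min (G l) K)) * (1 / G l) \<partial>U) \<le> (\<integral>l. 1 \<partial>U)"
    proof (rule integral_mono)
      show "integrable U (\<lambda>l. exp (ln (min (G l) K)) * (1 / G l))"
      proof (rule U_integrable_bounded[where B=1])
        show "\<bar>exp (ln (min (G l) K)) * (1 / G l)\<bar> \<le> 1" for l
          using Gpos[of l] h K by (auto simp: min_def)
      qed auto
      show "exp (ln (min (G l) K)) * (1 / G l) \<le> 1" for l
        using Gpos[of l] h K by (auto simp: min_def)
    qed auto
    then have "exp s * Y \<le> 1 + e" using b(3) by (simp add: Y_def)
    then have Y: "Y \<le> (1 + e) / exp s" by (simp add: field_simps)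
    \<comment> \<open>An upper bound for \<open>Y\<close>, used as weight in the
      arithmetic-geometric mean inequality so that the term with \<open>b\<close> contributes at
      most 1/2.\<close>
    define y where "y = (1 + e) / exp s"
    have y: "y > 0" using e by (simp add: y_def)
    have i1: "integrable U (\<lambda>l. (cmod (ev p l))\<^sup>2 * G l)" by (rule integrable_cmod_ev[OF G(1)])
    have i2: "integrable U (\<lambda>l. (cmod (ev b l))\<^sup>2 * (1 / G l))" by (rule integrable_cmod_ev[OF iH])
    \<comment> \<open>The product of two polynomials with constant coefficient 1 has mean 1.\<close>
    have "1 = (\<integral>l. Re (ev (p * b) l) \<partial>U)"
      using p b(1) by (simp add: integral_Re_ev coeff_mult)
    also have "\<dots> \<le> (\<integral>l. (y * ((cmod (ev p l))\<^sup>2 * G l) + ((cmod (ev b l))\<^sup>2 * (1 / G l)) / y) / 2 \<partial>U)"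
    proof (rule integral_mono)
      obtain Bp where Bp: "\<And>l. cmod (ev (p * b) l) \<le> Bp" using cmod_ev_bounded by blast
      show "integrable U (\<lambda>l. Re (ev (p * b) l))"
        by (rule U_integrable_bounded[where B=Bp]) (use Bp in \<open>auto intro: order_trans[OF abs_Re_le_cmod]\<close>)
      show "integrable U (\<lambda>l. (y * ((cmod (ev p l))\<^sup>2 * G l) + ((cmod (ev b l))\<^sup>2 * (1 / G l)) / y) / 2)"
        using i1 i2 by (intro integrable_divide Bochner_Integration.integrable_add integrable_mult_right)
      fix l
      have ident: "(y * (u\<^sup>2 * w) + (v\<^sup>2 * (1 / w)) / y) / 2 - u * v = (y * w * u - v)\<^sup>2 / (2 * y * w)"
        if "w > 0" for u v w :: real
        using that y by (simp add: field_simps power2_eq_square)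
      have "Re (ev (p * b) l) \<le> cmod (ev p l) * cmod (ev b l)"
        using complex_Re_le_cmod[of "ev (p * b) l"] by (simp add: ev_mult norm_mult)
      also have "\<dots> \<le> (y * ((cmod (ev p l))\<^sup>2 * G l) + ((cmod (ev b l))\<^sup>2 * (1 / G l)) / y) / 2"
      proof -
        have "0 \<le> (y * G l * cmod (ev p l) - cmod (ev b l))\<^sup>2 / (2 * y * G l)"
          using y Gpos[of l] by simp
        then show ?thesis using ident[OF Gpos[of l], of "cmod (ev p l)" "cmod (ev b l)"] by linarith
      qed
      finally show "Re (ev (p * b) l) \<le> (y * ((cmod (ev p l))\<^sup>2 * G l) + ((cmod (ev b l))\<^sup>2 * (1 / G l)) / y) / 2" .
    qed
    also have "\<dots> = (y * X + Y / y) / 2"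
    proof -
      have "(\<integral>l. (y * f l + g l / y) / 2 \<partial>U) = (y * (\<integral>l. f l \<partial>U) + (\<integral>l. g l \<partial>U) / y) / 2"
        if "integrable U f" "integrable U g" for f g :: "real \<Rightarrow> real"
        using that by simp
      from this[OF i1 i2] show ?thesis unfolding X_def Y_def .
    qed
    finally have "1 \<le> (y * X + Y / y) / 2" .
    moreover have "Y / y \<le> 1" using Y y unfolding y_def[symmetric] by (simp add: pos_divide_le_eq)
    moreover have "1 \<le> a" if "1 \<le> (a + b) / 2" "b \<le> 1" for a b :: real
      using that by simp
    ultimately have "1 \<le> y * X" by blast
    then have "1 / y \<le> X" using y by (simp add: field_simps)
    moreover have "exp (m - e) / (1 + e) \<le> 1 / y"
      unfolding y_def using b(2) e by (auto intro!: divide_right_mono)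
    ultimately show ?thesis by linarith
  qed
  have "(\<lambda>n. exp (m - 1 / Suc n) / (1 + 1 / Suc n)) \<longlonglongrightarrow> exp (m - 0) / (1 + 0)"
    by (intro tendsto_intros lim_1_over_n[THEN LIMSEQ_Suc]) auto
  then have "exp (m - 0) / (1 + 0) \<le> X"
    by (rule LIMSEQ_le_const2) (use main in \<open>auto simp del: of_nat_Suc\<close>)
  then show ?thesis by (simp add: m_def X_def)
qed

lemma szego_lower_pos:
  assumes G: "integrable U G" and h: "\<And>l. \<theta> \<le> G l" "\<theta> > 0" and p: "coeff p 0 = 1"
  shows "exp (\<integral>l. ln (G l) \<partial>U) \<le> (\<integral>l. (cmod (ev p l))\<^sup>2 * G l \<partial>U)"
proof -
  have [measurable]: "G \<in> borel_measurable borel" using G(1) by (auto dest: borel_measurable_integrable)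
  have "(\<lambda>n. \<integral>l. ln (min (G l) (\<theta> + real n)) \<partial>U) \<longlonglongrightarrow> (\<integral>l. ln (G l) \<partial>U)"
  proof (rule integral_dominated_convergence[where w="\<lambda>l. \<bar>ln \<theta>\<bar> + \<bar>ln (G l)\<bar>"])
    show "AE l in U. (\<lambda>n. ln (min (G l) (\<theta> + real n))) \<longlonglongrightarrow> ln (G l)"
    proof (rule AE_I2, rule tendsto_eventually)
      fix l
      obtain N :: nat where "G l \<le> real N" using real_arch_simple by blast
      then have "n \<ge> N \<Longrightarrow> min (G l) (\<theta> + real n) = G l" for n
        using h(2) by (auto simp: min_def dest: order_trans)
      then show "\<forall>\<^sub>F n in sequentially. ln (min (G l) (\<theta> + real n)) = ln (G l)"
        unfolding eventually_sequentially by metis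
    qed
    show "AE l in U. norm (ln (min (G l) (\<theta> + real n))) \<le> \<bar>ln \<theta>\<bar> + \<bar>ln (G l)\<bar>" for n
    proof (rule AE_I2)
      fix l
      have "ln \<theta> \<le> ln (min (G l) (\<theta> + real n))" "ln (min (G l) (\<theta> + real n)) \<le> ln (G l)"
        using h(1)[of l] h(2) by (auto simp: min_def)
      then show "norm (ln (min (G l) (\<theta> + real n))) \<le> \<bar>ln \<theta>\<bar> + \<bar>ln (G l)\<bar>" by auto
    qed
  qed (use integrable_ln_shift[OF G h] in auto)
  then have "(\<lambda>n. exp (\<integral>l. ln (min (G l) (\<theta> + real n)) \<partial>U)) \<longlonglongrightarrow> exp (\<integral>l. ln (G l) \<partial>U)"
    by (rule tendsto_exp)
  then show ?thesis
    by (rule LIMSEQ_le_const2) (use szego_lower_aux[OF G h p] h(2) in auto)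
qed

text \<open>A constant e added to \<open>G\<close> restores a positive lower bound and only
  increases the logarithm; on the other side it costs e times the unweighted squared norm of
  \<open>p\<close>, which vanishes with e.\<close>

lemma szego_lower:
  assumes G: "integrable U G" "\<And>l. 0 \<le> G l" "AE l in U. 0 < G l" and L: "integrable U (\<lambda>l. ln (G l))"
    and p: "coeff p 0 = 1"
  shows "exp (\<integral>l. ln (G l) \<partial>U) \<le> (\<integral>l. (cmod (ev p l))\<^sup>2 * G l \<partial>U)"
proof -
  define B where "B = (\<integral>l. (cmod (ev p l))\<^sup>2 * 1 \<partial>U)"
  have i1: "integrable U (\<lambda>l. (cmod (ev p l))\<^sup>2 * 1)" by (rule integrable_cmod_ev) simp
  have i2: "integrable U (\<lambda>l. (cmod (ev p l))\<^sup>2 * G l)" by (rule integrable_cmod_ev[OF G(1)])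
  have main: "exp (\<integral>l. ln (G l) \<partial>U) \<le> (\<integral>l. (cmod (ev p l))\<^sup>2 * G l \<partial>U) + e * B" if e: "e > 0" for e
  proof -
    have iG: "integrable U (\<lambda>l. G l + e)" using G by auto
    have "(\<integral>l. ln (G l) \<partial>U) \<le> (\<integral>l. ln (G l + e) \<partial>U)"
      using integrable_ln_shift[OF iG, of e] G(2) e G(3)
      by (intro integral_mono_AE L) (auto elim!: eventually_mono)
    then have "exp (\<integral>l. ln (G l) \<partial>U) \<le> exp (\<integral>l. ln (G l + e) \<partial>U)" by simp
    also have "\<dots> \<le> (\<integral>l. (cmod (ev p l))\<^sup>2 * (G l + e) \<partial>U)"
      by (rule szego_lower_pos[OF iG _ e p]) (use G in auto)
    also have "\<dots> = (\<integral>l. (cmod (ev p l))\<^sup>2 * G l \<partial>U) + e * B"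
      using i1 i2 by (simp add: distrib_left B_def mult.commute[of _ e])
    finally show ?thesis .
  qed
  have "(\<lambda>n. (\<integral>l. (cmod (ev p l))\<^sup>2 * G l \<partial>U) + 1 / Suc n * B) \<longlonglongrightarrow> (\<integral>l. (cmod (ev p l))\<^sup>2 * G l \<partial>U) + 0 * B"
    by (intro tendsto_intros lim_1_over_n[THEN LIMSEQ_Suc])
  then have "exp (\<integral>l. ln (G l) \<partial>U) \<le> (\<integral>l. (cmod (ev p l))\<^sup>2 * G l \<partial>U) + 0 * B"
    by (rule LIMSEQ_le_const) (intro exI allI impI main, simp)
  then show ?thesis by simp
qed

text \<open>With t = -ln H, \<open>poly_approx\<close> produces a filter whose squared modulus times
  exp(s) imitates 1/H. As t has to be bounded, \<open>H\<close> is first truncated at a level so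
  high that dividing \<open>G\<close> by the truncated weight hardly changes the mean. Used with H =
  G + \<eta> for the upper half of Szego's theorem and with H = max(G, \<theta>) for the
  converse.\<close>

lemma whitening_poly:
  assumes H: "integrable U H" "\<And>l. \<theta> \<le> H l" "\<theta> > 0" and G: "integrable U G" "\<And>l. 0 \<le> G l" and e: "e > 0"
  obtains p s where "coeff p 0 = (1::real)" "\<And>l. l \<in> {0..pi} \<Longrightarrow> exp s * (cmod (ev p l))\<^sup>2 \<le> 1 / \<theta> + e"
    "exp s * (\<integral>l. (cmod (ev p l))\<^sup>2 * G l \<partial>U) \<le> (\<integral>l. G l / H l \<partial>U) + e"
    "- s \<le> (\<integral>l. ln (H l) \<partial>U) + e"
proof -
  have [measurable]: "G \<in> borel_measurable borel" "H \<in> borel_measurable borel"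
    using G(1) H(1) by (auto dest: borel_measurable_integrable)
  have Hpos: "H l > 0" for l using H(2)[of l] H(3) by linarith
  have "(\<lambda>n. \<integral>l. G l / min (H l) (\<theta> + real n) \<partial>U) \<longlonglongrightarrow> (\<integral>l. G l / H l \<partial>U)"
  proof (rule integral_dominated_convergence[where w="\<lambda>l. G l / \<theta>"])
    show "AE l in U. (\<lambda>n. G l / min (H l) (\<theta> + real n)) \<longlonglongrightarrow> G l / H l"
    proof (rule AE_I2, rule tendsto_eventually)
      fix l
      obtain N :: nat where "H l \<le> real N" using real_arch_simple by blast
      then have "n \<ge> N \<Longrightarrow> min (H l) (\<theta> + real n) = H l" for n
        using H(3) by (auto simp: min_def dest: order_trans)
      then show "\<forall>\<^sub>F n in sequentially. G l / min (H l) (\<theta> + real n) = G l / H l"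
        unfolding eventually_sequentially by metis
    qed
    show "AE l in U. norm (G l / min (H l) (\<theta> + real n)) \<le> G l / \<theta>" for n
    proof (rule AE_I2)
      fix l
      have "\<theta> \<le> min (H l) (\<theta> + real n)" using H(2)[of l] by auto
      then show "norm (G l / min (H l) (\<theta> + real n)) \<le> G l / \<theta>"
        using H(3) G(2)[of l] by (auto intro!: divide_left_mono mult_pos_pos)
    qed
  qed (use G in auto)
  then have "eventually (\<lambda>n. (\<integral>l. G l / min (H l) (\<theta> + real n) \<partial>U) < (\<integral>l. G l / H l \<partial>U) + e / 2) sequentially"
    by (rule order_tendstoD) (use e in auto)
  then obtain n where n: "(\<integral>l. G l / min (H l) (\<theta> + real n) \<partial>U) < (\<integral>l. G l / H l \<partial>U) + e / 2"
    unfolding eventually_sequentially by auto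
  define K where "K = \<theta> + real n"
  have K: "K \<ge> \<theta>" by (simp add: K_def)
  have mb: "\<theta> \<le> min (H l) K" "min (H l) K \<le> K" "min (H l) K > 0" for l using H(2)[of l] H(3) K by auto
  obtain p s where p: "coeff p 0 = 1" "\<bar>s - (\<integral>l. - ln (min (H l) K) \<partial>U)\<bar> < e / 2"
    "\<And>l. l \<in> {0..pi} \<Longrightarrow> exp s * (cmod (ev p l))\<^sup>2 \<le> exp (- ln \<theta>) + e / 2"
    "\<bar>exp s * (\<integral>l. (cmod (ev p l))\<^sup>2 * G l \<partial>U) - (\<integral>l. exp (- ln (min (H l) K)) * G l \<partial>U)\<bar> < e / 2"
  proof (rule poly_approx[where t="\<lambda>l. - ln (min (H l) K)" and A="- ln K" and B="- ln \<theta>" and G=G and e="e/2"])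
    show "- ln K \<le> - ln (min (H l) K)" "- ln (min (H l) K) \<le> - ln \<theta>" for l
      using mb[of l] H(3) by (auto simp del: min_less_iff_conj)
  qed (use e G in auto)
  have "exp (- ln (min (H l) K)) * G l = G l / min (H l) K" for l
    using mb(3)[of l] by (subst exp_minus) (simp add: divide_inverse exp_ln[OF mb(3)] del: min_less_iff_conj)
  then have 3: "(\<integral>l. exp (- ln (min (H l) K)) * G l \<partial>U) < (\<integral>l. G l / H l \<partial>U) + e / 2"
    using n by (simp add: K_def)
  have "(\<integral>l. ln (min (H l) K) \<partial>U) \<le> (\<integral>l. ln (H l) \<partial>U)"
  proof (rule integral_mono)
    show "integrable U (\<lambda>l. ln (min (H l) K))"
      by (rule integrable_ln_shift[OF _ mb(1)]) (use H in auto)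
    show "integrable U (\<lambda>l. ln (H l))" by (rule integrable_ln_shift[OF H])
    show "ln (min (H l) K) \<le> ln (H l)" for l using mb(3)[of l] by (auto simp: min_def)
  qed
  moreover have "(\<integral>l. - ln (min (H l) K) \<partial>U) = - (\<integral>l. ln (min (H l) K) \<partial>U)" by simp
  ultimately have 4: "- s \<le> (\<integral>l. ln (H l) \<partial>U) + e" using p(2) e by linarith
  show ?thesis
  proof (rule that[OF p(1) _ _ 4])
    show "exp s * (\<integral>l. (cmod (ev p l))\<^sup>2 * G l \<partial>U) \<le> (\<integral>l. G l / H l \<partial>U) + e"
      using p(4) 3 by linarith
    show "exp s * (cmod (ev p l))\<^sup>2 \<le> 1 / \<theta> + e" if "l \<in> {0..pi}" for l
    proof -
      have "exp (- ln \<theta>) = 1 / \<theta>" using H(3) by (simp add: exp_minus inverse_eq_divide)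
      then show ?thesis using p(3)[OF that] e by linarith
    qed
  qed
qed

text \<open>Whitening with H = G + \<eta>: the mean of G/(G + \<eta>) is at most 1, so the
  prediction error is at most (1 + e) exp(-s). Since the shifted weight always has an integrable
  logarithm, the estimate can be used before integrability of ln G is known.\<close>

lemma szego_upper_shift:
  assumes G: "integrable U G" "\<And>l. 0 \<le> G l" and e: "e > 0" and \<eta>: "\<eta> > 0"
  shows "\<exists>p. coeff p 0 = 1 \<and> (\<integral>l. (cmod (ev p l))\<^sup>2 * G l \<partial>U) \<le> (1 + e) * exp ((\<integral>l. ln (G l + \<eta>) \<partial>U) + e)"
proof -
  have [measurable]: "G \<in> borel_measurable borel" using G(1) by (auto dest: borel_measurable_integrable)
  obtain p s where p: "coeff p 0 = 1"
    "exp s * (\<integral>l. (cmod (ev p l))\<^sup>2 * G l \<partial>U) \<le> (\<integral>l. G l / (G l + \<eta>) \<partial>U) + e"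
    "- s \<le> (\<integral>l. ln (G l + \<eta>) \<partial>U) + e"
    by (rule whitening_poly[of "\<lambda>l. G l + \<eta>" \<eta> G e]) (use G e \<eta> in auto)
  have q: "0 \<le> G l / (G l + \<eta>)" "G l / (G l + \<eta>) \<le> 1" for l using G(2)[of l] \<eta> by auto
  have "(\<integral>l. G l / (G l + \<eta>) \<partial>U) \<le> (\<integral>l. 1 \<partial>U)"
  proof (rule integral_mono)
    have "\<bar>G l / (G l + \<eta>)\<bar> \<le> 1" for l using q[of l] by linarith
    then show "integrable U (\<lambda>l. G l / (G l + \<eta>))" by (intro U_integrable_bounded[where B=1]) auto
  qed (use q in auto)
  then have "exp s * (\<integral>l. (cmod (ev p l))\<^sup>2 * G l \<partial>U) \<le> 1 + e" using p(2) by simp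
  then have "(\<integral>l. (cmod (ev p l))\<^sup>2 * G l \<partial>U) \<le> (1 + e) * exp (- s)"
    by (simp add: exp_minus field_simps)
  also have "\<dots> \<le> (1 + e) * exp ((\<integral>l. ln (G l + \<eta>) \<partial>U) + e)" using p(3) e by (intro mult_left_mono) auto
  finally show ?thesis using p(1) by blast
qed

text \<open>The shift 1/(n+1) is removed by dominated convergence, which is where integrability of
  the logarithm enters. The tolerance is split in three: the shift, the exponent, and the factor 1 +
  e/3, absorbed as at most exp(e/3).\<close>

lemma szego_upper:
  assumes G: "integrable U G" "\<And>l. 0 \<le> G l" "AE l in U. 0 < G l" and L: "integrable U (\<lambda>l. ln (G l))" and e: "e > 0"
  shows "\<exists>p. coeff p 0 = 1 \<and> (\<integral>l. (cmod (ev p l))\<^sup>2 * G l \<partial>U) \<le> exp ((\<integral>l. ln (G l) \<partial>U) + e)"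
proof -
  have [measurable]: "G \<in> borel_measurable borel" using G(1) by (auto dest: borel_measurable_integrable)
  have "(\<lambda>n. \<integral>l. ln (G l + 1 / Suc n) \<partial>U) \<longlonglongrightarrow> (\<integral>l. ln (G l) \<partial>U)"
  proof (rule integral_dominated_convergence[where w="\<lambda>l. \<bar>ln (G l)\<bar> + G l"])
    show "AE l in U. (\<lambda>n. ln (G l + 1 / Suc n)) \<longlonglongrightarrow> ln (G l)"
      using G(3)
    proof eventually_elim
      case (elim l)
      have "(\<lambda>n. ln (G l + 1 / Suc n)) \<longlonglongrightarrow> ln (G l + 0)"
        by (intro tendsto_intros lim_1_over_n[THEN LIMSEQ_Suc]) (use elim in auto)
      then show ?case by simp
    qed
    show "AE l in U. norm (ln (G l + 1 / Suc n)) \<le> \<bar>ln (G l)\<bar> + G l" for n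
      using G(3)
    proof eventually_elim
      case (elim l)
      have "0 < G l + 1 / Suc n" using elim by (intro add_pos_nonneg) auto
      then have "ln (G l) \<le> ln (G l + 1 / Suc n)" using elim by (simp del: of_nat_Suc)
      moreover have "ln (G l + 1 / Suc n) \<le> G l + 1 / Suc n - 1"
        using elim by (intro ln_le_minus_one add_pos_nonneg) auto
      moreover have "1 / real (Suc n) \<le> 1" by simp
      ultimately show ?case using elim unfolding real_norm_def by linarith
    qed
  qed (use L G in auto)
  then have "eventually (\<lambda>n. (\<integral>l. ln (G l + 1 / Suc n) \<partial>U) < (\<integral>l. ln (G l) \<partial>U) + e / 3) sequentially"
    by (rule order_tendstoD) (use e in auto)
  then obtain n where n: "(\<integral>l. ln (G l + 1 / Suc n) \<partial>U) < (\<integral>l. ln (G l) \<partial>U) + e / 3"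
    unfolding eventually_sequentially by auto
  obtain p where p: "coeff p 0 = 1"
    "(\<integral>l. (cmod (ev p l))\<^sup>2 * G l \<partial>U) \<le> (1 + e / 3) * exp ((\<integral>l. ln (G l + 1 / Suc n) \<partial>U) + e / 3)"
    using szego_upper_shift[OF G(1,2), of "e/3" "1 / Suc n"] e by auto
  have "(1 + e / 3) * exp ((\<integral>l. ln (G l + 1 / Suc n) \<partial>U) + e / 3) \<le> exp (e / 3) * exp ((\<integral>l. ln (G l) \<partial>U) + e / 3 + e / 3)"
    using n e by (intro mult_mono exp_ge_add_one_self) auto
  also have "\<dots> = exp ((\<integral>l. ln (G l) \<partial>U) + e)" by (simp flip: exp_add)
  finally show ?thesis using p by (intro exI[of _ p]) auto
qed

text \<open>If all errors are at least \<open>S\<close>, then \<open>szego_upper_shift\<close> with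
  e = 1 bounds the mean of ln(G + \<eta>) below by the same constant for every \<eta>. As \<eta>
  tends to 0, a zero set of positive measure would push this mean to minus infinity; once it is
  excluded, monotone convergence gives integrability of ln G itself.\<close>

lemma ln_integrable_of_prediction_bound:
  assumes G: "integrable U G" "\<And>l. 0 \<le> G l" and S: "S > 0" "\<And>p. coeff p 0 = 1 \<Longrightarrow> S \<le> (\<integral>l. (cmod (ev p l))\<^sup>2 * G l \<partial>U)"
  shows "AE l in U. 0 < G l" "integrable U (\<lambda>l. ln (G l))"
proof -
  have Gm[measurable]: "G \<in> borel_measurable borel" using G(1) by (auto dest: borel_measurable_integrable)
  define b where "b = ln (S / 2) - 1"
  have iG: "integrable U (\<lambda>l. G l + \<eta>)" for \<eta> using G by auto
  have iL: "integrable U (\<lambda>l. ln (G l + \<eta>))" if "\<eta> > 0" for \<eta>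
    by (rule integrable_ln_shift[OF iG, of \<eta>]) (use G(2) that in auto)
  have b: "b \<le> (\<integral>l. ln (G l + \<eta>) \<partial>U)" if \<eta>: "\<eta> > 0" for \<eta>
  proof -
    obtain p where "coeff p 0 = 1" "(\<integral>l. (cmod (ev p l))\<^sup>2 * G l \<partial>U) \<le> (1 + 1) * exp ((\<integral>l. ln (G l + \<eta>) \<partial>U) + 1)"
      using szego_upper_shift[OF G, of 1 \<eta>] \<eta> by auto
    with S(2)[of p] have "S / 2 \<le> exp ((\<integral>l. ln (G l + \<eta>) \<partial>U) + 1)" by simp
    then have "ln (S / 2) \<le> ln (exp ((\<integral>l. ln (G l + \<eta>) \<partial>U) + 1))" using S(1) by (subst ln_le_cancel_iff) auto
    then show ?thesis by (simp add: b_def)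
  qed
  define m where "m = measure U {l. G l = 0}"
  have m: "b \<le> (\<integral>l. G l \<partial>U) + m * ln \<eta>" if \<eta>: "0 < \<eta>" "\<eta> \<le> 1" for \<eta>
  proof -
    have "(\<integral>l. ln (G l + \<eta>) \<partial>U) \<le> (\<integral>l. G l + indicator {l. G l = 0} l * ln \<eta> \<partial>U)"
    proof (rule integral_mono[OF iL[OF \<eta>(1)]])
      show "ln (G l + \<eta>) \<le> G l + indicator {l. G l = 0} l * ln \<eta>" for l
        using ln_le_minus_one[of "G l + \<eta>"] G(2)[of l] \<eta> by (auto simp: indicator_def)
      show "integrable U (\<lambda>l. G l + indicator {l. G l = 0} l * ln \<eta>)"
        by (intro Bochner_Integration.integrable_add G(1) integrable_mult_left U_integrable_bounded[where B=1]) auto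
    qed
    also have "\<dots> = (\<integral>l. G l \<partial>U) + m * ln \<eta>"
    proof -
      have "(\<integral>l. indicator {l. G l = 0} l * ln \<eta> \<partial>U) = m * ln \<eta>" by (simp add: m_def)
      moreover have "integrable U (\<lambda>l. indicator {l. G l = 0} l * ln \<eta>)"
        by (intro integrable_mult_left U_integrable_bounded[where B=1]) auto
      ultimately show ?thesis using G(1) by simp
    qed
    finally show ?thesis using b[OF \<eta>(1)] by linarith
  qed
  have "m = 0"
  proof (rule ccontr)
    assume "m \<noteq> 0"
    then have mp: "m > 0" by (simp add: m_def zero_less_measure_iff)
    \<comment> \<open>With \<eta> = exp(-q) the inequality \<open>m\<close> would bound
      \<open>b\<close> by the mean of \<open>G\<close> minus the sum of 1 and the absolute values of
      both, which is impossible.\<close>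
    define q where "q = (\<bar>b\<bar> + \<bar>\<integral>l. G l \<partial>U\<bar> + 1) / m"
    have q: "q > 0" using mp by (auto simp: q_def intro!: divide_pos_pos add_nonneg_pos)
    have "b \<le> (\<integral>l. G l \<partial>U) + m * (- q)"
      using m[of "exp (- q)"] q by simp
    also have "m * (- q) = - (\<bar>b\<bar> + \<bar>\<integral>l. G l \<partial>U\<bar> + 1)" using mp by (simp add: q_def)
    finally show False by linarith
  qed
  then have "emeasure U {l. G l = 0} = 0" by (simp add: m_def U.emeasure_eq_measure)
  then have "AE l in U. G l \<noteq> 0" by (intro AE_I[where N="{l. G l = 0}"]) auto
  then show pos: "AE l in U. 0 < G l"
  proof eventually_elim
    case (elim l)
    then show ?case using G(2)[of l] by linarith
  qed
  \<comment> \<open>Smaller shifts increase -ln(G + shift), while the means stay below -b: the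
    situation of the monotone convergence theorem.\<close>
  define I where "I n = (\<integral>l. - ln (G l + 1 / Suc n) \<partial>U)" for n
  have anti: "G l + 1 / Suc n \<le> G l + 1 / Suc m" if "m \<le> n" for l m n
    using that by (simp add: frac_le)
  have "incseq I"
    unfolding I_def
  proof (intro incseq_SucI integral_mono)
    fix n l
    have "0 < G l + 1 / Suc (Suc n)" using G(2)[of l] by (intro add_nonneg_pos) auto
    then show "- ln (G l + 1 / Suc n) \<le> - ln (G l + 1 / Suc (Suc n))"
      using anti[of n "Suc n" l] by (simp del: of_nat_Suc)
  qed (use iL in auto)
  moreover have "I n \<le> - b" for n using b[of "1 / Suc n"] by (simp add: I_def)
  ultimately obtain x where x: "I \<longlonglongrightarrow> x" using incseq_convergent by blast
  have "integrable U (\<lambda>l. - ln (G l))"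
  proof (rule integrable_monotone_convergence[where f="\<lambda>n l. - ln (G l + 1 / Suc n)" and x=x])
    show "AE l in U. mono (\<lambda>n. - ln (G l + 1 / Suc n))"
      using pos
    proof eventually_elim
      case (elim l)
      show ?case
      proof (rule monoI)
        fix m n :: nat assume "m \<le> n"
        moreover have "0 < G l + 1 / Suc n" using G(2)[of l] by (intro add_nonneg_pos) auto
        ultimately show "- ln (G l + 1 / Suc m) \<le> - ln (G l + 1 / Suc n)" using anti[of m n l] by (simp del: of_nat_Suc)
      qed
    qed
    show "AE l in U. (\<lambda>n. - ln (G l + 1 / Suc n)) \<longlonglongrightarrow> - ln (G l)"
      using pos
    proof eventually_elim
      case (elim l)
      have "(\<lambda>n. - ln (G l + 1 / Suc n)) \<longlonglongrightarrow> - ln (G l + 0)"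
        by (intro tendsto_intros lim_1_over_n[THEN LIMSEQ_Suc]) (use elim in auto)
      then show ?case by simp
    qed
    show "(\<lambda>n. \<integral>l. - ln (G l + 1 / Suc n) \<partial>U) \<longlonglongrightarrow> x" using x unfolding I_def .
  qed (use iL in \<open>auto simp del: of_nat_Suc\<close>)
  then show "integrable U (\<lambda>l. ln (G l))" by simp
qed

text \<open>Cut \<open>G\<close> at a level \<open>K\<close>: the bounded part contributes at most
  \<open>K\<close> times the sum of squares by Parseval, and the excess has small mean while the
  squared modulus is at most n times the sum of squares by Cauchy-Schwarz. Hence covariance matrices
  have norm o(n) even for unbounded weights.\<close>

lemma qform_small:
  assumes G: "integrable U G" "\<And>l. 0 \<le> G l" and d: "d > 0"
  shows "\<exists>N. \<forall>n\<ge>N. \<forall>c. (\<integral>l. (cmod (ev (polyn n c) l))\<^sup>2 * G l \<partial>U) \<le> d * real n * (\<Sum>i<n. (c i)\<^sup>2)"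
proof -
  have [measurable]: "G \<in> borel_measurable borel" using G(1) by (auto dest: borel_measurable_integrable)
  have "(\<lambda>n. \<integral>l. max (G l - real n) 0 \<partial>U) \<longlonglongrightarrow> (\<integral>l. 0 \<partial>U)"
  proof (rule integral_dominated_convergence[where w=G])
    show "AE l in U. (\<lambda>n. max (G l - real n) 0) \<longlonglongrightarrow> 0"
    proof (rule AE_I2, rule tendsto_eventually)
      fix l
      obtain N :: nat where "G l \<le> real N" using real_arch_simple by blast
      then have "n \<ge> N \<Longrightarrow> max (G l - real n) 0 = 0" for n by (auto dest: order_trans)
      then show "\<forall>\<^sub>F n in sequentially. max (G l - real n) 0 = 0"
        unfolding eventually_sequentially by metis
    qed
    show "AE l in U. norm (max (G l - real n) 0) \<le> G l" for n using G(2) by auto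
  qed (use G in auto)
  then have "eventually (\<lambda>n. (\<integral>l. max (G l - real n) 0 \<partial>U) < d / 2) sequentially"
    by (rule order_tendstoD) (use d in auto)
  then obtain K where K: "(\<integral>l. max (G l - real K) 0 \<partial>U) < d / 2"
    unfolding eventually_sequentially by auto
  obtain N where N: "2 * real K / d \<le> real N" using real_arch_simple by blast
  show ?thesis
  proof (intro exI[of _ N] allI impI)
    fix n c assume n: "N \<le> n"
    let ?S = "\<Sum>i<n. (c i)\<^sup>2" and ?f = "\<lambda>l. (cmod (ev (polyn n c) l))\<^sup>2"
    have S: "?S \<ge> 0" by (rule sum_nonneg) auto
    have f: "?f l \<le> real n * ?S" for l
    proof -
      have "cmod (ev (polyn n c) l) \<le> (\<Sum>i<n. \<bar>c i\<bar>)"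
      proof -
        have "ev (polyn n c) l = (\<Sum>i<n. of_real (c i) * cis (real i * l))"
          by (subst ev_eq[of n]) (auto simp: coeff_polyn intro!: sum.cong)
        also have "cmod \<dots> \<le> (\<Sum>i<n. \<bar>c i\<bar>)"
          by (rule order_trans[OF norm_sum]) (simp add: norm_mult)
        finally show ?thesis .
      qed
      then have "?f l \<le> (\<Sum>i<n. \<bar>c i\<bar>)\<^sup>2" by (intro power_mono) auto
      also have "\<dots> \<le> real n * ?S"
        using Cauchy_Schwarz_ineq_sum[of "\<lambda>_. 1" "\<lambda>i. \<bar>c i\<bar>" "{..<n}"] by simp
      finally show ?thesis .
    qed
    have i0: "integrable U (\<lambda>l. ?f l * 1)" by (rule integrable_cmod_ev) simp
    have i1: "integrable U (\<lambda>l. max (G l - real K) 0)"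
      by (rule Bochner_Integration.integrable_bound[OF G(1)]) (use G(2) in auto)
    have "(\<integral>l. ?f l * G l \<partial>U) \<le> (\<integral>l. ?f l * real K + real n * ?S * max (G l - real K) 0 \<partial>U)"
    proof (rule integral_mono)
      show "?f l * G l \<le> ?f l * real K + real n * ?S * max (G l - real K) 0" for l
      proof -
        have "?f l * G l \<le> ?f l * (real K + max (G l - real K) 0)" by (intro mult_left_mono) auto
        also have "\<dots> \<le> ?f l * real K + real n * ?S * max (G l - real K) 0"
          using f[of l] by (simp add: distrib_left mult_right_mono)
        finally show ?thesis .
      qed
    qed (use i0 i1 G in \<open>auto intro!: integrable_cmod_ev\<close>)
    also have "\<dots> = ?S * real K + real n * ?S * (\<integral>l. max (G l - real K) 0 \<partial>U)"
      using i0 i1 by (simp add: parseval_polyn)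
    also have "\<dots> \<le> ?S * (d / 2 * real n) + real n * ?S * (d / 2)"
    proof (intro add_mono mult_left_mono)
      have "real K \<le> d / 2 * real N" using N d by (simp add: field_simps)
      also have "\<dots> \<le> d / 2 * real n" using n d by (intro mult_left_mono) auto
      finally show "real K \<le> d / 2 * real n" .
    qed (use S K in auto)
    also have "\<dots> = d * real n * ?S" by (simp add: algebra_simps)
    finally show "(\<integral>l. ?f l * G l \<partial>U) \<le> d * real n * ?S" .
  qed
qed

section \<open>Folding the spectral density onto the half circle, and the water level\<close>

lemma integrable_reflect:
  fixes h :: "real \<Rightarrow> real"
  assumes [measurable]: "h \<in> borel_measurable borel"
  shows "set_integrable lborel {-pi<..<0} h \<longleftrightarrow> integrable U (\<lambda>x. h (- x))"
    and "(\<integral>x. indicator {-pi<..<0} x * h x \<partial>lborel) = pi * (\<integral>x. h (- x) \<partial>U)"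
proof -
  have ind: "indicator {-pi<..<0} (- x) = (indicator {0<..<pi} x :: real)" for x :: real by (auto simp: indicator_def)
  have "set_integrable lborel {-pi<..<0} h \<longleftrightarrow> integrable lborel (\<lambda>x. indicator {-pi<..<0} (0 + (-1) * x) * h (0 + (-1) * x))"
    unfolding set_integrable_def
    by (subst lborel_integrable_real_affine_iff[of "-1" _ 0, symmetric]) auto
  then show "set_integrable lborel {-pi<..<0} h \<longleftrightarrow> integrable U (\<lambda>x. h (- x))"
    by (subst integrable_U) (auto simp: ind set_integrable_def)
  have "(\<integral>x. indicator {-pi<..<0} x * h x \<partial>lborel) = (\<integral>x. indicator {-pi<..<0} (0 + (-1) * x) * h (0 + (-1) * x) \<partial>lborel)"
    by (subst lborel_integral_real_affine[of "-1" _ 0]) auto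
  also have "\<dots> = pi * (\<integral>x. h (- x) \<partial>U)"
    by (subst integral_U) (auto simp: ind interval_lebesgue_integral_def set_lebesgue_integral_def zero_ereal_def)
  finally show "(\<integral>x. indicator {-pi<..<0} x * h x \<partial>lborel) = pi * (\<integral>x. h (- x) \<partial>U)" .
qed

lemma LBINT_symmetric:
  fixes h :: "real \<Rightarrow> real"
  assumes [measurable]: "h \<in> borel_measurable borel" and i: "integrable U h" "integrable U (\<lambda>x. h (- x))"
  shows "(LBINT x=-pi..pi. h x) = pi * ((\<integral>x. h x \<partial>U) + (\<integral>x. h (- x) \<partial>U))"
proof -
  have i1: "set_integrable lborel {0<..<pi} h" using i(1) by (simp add: integrable_U)
  have i2: "set_integrable lborel {-pi<..<0} h" using i(2) by (simp add: integrable_reflect)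
  have "(LBINT x=-pi..pi. h x) = (\<integral>x. indicator {-pi<..<pi} x * h x \<partial>lborel)"
    by (simp add: interval_lebesgue_integral_def set_lebesgue_integral_def)
  also have "\<dots> = (\<integral>x. indicator {-pi<..<0} x * h x + indicator {0<..<pi} x * h x \<partial>lborel)"
    using AE_lborel_singleton[of 0]
    by (intro integral_cong_AE) (auto simp: indicator_def elim!: eventually_mono)
  also have "\<dots> = (\<integral>x. indicator {-pi<..<0} x * h x \<partial>lborel) + (\<integral>x. indicator {0<..<pi} x * h x \<partial>lborel)"
    using i1 i2 by (subst Bochner_Integration.integral_add) (auto simp: set_integrable_def)
  also have "(\<integral>x. indicator {0<..<pi} x * h x \<partial>lborel) = pi * (\<integral>x. h x \<partial>U)"
    by (subst integral_U) (auto simp: interval_lebesgue_integral_def set_lebesgue_integral_def zero_ereal_def)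
  finally show ?thesis by (simp add: integrable_reflect distrib_left)
qed

lemma spectral_density_half:
  fixes h :: "real \<Rightarrow> real"
  assumes [measurable]: "h \<in> borel_measurable borel" and i: "set_integrable lborel {-pi..pi} h"
  shows "integrable U h" "integrable U (\<lambda>x. h (- x))"
proof -
  have "set_integrable lborel {0<..<pi} h" "set_integrable lborel {-pi<..<0} h"
    by (rule set_integrable_subset[OF i]; auto)+
  then show "integrable U h" "integrable U (\<lambda>x. h (- x))"
    by (simp_all add: integrable_U integrable_reflect)
qed

text \<open>The factor pi compensates the density 1/pi of \<open>U\<close>, so that
  \<open>\<gamma>\<close> has cosine weight \<open>Gs g\<close>. The indicator makes the function
  nonnegative on the whole line although \<open>g\<close> is controlled only between -pi and
  pi.\<close>

definition Gs :: "(real \<Rightarrow> real) \<Rightarrow> real \<Rightarrow> real" where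
  "Gs g l = indicator {0..pi} l * (pi * (g l + g (- l)))"

lemma Gs_measurable[measurable]:
  assumes [measurable]: "g \<in> borel_measurable borel" shows "Gs g \<in> borel_measurable borel"
  unfolding Gs_def[abs_def] by measurable

context
  fixes \<gamma> :: "int \<Rightarrow> real" and g :: "real \<Rightarrow> real"
  assumes spec: "spectral_density \<gamma> g"
begin

lemma spec_meas[measurable]: "g \<in> borel_measurable borel"
  using spec by (auto simp: spectral_density_def)

lemma spec_half: "integrable U g" "integrable U (\<lambda>x. g (- x))"
  using spec by (auto intro: spectral_density_half simp: spectral_density_def)

lemma AE_Gs: "AE l in U. Gs g l = pi * (g l + g (- l))"
  using AE_U_in by eventually_elim (auto simp: Gs_def)

lemma Gs_meas: "Gs g \<in> borel_measurable borel"
  by measurable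

lemma Gs_integrable: "integrable U (Gs g)"
proof -
  have "integrable U (\<lambda>l. pi * (g l + g (- l)))" using spec_half by auto
  then show ?thesis by (rule integrable_cong_AE_imp) (use AE_Gs in \<open>auto elim: eventually_mono\<close>)
qed

lemma Gs_nonneg: "0 \<le> Gs g l"
  using spec by (auto simp: Gs_def spectral_density_def indicator_def)

lemma spec_trig:
  assumes [measurable]: "f \<in> borel_measurable borel" and b: "\<And>x. \<bar>f x\<bar> \<le> (1::real)"
  shows "(LBINT l=-pi..pi. f l * g l) = pi * ((\<integral>x. f x * g x \<partial>U) + (\<integral>x. f (- x) * g (- x) \<partial>U))"
  by (rule LBINT_symmetric)
     (use spec_half b in \<open>auto intro: U_integrable_mult_bounded[where B=1]\<close>)

lemma spec_cos_sin:
  "\<gamma> k = (LBINT l=-pi..pi. cos (real_of_int k * l) * g l)" (is ?A)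
  "0 = (LBINT l=-pi..pi. sin (real_of_int k * l) * g l)" (is ?B)
proof -
  have gi: "integrable lborel (\<lambda>l. indicator {-pi<..<pi} l *\<^sub>R g l)"
  proof -
    have "set_integrable lborel {-pi<..<pi} g"
      by (rule set_integrable_subset[of lborel "{-pi..pi}"]) (use spec in \<open>auto simp: spectral_density_def\<close>)
    then show ?thesis by (simp add: set_integrable_def)
  qed
  let ?F = "\<lambda>l. indicator {-pi<..<pi} l *\<^sub>R (cis (real_of_int k * l) * complex_of_real (g l))"
  have I: "integrable lborel ?F"
  proof (rule Bochner_Integration.integrable_bound[OF gi])
    show "?F \<in> borel_measurable lborel"
    proof -
      have [measurable]: "(\<lambda>l. cis (real_of_int k * l)) \<in> borel_measurable borel"
        by (intro borel_measurable_continuous_onI continuous_intros)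
      show ?thesis by measurable
    qed
  qed (auto simp: norm_mult)
  have eq: "complex_of_real (\<gamma> k) = (\<integral>l. ?F l \<partial>lborel)"
    using spec by (simp add: spectral_density_def interval_lebesgue_integral_def set_lebesgue_integral_def)
  have "Re (complex_of_real (\<gamma> k)) = (\<integral>l. Re (?F l) \<partial>lborel)"
    unfolding eq by (rule integral_Re[OF I, symmetric])
  then show ?A by (simp add: interval_lebesgue_integral_def set_lebesgue_integral_def)
  have "Im (complex_of_real (\<gamma> k)) = (\<integral>l. Im (?F l) \<partial>lborel)"
    unfolding eq by (rule integral_Im[OF I, symmetric])
  then show ?B by (simp add: interval_lebesgue_integral_def set_lebesgue_integral_def)
qed

lemma gamma_Gs: "\<gamma> k = (\<integral>l. cos (real_of_int k * l) * Gs g l \<partial>U)"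
proof -
  have i: "integrable U (\<lambda>x. cos (real_of_int k * x) * g x)" "integrable U (\<lambda>x. cos (real_of_int k * x) * g (- x))"
    by (intro U_integrable_mult_bounded[where B=1] spec_half; auto)+
  have "\<gamma> k = pi * ((\<integral>x. cos (real_of_int k * x) * g x \<partial>U) + (\<integral>x. cos (real_of_int k * x) * g (- x) \<partial>U))"
    by (subst spec_cos_sin, subst spec_trig) auto
  also have "\<dots> = (\<integral>x. pi * (cos (real_of_int k * x) * g x + cos (real_of_int k * x) * g (- x)) \<partial>U)"
    using i by simp
  also have "\<dots> = (\<integral>l. cos (real_of_int k * l) * Gs g l \<partial>U)"
    by (rule integral_cong_AE) (use AE_Gs in \<open>auto elim!: eventually_mono simp: algebra_simps\<close>)
  finally show ?thesis .
qed

text \<open>A finite measure on the circle is determined by its Fourier coefficients; here only the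
  odd part of the density has to be shown to vanish, and it is tested against
  products of the sine with cosine polynomials.\<close>

lemma spec_even: "AE l in U. g (- l) = g l"
proof -
  \<comment> \<open>The factor sin turns cosine tests of \<open>D\<close> into sine tests of the odd
    part of \<open>g\<close>, because cos(n x) sin(x) is half the difference of two sines; those
    integrals vanish as \<open>\<gamma>\<close> is real. On the open interval sin is positive, so
    nothing is lost.\<close>
  define D where "D l = sin l * (g l - g (- l))" for l
  have iD: "integrable U D"
    unfolding D_def by (rule U_integrable_mult_bounded[where B=1]) (use spec_half in auto)
  then have [measurable]: "D \<in> borel_measurable borel" by (auto dest: borel_measurable_integrable)
  have s: "(\<integral>x. sin (real_of_int k * x) * (g x - g (- x)) \<partial>U) = 0" for k
  proof -
    have i: "integrable U (\<lambda>x. sin (real_of_int k * x) * g x)" "integrable U (\<lambda>x. sin (real_of_int k * x) * g (- x))"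
      by (intro U_integrable_mult_bounded[where B=1] spec_half; auto)+
    have "0 = pi * ((\<integral>x. sin (real_of_int k * x) * g x \<partial>U) + (\<integral>x. sin (real_of_int k * - x) * g (- x) \<partial>U))"
      by (subst spec_cos_sin(2)[of k], subst spec_trig) auto
    then show ?thesis using i by (simp add: right_diff_distrib)
  qed
  have is': "integrable U (\<lambda>x. sin (real_of_int k * x) * (g x - g (- x)))" for k
    by (intro U_integrable_mult_bounded[where B=1] Bochner_Integration.integrable_diff spec_half) auto
  have c: "(\<integral>x. cos (real n * x) * D x \<partial>U) = 0" for n
  proof -
    have "cos (real n * x) * D x = (sin (real_of_int (int n + 1) * x) * (g x - g (- x)) - sin (real_of_int (int n - 1) * x) * (g x - g (- x))) / 2" for x
      by (simp add: D_def distrib_right left_diff_distrib sin_add sin_diff algebra_simps)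
    then have "(\<integral>x. cos (real n * x) * D x \<partial>U) =
      (\<integral>x. (sin (real_of_int (int n + 1) * x) * (g x - g (- x)) - sin (real_of_int (int n - 1) * x) * (g x - g (- x))) / 2 \<partial>U)"
      by (simp only:)
    also have "\<dots> = 0"
      using is'[of "int n + 1"] is'[of "int n - 1"] s[of "int n + 1"] s[of "int n - 1"]
      by (simp del: of_int_add of_int_diff)
    finally show ?thesis .
  qed
  have p: "(\<integral>x. Re (ev p x) * D x \<partial>U) = 0" for p
  proof -
    have ic: "integrable U (\<lambda>x. coeff p i * (cos (real i * x) * D x))" for i
      by (intro integrable_mult_right U_integrable_mult_bounded[where B=1] iD) auto
    have "(\<integral>x. Re (ev p x) * D x \<partial>U) = (\<integral>x. (\<Sum>i<Suc (degree p). coeff p i * (cos (real i * x) * D x)) \<partial>U)"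
      by (simp only: Re_ev sum_distrib_right mult.assoc)
    also have "\<dots> = (\<Sum>i<Suc (degree p). \<integral>x. coeff p i * (cos (real i * x) * D x) \<partial>U)"
      by (rule Bochner_Integration.integral_sum) (rule ic)
    also have "\<dots> = 0" using c by simp
    finally show ?thesis .
  qed
  \<comment> \<open>Testing \<open>D\<close> against cosine polynomials that converge to its sign
    turns orthogonality into vanishing of the integral of |D|.\<close>
  have sgnb: "- 1 \<le> sgn (D l)" "sgn (D l) \<le> 1" for l by (auto simp: sgn_if)
  have "(\<lambda>l. sgn (D l)) \<in> borel_measurable borel" by measurable
  from bounded_ae_limit_cosine_polys[OF this sgnb]
  obtain T where T0: "\<forall>n. \<forall>l\<in>{0..pi}. -1 - 1 / Suc n \<le> Re (ev (T n) l) \<and> Re (ev (T n) l) \<le> 1 + 1 / Suc n"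
     and Tlim: "AE l in U. (\<lambda>n. Re (ev (T n) l)) \<longlonglongrightarrow> sgn (D l)"
    by blast
  have "(\<lambda>n. \<integral>x. Re (ev (T n) x) * D x \<partial>U) \<longlonglongrightarrow> (\<integral>x. sgn (D x) * D x \<partial>U)"
  proof (rule integral_dominated_convergence[where w="\<lambda>l. 2 * \<bar>D l\<bar>"])
    show "AE l in U. (\<lambda>n. Re (ev (T n) l) * D l) \<longlonglongrightarrow> sgn (D l) * D l"
      using Tlim by eventually_elim (intro tendsto_intros)
    show "AE l in U. norm (Re (ev (T n) l) * D l) \<le> 2 * \<bar>D l\<bar>" for n
      using AE_U_in
    proof eventually_elim
      case (elim l)
      have "1 / real (Suc n) \<le> 1" by simp
      moreover have "-1 - 1 / Suc n \<le> Re (ev (T n) l) \<and> Re (ev (T n) l) \<le> 1 + 1 / Suc n"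
        using T0 elim by auto
      ultimately have "\<bar>Re (ev (T n) l)\<bar> \<le> 2" by linarith
      then show ?case by (simp add: abs_mult mult_right_mono)
    qed
  qed (use iD in auto)
  then have "(\<integral>x. sgn (D x) * D x \<partial>U) = 0" using p by (simp add: LIMSEQ_const_iff)
  then have "(\<integral>x. \<bar>D x\<bar> \<partial>U) = 0" by (simp add: abs_sgn mult.commute)
  then have "AE x in U. \<bar>D x\<bar> = 0"
    by (subst (asm) integral_nonneg_eq_0_iff_AE) (use iD in auto)
  with AE_U_in show ?thesis
  proof eventually_elim
    case (elim x)
    then have "sin x > 0" by (auto intro: sin_gt_zero)
    with elim show ?case by (auto simp: D_def)
  qed
qed

lemma AE_Gs_even: "AE l in U. g l = Gs g l / (2 * pi) \<and> g (- l) = Gs g l / (2 * pi)"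
  using spec_even AE_Gs by eventually_elim (auto simp: field_simps)

text \<open>Here evenness of \<open>g\<close> matters: \<open>F\<close> is nonlinear, so knowing the
  folded sum is not enough, and \<open>g\<close> itself must equal \<open>Gs g / (2 * pi)\<close> on
  both halves.\<close>

lemma LBINT_fun_spec:
  assumes [measurable]: "F \<in> borel_measurable borel" and i: "integrable U (\<lambda>l. F (Gs g l / (2 * pi)))"
  shows "(LBINT l=-pi..pi. F (g l)) = 2 * pi * (\<integral>l. F (Gs g l / (2 * pi)) \<partial>U)"
proof -
  have e1: "AE l in U. g l = Gs g l / (2 * pi)" and e2: "AE l in U. g (- l) = Gs g l / (2 * pi)"
    using AE_Gs_even by (eventually_elim, simp)+
  have f1: "AE l in U. F (g l) = F (Gs g l / (2 * pi))" using e1 by eventually_elim simp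
  have f2: "AE l in U. F (g (- l)) = F (Gs g l / (2 * pi))" using e2 by eventually_elim simp
  have e: "(\<integral>l. F (g l) \<partial>U) = (\<integral>l. F (Gs g l / (2 * pi)) \<partial>U)"
    by (rule integral_cong_AE[OF _ _ f1]) measurable
  moreover have "(\<integral>l. F (g (- l)) \<partial>U) = (\<integral>l. F (Gs g l / (2 * pi)) \<partial>U)"
    by (rule integral_cong_AE[OF _ _ f2]) measurable
  moreover have "integrable U (\<lambda>l. F (g l))"
    by (rule integrable_cong_AE_imp[OF i]) (use f1 in \<open>auto elim: eventually_mono\<close>)
  moreover have "integrable U (\<lambda>l. F (g (- l)))"
    by (rule integrable_cong_AE_imp[OF i]) (use f2 in \<open>auto elim: eventually_mono\<close>)
  ultimately show ?thesis
    by (subst LBINT_symmetric) auto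
qed

end

declare spec_meas[measurable del]

text \<open>Existence is the intermediate value theorem: the mean is 1-Lipschitz in the level, 0 at
  level 0 and at least P at level P plus the mean of \<open>G\<close>. Uniqueness holds because the
  mean grows at least proportionally to the level. Both are required to resolve the definite
  description in \<open>alpha_P\<close>.\<close>

lemma waterlevel:
  fixes G :: "real \<Rightarrow> real"
  assumes G: "integrable U G" "\<And>l. 0 \<le> G l" and P: "P > 0"
  shows "\<exists>\<theta>>0. (\<integral>l. max (\<theta> - G l) 0 \<partial>U) = P"
    and "\<And>a b. a > 0 \<Longrightarrow> b > 0 \<Longrightarrow> (\<integral>l. max (a - G l) 0 \<partial>U) = P \<Longrightarrow> (\<integral>l. max (b - G l) 0 \<partial>U) = P \<Longrightarrow> a = b"
proof -
  have [measurable]: "G \<in> borel_measurable borel" using G(1) by (auto dest: borel_measurable_integrable)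
  define \<psi> where "\<psi> a = (\<integral>l. max (a - G l) 0 \<partial>U)" for a
  have i: "integrable U (\<lambda>l. max (a - G l) 0)" for a
  proof (rule U_integrable_bounded[where B="\<bar>a\<bar>"])
    fix l
    show "\<bar>max (a - G l) 0\<bar> \<le> \<bar>a\<bar>" using G(2)[of l] by linarith
  qed measurable
  have lip: "\<psi> a \<le> \<psi> b + \<bar>a - b\<bar>" for a b
  proof -
    have "\<psi> a \<le> (\<integral>l. max (b - G l) 0 + \<bar>a - b\<bar> \<partial>U)"
      unfolding \<psi>_def by (rule integral_mono) (use i in auto)
    then show ?thesis using i by (simp add: \<psi>_def)
  qed
  have cont: "isCont \<psi> x" for x
    unfolding isCont_def
  proof (rule LIM_I)
    fix r :: real assume "r > 0"
    then show "\<exists>s>0. \<forall>y. y \<noteq> x \<and> norm (y - x) < s \<longrightarrow> norm (\<psi> y - \<psi> x) < r"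
      using lip[of x] lip[of _ x] by (intro exI[of _ r]) (auto simp: abs_if abs_minus_commute split: if_splits, (smt (verit))+)
  qed
  define b where "b = P + (\<integral>l. G l \<partial>U)"
  have b0: "b \<ge> 0" unfolding b_def using P G by (auto intro!: add_nonneg_nonneg integral_nonneg_AE)
  have "\<psi> 0 = 0" using G(2) by (simp add: \<psi>_def max_def)
  moreover have "\<psi> b \<ge> P"
  proof -
    have "P = (\<integral>l. b - G l \<partial>U)" using G by (simp add: b_def)
    also have "\<dots> \<le> \<psi> b" unfolding \<psi>_def by (rule integral_mono) (use i G in auto)
    finally show ?thesis .
  qed
  ultimately obtain x where x: "0 \<le> x" "\<psi> x = P"
    using IVT[of \<psi> 0 P b] cont b0 P by auto
  with \<open>\<psi> 0 = 0\<close> P have "x > 0" by (cases "x = 0") auto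
  with x show "\<exists>\<theta>>0. (\<integral>l. max (\<theta> - G l) 0 \<partial>U) = P" by (auto simp: \<psi>_def)
  have lt: False if ab: "0 < a" "a < b" and eq: "\<psi> a = P" "\<psi> b = P" for a b
  proof -
    \<comment> \<open>Scaling the level and \<open>G\<close> together by a/b < 1 scales the whole
      area, and leaving \<open>G\<close> unscaled can only reduce it; so \<open>\<psi> a\<close> is
      at most (a/b) P < P.\<close>
    have "\<psi> a \<le> (\<integral>l. (a / b) * max (b - G l) 0 \<partial>U)"
      unfolding \<psi>_def
    proof (rule integral_mono)
      fix l
      have "(a / b) * (b - G l) = a - (a / b) * G l" using ab by (simp add: field_simps)
      moreover have "(a / b) * G l \<le> 1 * G l" using ab G(2)[of l] by (intro mult_right_mono) auto
      moreover have "(a / b) * max (b - G l) 0 \<ge> (a / b) * (b - G l)" "(a / b) * max (b - G l) 0 \<ge> 0"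
        using ab mult_left_mono[of "b - G l" "max (b - G l) 0" "a / b"] by auto
      ultimately show "max (a - G l) 0 \<le> (a / b) * max (b - G l) 0" by auto
    qed (use i in auto)
    also have "\<dots> = (a / b) * P" using eq(2) by (simp add: \<psi>_def)
    finally show False using ab eq(1) P by (simp add: field_simps)
  qed
  show "a = b" if "a > 0" "b > 0" "(\<integral>l. max (a - G l) 0 \<partial>U) = P" "(\<integral>l. max (b - G l) 0 \<partial>U) = P" for a b
    using lt[of a b] lt[of b a] that by (cases a b rule: linorder_cases) (auto simp: \<psi>_def)
qed

lemma alpha_P_Gs:
  assumes spec: "spectral_density \<gamma> g" and P: "P > 0"
  shows "alpha_P g P > 0" "(\<integral>l. max (2 * pi * alpha_P g P - Gs g l) 0 \<partial>U) = P"
proof -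
  note Gm[measurable] = Gs_meas[OF spec]
  have i: "integrable U (\<lambda>l. max (a - Gs g l / (2 * pi)) 0)" for a
  proof (rule U_integrable_bounded[where B="\<bar>a\<bar>"])
    fix l
    have "0 \<le> Gs g l / (2 * pi)" using Gs_nonneg[OF spec] by simp
    then show "\<bar>max (a - Gs g l / (2 * pi)) 0\<bar> \<le> \<bar>a\<bar>" by linarith
  qed measurable
  have e: "(LBINT l=-pi..pi. max (a - g l) 0) = (\<integral>l. max (2 * pi * a - Gs g l) 0 \<partial>U)" for a
  proof -
    have "(LBINT l=-pi..pi. max (a - g l) 0) = 2 * pi * (\<integral>l. max (a - Gs g l / (2 * pi)) 0 \<partial>U)"
      by (rule LBINT_fun_spec[OF spec, of "\<lambda>x. max (a - x) 0"]) (use i in auto)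
    also have "\<dots> = (\<integral>l. 2 * pi * max (a - Gs g l / (2 * pi)) 0 \<partial>U)" by simp
    also have "\<dots> = (\<integral>l. max (2 * pi * a - Gs g l) 0 \<partial>U)"
      by (rule Bochner_Integration.integral_cong) (auto simp: max_def field_simps)
    finally show ?thesis .
  qed
  obtain \<theta> where \<theta>: "\<theta> > 0" "(\<integral>l. max (\<theta> - Gs g l) 0 \<partial>U) = P"
    using waterlevel(1)[OF Gs_integrable[OF spec] Gs_nonneg[OF spec] P] by blast
  have "alpha_P g P > 0 \<and> (LBINT l=-pi..pi. max (alpha_P g P - g l) 0) = P"
    unfolding alpha_P_def
  proof (rule theI)
    show "\<theta> / (2 * pi) > 0 \<and> (LBINT l=-pi..pi. max (\<theta> / (2 * pi) - g l) 0) = P"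
      using \<theta> by (simp add: e)
    fix a assume a: "a > 0 \<and> (LBINT l=-pi..pi. max (a - g l) 0) = P"
    then have "2 * pi * a = \<theta>"
      using waterlevel(2)[OF Gs_integrable[OF spec] Gs_nonneg[OF spec] P, of "2 * pi * a" \<theta>] \<theta> by (simp add: e)
    then show "a = \<theta> / (2 * pi)" by (simp add: field_simps)
  qed
  then show "alpha_P g P > 0" "(\<integral>l. max (2 * pi * alpha_P g P - Gs g l) 0 \<partial>U) = P"
    by (simp_all add: e)
qed

text \<open>After folding, 1 + f/g is max(G, \<theta>)/G wherever G > 0, and 1/(4 pi) times the
  length 2 pi leaves the factor 1/2. The right side is the form in which the capacity is used for
  the channel.\<close>

lemma capacity_Gs:
  assumes spec: "spectral_density \<gamma> g" and P: "P > 0"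
    and pos: "AE l in U. 0 < Gs g l" and L: "integrable U (\<lambda>l. ln (Gs g l))"
  defines "\<theta> \<equiv> 2 * pi * alpha_P g P"
  shows "1 / (4 * pi) * (LBINT l=-pi..pi. ln (1 + wf g P l / g l))
     = 1 / 2 * ((\<integral>l. ln (max (Gs g l) \<theta>) \<partial>U) - (\<integral>l. ln (Gs g l) \<partial>U))"
proof -
  note Gm[measurable] = Gs_meas[OF spec]
  define a where "a = alpha_P g P"
  have a: "a > 0" using alpha_P_Gs[OF spec P] by (simp add: a_def)
  have \<theta>: "\<theta> = 2 * pi * a" "\<theta> > 0" using a by (auto simp: \<theta>_def a_def)
  define F where "F x = ln (1 + max (a - x) 0 / x)" for x
  have iH: "integrable U (\<lambda>l. ln (max (Gs g l) \<theta>))"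
    by (rule integrable_ln_shift[of _ \<theta>]) (use Gs_integrable[OF spec] \<theta> in auto)
  have eq: "AE l in U. F (Gs g l / (2 * pi)) = ln (max (Gs g l) \<theta>) - ln (Gs g l)"
    using pos
  proof eventually_elim
    case (elim l)
    have "1 + max (a - Gs g l / (2 * pi)) 0 / (Gs g l / (2 * pi)) = max (Gs g l) \<theta> / Gs g l"
      using elim \<theta> by (simp add: max_def field_simps)
    then show ?case using elim \<theta> by (simp add: F_def ln_div)
  qed
  have [measurable]: "F \<in> borel_measurable borel" unfolding F_def[abs_def] by measurable
  have "integrable U (\<lambda>l. ln (max (Gs g l) \<theta>) - ln (Gs g l))" using iH L by auto
  then have iF: "integrable U (\<lambda>l. F (Gs g l / (2 * pi)))"
  proof (rule integrable_cong_AE_imp)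
    show "(\<lambda>l. F (Gs g l / (2 * pi))) \<in> borel_measurable U" by measurable
    show "AE l in U. ln (max (Gs g l) \<theta>) - ln (Gs g l) = F (Gs g l / (2 * pi))"
      using eq by eventually_elim simp
  qed
  have "(LBINT l=-pi..pi. ln (1 + wf g P l / g l)) = (LBINT l=-pi..pi. F (g l))"
    by (simp add: F_def wf_def a_def)
  also have "\<dots> = 2 * pi * (\<integral>l. F (Gs g l / (2 * pi)) \<partial>U)"
    by (rule LBINT_fun_spec[OF spec _ iF]) measurable
  also have "(\<integral>l. F (Gs g l / (2 * pi)) \<partial>U) = (\<integral>l. ln (max (Gs g l) \<theta>) - ln (Gs g l) \<partial>U)"
    by (rule integral_cong_AE[OF _ _ eq]) measurable
  also have "\<dots> = (\<integral>l. ln (max (Gs g l) \<theta>) \<partial>U) - (\<integral>l. ln (Gs g l) \<partial>U)" using iH L by simp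
  finally show ?thesis by simp
qed

text \<open>Induction on the gap: the coefficient at n is cancelled by subtracting its multiple of a
  shifted predictor x^n p, whose error is chosen tiny relative to that coefficient. Arbitrarily
  small one-step errors thus give arbitrarily small errors from remote variables alone.\<close>

lemma remote_predictors:
  assumes G: "integrable U G" "\<And>l. 0 \<le> G l"
    and small: "\<And>S. S > 0 \<Longrightarrow> \<exists>p. coeff p 0 = 1 \<and> (\<integral>l. (cmod (ev p l))\<^sup>2 * G l \<partial>U) < S"
    and e: "e > 0"
  shows "\<exists>r. coeff r 0 = 1 \<and> (\<forall>i. 0 < i \<and> i < n \<longrightarrow> coeff r i = 0) \<and> (\<integral>l. (cmod (ev r l))\<^sup>2 * G l \<partial>U) < e"
  using e
proof (induction n arbitrary: e)
  case 0 then show ?case using small by auto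
next
  case (Suc n)
  show ?case
  proof (cases "n = 0")
    case True then show ?thesis using small[OF Suc.prems] by auto
  next
    case False
    obtain r where r: "coeff r 0 = 1" "\<And>i. 0 < i \<Longrightarrow> i < n \<Longrightarrow> coeff r i = 0" "(\<integral>l. (cmod (ev r l))\<^sup>2 * G l \<partial>U) < e / 4"
      using Suc.IH[of "e / 4"] Suc.prems by auto
    define a where "a = coeff r n"
    \<comment> \<open>Errors are doubled when the square of the sum is split, so e/4 for
      \<open>r\<close> and e/(4 (a^2 + 1)) for \<open>p\<close> leave less than e in total; the
      added 1 covers a = 0.\<close>
    obtain p where p: "coeff p 0 = 1" "(\<integral>l. (cmod (ev p l))\<^sup>2 * G l \<partial>U) < e / (4 * (a\<^sup>2 + 1))"
      using small[of "e / (4 * (a\<^sup>2 + 1))"] Suc.prems by (auto simp: add_nonneg_pos)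
    define r' where "r' = r - monom a n * p"
    have i: "integrable U (\<lambda>l. (cmod (ev q l))\<^sup>2 * G l)" for q by (rule integrable_cmod_ev[OF G(1)])
    have ev': "ev r' l = ev r l - of_real a * cis (real n * l) * ev p l" for l
    proof -
      have "r' = r + Polynomial.smult (-1) (monom a n * p)" by (simp add: r'_def)
      then show ?thesis by (simp only: ev_add ev_smult ev_mult ev_monom) simp
    qed
    have "(\<integral>l. (cmod (ev r' l))\<^sup>2 * G l \<partial>U) \<le> (\<integral>l. 2 * ((cmod (ev r l))\<^sup>2 * G l) + 2 * a\<^sup>2 * ((cmod (ev p l))\<^sup>2 * G l) \<partial>U)"
    proof (rule integral_mono)
      fix l
      have "cmod (ev r' l) \<le> cmod (ev r l) + \<bar>a\<bar> * cmod (ev p l)"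
        unfolding ev' by (rule order_trans[OF norm_triangle_ineq4]) (simp add: norm_mult)
      then have "(cmod (ev r' l))\<^sup>2 \<le> (cmod (ev r l) + \<bar>a\<bar> * cmod (ev p l))\<^sup>2" by (intro power_mono) auto
      also have "\<dots> \<le> 2 * (cmod (ev r l))\<^sup>2 + 2 * a\<^sup>2 * (cmod (ev p l))\<^sup>2"
      proof -
        have "(x + y)\<^sup>2 \<le> 2 * x\<^sup>2 + 2 * y\<^sup>2" for x y :: real
          using zero_le_power2[of "x - y"] by (simp add: power2_eq_square algebra_simps)
        from this[of "cmod (ev r l)" "\<bar>a\<bar> * cmod (ev p l)"] show ?thesis by (simp add: power_mult_distrib)
      qed
      finally have "(cmod (ev r' l))\<^sup>2 * G l \<le> (2 * (cmod (ev r l))\<^sup>2 + 2 * a\<^sup>2 * (cmod (ev p l))\<^sup>2) * G l"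
        using G(2) by (intro mult_right_mono) auto
      then show "(cmod (ev r' l))\<^sup>2 * G l \<le> 2 * ((cmod (ev r l))\<^sup>2 * G l) + 2 * a\<^sup>2 * ((cmod (ev p l))\<^sup>2 * G l)"
        by (simp add: algebra_simps)
    qed (use i in auto)
    also have "\<dots> = 2 * (\<integral>l. (cmod (ev r l))\<^sup>2 * G l \<partial>U) + 2 * a\<^sup>2 * (\<integral>l. (cmod (ev p l))\<^sup>2 * G l \<partial>U)"
      using i by simp
    also have "\<dots> < e"
    proof -
      have "2 * a\<^sup>2 * (\<integral>l. (cmod (ev p l))\<^sup>2 * G l \<partial>U) \<le> 2 * a\<^sup>2 * (e / (4 * (a\<^sup>2 + 1)))"
        using p(2) by (intro mult_left_mono) auto
      also have "\<dots> = (a\<^sup>2 / (a\<^sup>2 + 1)) * (e / 2)"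
      proof -
        have "2 * x * (e / (4 * (x + 1))) = (x / (x + 1)) * (e / 2)" if "x + 1 \<noteq> 0" for x
          using that by (simp add: divide_simps)
        moreover have "a\<^sup>2 + 1 \<noteq> 0" using zero_le_power2[of a] by linarith
        ultimately show ?thesis by blast
      qed
      also have "\<dots> \<le> 1 * (e / 2)" using Suc.prems by (intro mult_right_mono) (auto simp: divide_le_eq_1 add_nonneg_pos)
      finally show ?thesis using r(3) by simp
    qed
    finally have "(\<integral>l. (cmod (ev r' l))\<^sup>2 * G l \<partial>U) < e" .
    moreover have "coeff r' i = (if i < n then coeff r i else coeff r i - a * coeff p (i - n))" for i
      by (simp add: r'_def coeff_monom_mult)
    ultimately show ?thesis using r p False
      by (intro exI[of _ r']) (auto simp: a_def less_Suc_eq)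
  qed
qed

text \<open>If prediction errors could be arbitrarily small, \<open>remote_predictors\<close> would
  place \<open>Z 0\<close> in the closed span of the variables from n on, for every n. Pure
  nondeterminism makes every such variable null, against positive variance.\<close>

lemma regular_prediction_bound:
  assumes noise: "ANWGN_noise M Z \<gamma>" and nondeg: "\<gamma> 0 > 0" and spec: "spectral_density \<gamma> g"
  shows "\<exists>S>0. \<forall>p. coeff p 0 = 1 \<longrightarrow> S \<le> (\<integral>l. (cmod (ev p l))\<^sup>2 * Gs g l \<partial>U)"
proof (rule ccontr)
  assume "\<not> ?thesis"
  then have small: "\<exists>p. coeff p 0 = 1 \<and> (\<integral>l. (cmod (ev p l))\<^sup>2 * Gs g l \<partial>U) < S" if "S > 0" for S
    using that by (meson not_le)
  interpret prob_space M using noise by (simp add: ANWGN_noise_def)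
  have Zm[measurable]: "Z k \<in> borel_measurable M" for k using noise by (simp add: ANWGN_noise_def)
  have Z2: "integrable M (\<lambda>\<omega>. (Z k \<omega>)\<^sup>2)" for k using noise by (simp add: ANWGN_noise_def)
  have cov: "(\<integral>\<omega>. Z i \<omega> * Z j \<omega> \<partial>M) = \<gamma> (int j - int i)" for i j using noise by (simp add: ANWGN_noise_def)
  have ZZ: "integrable M (\<lambda>\<omega>. Z i \<omega> * Z j \<omega>)" for i j
  proof (rule Bochner_Integration.integrable_bound[of M "\<lambda>\<omega>. (Z i \<omega>)\<^sup>2 + (Z j \<omega>)\<^sup>2"])
    have ab: "\<bar>a * b\<bar> \<le> a\<^sup>2 + b\<^sup>2" for a b :: real
    proof -
      have "0 \<le> (\<bar>a\<bar> - \<bar>b\<bar>)\<^sup>2" by simp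
      then have "2 * (\<bar>a\<bar> * \<bar>b\<bar>) \<le> a\<^sup>2 + b\<^sup>2" by (simp add: power2_eq_square algebra_simps)
      moreover have "0 \<le> \<bar>a\<bar> * \<bar>b\<bar>" by simp
      ultimately show ?thesis unfolding abs_mult by linarith
    qed
    show "AE \<omega> in M. norm (Z i \<omega> * Z j \<omega>) \<le> norm ((Z i \<omega>)\<^sup>2 + (Z j \<omega>)\<^sup>2)" using ab by auto
  qed (use Z2 in auto)
  have "in_closed_span_from M Z n (Z 0)" for n
    unfolding in_closed_span_from_def
  proof (intro allI impI)
    fix e :: real assume "e > 0"
    from remote_predictors[OF Gs_integrable[OF spec] Gs_nonneg[OF spec] small this, of n]
    obtain r where r: "coeff r 0 = 1" "\<And>i. 0 < i \<Longrightarrow> i < n \<Longrightarrow> coeff r i = 0" "(\<integral>l. (cmod (ev r l))\<^sup>2 * Gs g l \<partial>U) < e"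
      by auto
    define N where "N = Suc (degree r) + n"
    \<comment> \<open>The coefficients of 1 - r. Those strictly between 0 and n vanish, so summing
      from n on loses nothing, also for n = 0 since the coefficient at 0 is 0.\<close>
    define c where "c k = (if k = 0 then 0 else - coeff r k)" for k
    have "Z 0 \<omega> - (\<Sum>k\<in>{n..<N}. c k * Z k \<omega>) = (\<Sum>k<N. coeff r k * Z k \<omega>)" for \<omega>
    proof -
      have "(\<Sum>k\<in>{n..<N}. c k * Z k \<omega>) = (\<Sum>k<N. c k * Z k \<omega>)"
        by (rule sum.mono_neutral_left) (auto simp: c_def r(2))
      also have "\<dots> = (\<Sum>k<N. (if k = 0 then Z 0 \<omega> else 0) - coeff r k * Z k \<omega>)"
        by (intro sum.cong) (auto simp: c_def r(1))
      also have "\<dots> = Z 0 \<omega> - (\<Sum>k<N. coeff r k * Z k \<omega>)"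
        by (simp add: sum_subtractf N_def)
      finally show ?thesis by simp
    qed
    then have "(\<integral>\<omega>. (Z 0 \<omega> - (\<Sum>k\<in>{n..<N}. c k * Z k \<omega>))\<^sup>2 \<partial>M) = (\<integral>\<omega>. (\<Sum>i<N. \<Sum>j<N. coeff r i * coeff r j * (Z i \<omega> * Z j \<omega>)) \<partial>M)"
      by (simp add: power2_eq_square sum_product algebra_simps)
    also have "\<dots> = (\<Sum>i<N. \<Sum>j<N. coeff r i * coeff r j * \<gamma> (int j - int i))"
      using ZZ by (subst Bochner_Integration.integral_sum)
        (auto intro!: Bochner_Integration.integrable_sum sum.cong simp: Bochner_Integration.integral_sum cov)
    also have "\<dots> = (\<integral>l. (cmod (ev (polyn N (coeff r)) l))\<^sup>2 * Gs g l \<partial>U)"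
      by (rule qform_integral[OF Gs_integrable[OF spec] gamma_Gs[OF spec]])
    also have "polyn N (coeff r) = r" by (rule polyn_coeff) (simp add: N_def)
    finally have "(\<integral>\<omega>. (Z 0 \<omega> - (\<Sum>k\<in>{n..<N}. c k * Z k \<omega>))\<^sup>2 \<partial>M) < e"
      using r(3) by (simp only:)
    then show "\<exists>N c. (\<integral>\<omega>. (Z 0 \<omega> - (\<Sum>k\<in>{n..<N}. c k * Z k \<omega>))\<^sup>2 \<partial>M) < e"
      by (intro exI)
  qed
  moreover have "purely_nondeterministic M Z" using noise by (simp add: ANWGN_noise_def)
  ultimately have "(\<integral>\<omega>. (Z 0 \<omega>)\<^sup>2 \<partial>M) = 0"
    using Z2 Zm by (simp add: purely_nondeterministic_def)
  then show False using cov[of 0 0] nondeg by (simp add: power2_eq_square)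
qed

section \<open>Gaussian vectors\<close>

text \<open>A single infinite matrix all of whose leading sections are positive definite, so that
  factorisations of growing size can be built by induction.\<close>

definition posdef :: "(nat \<Rightarrow> nat \<Rightarrow> real) \<Rightarrow> bool" where
  "posdef v \<longleftrightarrow> (\<forall>i j. v i j = v j i) \<and>
     (\<forall>n c. (\<exists>i<n. c i \<noteq> 0) \<longrightarrow> 0 < (\<Sum>i<n. \<Sum>j<n. c i * c j * v i j))"

text \<open>\<open>L\<close> is the lower triangular Cholesky factor of the leading section and
  \<open>M\<close> its inverse. They are carried together because \<open>L\<close> generates the
  vector from white noise, while \<open>M\<close> whitens it and enters the density.\<close>

definition chol :: "nat \<Rightarrow> (nat \<Rightarrow> nat \<Rightarrow> real) \<Rightarrow> (nat \<Rightarrow> nat \<Rightarrow> real) \<Rightarrow> (nat \<Rightarrow> nat \<Rightarrow> real) \<Rightarrow> bool" where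
  "chol n v L M \<longleftrightarrow> (\<forall>i j. i < j \<longrightarrow> L i j = 0 \<and> M i j = 0) \<and>
     (\<forall>i<n. 0 < L i i \<and> M i i = 1 / L i i) \<and>
     (\<forall>i<n. \<forall>j<n. (\<Sum>k<n. L i k * L j k) = v i j) \<and>
     (\<forall>i<n. \<forall>j<n. (\<Sum>k<n. L i k * M k j) = (if i = j then 1 else 0)) \<and>
     (\<forall>i<n. \<forall>j<n. (\<Sum>k<n. M i k * L k j) = (if i = j then 1 else 0))"

lemma sum_mat_assoc:
  fixes a :: "nat \<Rightarrow> real"
  shows "(\<Sum>k<n. (\<Sum>m<n. a m * b m k) * c k) = (\<Sum>m<n. a m * (\<Sum>k<n. b m k * c k))"
proof -
  have "(\<Sum>k<n. (\<Sum>m<n. a m * b m k) * c k) = (\<Sum>k<n. \<Sum>m<n. a m * b m k * c k)"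
    by (simp add: sum_distrib_right)
  also have "\<dots> = (\<Sum>m<n. \<Sum>k<n. a m * b m k * c k)" by (rule sum.swap)
  finally show ?thesis by (simp add: sum_distrib_left mult.assoc)
qed

lemma sum_delta_mult:
  fixes a :: "nat \<Rightarrow> real"
  shows "i < n \<Longrightarrow> (\<Sum>k<n. (if i = k then 1 else 0) * a k) = a i"
    and "i < n \<Longrightarrow> (\<Sum>k<n. a k * (if k = i then 1 else 0)) = a i"
proof -
  assume "i < n"
  have "(\<Sum>k<n. (if i = k then 1 else 0) * a k) = (\<Sum>k<n. if i = k then a k else 0)"
    by (intro sum.cong) auto
  then show "(\<Sum>k<n. (if i = k then 1 else 0) * a k) = a i" using \<open>i < n\<close> by simp
  have "(\<Sum>k<n. a k * (if k = i then 1 else 0)) = (\<Sum>k<n. if k = i then a k else 0)"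
    by (intro sum.cong) auto
  then show "(\<Sum>k<n. a k * (if k = i then 1 else 0)) = a i" using \<open>i < n\<close> by simp
qed

text \<open>Bordering: the new row is the solution \<open>l\<close> of L l = v(., n), and the new
  diagonal entry is the root of the Schur complement v(n, n) - |l|^2. This is the error variance
  when the last coordinate is predicted linearly from the others, hence positive.\<close>

lemma chol_exists:
  assumes v: "posdef v"
  shows "\<exists>L M. chol n v L M"
proof (induction n)
  case 0
  show ?case by (rule exI[of _ "\<lambda>_ _. 0"])+ (simp add: chol_def)
next
  case (Suc n)
  then obtain L M where C: "chol n v L M" by blast
  have up: "\<And>i j. i < j \<Longrightarrow> L i j = 0" "\<And>i j. i < j \<Longrightarrow> M i j = 0"
    and dg: "\<And>i. i < n \<Longrightarrow> 0 < L i i" "\<And>i. i < n \<Longrightarrow> M i i = 1 / L i i"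
    and LL: "\<And>i j. i < n \<Longrightarrow> j < n \<Longrightarrow> (\<Sum>k<n. L i k * L j k) = v i j"
    and LM: "\<And>i j. i < n \<Longrightarrow> j < n \<Longrightarrow> (\<Sum>k<n. L i k * M k j) = (if i = j then 1 else 0)"
    and MxL: "\<And>i j. i < n \<Longrightarrow> j < n \<Longrightarrow> (\<Sum>k<n. M i k * L k j) = (if i = j then 1 else 0)"
    using C by (auto simp: chol_def)
  have sym: "v i j = v j i" for i j using v by (simp add: posdef_def)
  define l where "l k = (\<Sum>m<n. M k m * v m n)" for k
  have Ll: "(\<Sum>k<n. L j k * l k) = v j n" if "j < n" for j
  proof -
    have "(\<Sum>k<n. L j k * l k) = (\<Sum>m<n. (\<Sum>k<n. L j k * M k m) * v m n)"
      unfolding l_def by (rule sum_mat_assoc[symmetric])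
    also have "\<dots> = (\<Sum>m<n. (if j = m then 1 else 0) * v m n)"
      by (intro sum.cong) (auto simp: LM that)
    finally show ?thesis by (simp only: sum_delta_mult(1)[OF that])
  qed
  \<comment> \<open>Coefficients of the best linear prediction of coordinate n from the earlier
    ones; up to the factor -1/d they also form the new row of \<open>M\<close>.\<close>
  define e where "e m = (\<Sum>k<n. l k * M k m)" for m
  have eL: "(\<Sum>m<n. e m * L m k) = l k" if "k < n" for k
  proof -
    have "(\<Sum>m<n. e m * L m k) = (\<Sum>j<n. l j * (\<Sum>m<n. M j m * L m k))"
      unfolding e_def by (rule sum_mat_assoc)
    also have "\<dots> = (\<Sum>j<n. l j * (if j = k then 1 else 0))"
      by (intro sum.cong) (auto simp: MxL that)
    finally show ?thesis by (simp only: sum_delta_mult(2)[OF that])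
  qed
  define q where "q = (\<Sum>k<n. (l k)\<^sup>2)"
  have ev: "(\<Sum>m<n. e m * v m n) = q"
  proof -
    have "(\<Sum>m<n. e m * v m n) = (\<Sum>k<n. l k * (\<Sum>m<n. M k m * v m n))"
      unfolding e_def by (rule sum_mat_assoc)
    then show ?thesis by (simp add: q_def l_def power2_eq_square)
  qed
  have eve: "(\<Sum>i<n. \<Sum>j<n. e i * e j * v i j) = q"
  proof -
    have "(\<Sum>i<n. \<Sum>j<n. e i * e j * v i j) = (\<Sum>i<n. \<Sum>j<n. \<Sum>k<n. (e i * L i k) * (e j * L j k))"
      by (intro sum.cong refl) (simp add: LL[symmetric] sum_distrib_left algebra_simps)
    also have "\<dots> = (\<Sum>i<n. \<Sum>k<n. \<Sum>j<n. (e i * L i k) * (e j * L j k))"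
      by (intro sum.cong refl sum.swap)
    also have "\<dots> = (\<Sum>k<n. \<Sum>i<n. \<Sum>j<n. (e i * L i k) * (e j * L j k))"
      by (rule sum.swap)
    also have "\<dots> = (\<Sum>k<n. (\<Sum>i<n. e i * L i k) * (\<Sum>j<n. e j * L j k))"
      by (simp add: sum_product)
    finally show ?thesis by (simp add: eL q_def power2_eq_square)
  qed
  have "0 < v n n - q"
  proof -
    \<comment> \<open>The vector of the prediction error: 1 at n and minus the predictor before
      it.\<close>
    define c where "c i = (if i < n then - e i else 1)" for i
    have "\<exists>i<Suc n. c i \<noteq> 0" by (rule exI[of _ n]) (simp add: c_def)
    then have "0 < (\<Sum>i<Suc n. \<Sum>j<Suc n. c i * c j * v i j)"
      using v unfolding posdef_def by blast
    also have "\<dots> = (\<Sum>i<n. \<Sum>j<n. e i * e j * v i j) - (\<Sum>i<n. e i * v i n) - (\<Sum>j<n. e j * v n j) + v n n"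
      by (simp add: c_def sum.distrib sum_negf sum_subtractf)
    also have "(\<Sum>j<n. e j * v n j) = (\<Sum>j<n. e j * v j n)" by (simp add: sym)
    finally show ?thesis by (simp add: ev eve)
  qed
  define d where "d = sqrt (v n n - q)"
  have d: "d > 0" "d * d = v n n - q" using \<open>0 < v n n - q\<close> by (auto simp: d_def)
  define L' where "L' i j = (if i = n then (if j < n then l j else if j = n then d else 0) else L i j)" for i j
  define M' where "M' i j = (if i = n then (if j < n then - (1/d) * e j else if j = n then 1/d else 0) else M i j)" for i j
  have s1: "(\<Sum>k<n. L' n k * f k) = (\<Sum>k<n. l k * f k)" "(\<Sum>k<n. f k * L' n k) = (\<Sum>k<n. f k * l k)"
    "(\<Sum>k<n. M' n k * f k) = - (1/d) * (\<Sum>k<n. e k * f k)"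
    "i \<noteq> n \<Longrightarrow> L' i k = L i k" "i \<noteq> n \<Longrightarrow> M' i k = M i k" "L' n n = d" "M' n n = 1/d" for f i k
    by (auto simp: L'_def M'_def sum_distrib_left mult.assoc intro!: sum.cong)
  have s2: "(\<Sum>k<n. f k * L' k j) = (\<Sum>k<n. f k * L k j)" "(\<Sum>k<n. f k * M' k j) = (\<Sum>k<n. f k * M k j)" for f j
    by (auto simp: L'_def M'_def intro!: sum.cong)
  have z: "(\<Sum>k<n. f k * L k n) = 0" "(\<Sum>k<n. f k * M k n) = 0" for f
    by (auto simp: up intro!: sum.neutral)
  have "chol (Suc n) v L' M'"
    unfolding chol_def
  proof (intro conjI allI impI)
    fix i j :: nat assume "i < j" then show "L' i j = 0" "M' i j = 0" by (auto simp: L'_def M'_def up)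
  next
    fix i assume "i < Suc n" then show "0 < L' i i" "M' i i = 1 / L' i i" using d dg by (auto simp: L'_def M'_def less_Suc_eq)
  next
    fix i j assume ij: "i < Suc n" "j < Suc n"
    show "(\<Sum>k<Suc n. L' i k * L' j k) = v i j"
    proof (cases "i = n"; cases "j = n")
      assume "i = n" "j = n"
      then show ?thesis using d by (simp add: s1 q_def power2_eq_square L'_def)
    next
      assume "i = n" "j \<noteq> n"
      then show ?thesis using Ll[of j] ij sym[of n j] by (simp add: s1 mult.commute up)
    next
      assume "i \<noteq> n" "j = n"
      then show ?thesis using Ll[of i] ij by (simp add: s1 up)
    next
      assume "i \<noteq> n" "j \<noteq> n"
      then show ?thesis using LL[of i j] ij by (simp add: s1 up)
    qed
    show "(\<Sum>k<Suc n. L' i k * M' k j) = (if i = j then 1 else 0)"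
    proof (cases "i = n"; cases "j = n")
      assume "i = n" "j = n"
      then show ?thesis using d by (simp add: s1 s2 z)
    next
      assume "i = n" "j \<noteq> n"
      then show ?thesis using d ij by (simp add: s1 s2) (simp add: M'_def e_def)
    next
      assume "i \<noteq> n" "j = n"
      then show ?thesis using ij by (simp add: s1 s2 z up)
    next
      assume "i \<noteq> n" "j \<noteq> n"
      then show ?thesis using LM[of i j] ij by (simp add: s1 s2 up)
    qed
    show "(\<Sum>k<Suc n. M' i k * L' k j) = (if i = j then 1 else 0)"
    proof (cases "i = n"; cases "j = n")
      assume "i = n" "j = n"
      then show ?thesis using d by (simp add: s2 z s1)
    next
      assume "i = n" "j \<noteq> n"
      then show ?thesis using d ij eL[of j] by (simp add: s2 s1) (simp add: L'_def)
    next
      assume "i \<noteq> n" "j = n"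
      then show ?thesis using ij by (simp add: s2 z s1 up)
    next
      assume "i \<noteq> n" "j \<noteq> n"
      then show ?thesis using MxL[of i j] ij by (simp add: s2 s1 up)
    qed
  qed
  then show ?case by blast
qed

lemma chol_trans:
  assumes "chol n v L M" "i < n" "j < n"
  shows "(\<Sum>k<n. M i k * (\<Sum>m<n. L k m * u m)) = u i" "(\<Sum>k<n. L i k * (\<Sum>m<n. M k m * u m)) = u i"
proof -
  have "(\<Sum>k<n. M i k * (\<Sum>m<n. L k m * u m)) = (\<Sum>m<n. (\<Sum>k<n. M i k * L k m) * u m)"
    by (rule sum_mat_assoc[symmetric])
  also have "\<dots> = (\<Sum>m<n. (if i = m then 1 else 0) * u m)"
    using assms by (intro sum.cong) (auto simp: chol_def)
  finally show "(\<Sum>k<n. M i k * (\<Sum>m<n. L k m * u m)) = u i" by (simp only: sum_delta_mult(1)[OF assms(2)])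
  have "(\<Sum>k<n. L i k * (\<Sum>m<n. M k m * u m)) = (\<Sum>m<n. (\<Sum>k<n. L i k * M k m) * u m)"
    by (rule sum_mat_assoc[symmetric])
  also have "\<dots> = (\<Sum>m<n. (if i = m then 1 else 0) * u m)"
    using assms by (intro sum.cong) (auto simp: chol_def)
  finally show "(\<Sum>k<n. L i k * (\<Sum>m<n. M k m * u m)) = u i" by (simp only: sum_delta_mult(1)[OF assms(2)])
qed

text \<open>Density of a centred Gaussian vector, written through its triangular whitening matrix
  \<open>M\<close>: the product of the diagonal entries is the Jacobian of whitening.\<close>

definition gd :: "nat \<Rightarrow> (nat \<Rightarrow> nat \<Rightarrow> real) \<Rightarrow> (nat \<Rightarrow> real) \<Rightarrow> real" where
  "gd n M z = (\<Prod>i<n. M i i) * (\<Prod>k<n. std_normal_density (\<Sum>j<n. M k j * z j))"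

lemma std_normal_prod:
  "(\<Prod>k<n. std_normal_density (u k)) = exp (- (1/2) * (\<Sum>k<n. (u k)\<^sup>2)) / sqrt ((2 * pi) ^ n)"
proof -
  have "(\<Prod>k<n. std_normal_density (u k)) = (\<Prod>k<n. exp (- (u k)\<^sup>2 / 2)) / (\<Prod>k<n. sqrt (2 * pi))"
    by (simp add: std_normal_density_def prod_dividef)
  also have "(\<Prod>k<n. exp (- (u k)\<^sup>2 / 2)) = exp (- (1/2) * (\<Sum>k<n. (u k)\<^sup>2))"
    by (simp add: exp_sum[symmetric] sum_distrib_left sum_negf)
  finally show ?thesis by (simp only: prod_constant card_lessThan real_sqrt_power)
qed

text \<open>\<open>gdens\<close> is given by an abstract matrix inverse and a determinant. With V =
  A A^T and B the inverse of A, the product B^T B is a two-sided inverse of V and uniqueness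
  identifies it with \<open>Vinv\<close>; the determinant is the squared product of the diagonal
  because A is triangular.\<close>

lemma gdens_chol:
  assumes C: "chol n (\<lambda>i j. \<gamma> (int j - int i)) L M"
  shows "gdens \<gamma> n z = gd n M z"
proof -
  have up: "\<And>i j. i < j \<Longrightarrow> L i j = 0" "\<And>i j. i < j \<Longrightarrow> M i j = 0"
    and dg: "\<And>i. i < n \<Longrightarrow> 0 < L i i" "\<And>i. i < n \<Longrightarrow> M i i = 1 / L i i"
    and LL: "\<And>i j. i < n \<Longrightarrow> j < n \<Longrightarrow> (\<Sum>k<n. L i k * L j k) = \<gamma> (int j - int i)"
    and LM: "\<And>i j. i < n \<Longrightarrow> j < n \<Longrightarrow> (\<Sum>k<n. L i k * M k j) = (if i = j then 1 else 0)"
    and MxL: "\<And>i j. i < n \<Longrightarrow> j < n \<Longrightarrow> (\<Sum>k<n. M i k * L k j) = (if i = j then 1 else 0)"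
    using C by (auto simp: chol_def)
  define A where "A = mat n n (\<lambda>(i,j). L i j)"
  define B where "B = mat n n (\<lambda>(i,j). M i j)"
  let ?V = "Vmat \<gamma> n"
  have cA[simp]: "A \<in> carrier_mat n n" and cB[simp]: "B \<in> carrier_mat n n" and cV: "?V \<in> carrier_mat n n"
    by (auto simp: A_def B_def Vmat_def)
  have T: "A\<^sup>T \<in> carrier_mat n n" "B\<^sup>T \<in> carrier_mat n n" by (auto simp: A_def B_def)
  have V: "?V = A * A\<^sup>T"
    by (rule eq_matI) (auto simp: Vmat_def A_def scalar_prod_def LL lessThan_atLeast0[symmetric])
  have AB: "A * B = 1\<^sub>m n" and BA: "B * A = 1\<^sub>m n"
    by (rule eq_matI; auto simp: A_def B_def scalar_prod_def LM MxL lessThan_atLeast0[symmetric])+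
  have detA: "Determinant.det A = (\<Prod>i<n. L i i)"
  proof -
    have "Determinant.det A = prod_list (diag_mat A)"
      by (rule det_lower_triangular[of n]) (auto simp: A_def up)
    also have "\<dots> = (\<Prod>i<n. L i i)"
      by (simp add: prod_list_diag_prod A_def lessThan_atLeast0)
    finally show ?thesis .
  qed
  have detV: "Determinant.det ?V = (\<Prod>i<n. L i i)\<^sup>2"
    by (simp add: V det_mult[OF cA T(1)] det_transpose[OF cA] detA power2_eq_square)
  define D where "D = B\<^sup>T * B"
  have cD[simp]: "D \<in> carrier_mat n n" unfolding D_def by (rule mult_carrier_mat[of _ n n]) auto
  have VD: "?V * D = 1\<^sub>m n"
  proof -
    have "?V * D = A * (A\<^sup>T * B\<^sup>T) * B"
    proof -
      have "A * A\<^sup>T * (B\<^sup>T * B) = A * (A\<^sup>T * (B\<^sup>T * B))"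
        by (rule assoc_mult_mat[OF cA T(1) mult_carrier_mat[OF T(2) cB]])
      also have "A\<^sup>T * (B\<^sup>T * B) = A\<^sup>T * B\<^sup>T * B"
        by (rule assoc_mult_mat[OF T(1) T(2) cB, symmetric])
      also have "A * (A\<^sup>T * B\<^sup>T * B) = A * (A\<^sup>T * B\<^sup>T) * B"
        by (rule assoc_mult_mat[OF cA mult_carrier_mat[OF T] cB, symmetric])
      finally show ?thesis unfolding V D_def .
    qed
    also have "A\<^sup>T * B\<^sup>T = (B * A)\<^sup>T" by (rule transpose_mult[OF cB cA, symmetric])
    finally show ?thesis by (simp add: BA AB right_mult_one_mat[OF cA])
  qed
  have DV: "D * ?V = 1\<^sub>m n"
    using mat_mult_left_right_inverse[OF cV cD VD] .
  \<comment> \<open>The explicit inverse \<open>D\<close> makes V a unit of the matrix ring, which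
    excludes the value \<open>None\<close>.\<close>
  obtain E where E: "mat_inverse ?V = Some E"
  proof (cases "mat_inverse ?V")
    case None
    then have "?V \<notin> Units (ring_mat TYPE(real) n ())" by (rule mat_inverse(1)[OF cV])
    moreover have "?V \<in> Units (ring_mat TYPE(real) n ())"
      unfolding Units_def using cV cD VD DV by (auto simp: ring_mat_simps intro!: bexI[of _ D])
    ultimately show ?thesis by blast
  qed auto
  from mat_inverse(2)[OF cV E] have E': "E * ?V = 1\<^sub>m n" and cE: "E \<in> carrier_mat n n" by auto
  have "E = E * (?V * D)" by (simp add: VD right_mult_one_mat[OF cE])
  also have "\<dots> = (E * ?V) * D" by (rule assoc_mult_mat[OF cE cV cD, symmetric])
  finally have "E = D" by (simp add: E' left_mult_one_mat[OF cD])
  then have Vi: "Vinv \<gamma> n $$ (i, j) = (\<Sum>k<n. M k i * M k j)" if "i < n" "j < n" for i j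
    using that by (simp add: Vinv_def E D_def B_def scalar_prod_def lessThan_atLeast0)
  have "(\<Sum>i<n. \<Sum>j<n. z i * (Vinv \<gamma> n $$ (i, j)) * z j) = (\<Sum>i<n. \<Sum>j<n. \<Sum>k<n. (M k i * z i) * (M k j * z j))"
    by (intro sum.cong refl) (simp add: Vi sum_distrib_left sum_distrib_right algebra_simps)
  also have "\<dots> = (\<Sum>i<n. \<Sum>k<n. \<Sum>j<n. (M k i * z i) * (M k j * z j))"
    by (intro sum.cong refl sum.swap)
  also have "\<dots> = (\<Sum>k<n. \<Sum>i<n. \<Sum>j<n. (M k i * z i) * (M k j * z j))"
    by (rule sum.swap)
  also have "\<dots> = (\<Sum>k<n. (\<Sum>j<n. M k j * z j)\<^sup>2)"
    by (simp add: sum_product power2_eq_square)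
  finally have Q: "(\<Sum>i<n. \<Sum>j<n. z i * (Vinv \<gamma> n $$ (i, j)) * z j) = (\<Sum>k<n. (\<Sum>j<n. M k j * z j)\<^sup>2)" .
  have "(\<Prod>i<n. M i i) = 1 / (\<Prod>i<n. L i i)" by (simp add: dg prod_dividef)
  moreover have "(\<Prod>i<n. L i i) > 0" by (rule prod_pos) (use dg in auto)
  ultimately show ?thesis
    unfolding gdens_def gd_def std_normal_prod Q detV by (simp add: real_sqrt_mult)
qed

section \<open>Triangular changes of variables and Gaussian laws on R^n\<close>

interpretation lb: product_sigma_finite "\<lambda>_::nat. lborel :: real measure" ..

lemma space_Rn: "space (Rn n) = ({..<n} \<rightarrow>\<^sub>E UNIV)"
  by (simp add: Rn_def space_PiM)

lemma Rn_component[measurable]: "i < n \<Longrightarrow> (\<lambda>x. x i) \<in> borel_measurable (Rn n)"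
  using measurable_component_singleton[of i "{..<n}" "\<lambda>_. lborel"] by (simp add: Rn_def)

text \<open>The result is restricted to indices below n because the points of \<open>Rn n\<close>
  are extensional functions.\<close>

definition aff :: "nat \<Rightarrow> (nat \<Rightarrow> nat \<Rightarrow> real) \<Rightarrow> (nat \<Rightarrow> real) \<Rightarrow> (nat \<Rightarrow> real) \<Rightarrow> nat \<Rightarrow> real" where
  "aff n M b z = (\<lambda>k\<in>{..<n}. b k + (\<Sum>j<n. M k j * z j))"

lemma aff_measurable[measurable]: "aff n M b \<in> measurable (Rn n) (Rn n)"
proof -
  have "aff n M b \<in> measurable (Rn n) (PiM {..<n} (\<lambda>_. borel))"
    unfolding aff_def[abs_def] by (rule measurable_restrict) measurable
  also have "measurable (Rn n) (PiM {..<n} (\<lambda>_. borel)) = measurable (Rn n) (Rn n)"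
    unfolding Rn_def by (intro measurable_cong_sets sets_PiM_cong) auto
  finally show ?thesis .
qed

lemma Rn_Suc: "Rn (Suc n) = PiM (insert n {..<n}) (\<lambda>_. lborel)"
  by (simp add: Rn_def lessThan_Suc)

lemma nn_integral_Rn_Suc:
  "f \<in> borel_measurable (Rn (Suc n)) \<Longrightarrow> (\<integral>\<^sup>+z. f z \<partial>Rn (Suc n)) = (\<integral>\<^sup>+x. \<integral>\<^sup>+y. f (x(n := y)) \<partial>lborel \<partial>Rn n)"
  unfolding Rn_Suc by (subst lb.product_nn_integral_insert) (auto simp: Rn_def)

lemma upd_measurable: "(\<lambda>p. (fst p)(n := snd p)) \<in> measurable (Rn n \<Otimes>\<^sub>M lborel) (Rn (Suc n))"
proof -
  have "(\<lambda>p. (fst p)(n := snd p)) = (\<lambda>(x, y). x(n := y))" by (rule ext) (simp split: prod.split)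
  then show ?thesis
    using measurable_add_dim[of n "{..<n}" "\<lambda>_. lborel"] by (simp add: Rn_def lessThan_Suc)
qed

text \<open>For a triangular matrix the last output coordinate is an affine function of the last
  input coordinate, with a shift depending on the others. Tonelli and the substitution on the line
  therefore produce one diagonal factor per induction step.\<close>

lemma nn_integral_aff:
  assumes up: "\<And>i j. i < j \<Longrightarrow> M i j = 0" and dg: "\<And>i. i < n \<Longrightarrow> 0 < M i i"
    and F: "F \<in> borel_measurable (Rn n)"
  shows "(\<integral>\<^sup>+z. F (aff n M b z) \<partial>Rn n) * ennreal (\<Prod>i<n. M i i) = (\<integral>\<^sup>+u. F u \<partial>Rn n)"
  using dg F
proof (induction n arbitrary: F)
  case 0
  have "aff 0 M b z = z" if "z \<in> space (Rn 0)" for z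
    using that by (auto simp: aff_def space_Rn fun_eq_iff)
  then show ?case by (simp cong: nn_integral_cong)
next
  case (Suc n)
  note F[measurable] = Suc.prems(2)
  define H where "H w = (\<integral>\<^sup>+y. F (w(n := y)) \<partial>lborel)" for w
  have FU: "(\<lambda>p. F ((fst p)(n := snd p))) \<in> borel_measurable (Rn n \<Otimes>\<^sub>M lborel)"
    by (rule measurable_compose[OF upd_measurable F])
  then have H[measurable]: "H \<in> borel_measurable (Rn n)"
    unfolding H_def by (intro lborel.borel_measurable_nn_integral) (simp add: case_prod_beta')
  have Fw: "(\<lambda>y. F (w(n := y))) \<in> borel_measurable borel" if "w \<in> space (Rn n)" for w
    using measurable_compose[OF measurable_Pair1' FU, of w] that by simp
  have m: "0 < M n n" using Suc.prems(1) by simp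
  have split: "aff (Suc n) M b (x(n := y)) = (aff n M b x)(n := (b n + (\<Sum>j<n. M n j * x j)) + M n n * y)"
    if x: "x \<in> space (Rn n)" for x y
    unfolding aff_def fun_eq_iff
  proof
    fix k
    have "(\<Sum>j<n. M k j * (x(n := y)) j) = (\<Sum>j<n. M k j * x j)" by (intro sum.cong) auto
    then show "(\<lambda>k\<in>{..<Suc n}. b k + (\<Sum>j<Suc n. M k j * (x(n := y)) j)) k =
      ((\<lambda>k\<in>{..<n}. b k + (\<Sum>j<n. M k j * x j))(n := (b n + (\<Sum>j<n. M n j * x j)) + M n n * y)) k"
      by (auto simp: up less_Suc_eq restrict_def)
  qed
  have as: "aff n M b x \<in> space (Rn n)" for x by (auto simp: space_Rn aff_def)
  have inner: "(\<integral>\<^sup>+y. F (aff (Suc n) M b (x(n := y))) \<partial>lborel) * ennreal (M n n) = H (aff n M b x)"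
    if x: "x \<in> space (Rn n)" for x
  proof -
    have "H (aff n M b x) = ennreal \<bar>M n n\<bar> * (\<integral>\<^sup>+y. F ((aff n M b x)(n := (b n + (\<Sum>j<n. M n j * x j)) + M n n * y)) \<partial>lborel)"
      unfolding H_def using m Fw[OF as] by (intro nn_integral_real_affine) auto
    then show ?thesis using m by (simp add: split[OF x] mult.commute)
  qed
  have G[measurable]: "(\<lambda>z. F (aff (Suc n) M b z)) \<in> borel_measurable (Rn (Suc n))" by measurable
  have "(\<integral>\<^sup>+z. F (aff (Suc n) M b z) \<partial>Rn (Suc n)) * ennreal (\<Prod>i<Suc n. M i i)
    = (\<integral>\<^sup>+x. (\<integral>\<^sup>+y. F (aff (Suc n) M b (x(n := y))) \<partial>lborel) \<partial>Rn n) * ennreal (M n n) * ennreal (\<Prod>i<n. M i i)"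
  proof -
    have "0 \<le> (\<Prod>i<n. M i i)" by (rule prod_nonneg) (use Suc.prems(1) in \<open>auto intro: less_imp_le\<close>)
    then show ?thesis using m by (subst nn_integral_Rn_Suc[OF G]) (simp add: ennreal_mult mult_ac)
  qed
  also have "(\<integral>\<^sup>+x. (\<integral>\<^sup>+y. F (aff (Suc n) M b (x(n := y))) \<partial>lborel) \<partial>Rn n) * ennreal (M n n)
     = (\<integral>\<^sup>+x. (\<integral>\<^sup>+y. F (aff (Suc n) M b (x(n := y))) \<partial>lborel) * ennreal (M n n) \<partial>Rn n)"
  proof (rule nn_integral_multc[symmetric])
    have "(\<lambda>p. F (aff (Suc n) M b ((fst p)(n := snd p)))) \<in> borel_measurable (Rn n \<Otimes>\<^sub>M lborel)"
      by (rule measurable_compose[OF upd_measurable G])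
    then show "(\<lambda>x. \<integral>\<^sup>+y. F (aff (Suc n) M b (x(n := y))) \<partial>lborel) \<in> borel_measurable (Rn n)"
      by (intro lborel.borel_measurable_nn_integral) (simp add: case_prod_beta')
  qed
  also have "\<dots> = (\<integral>\<^sup>+x. H (aff n M b x) \<partial>Rn n)"
    by (rule nn_integral_cong) (rule inner)
  also have "\<dots> * ennreal (\<Prod>i<n. M i i) = (\<integral>\<^sup>+u. H u \<partial>Rn n)"
    by (rule Suc.IH) (use Suc.prems in auto)
  also have "\<dots> = (\<integral>\<^sup>+u. F u \<partial>Rn (Suc n))"
    unfolding H_def by (subst nn_integral_Rn_Suc) auto
  finally show ?case .
qed

definition phi :: "nat \<Rightarrow> (nat \<Rightarrow> real) \<Rightarrow> real" where
  "phi n u = (\<Prod>i<n. std_normal_density (u i))"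

lemma phi_measurable[measurable]: "phi n \<in> borel_measurable (Rn n)"
  unfolding phi_def[abs_def] by measurable

lemma gd_phi: "gd n M z = (\<Prod>i<n. M i i) * phi n (aff n M (\<lambda>_. 0) z)"
  by (auto simp: gd_def phi_def aff_def intro!: prod.cong)

lemma gd_measurable[measurable]: "gd n M \<in> borel_measurable (Rn n)"
  unfolding gd_phi[abs_def] by measurable

definition stdg :: "nat \<Rightarrow> (nat \<Rightarrow> real) measure" where
  "stdg n = PiM {..<n} (\<lambda>_. density lborel (\<lambda>x. ennreal (std_normal_density x)))"

interpretation std1: prob_space "density lborel (\<lambda>x. ennreal (std_normal_density x))"
  by (rule prob_space_normal_density) simp

interpretation stdp: product_sigma_finite "\<lambda>_::nat. density lborel (\<lambda>x. ennreal (std_normal_density x))"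
  by (intro product_sigma_finite.intro std1.sigma_finite_measure_axioms)

lemma stdg_prob: "prob_space (stdg n)"
  unfolding stdg_def by (rule prob_space_PiM) (rule std1.prob_space_axioms)

interpretation stdg: prob_space "stdg n" for n by (rule stdg_prob)

lemma sets_stdg[simp, measurable_cong]: "sets (stdg n) = sets (Rn n)"
  unfolding stdg_def Rn_def by (rule sets_PiM_cong) auto

lemma space_stdg[simp]: "space (stdg n) = space (Rn n)"
  by (rule sets_eq_imp_space_eq) simp

lemma indicator_PiE_prod:
  fixes n :: nat
  assumes u: "u \<in> extensional {..<n}"
  shows "indicator (Pi\<^sub>E {..<n} A) u = (\<Prod>i<n. indicator (A i) (u i) :: ennreal)"
proof (cases "\<forall>i\<in>{..<n}. u i \<in> A i")
  case True
  then have "(\<Prod>i<n. indicator (A i) (u i) :: ennreal) = (\<Prod>i<n. 1)" by (intro prod.cong) auto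
  moreover have "u \<in> Pi\<^sub>E {..<n} A" using True u unfolding PiE_def Pi_def by blast
  ultimately show ?thesis by simp
next
  case False
  then obtain i where i: "i < n" "u i \<notin> A i" by blast
  then have "\<exists>i\<in>{..<n}. indicator (A i) (u i) = (0::ennreal)" by (intro bexI[of _ i]) auto
  then have "(\<Prod>i<n. indicator (A i) (u i) :: ennreal) = 0" by (simp add: prod_zero)
  moreover have "u \<notin> Pi\<^sub>E {..<n} A" using False unfolding PiE_def Pi_def by blast
  ultimately show ?thesis by simp
qed

lemma stdg_density: "stdg n = density (Rn n) (\<lambda>u. ennreal (phi n u))"
proof -
  have "density (Rn n) (\<lambda>u. ennreal (phi n u)) = PiM {..<n} (\<lambda>_. density lborel (\<lambda>x. ennreal (std_normal_density x)))"
  proof (rule stdp.PiM_eqI)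
    show "sets (density (Rn n) (\<lambda>u. ennreal (phi n u))) = sets (PiM {..<n} (\<lambda>_. density lborel (\<lambda>x. ennreal (std_normal_density x))))"
      using sets_stdg[of n] by (simp add: stdg_def)
    fix A assume A: "\<And>i. i \<in> {..<n} \<Longrightarrow> A i \<in> sets (density lborel (\<lambda>x. ennreal (std_normal_density x)))"
    then have A': "\<And>i. i < n \<Longrightarrow> A i \<in> sets borel" by auto
    have "Pi\<^sub>E {..<n} A \<in> sets (Rn n)" unfolding Rn_def using A' by (intro sets_PiM_I_finite) auto
    then have "emeasure (density (Rn n) (\<lambda>u. ennreal (phi n u))) (Pi\<^sub>E {..<n} A)
      = (\<integral>\<^sup>+u. ennreal (phi n u) * indicator (Pi\<^sub>E {..<n} A) u \<partial>Rn n)"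
      by (simp add: emeasure_density)
    also have "\<dots> = (\<integral>\<^sup>+u. (\<Prod>i<n. ennreal (std_normal_density (u i)) * indicator (A i) (u i)) \<partial>Rn n)"
    proof (rule nn_integral_cong)
      fix u assume u: "u \<in> space (Rn n)"
      have "u \<in> extensional {..<n}" using u by (simp add: space_Rn PiE_def)
      from indicator_PiE_prod[OF this, of A]
      show "ennreal (phi n u) * indicator (Pi\<^sub>E {..<n} A) u = (\<Prod>i<n. ennreal (std_normal_density (u i)) * indicator (A i) (u i))"
        by (simp add: phi_def prod.distrib prod_ennreal)
    qed
    also have "\<dots> = (\<Prod>i<n. \<integral>\<^sup>+x. ennreal (std_normal_density x) * indicator (A i) x \<partial>lborel)"
      unfolding Rn_def using A' by (intro lb.product_nn_integral_prod) auto
    also have "\<dots> = (\<Prod>i<n. emeasure (density lborel (\<lambda>x. ennreal (std_normal_density x))) (A i))"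
      using A' by (intro prod.cong) (auto simp: emeasure_density)
    finally show "emeasure (density (Rn n) (\<lambda>u. ennreal (phi n u))) (Pi\<^sub>E {..<n} A)
      = (\<Prod>i\<in>{..<n}. emeasure (density lborel (\<lambda>x. ennreal (std_normal_density x))) (A i))" .
  qed simp
  then show ?thesis by (simp add: stdg_def)
qed

lemma nn_integral_stdg: "F \<in> borel_measurable (Rn n) \<Longrightarrow> (\<integral>\<^sup>+u. F u \<partial>stdg n) = (\<integral>\<^sup>+u. ennreal (phi n u) * F u \<partial>Rn n)"
  unfolding stdg_density by (subst nn_integral_density) auto

text \<open>The affine map from u to x + L u is inverse to the triangular map from z to M z - M x,
  so the change of variables applies. Statements about channel outputs become statements about white
  noise u.\<close>

lemma nn_integral_gd:
  assumes C: "chol n v L M" and H[measurable]: "H \<in> borel_measurable (Rn n)"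
  shows "(\<integral>\<^sup>+y. ennreal (gd n M (\<lambda>i. y i - x i)) * H y \<partial>Rn n) = (\<integral>\<^sup>+u. H (aff n L x u) \<partial>stdg n)"
proof -
  have up: "\<And>i j. i < j \<Longrightarrow> M i j = 0" and dg: "\<And>i. i < n \<Longrightarrow> 0 < M i i"
    using C by (auto simp: chol_def)
  define b where "b k = - (\<Sum>j<n. M k j * x j)" for k
  have inv: "aff n L x (aff n M b z) = z" if z: "z \<in> space (Rn n)" for z
  proof
    fix k
    show "aff n L x (aff n M b z) k = z k"
    proof (cases "k < n")
      case True
      have "aff n L x (aff n M b z) k = x k + (\<Sum>j<n. L k j * (\<Sum>m<n. M j m * (z m - x m)))"
        using True by (simp add: aff_def b_def right_diff_distrib sum_subtractf)
      also have "\<dots> = x k + (z k - x k)" by (simp only: chol_trans(2)[OF C True True])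
      finally show ?thesis by simp
    qed (use z in \<open>auto simp: aff_def space_Rn PiE_iff extensional_def\<close>)
  qed
  have ph: "phi n (aff n M b z) = phi n (aff n M (\<lambda>_. 0) (\<lambda>i. z i - x i))" for z
    by (auto simp: phi_def aff_def b_def right_diff_distrib sum_subtractf intro!: prod.cong)
  have pp: "(\<Prod>i<n. M i i) \<ge> 0" by (rule prod_nonneg) (use dg in \<open>auto intro: less_imp_le\<close>)
  have m[measurable]: "(\<lambda>z. phi n (aff n M b z)) \<in> borel_measurable (Rn n)" by measurable
  have "(\<integral>\<^sup>+u. H (aff n L x u) \<partial>stdg n) = (\<integral>\<^sup>+u. ennreal (phi n u) * H (aff n L x u) \<partial>Rn n)"
    by (rule nn_integral_stdg) measurable
  also have "\<dots> = (\<integral>\<^sup>+z. ennreal (phi n (aff n M b z)) * H (aff n L x (aff n M b z)) \<partial>Rn n) * ennreal (\<Prod>i<n. M i i)"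
    by (rule nn_integral_aff[symmetric]) (use up dg in \<open>auto\<close>)
  also have "\<dots> = (\<integral>\<^sup>+z. ennreal (phi n (aff n M b z)) * H z \<partial>Rn n) * ennreal (\<Prod>i<n. M i i)"
    by (intro arg_cong2[where f="(*)"] nn_integral_cong refl) (simp add: inv)
  also have "\<dots> = (\<integral>\<^sup>+z. ennreal (phi n (aff n M b z)) * H z * ennreal (\<Prod>i<n. M i i) \<partial>Rn n)"
    by (rule nn_integral_multc[symmetric]) measurable
  also have "\<dots> = (\<integral>\<^sup>+y. ennreal (gd n M (\<lambda>i. y i - x i)) * H y \<partial>Rn n)"
    by (intro nn_integral_cong) (simp add: gd_phi ph ennreal_mult'[OF pp] mult_ac)
  finally show ?thesis by simp
qed

lemma gd_shift_measurable[measurable]: "(\<lambda>y. gd n M (\<lambda>i. y i - x i)) \<in> borel_measurable (Rn n)"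
  unfolding gd_def by measurable

lemma gd_distr:
  assumes C: "chol n v L M"
  shows "density (Rn n) (\<lambda>y. ennreal (gd n M (\<lambda>i. y i - x i))) = distr (stdg n) (Rn n) (aff n L x)"
proof (rule measure_eqI)
  fix A assume "A \<in> sets (density (Rn n) (\<lambda>y. ennreal (gd n M (\<lambda>i. y i - x i))))"
  then have A[measurable]: "A \<in> sets (Rn n)" by simp
  have "emeasure (density (Rn n) (\<lambda>y. ennreal (gd n M (\<lambda>i. y i - x i)))) A = (\<integral>\<^sup>+u. indicator A (aff n L x u) \<partial>stdg n)"
    by (subst emeasure_density) (auto simp: nn_integral_gd[OF C])
  also have "\<dots> = (\<integral>\<^sup>+u. indicator (aff n L x -` A \<inter> space (stdg n)) u \<partial>stdg n)"
    by (rule nn_integral_cong) (auto simp: indicator_def)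
  also have "\<dots> = emeasure (distr (stdg n) (Rn n) (aff n L x)) A"
    by (subst emeasure_distr) (auto intro!: nn_integral_indicator measurable_sets[of _ _ "Rn n"] simp del: space_stdg)
  finally show "emeasure (density (Rn n) (\<lambda>y. ennreal (gd n M (\<lambda>i. y i - x i)))) A = emeasure (distr (stdg n) (Rn n) (aff n L x)) A" .
qed simp

section \<open>Moments and deviation bounds for standard Gaussian vectors\<close>

abbreviation std1 :: "real measure" where
  "std1 \<equiv> density lborel (\<lambda>x. ennreal (std_normal_density x))"

definition mom :: "nat \<Rightarrow> real" where
  "mom k = (\<integral>x. x ^ k \<partial>std1)"

lemma integrable_std1_power: "integrable std1 (\<lambda>x. x ^ k)"
  using integrable_std_normal_moment[of k] by (subst integrable_density) auto

lemma mom_eq: "mom k = (\<integral>x. std_normal_density x * x ^ k \<partial>lborel)"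
  unfolding mom_def by (subst integral_density) auto

lemma mom_values: "mom 0 = 1" "mom (Suc 0) = 0" "mom 2 = 1" "mom 4 = 3"
  using integral_std_normal_moment_even[of 0] integral_std_normal_moment_odd[of 0]
    integral_std_normal_moment_even[of 1] integral_std_normal_moment_even[of 2]
  by (simp_all add: mom_eq eval_nat_numeral)

lemma mom_four: "mom (Suc (Suc (Suc (Suc 0)))) = 3"
  using mom_values(4) by (simp add: eval_nat_numeral)

lemma measure_stdg_space[simp]: "measure (stdg n) (space (Rn n)) = 1"
  using stdg.prob_space[of n] by simp

lemma stdg_monomial:
  shows "integrable (stdg n) (\<lambda>u. \<Prod>r<n. u r ^ e r)"
    and "(\<integral>u. (\<Prod>r<n. u r ^ e r) \<partial>stdg n) = (\<Prod>r<n. mom (e r))"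
proof -
  show "integrable (stdg n) (\<lambda>u. \<Prod>r<n. u r ^ e r)"
    unfolding stdg_def using stdp.product_integrable_prod[of "{..<n}" "\<lambda>r x. x ^ e r"] integrable_std1_power by simp
  show "(\<integral>u. (\<Prod>r<n. u r ^ e r) \<partial>stdg n) = (\<Prod>r<n. mom (e r))"
    unfolding stdg_def mom_def using stdp.product_integral_prod[of "{..<n}" "\<lambda>r x. x ^ e r"] integrable_std1_power by simp
qed

text \<open>A product measure factors the expectation of a product over all coordinates, so a
  monomial is written with the multiplicity of each index as exponent.\<close>

lemma monomial2:
  fixes i j n :: nat
  shows "i < n \<Longrightarrow> j < n \<Longrightarrow> u i * u j = (\<Prod>r<n. (u r :: real) ^ (of_bool (i = r) + of_bool (j = r)))"
proof -
  assume "i < n" "j < n"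
  have "u r ^ of_bool (i = r) = (if i = r then u r else 1)" for r i by simp
  with \<open>i < n\<close> \<open>j < n\<close> show ?thesis by (simp add: power_add prod.distrib)
qed

lemma monomial4:
  fixes i j k l n :: nat
  shows "i < n \<Longrightarrow> j < n \<Longrightarrow> k < n \<Longrightarrow> l < n \<Longrightarrow>
  (u i * u j) * (u k * u l) = (\<Prod>r<n. (u r :: real) ^ (of_bool (i = r) + of_bool (j = r) + (of_bool (k = r) + of_bool (l = r))))"
  by (simp add: monomial2[of i n j u] monomial2[of k n l u] power_add[of _ "of_bool _ + of_bool _" "of_bool _ + of_bool _"] prod.distrib del: of_bool_eq)

lemma prod_mom_zero:
  fixes r n :: nat
  shows "r < n \<Longrightarrow> e r = Suc 0 \<Longrightarrow> (\<Prod>r<n. mom (e r)) = 0"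
  by (rule prod_zero) (auto simp: mom_values intro!: bexI[of _ r])

lemma prod_mom_one: "(\<And>r. e r = 0 \<or> e r = 2) \<Longrightarrow> (\<Prod>r<n. mom (e r)) = 1"
proof (rule prod.neutral, rule ballI)
  fix r assume "\<And>r. e r = 0 \<or> e r = 2"
  from this[of r] show "mom (e r) = 1" by (auto simp: mom_values)
qed

lemma stdg_moment2:
  assumes "i < n" "j < n"
  shows "integrable (stdg n) (\<lambda>u. u i * u j)"
    and "(\<integral>u. u i * u j \<partial>stdg n) = of_bool (i = j)"
proof -
  show "integrable (stdg n) (\<lambda>u. u i * u j)"
    unfolding monomial2[OF assms] by (rule stdg_monomial)
  have "(\<integral>u. u i * u j \<partial>stdg n) = (\<Prod>r<n. mom (of_bool (i = r) + of_bool (j = r)))"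
    unfolding monomial2[OF assms] by (rule stdg_monomial)
  also have "\<dots> = of_bool (i = j)"
  proof (cases "i = j")
    case True then show ?thesis by (subst prod_mom_one) auto
  next
    case False then show ?thesis using assms by (subst prod_mom_zero[of i]) auto
  qed
  finally show "(\<integral>u. u i * u j \<partial>stdg n) = of_bool (i = j)" .
qed

text \<open>Isserlis' formula; the three terms are the pairings of the four indices. When all
  indices coincide every pairing counts, which matches the fourth moment 3.\<close>

lemma stdg_moment4:
  assumes "i < n" "j < n" "k < n" "l < n"
  shows "integrable (stdg n) (\<lambda>u. (u i * u j) * (u k * u l))"
    and "(\<integral>u. (u i * u j) * (u k * u l) \<partial>stdg n) =
      of_bool (i = j \<and> k = l) + of_bool (i = k \<and> j = l) + of_bool (i = l \<and> j = k)"
proof -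
  show "integrable (stdg n) (\<lambda>u. (u i * u j) * (u k * u l))"
    unfolding monomial4[OF assms] by (rule stdg_monomial)
  let ?e = "\<lambda>r. of_bool (i = r) + of_bool (j = r) + (of_bool (k = r) + of_bool (l = r)) :: nat"
  have "(\<integral>u. (u i * u j) * (u k * u l) \<partial>stdg n) = (\<Prod>r<n. mom (?e r))"
    unfolding monomial4[OF assms] by (rule stdg_monomial)
  also have "\<dots> = of_bool (i = j \<and> k = l) + of_bool (i = k \<and> j = l) + of_bool (i = l \<and> j = k)"
  proof -
    \<comment> \<open>Patterns of coincidence. Unless the indices pair up, some index occurs exactly
      once and contributes mean 0.\<close>
    consider "i = j" "k = l" "i = k" | "i = j" "k = l" "i \<noteq> k" | "i = j" "k \<noteq> l" "i \<noteq> k" | "i = j" "k \<noteq> l" "i = k"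
      | "i \<noteq> j" "i = k" "j = l" | "i \<noteq> j" "i = k" "j \<noteq> l" | "i \<noteq> j" "i \<noteq> k" "i = l" "j = k" | "i \<noteq> j" "i \<noteq> k" "i = l" "j \<noteq> k"
      | "i \<noteq> j" "i \<noteq> k" "i \<noteq> l" by blast
    then show ?thesis
    proof cases
      case 1
      then have "(\<Prod>r<n. mom (?e r)) = (\<Prod>r<n. if i = r then 3 else 1)"
        by (intro prod.cong) (auto simp: mom_values mom_four)
      then show ?thesis using 1 assms by simp
    next
      case 2 then show ?thesis by (subst prod_mom_one) auto
    next
      case 3 then show ?thesis using assms by (subst prod_mom_zero[of k]) auto
    next
      case 4 then show ?thesis using assms by (subst prod_mom_zero[of l]) auto
    next
      case 5 then show ?thesis by (subst prod_mom_one) auto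
    next
      case 6 then show ?thesis using assms by (subst prod_mom_zero[of j]) auto
    next
      case 7 then show ?thesis by (subst prod_mom_one) auto
    next
      case 8 then show ?thesis using assms by (subst prod_mom_zero[of j]) auto
    next
      case 9 then show ?thesis using assms by (subst prod_mom_zero[of i]) auto
    qed
  qed
  finally show "(\<integral>u. (u i * u j) * (u k * u l) \<partial>stdg n) =
      of_bool (i = j \<and> k = l) + of_bool (i = k \<and> j = l) + of_bool (i = l \<and> j = k)" .
qed

lemma stdg_linear:
  shows "integrable (stdg n) (\<lambda>u. (\<Sum>i<n. b i * u i)\<^sup>2)"
    and "(\<integral>u. (\<Sum>i<n. b i * u i)\<^sup>2 \<partial>stdg n) = (\<Sum>i<n. (b i)\<^sup>2)"
proof -
  have e: "(\<Sum>i<n. b i * u i)\<^sup>2 = (\<Sum>i<n. \<Sum>j<n. (b i * b j) * (u i * u j))" for u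
    by (simp add: power2_eq_square sum_product algebra_simps)
  show "integrable (stdg n) (\<lambda>u. (\<Sum>i<n. b i * u i)\<^sup>2)"
    unfolding e by (intro Bochner_Integration.integrable_sum integrable_mult_right stdg_moment2) auto
  have "(\<integral>u. (\<Sum>i<n. b i * u i)\<^sup>2 \<partial>stdg n) = (\<Sum>i<n. \<Sum>j<n. (b i * b j) * of_bool (i = j))"
    unfolding e using stdg_moment2
    by (subst Bochner_Integration.integral_sum)
       (auto intro!: Bochner_Integration.integrable_sum sum.cong simp: Bochner_Integration.integral_sum)
  also have "\<dots> = (\<Sum>i<n. \<Sum>j<n. if i = j then b i * b j else 0)" by (intro sum.cong) auto
  finally show "(\<integral>u. (\<Sum>i<n. b i * u i)\<^sup>2 \<partial>stdg n) = (\<Sum>i<n. (b i)\<^sup>2)" by (simp add: power2_eq_square)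
qed

text \<open>Of the three pairings the one inside each factor is removed by centring; the remaining
  two give equal sums by symmetry of \<open>Q\<close>, hence twice the squared Frobenius
  norm.\<close>

lemma stdg_quadratic:
  fixes n :: nat and Q :: "nat \<Rightarrow> nat \<Rightarrow> real"
  assumes sym: "\<And>i j. Q i j = Q j i"
  defines "q \<equiv> \<lambda>u. (\<Sum>i<n. \<Sum>j<n. Q i j * (u i * u j - of_bool (i = j)))"
  shows "integrable (stdg n) (\<lambda>u. (q u)\<^sup>2)"
    and "(\<integral>u. (q u)\<^sup>2 \<partial>stdg n) = 2 * (\<Sum>i<n. \<Sum>j<n. (Q i j)\<^sup>2)"
proof -
  let ?t = "\<lambda>u i j k l. (u i * u j - of_bool (i = j)) * (u k * u l - of_bool (k = l)) :: real"
  have t: "integrable (stdg n) (\<lambda>u. ?t u i j k l)"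
    "(\<integral>u. ?t u i j k l \<partial>stdg n) = of_bool (i = k \<and> j = l) + of_bool (i = l \<and> j = k)"
    if "i < n" "j < n" "k < n" "l < n" for i j k l
  proof -
    have e: "?t u i j k l = (u i * u j) * (u k * u l) - of_bool (k = l) * (u i * u j) - of_bool (i = j) * (u k * u l) + of_bool (i = j) * of_bool (k = l)" for u
      by (simp add: algebra_simps)
    note m = stdg_moment4[OF that] stdg_moment2[OF that(1,2)] stdg_moment2[OF that(3,4)]
    show "integrable (stdg n) (\<lambda>u. ?t u i j k l)"
      unfolding e by (intro Bochner_Integration.integrable_add Bochner_Integration.integrable_diff integrable_mult_right m) auto
    show "(\<integral>u. ?t u i j k l \<partial>stdg n) = of_bool (i = k \<and> j = l) + of_bool (i = l \<and> j = k)"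
      unfolding e using m by (simp add: stdg.prob_space)
  qed
  have e: "(q u)\<^sup>2 = (\<Sum>i<n. \<Sum>j<n. \<Sum>k<n. \<Sum>l<n. (Q i j * Q k l) * ?t u i j k l)" for u
  proof -
    have "(q u)\<^sup>2 = (\<Sum>i<n. \<Sum>j<n. (Q i j * (u i * u j - of_bool (i = j))) * q u)"
      by (simp add: power2_eq_square sum_distrib_right) (simp add: q_def sum_distrib_right)
    also have "\<dots> = (\<Sum>i<n. \<Sum>j<n. \<Sum>k<n. \<Sum>l<n. (Q i j * (u i * u j - of_bool (i = j))) * (Q k l * (u k * u l - of_bool (k = l))))"
      by (simp only: q_def sum_distrib_left)
    finally show ?thesis by (simp only: mult_ac)
  qed
  show "integrable (stdg n) (\<lambda>u. (q u)\<^sup>2)"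
    unfolding e by (intro Bochner_Integration.integrable_sum integrable_mult_right t(1)) auto
  have "(\<integral>u. (q u)\<^sup>2 \<partial>stdg n) = (\<Sum>i<n. \<Sum>j<n. \<Sum>k<n. \<Sum>l<n. \<integral>u. (Q i j * Q k l) * ?t u i j k l \<partial>stdg n)"
    unfolding e
    apply (subst Bochner_Integration.integral_sum, (intro Bochner_Integration.integrable_sum integrable_mult_right t(1); simp), intro sum.cong refl)+
    done
  also have "\<dots> = (\<Sum>i<n. \<Sum>j<n. \<Sum>k<n. \<Sum>l<n. (Q i j * Q k l) * (of_bool (i = k \<and> j = l) + of_bool (i = l \<and> j = k)))"
    by (intro sum.cong refl) (simp add: t(2))
  also have "\<dots> = (\<Sum>i<n. \<Sum>j<n. 2 * (Q i j)\<^sup>2)"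
  proof (intro sum.cong refl)
    fix i j assume ij: "i \<in> {..<n}" "j \<in> {..<n}"
    have "(\<Sum>k<n. \<Sum>l<n. (Q i j * Q k l) * (of_bool (i = k \<and> j = l) + of_bool (i = l \<and> j = k)))
      = (\<Sum>k<n. \<Sum>l<n. (if k = i then if l = j then Q i j * Q i j else 0 else 0) + (if k = j then if l = i then Q i j * Q j i else 0 else 0))"
      by (intro sum.cong refl) (auto simp: distrib_left)
    also have "\<dots> = (\<Sum>k<n. (if k = i then Q i j * Q i j else 0) + (if k = j then Q i j * Q j i else 0))"
      using ij by (intro sum.cong refl) (auto simp: sum.distrib)
    also have "\<dots> = Q i j * Q i j + Q i j * Q j i" using ij by (simp add: sum.distrib)
    finally show "(\<Sum>k<n. \<Sum>l<n. (Q i j * Q k l) * (of_bool (i = k \<and> j = l) + of_bool (i = l \<and> j = k))) = 2 * (Q i j)\<^sup>2"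
      using sym[of j i] by (simp add: power2_eq_square)
  qed
  finally show "(\<integral>u. (q u)\<^sup>2 \<partial>stdg n) = 2 * (\<Sum>i<n. \<Sum>j<n. (Q i j)\<^sup>2)" by (simp add: sum_distrib_left)
qed

lemma stdg_chebyshev:
  assumes [measurable]: "X \<in> borel_measurable (stdg n)" and X: "integrable (stdg n) (\<lambda>u. (X u)\<^sup>2)" and t: "t > 0"
  shows "measure (stdg n) {u \<in> space (Rn n). t \<le> \<bar>X u\<bar>} \<le> (\<integral>u. (X u)\<^sup>2 \<partial>stdg n) / t\<^sup>2"
proof -
  have "{u \<in> space (Rn n). t \<le> \<bar>X u\<bar>} = {u \<in> space (stdg n). (X u)\<^sup>2 \<ge> t\<^sup>2}"
    using t by (auto simp: abs_le_square_iff[symmetric])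
  then show ?thesis
    using integral_Markov_inequality_measure[OF X, of "space (stdg n)" "t\<^sup>2"] t by simp
qed

text \<open>The matrix norm bound for the transpose of B controls both the linear form
  with coefficients B^T c and the Frobenius norm of B^T B.\<close>

lemma stdg_gram_deviation:
  fixes B :: "nat \<Rightarrow> nat \<Rightarrow> real" and c :: "nat \<Rightarrow> real"
  assumes \<beta>: "\<And>c. (\<Sum>j<n. (\<Sum>k<n. c k * B k j)\<^sup>2) \<le> \<beta> * (\<Sum>k<n. (c k)\<^sup>2)" and t: "t > 0"
  shows "measure (stdg n) {u \<in> space (Rn n). t \<le> \<bar>(\<Sum>k<n. (\<Sum>j<n. B k j * u j)\<^sup>2) - (\<Sum>k<n. \<Sum>j<n. (B k j)\<^sup>2)\<bar>}
      \<le> 2 * \<beta> * (\<Sum>k<n. \<Sum>j<n. (B k j)\<^sup>2) / t\<^sup>2"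
    and "measure (stdg n) {u \<in> space (Rn n). t \<le> \<bar>\<Sum>k<n. c k * (\<Sum>j<n. B k j * u j)\<bar>}
      \<le> \<beta> * (\<Sum>k<n. (c k)\<^sup>2) / t\<^sup>2"
proof -
  define Q where "Q i j = (\<Sum>k<n. B k i * B k j)" for i j
  have sym: "Q i j = Q j i" for i j by (simp add: Q_def mult.commute)
  define q where "q u = (\<Sum>i<n. \<Sum>j<n. Q i j * (u i * u j - of_bool (i = j)))" for u
  have tr: "(\<Sum>i<n. \<Sum>j<n. Q i j * of_bool (i = j)) = (\<Sum>k<n. \<Sum>j<n. (B k j)\<^sup>2)"
  proof -
    have "(\<Sum>i<n. \<Sum>j<n. Q i j * of_bool (i = j)) = (\<Sum>i<n. \<Sum>j<n. if i = j then Q i j else 0)"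
      by (intro sum.cong) auto
    also have "\<dots> = (\<Sum>i<n. \<Sum>k<n. (B k i)\<^sup>2)" by (simp add: Q_def power2_eq_square)
    also have "\<dots> = (\<Sum>k<n. \<Sum>j<n. (B k j)\<^sup>2)" by (rule sum.swap)
    finally show ?thesis .
  qed
  have qq: "(\<Sum>i<n. \<Sum>j<n. Q i j * (u i * u j)) = (\<Sum>k<n. (\<Sum>j<n. B k j * u j)\<^sup>2)" for u
  proof -
    have "(\<Sum>i<n. \<Sum>j<n. Q i j * (u i * u j)) = (\<Sum>i<n. \<Sum>j<n. \<Sum>k<n. (B k i * u i) * (B k j * u j))"
      by (intro sum.cong refl) (simp add: Q_def sum_distrib_right sum_distrib_left algebra_simps)
    also have "\<dots> = (\<Sum>i<n. \<Sum>k<n. \<Sum>j<n. (B k i * u i) * (B k j * u j))"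
      by (intro sum.cong refl sum.swap)
    also have "\<dots> = (\<Sum>k<n. \<Sum>i<n. \<Sum>j<n. (B k i * u i) * (B k j * u j))" by (rule sum.swap)
    finally show ?thesis by (simp add: sum_product power2_eq_square)
  qed
  have q: "q u = (\<Sum>k<n. (\<Sum>j<n. B k j * u j)\<^sup>2) - (\<Sum>k<n. \<Sum>j<n. (B k j)\<^sup>2)" for u
    unfolding qq[symmetric] tr[symmetric] q_def by (simp add: right_diff_distrib sum_subtractf)
  have "(\<Sum>i<n. \<Sum>j<n. (Q i j)\<^sup>2) = (\<Sum>i<n. \<Sum>j<n. (\<Sum>k<n. B k i * B k j)\<^sup>2)" by (simp add: Q_def)
  \<comment> \<open>The hypothesis is applied with the i-th column of \<open>B\<close> as
    coefficient vector: the squared Frobenius norm of B^T B is at most \<open>\<beta>\<close> times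
    that of B.\<close>
  also have "\<dots> \<le> (\<Sum>i<n. \<beta> * (\<Sum>k<n. (B k i)\<^sup>2))"
    by (rule sum_mono) (rule \<beta>)
  also have "\<dots> = \<beta> * (\<Sum>i<n. \<Sum>k<n. (B k i)\<^sup>2)" by (simp add: sum_distrib_left)
  also have "(\<Sum>i<n. \<Sum>k<n. (B k i)\<^sup>2) = (\<Sum>k<n. \<Sum>j<n. (B k j)\<^sup>2)" by (rule sum.swap)
  finally have Q2: "2 * (\<Sum>i<n. \<Sum>j<n. (Q i j)\<^sup>2) \<le> 2 * \<beta> * (\<Sum>k<n. \<Sum>j<n. (B k j)\<^sup>2)" by simp
  have "measure (stdg n) {u \<in> space (Rn n). t \<le> \<bar>q u\<bar>} \<le> 2 * (\<Sum>i<n. \<Sum>j<n. (Q i j)\<^sup>2) / t\<^sup>2"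
    using stdg_chebyshev[of q n t] stdg_quadratic[OF sym, of n] t unfolding q_def[abs_def] by simp
  also have "\<dots> \<le> 2 * \<beta> * (\<Sum>k<n. \<Sum>j<n. (B k j)\<^sup>2) / t\<^sup>2" by (rule divide_right_mono[OF Q2]) simp
  finally show "measure (stdg n) {u \<in> space (Rn n). t \<le> \<bar>(\<Sum>k<n. (\<Sum>j<n. B k j * u j)\<^sup>2) - (\<Sum>k<n. \<Sum>j<n. (B k j)\<^sup>2)\<bar>}
      \<le> 2 * \<beta> * (\<Sum>k<n. \<Sum>j<n. (B k j)\<^sup>2) / t\<^sup>2" unfolding q .
  define b where "b j = (\<Sum>k<n. c k * B k j)" for j
  have l: "(\<Sum>k<n. c k * (\<Sum>j<n. B k j * u j)) = (\<Sum>j<n. b j * u j)" for u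
    unfolding b_def by (rule sum_mat_assoc[symmetric])
  have "measure (stdg n) {u \<in> space (Rn n). t \<le> \<bar>\<Sum>j<n. b j * u j\<bar>} \<le> (\<Sum>i<n. (b i)\<^sup>2) / t\<^sup>2"
    using stdg_chebyshev[of "\<lambda>u. \<Sum>j<n. b j * u j" n t] stdg_linear[of n b] t by simp
  also have "\<dots> \<le> \<beta> * (\<Sum>k<n. (c k)\<^sup>2) / t\<^sup>2"
    using \<beta>[of c] by (intro divide_right_mono) (auto simp: b_def)
  finally show "measure (stdg n) {u \<in> space (Rn n). t \<le> \<bar>\<Sum>k<n. c k * (\<Sum>j<n. B k j * u j)\<bar>}
      \<le> \<beta> * (\<Sum>k<n. (c k)\<^sup>2) / t\<^sup>2" unfolding l .
qed

lemma stdg_norm_deviation: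
  assumes t: "t > 0"
  shows "measure (stdg n) {u \<in> space (Rn n). t \<le> \<bar>(\<Sum>k<n. (u k)\<^sup>2) - real n\<bar>} \<le> 2 * real n / t\<^sup>2"
proof -
  define B :: "nat \<Rightarrow> nat \<Rightarrow> real" where "B k j = (if k = j then 1 else 0)" for k j
  have 1: "(\<Sum>j<n. B k j * u j) = u k" if "k < n" for u k
    unfolding B_def by (rule sum_delta_mult(1)[OF that])
  have 2: "(\<Sum>k<n. c k * B k j) = c j" if "j < n" for c j
    unfolding B_def by (rule sum_delta_mult(2)[OF that])
  have 3: "(\<Sum>k<n. \<Sum>j<n. (B k j)\<^sup>2) = real n"
  proof -
    have "(\<Sum>k<n. \<Sum>j<n. (B k j)\<^sup>2) = (\<Sum>k<n. \<Sum>j<n. if k = j then 1 else 0)"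
      by (intro sum.cong) (auto simp: B_def)
    then show ?thesis by simp
  qed
  show ?thesis
    using stdg_gram_deviation(1)[where n=n and B=B and \<beta>=1 and t=t] t by (simp add: 1 2 3)
qed

section \<open>Stationary covariances\<close>

text \<open>The weights for which Szego's theorem has a positive limit, that is, the spectra of
  regular processes. The input and output spectra of the direct part belong to this class
  too.\<close>

definition nice :: "(real \<Rightarrow> real) \<Rightarrow> bool" where
  "nice G \<longleftrightarrow> integrable U G \<and> (\<forall>l. 0 \<le> G l) \<and> (AE l in U. 0 < G l) \<and> integrable U (\<lambda>l. ln (G l))"

definition cv :: "(real \<Rightarrow> real) \<Rightarrow> nat \<Rightarrow> nat \<Rightarrow> real" where
  "cv G i j = (\<integral>l. cos (real_of_int (int j - int i) * l) * G l \<partial>U)"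

lemma cv_form:
  assumes "integrable U G"
  shows "(\<Sum>i<n. \<Sum>j<n. c i * c j * cv G i j) = (\<integral>l. (cmod (ev (polyn n c) l))\<^sup>2 * G l \<partial>U)"
  unfolding cv_def
  by (rule qform_integral[OF assms, of "\<lambda>k. \<integral>l. cos (real_of_int k * l) * G l \<partial>U"]) (rule refl)

lemma cv_sym: "cv G i j = cv G j i"
proof -
  have "cos (real_of_int (int j - int i) * l) = cos (real_of_int (int i - int j) * l)" for l
  proof -
    have "real_of_int (int j - int i) * l = - (real_of_int (int i - int j) * l)" by (simp add: algebra_simps)
    then show ?thesis by (simp only: cos_minus)
  qed
  then show ?thesis by (simp only: cv_def)
qed

lemma cv_reflect: "i < n \<Longrightarrow> j < n \<Longrightarrow> cv G (n - 1 - i) (n - 1 - j) = cv G i j"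
proof -
  assume "i < n" "j < n"
  then have "int (n - 1 - j) - int (n - 1 - i) = int i - int j" by auto
  then show ?thesis by (subst cv_sym[of G i j]) (simp only: cv_def)
qed

text \<open>Stationary covariances are invariant under time reversal. This converts between rows of
  a triangular factor, which end at the current coordinate, and polynomials normalised at their
  lowest coefficient.\<close>

lemma cv_form_reverse:
  "(\<Sum>i<n. \<Sum>j<n. c (n - 1 - i) * c (n - 1 - j) * cv G i j) = (\<Sum>i<n. \<Sum>j<n. c i * c j * cv G i j)"
proof -
  have "(\<Sum>i<n. \<Sum>j<n. c i * c j * cv G i j) = (\<Sum>i<n. \<Sum>j<n. c i * c (n - 1 - j) * cv G i (n - 1 - j))"
    by (rule sum.cong[OF refl]) (subst sum.nat_diff_reindex[symmetric], simp)
  also have "\<dots> = (\<Sum>i<n. \<Sum>j<n. c (n - 1 - i) * c (n - 1 - j) * cv G (n - 1 - i) (n - 1 - j))"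
    by (subst sum.nat_diff_reindex[symmetric]) simp
  also have "\<dots> = (\<Sum>i<n. \<Sum>j<n. c (n - 1 - i) * c (n - 1 - j) * cv G i j)"
  proof (intro sum.cong refl)
    fix i j assume "i \<in> {..<n}" "j \<in> {..<n}"
    then show "c (n - 1 - i) * c (n - 1 - j) * cv G (n - 1 - i) (n - 1 - j) = c (n - 1 - i) * c (n - 1 - j) * cv G i j"
      using cv_reflect[of i n j G] by simp
  qed
  finally show ?thesis by simp
qed

text \<open>Dividing by the lowest term c_k x^k leaves a polynomial with constant coefficient 1, and
  multiplication by x^k does not change the modulus on the circle, so Szego's lower bound
  applies.\<close>

lemma cv_form_lower:
  assumes G: "nice G" and k: "k < n" and z: "\<And>i. i < k \<Longrightarrow> c i = 0"
  shows "(c k)\<^sup>2 * exp (\<integral>l. ln (G l) \<partial>U) \<le> (\<Sum>i<n. \<Sum>j<n. c i * c j * cv G i j)"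
proof (cases "c k = 0")
  case True
  have "0 \<le> (\<integral>l. (cmod (ev (polyn n c) l))\<^sup>2 * G l \<partial>U)"
    by (rule integral_nonneg_AE) (use G in \<open>auto simp: nice_def\<close>)
  then show ?thesis using True G by (simp add: cv_form nice_def)
next
  case False
  have G': "integrable U G" using G by (simp add: nice_def)
  define p where "p = polyn (n - k) (\<lambda>i. c (i + k) / c k)"
  have "coeff (polyn n c) i = coeff (Polynomial.smult (c k) (monom 1 k * p)) i" for i
    using z[of i] k False by (auto simp: coeff_polyn coeff_monom_mult p_def)
  then have e: "polyn n c = Polynomial.smult (c k) (monom 1 k * p)" by (rule poly_eqI)
  have "exp (\<integral>l. ln (G l) \<partial>U) \<le> (\<integral>l. (cmod (ev p l))\<^sup>2 * G l \<partial>U)"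
    by (rule szego_lower) (use G False k in \<open>auto simp: nice_def p_def coeff_polyn\<close>)
  moreover have "(\<integral>l. (cmod (ev (polyn n c) l))\<^sup>2 * G l \<partial>U) = (\<integral>l. (c k)\<^sup>2 * ((cmod (ev p l))\<^sup>2 * G l) \<partial>U)"
    unfolding e by (simp add: ev_smult ev_mult ev_monom norm_mult power_mult_distrib mult.assoc)
  ultimately show ?thesis by (simp add: cv_form[OF G'] mult_left_mono)
qed

lemma posdef_cv:
  assumes G: "nice G" shows "posdef (cv G)"
  unfolding posdef_def
proof (intro conjI allI impI)
  fix n and c :: "nat \<Rightarrow> real" assume "\<exists>i<n. c i \<noteq> 0"
  then have ex: "\<exists>i. i < n \<and> c i \<noteq> 0" by blast
  define k where "k = (LEAST i. i < n \<and> c i \<noteq> 0)"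
  have k: "k < n" "c k \<noteq> 0" using LeastI_ex[OF ex] by (auto simp: k_def)
  have "c i = 0" if "i < k" for i using not_less_Least[of i "\<lambda>i. i < n \<and> c i \<noteq> 0"] that k by (auto simp: k_def)
  from cv_form_lower[OF G k(1) this] have "(c k)\<^sup>2 * exp (\<integral>l. ln (G l) \<partial>U) \<le> (\<Sum>i<n. \<Sum>j<n. c i * c j * cv G i j)" .
  moreover have "0 < (c k)\<^sup>2 * exp (\<integral>l. ln (G l) \<partial>U)" using k by simp
  ultimately show "0 < (\<Sum>i<n. \<Sum>j<n. c i * c j * cv G i j)" by linarith
qed (rule cv_sym)

lemma chol_form:
  assumes C: "chol n v L M"
  shows "(\<Sum>m<n. (\<Sum>i<n. c i * L i m)\<^sup>2) = (\<Sum>i<n. \<Sum>j<n. c i * c j * v i j)"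
proof -
  have "(\<Sum>i<n. \<Sum>j<n. c i * c j * v i j) = (\<Sum>i<n. \<Sum>j<n. \<Sum>k<n. (c i * L i k) * (c j * L j k))"
  proof (intro sum.cong refl)
    fix i j assume "i \<in> {..<n}" "j \<in> {..<n}"
    then have "v i j = (\<Sum>k<n. L i k * L j k)" using C by (simp add: chol_def)
    then show "c i * c j * v i j = (\<Sum>k<n. (c i * L i k) * (c j * L j k))" by (simp add: sum_distrib_left algebra_simps)
  qed
  also have "\<dots> = (\<Sum>i<n. \<Sum>k<n. \<Sum>j<n. (c i * L i k) * (c j * L j k))" by (intro sum.cong refl sum.swap)
  also have "\<dots> = (\<Sum>k<n. \<Sum>i<n. \<Sum>j<n. (c i * L i k) * (c j * L j k))" by (rule sum.swap)
  finally show ?thesis by (simp add: sum_product power2_eq_square)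
qed

text \<open>The squared diagonal entry is the error variance in predicting coordinate k from its
  finite past. Row k of \<open>M\<close> has quadratic form 1 and last entry 1/L_kk; read backwards
  it starts with that entry, and the lower bound for forms becomes one for L_kk.\<close>

lemma chol_diag_lower:
  assumes G: "nice G" and C: "chol n (cv G) L M" and k: "k < n"
  shows "exp (\<integral>l. ln (G l) \<partial>U) \<le> (L k k)\<^sup>2"
proof -
  have up: "\<And>i j. i < j \<Longrightarrow> M i j = 0" and dg: "L k k > 0" "M k k = 1 / L k k"
    using C k by (auto simp: chol_def)
  define c where "c i = M k (n - 1 - i)" for i
  have "(\<Sum>i<n. \<Sum>j<n. M k i * M k j * cv G i j) = (\<Sum>m<n. (\<Sum>i<n. M k i * L i m)\<^sup>2)"
    by (rule chol_form[OF C, symmetric])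
  also have "\<dots> = (\<Sum>m<n. if k = m then 1 else 0)"
    using C k by (intro sum.cong) (auto simp: chol_def)
  also have "\<dots> = 1" using k by simp
  finally have 1: "(\<Sum>i<n. \<Sum>j<n. c i * c j * cv G i j) = 1"
    unfolding c_def by (subst cv_form_reverse)
  have "(c (n - 1 - k))\<^sup>2 * exp (\<integral>l. ln (G l) \<partial>U) \<le> (\<Sum>i<n. \<Sum>j<n. c i * c j * cv G i j)"
    by (rule cv_form_lower[OF G]) (use k in \<open>auto simp: c_def intro!: up\<close>)
  also have "c (n - 1 - k) = 1 / L k k" using k dg by (simp add: c_def)
  finally show ?thesis using dg 1 by (simp add: power_divide field_simps)
qed

text \<open>Truncated matrix of multiplication by \<open>a\<close>, lower triangular and Toeplitz:
  applied to the coefficients of a polynomial it yields the first coefficients of the product. Its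
  diagonal is the constant coefficient of \<open>a\<close>.\<close>

definition convm :: "real poly \<Rightarrow> nat \<Rightarrow> nat \<Rightarrow> real" where
  "convm a k i = (if i \<le> k then coeff a (k - i) else 0)"

lemma convm_form:
  assumes "integrable U G" and k: "k < n"
  shows "(\<Sum>i<n. \<Sum>j<n. convm a k i * convm a k j * cv G i j) = (\<integral>l. (cmod (ev (polyn (Suc k) (coeff a)) l))\<^sup>2 * G l \<partial>U)"
proof -
  have "(\<Sum>i<n. \<Sum>j<n. convm a k i * convm a k j * cv G i j) = (\<Sum>i<Suc k. \<Sum>j<n. convm a k i * convm a k j * cv G i j)"
    by (rule sum.mono_neutral_right) (use k in \<open>auto simp: convm_def\<close>)
  also have "\<dots> = (\<Sum>i<Suc k. \<Sum>j<Suc k. convm a k i * convm a k j * cv G i j)"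
    by (intro sum.cong refl sum.mono_neutral_right) (use k in \<open>auto simp: convm_def\<close>)
  also have "\<dots> = (\<Sum>i<Suc k. \<Sum>j<Suc k. coeff a (Suc k - 1 - i) * coeff a (Suc k - 1 - j) * cv G i j)"
    by (intro sum.cong refl) (auto simp: convm_def)
  also have "\<dots> = (\<Sum>i<Suc k. \<Sum>j<Suc k. coeff a i * coeff a j * cv G i j)"
    by (rule cv_form_reverse)
  also have "\<dots> = (\<integral>l. (cmod (ev (polyn (Suc k) (coeff a)) l))\<^sup>2 * G l \<partial>U)"
    by (rule cv_form[OF assms(1)])
  finally show ?thesis .
qed

text \<open>Row k of \<open>convm a\<close> is a particular predictor of coordinate k and cannot
  beat the optimal one: pairing it with column k of \<open>L\<close> leaves only L_kk, and one
  square is at most the whole sum. The degree bound ensures that the row contains all coefficients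
  of \<open>a\<close>.\<close>

lemma chol_diag_upper:
  assumes G: "integrable U G" and C: "chol n (cv G) L M" and k: "k < n" and a: "coeff a 0 = 1" "degree a \<le> k"
  shows "(L k k)\<^sup>2 \<le> (\<integral>l. (cmod (ev a l))\<^sup>2 * G l \<partial>U)"
proof -
  have up: "\<And>i j. i < j \<Longrightarrow> L i j = 0" using C by (simp add: chol_def)
  have "(\<Sum>i<n. convm a k i * L i k) = (\<Sum>i<n. if i = k then L k k else 0)"
  proof (intro sum.cong refl)
    fix i
    show "convm a k i * L i k = (if i = k then L k k else 0)"
      using up[of i k] by (cases i k rule: linorder_cases) (auto simp: convm_def a)
  qed
  then have "L k k = (\<Sum>i<n. convm a k i * L i k)" using k by simp
  then have "(L k k)\<^sup>2 = (\<Sum>i<n. convm a k i * L i k)\<^sup>2" by simp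
  also have "\<dots> \<le> (\<Sum>m<n. (\<Sum>i<n. convm a k i * L i m)\<^sup>2)"
    using k by (intro member_le_sum) auto
  also have "\<dots> = (\<integral>l. (cmod (ev (polyn (Suc k) (coeff a)) l))\<^sup>2 * G l \<partial>U)"
    unfolding chol_form[OF C] by (rule convm_form[OF G k])
  also have "polyn (Suc k) (coeff a) = a" by (rule polyn_coeff) (use a in simp)
  finally show ?thesis .
qed

text \<open>The inner sums are the first n coefficients of the product of \<open>a\<close> with the
  polynomial of \<open>x\<close>. Dropping the others only decreases the sum of squares, and
  Parseval reduces the claim to the pointwise bound on the modulus.\<close>

lemma convm_norm:
  assumes \<kappa>: "\<And>l. l \<in> {0..pi} \<Longrightarrow> (cmod (ev a l))\<^sup>2 \<le> \<kappa>"
  shows "(\<Sum>k<n. (\<Sum>i<n. convm a k i * x i)\<^sup>2) \<le> \<kappa> * (\<Sum>i<n. (x i)\<^sup>2)"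
proof -
  define p where "p = a * polyn n x"
  define N where "N = n + Suc (degree p)"
  have c: "coeff p k = (\<Sum>i<n. convm a k i * x i)" if "k < n" for k
  proof -
    have "coeff p k = (\<Sum>i\<le>k. coeff (polyn n x) i * coeff a (k - i))"
      unfolding p_def by (subst mult.commute) (rule coeff_mult)
    also have "\<dots> = (\<Sum>i\<le>k. convm a k i * x i)"
      using that by (intro sum.cong) (auto simp: coeff_polyn convm_def)
    also have "\<dots> = (\<Sum>i<n. convm a k i * x i)"
      by (rule sum.mono_neutral_left) (use that in \<open>auto simp: convm_def\<close>)
    finally show ?thesis .
  qed
  have "(\<Sum>k<n. (\<Sum>i<n. convm a k i * x i)\<^sup>2) = (\<Sum>k<n. (coeff p k)\<^sup>2)" by (simp add: c)
  also have "\<dots> \<le> (\<Sum>k<N. (coeff p k)\<^sup>2)" by (rule sum_mono2) (auto simp: N_def)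
  also have "\<dots> = (\<integral>l. (cmod (ev p l))\<^sup>2 \<partial>U)" by (rule parseval[symmetric]) (simp add: N_def)
  also have "\<dots> \<le> (\<integral>l. \<kappa> * ((cmod (ev (polyn n x) l))\<^sup>2 * 1) \<partial>U)"
  proof (rule integral_mono_AE)
    show "integrable U (\<lambda>l. (cmod (ev p l))\<^sup>2)" using integrable_cmod_ev[of "\<lambda>_. 1" p] by simp
    show "integrable U (\<lambda>l. \<kappa> * ((cmod (ev (polyn n x) l))\<^sup>2 * 1))"
      by (intro integrable_mult_right integrable_cmod_ev) simp
    show "AE l in U. (cmod (ev p l))\<^sup>2 \<le> \<kappa> * ((cmod (ev (polyn n x) l))\<^sup>2 * 1)"
      using AE_U_in by eventually_elim (auto simp: p_def ev_mult norm_mult power_mult_distrib intro!: mult_right_mono \<kappa>)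
  qed
  also have "\<dots> = \<kappa> * (\<Sum>i<n. (x i)\<^sup>2)" by (simp add: parseval_polyn)
  finally show ?thesis .
qed

text \<open>Duality: pairing the transposed image with itself and applying Cauchy-Schwarz bounds S^2
  by \<open>\<kappa>\<close> S times the sum of squares of \<open>c\<close>, and one factor S
  cancels.\<close>

lemma transpose_norm:
  fixes A :: "nat \<Rightarrow> nat \<Rightarrow> real"
  assumes A: "\<And>x. (\<Sum>k<n. (\<Sum>i<n. A k i * x i)\<^sup>2) \<le> \<kappa> * (\<Sum>i<n. (x i)\<^sup>2)" and \<kappa>: "\<kappa> \<ge> 0"
  shows "(\<Sum>i<n. (\<Sum>k<n. c k * A k i)\<^sup>2) \<le> \<kappa> * (\<Sum>k<n. (c k)\<^sup>2)"
proof -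
  define w where "w i = (\<Sum>k<n. c k * A k i)" for i
  define S where "S = (\<Sum>i<n. (w i)\<^sup>2)"
  have S0: "S \<ge> 0" unfolding S_def by (rule sum_nonneg) auto
  have c0: "(\<Sum>k<n. (c k)\<^sup>2) \<ge> 0" by (rule sum_nonneg) auto
  have "S = (\<Sum>i<n. (\<Sum>k<n. c k * A k i) * w i)" by (simp add: S_def w_def power2_eq_square)
  also have "\<dots> = (\<Sum>k<n. c k * (\<Sum>i<n. A k i * w i))" by (rule sum_mat_assoc)
  finally have "S\<^sup>2 = (\<Sum>k<n. c k * (\<Sum>i<n. A k i * w i))\<^sup>2" by simp
  also have "\<dots> \<le> (\<Sum>k<n. (c k)\<^sup>2) * (\<Sum>k<n. (\<Sum>i<n. A k i * w i)\<^sup>2)"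
    by (rule Cauchy_Schwarz_ineq_sum)
  also have "\<dots> \<le> (\<Sum>k<n. (c k)\<^sup>2) * (\<kappa> * S)"
    unfolding S_def by (rule mult_left_mono[OF A c0])
  finally have "S * S \<le> (\<kappa> * (\<Sum>k<n. (c k)\<^sup>2)) * S" by (simp add: power2_eq_square mult_ac)
  then have "S \<le> \<kappa> * (\<Sum>k<n. (c k)\<^sup>2)"
    using S0 \<kappa> c0 by (cases "S = 0") auto
  then show ?thesis by (simp add: S_def w_def)
qed

lemma chol_norm_small:
  assumes G: "nice G" and d: "d > 0"
  shows "\<exists>N. \<forall>n\<ge>N. \<forall>L M c. chol n (cv G) L M \<longrightarrow> (\<Sum>j<n. (\<Sum>i<n. c i * L i j)\<^sup>2) \<le> d * real n * (\<Sum>i<n. (c i)\<^sup>2)"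
proof -
  obtain N where N: "\<And>n c. n \<ge> N \<Longrightarrow> (\<integral>l. (cmod (ev (polyn n c) l))\<^sup>2 * G l \<partial>U) \<le> d * real n * (\<Sum>i<n. (c i)\<^sup>2)"
    using qform_small[of G d] G d by (auto simp: nice_def)
  show ?thesis
    by (intro exI[of _ N] allI impI) (use N G in \<open>simp add: chol_form cv_form nice_def\<close>)
qed

text \<open>Twice the sum of logarithms is the log determinant of the covariance. Finite-past
  prediction errors are never below the infinite-past one, so the bound holds at every n without an
  error term.\<close>

lemma chol_lndet_lower:
  assumes G: "nice G" and C: "chol n (cv G) L M"
  shows "real n * (\<integral>l. ln (G l) \<partial>U) \<le> 2 * (\<Sum>k<n. ln (L k k))"
proof -
  have "(\<integral>l. ln (G l) \<partial>U) \<le> 2 * ln (L k k)" if "k < n" for k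
  proof -
    have p: "L k k > 0" using C that by (simp add: chol_def)
    have "ln (exp (\<integral>l. ln (G l) \<partial>U)) \<le> ln ((L k k)\<^sup>2)"
      using chol_diag_lower[OF G C that] p by (subst ln_le_cancel_iff) auto
    then show ?thesis using p by (simp add: ln_realpow)
  qed
  then have "(\<Sum>k<n. (\<integral>l. ln (G l) \<partial>U)) \<le> (\<Sum>k<n. 2 * ln (L k k))" by (intro sum_mono) auto
  then show ?thesis by (simp add: sum_distrib_left)
qed

text \<open>A nearly optimal predictor of degree d controls every diagonal entry from d on. The
  first d entries are controlled only by the variance, a fixed cost d K that is below n e/2 for
  large n.\<close>

lemma chol_lndet_upper:
  assumes G: "nice G" and e: "e > 0"
  shows "\<exists>N. \<forall>n\<ge>N. \<forall>L M. chol n (cv G) L M \<longrightarrow> 2 * (\<Sum>k<n. ln (L k k)) \<le> real n * ((\<integral>l. ln (G l) \<partial>U) + e)"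
proof -
  have G': "integrable U G" using G by (simp add: nice_def)
  obtain a where a: "coeff a 0 = 1" "(\<integral>l. (cmod (ev a l))\<^sup>2 * G l \<partial>U) \<le> exp ((\<integral>l. ln (G l) \<partial>U) + e / 2)"
    using szego_upper[of G "e / 2"] G e by (auto simp: nice_def)
  define m where "m = (\<integral>l. ln (G l) \<partial>U)"
  define d where "d = degree a"
  define K where "K = \<bar>ln (\<bar>cv G 0 0\<bar> + 1)\<bar> + \<bar>m + e / 2\<bar>"
  have K0: "K \<ge> 0" by (simp add: K_def)
  obtain N where N: "real d * K * 2 / e \<le> real N" using real_arch_simple by blast
  show ?thesis
  proof (intro exI[of _ N] allI impI)
    fix n L M assume n: "N \<le> n" and C: "chol n (cv G) L M"
    have ub: "2 * ln (L k k) \<le> (m + e / 2) + (if k < d then K else 0)" if k: "k < n" for k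
    proof -
      have p: "L k k > 0" using C that by (simp add: chol_def)
      show ?thesis
      proof (cases "k < d")
        case True
        have "(L k k)\<^sup>2 \<le> (\<Sum>j<n. (L k j)\<^sup>2)" using k by (intro member_le_sum) auto
        also have "\<dots> = cv G k k" using C k by (simp add: chol_def power2_eq_square)
        also have "\<dots> = cv G 0 0" by (simp add: cv_def)
        finally have "(L k k)\<^sup>2 \<le> \<bar>cv G 0 0\<bar> + 1" by simp
        then have "ln ((L k k)\<^sup>2) \<le> ln (\<bar>cv G 0 0\<bar> + 1)" using p by (subst ln_le_cancel_iff) auto
        then have "2 * ln (L k k) \<le> ln (\<bar>cv G 0 0\<bar> + 1)" using p by (simp add: ln_realpow)
        then show ?thesis using True unfolding K_def by simp
      next
        case False
        have "(L k k)\<^sup>2 \<le> exp (m + e / 2)"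
          using chol_diag_upper[OF G' C k a(1)] False a(2) by (simp add: d_def m_def)
        then have "ln ((L k k)\<^sup>2) \<le> ln (exp (m + e / 2))" using p by (subst ln_le_cancel_iff) auto
        then have "2 * ln (L k k) \<le> m + e / 2" using p by (simp add: ln_realpow)
        then show ?thesis using False by simp
      qed
    qed
    have "(\<Sum>k<n. 2 * ln (L k k)) \<le> (\<Sum>k<n. (m + e / 2) + (if k < d then K else 0))"
      by (rule sum_mono) (use ub in auto)
    also have "\<dots> = real n * (m + e / 2) + (\<Sum>k\<in>{..<n} \<inter> {k. k < d}. K)"
      by (simp only: sum.distrib) (subst sum.inter_restrict, auto simp: algebra_simps)
    also have "(\<Sum>k\<in>{..<n} \<inter> {k. k < d}. K) \<le> (\<Sum>k<d. K)"
      using K0 by (intro sum_mono2) auto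
    also have "\<dots> = real d * K" by simp
    also have "real d * K \<le> real n * (e / 2)"
    proof -
      have "real d * K \<le> real N * (e / 2)" using N e by (simp add: field_simps)
      also have "\<dots> \<le> real n * (e / 2)" using n e by (intro mult_right_mono) auto
      finally show ?thesis .
    qed
    finally have "(\<Sum>k<n. 2 * ln (L k k)) \<le> real n * (m + e)" by (simp add: algebra_simps)
    then show "2 * (\<Sum>k<n. ln (L k k)) \<le> real n * ((\<integral>l. ln (G l) \<partial>U) + e)" by (simp add: sum_distrib_left m_def)
  qed
qed

section \<open>The channel\<close>

lemma gd_total:
  assumes up: "\<And>i j. i < j \<Longrightarrow> M i j = 0" and dg: "\<And>i. i < n \<Longrightarrow> 0 < M i i"
  shows "(\<integral>\<^sup>+y. ennreal (gd n M y) \<partial>Rn n) = 1"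
proof -
  have pp: "(\<Prod>i<n. M i i) \<ge> 0" by (rule prod_nonneg) (use dg in \<open>auto intro: less_imp_le\<close>)
  have "(\<integral>\<^sup>+y. ennreal (gd n M y) \<partial>Rn n) = (\<integral>\<^sup>+y. ennreal (phi n (aff n M (\<lambda>_. 0) y)) * ennreal (\<Prod>i<n. M i i) \<partial>Rn n)"
    by (intro nn_integral_cong) (simp add: gd_phi ennreal_mult' pp mult.commute)
  also have "\<dots> = (\<integral>\<^sup>+y. ennreal (phi n (aff n M (\<lambda>_. 0) y)) \<partial>Rn n) * ennreal (\<Prod>i<n. M i i)"
    by (rule nn_integral_multc) measurable
  also have "\<dots> = (\<integral>\<^sup>+u. ennreal (phi n u) \<partial>Rn n)"
    by (rule nn_integral_aff[OF up dg]) auto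
  also have "\<dots> = emeasure (stdg n) (space (stdg n))"
    unfolding stdg_density by (subst emeasure_density) (auto intro!: nn_integral_cong simp: indicator_def)
  also have "\<dots> = 1" by (rule stdg.emeasure_space_1)
  finally show ?thesis .
qed

lemma gd_nonneg: "(\<And>i. i < n \<Longrightarrow> 0 < M i i) \<Longrightarrow> 0 \<le> gd n M z"
  unfolding gd_def by (intro mult_nonneg_nonneg prod_nonneg) (auto intro: less_imp_le)

lemma gd_exp:
  assumes "\<And>i. i < n \<Longrightarrow> 0 < M i i"
  shows "gd n M z = exp ((\<Sum>i<n. ln (M i i)) - (1/2) * (\<Sum>k<n. (\<Sum>j<n. M k j * z j)\<^sup>2)) / sqrt ((2 * pi) ^ n)"
proof -
  have "(\<Prod>i<n. M i i) = exp (\<Sum>i<n. ln (M i i))"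
    using assms by (simp add: exp_sum)
  moreover have "exp a * (exp (- (1/2) * b) / r) = exp (a - (1/2) * b) / r" for a b r :: real
    by (simp add: exp_add[symmetric])
  ultimately show ?thesis unfolding gd_def std_normal_prod by (simp only:)
qed

lemma gd_exp_chol:
  assumes C: "chol n v L M"
  shows "gd n M z = exp (- (\<Sum>i<n. ln (L i i)) - (1/2) * (\<Sum>k<n. (\<Sum>j<n. M k j * z j)\<^sup>2)) / sqrt ((2 * pi) ^ n)"
proof -
  have d: "0 < L i i" "M i i = 1 / L i i" if "i < n" for i using C that by (auto simp: chol_def)
  have "(\<Sum>i<n. ln (M i i)) = - (\<Sum>i<n. ln (L i i))"
    unfolding sum_negf[symmetric] using d by (intro sum.cong refl) (simp add: ln_div less_imp_neq[symmetric])
  then show ?thesis using gd_exp[of n M z] d by simp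
qed

lemma chol_whiten:
  assumes C: "chol n v L M" and k: "k < n"
  shows "(\<Sum>j<n. M k j * (aff n L x u j - x j)) = u k"
proof -
  have "(\<Sum>j<n. M k j * (aff n L x u j - x j)) = (\<Sum>j<n. M k j * (\<Sum>m<n. L j m * u m))"
    by (intro sum.cong) (auto simp: aff_def)
  also have "\<dots> = u k" by (rule chol_trans(1)[OF C k k])
  finally show ?thesis .
qed

text \<open>The channel after folding: what remains of the process is the weight \<open>G\<close> of
  its covariance and the water level \<open>\<theta>\<close>, which is 2 pi times the level
  \<open>alpha_P\<close> of the original spectrum.\<close>

locale anwgn =
  fixes \<gamma> :: "int \<Rightarrow> real" and G :: "real \<Rightarrow> real" and P \<theta> :: real
  assumes G: "nice G" and \<gamma>: "\<And>i j. \<gamma> (int j - int i) = cv G i j"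
    and P: "P > 0" and \<theta>: "\<theta> > 0" and level: "(\<integral>l. max (\<theta> - G l) 0 \<partial>U) = P"
begin

definition cap :: real where
  "cap = 1 / 2 * ((\<integral>l. ln (max (G l) \<theta>) \<partial>U) - (\<integral>l. ln (G l) \<partial>U))"

lemma Gi: "integrable U G" and G0: "0 \<le> G l" and Gpos: "AE l in U. 0 < G l" and Gln: "integrable U (\<lambda>l. ln (G l))"
  using G by (auto simp: nice_def)

lemma Gm: "G \<in> borel_measurable borel" using Gi by (auto dest: borel_measurable_integrable)

lemma chol_ex: "\<exists>L M. chol n (cv G) L M"
  by (rule chol_exists[OF posdef_cv[OF G]])

lemma gdens_eq: "chol n (cv G) L M \<Longrightarrow> gdens \<gamma> n z = gd n M z"
  by (rule gdens_chol) (simp add: \<gamma>)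

lemma W_distr: "chol n (cv G) L M \<Longrightarrow> W \<gamma> n x = distr (stdg n) (Rn n) (aff n L x)"
  unfolding W_def by (simp only: gdens_eq gd_distr)

lemma sets_W[simp, measurable_cong]: "sets (W \<gamma> n x) = sets (Rn n)"
  by (simp add: W_def)

lemma space_W[simp]: "space (W \<gamma> n x) = space (Rn n)"
  by (simp add: W_def)

lemma prob_W: "prob_space (W \<gamma> n x)"
proof -
  obtain L M where "chol n (cv G) L M" using chol_ex by blast
  then show ?thesis by (simp add: W_distr stdg.prob_space_distr)
qed

lemma measure_W:
  assumes C: "chol n (cv G) L M" and A: "A \<in> sets (Rn n)"
  shows "measure (W \<gamma> n x) A = measure (stdg n) {u \<in> space (Rn n). aff n L x u \<in> A}"
proof -
  have "measure (W \<gamma> n x) A = measure (stdg n) (aff n L x -` A \<inter> space (stdg n))"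
    unfolding W_distr[OF C] using A by (intro measure_distr) auto
  also have "aff n L x -` A \<inter> space (stdg n) = {u \<in> space (Rn n). aff n L x u \<in> A}" by auto
  finally show ?thesis .
qed

text \<open>Pointwise, G/max(G, \<theta>) and max(\<theta> - G, 0)/\<theta> add up to 1. This is the
  optimality condition of water filling: noise and input terms in the exponent of the converse
  compensate exactly.\<close>

lemma waterfilling_identity: "(\<integral>l. G l / max (G l) \<theta> \<partial>U) + P / \<theta> = 1"
proof -
  note Gm[measurable]
  have i1: "integrable U (\<lambda>l. G l / max (G l) \<theta>)"
  proof (rule U_integrable_bounded[where B=1])
    fix l show "\<bar>G l / max (G l) \<theta>\<bar> \<le> 1" using G0[of l] \<theta> by (auto simp: max_def)
  qed measurable
  have i2: "integrable U (\<lambda>l. max (\<theta> - G l) 0)"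
    by (rule U_integrable_bounded[where B=\<theta>]) (use G0 \<theta> in \<open>auto simp: max_def\<close>)
  have "1 = (\<integral>l. G l / max (G l) \<theta> + max (\<theta> - G l) 0 / \<theta> \<partial>U)"
  proof -
    have "G l / max (G l) \<theta> + max (\<theta> - G l) 0 / \<theta> = 1" for l
      using \<theta> by (auto simp: max_def field_simps)
    then show ?thesis by simp
  qed
  also have "\<dots> = (\<integral>l. G l / max (G l) \<theta> \<partial>U) + P / \<theta>"
    using i1 i2 by (simp add: level)
  finally show ?thesis by simp
qed

text \<open>The density q whitens y by exp(s/2) A, where A is truncated multiplication by the
  polynomial \<open>a\<close> and exp(s)|a|^2 imitates 1/max(G, \<theta>). At y = x + L u its
  exponent contains exp(s)|A x + B u|^2 with B = A L. The x part is at most about n P/\<theta> by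
  the pointwise bound on \<open>a\<close>, the u part concentrates near n times the mean of G/max(G,
  \<theta>), and the cross term is negligible; together they are at most about n, the size of |u|^2
  in the channel density. What remains is half the difference of the log determinants, n
  \<open>cap\<close>.\<close>

lemma converse_density:
  assumes e: "e > 0"
  shows "\<exists>N. \<forall>n\<ge>N. \<exists>q. q \<in> borel_measurable (Rn n) \<and> (\<forall>y. 0 \<le> q y) \<and> (\<integral>\<^sup>+y. ennreal (q y) \<partial>Rn n) = 1 \<and>
    (\<forall>x\<in>costset n P. measure (W \<gamma> n x)
       {y \<in> space (Rn n). exp (real n * (cap + e)) * q y < gdens \<gamma> n (\<lambda>i. y i - x i)} \<le> e)"
proof -
  note Gm[measurable]
  define h where "h l = max (G l) \<theta>" for l
  have h: "integrable U h" "\<And>l. \<theta> \<le> h l" unfolding h_def using Gi by auto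
  \<comment> \<open>Approximation error of the polynomial: it enters once in the filtered noise
    energy, once in \<open>s\<close>, and with factor P in the input energy, e/4 in total.\<close>
  define e0 where "e0 = e / (4 * (2 + P))"
  have e0: "e0 > 0" "2 * e0 + e0 * P = e / 4" using e P by (auto simp: e0_def divide_simps) (simp add: algebra_simps)
  define H where "H = (\<integral>l. ln (h l) \<partial>U)"
  define m where "m = (\<integral>l. ln (G l) \<partial>U)"
  define I where "I = (\<integral>l. G l / h l \<partial>U)"
  have I: "I + P / \<theta> = 1" "I \<ge> 0"
    using waterfilling_identity G0 \<theta> unfolding I_def h_def
    by (auto intro!: integral_nonneg_AE AE_I2 divide_nonneg_nonneg simp: max_def)
  have cap: "cap = 1 / 2 * (H - m)" by (simp add: cap_def H_def m_def h_def)
  obtain a s where a: "coeff a 0 = 1" "\<And>l. l \<in> {0..pi} \<Longrightarrow> exp s * (cmod (ev a l))\<^sup>2 \<le> 1 / \<theta> + e0"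
    "exp s * (\<integral>l. (cmod (ev a l))\<^sup>2 * G l \<partial>U) \<le> I + e0" "- s \<le> H + e0"
    by (rule whitening_poly[OF h \<theta> Gi G0 e0(1)], rule that) (assumption | simp only: I_def H_def)+
  define \<kappa> where "\<kappa> = 1 / \<theta> + e0"
  define \<kappa>0 where "\<kappa>0 = \<kappa> * exp (- s)"
  have "\<kappa> > 0" unfolding \<kappa>_def using \<theta> e0(1) by (intro add_pos_pos) auto
  then have \<kappa>: "\<kappa> > 0" "\<kappa>0 > 0" "exp s * \<kappa>0 = \<kappa>" by (auto simp: \<kappa>0_def exp_minus)
  have ev\<kappa>: "(cmod (ev a l))\<^sup>2 \<le> \<kappa>0" if "l \<in> {0..pi}" for l
    using a(2)[OF that] unfolding \<kappa>0_def \<kappa>_def by (simp add: exp_minus field_simps)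
  define form where "form k = (\<integral>l. (cmod (ev (polyn (Suc k) (coeff a)) l))\<^sup>2 * G l \<partial>U)" for k
  define \<tau> where "\<tau> = (\<integral>l. (cmod (ev a l))\<^sup>2 * G l \<partial>U)"
  have form0: "form k \<ge> 0" for k unfolding form_def by (rule integral_nonneg_AE) (use G0 in auto)
  have \<tau>0: "\<tau> \<ge> 0" unfolding \<tau>_def by (rule integral_nonneg_AE) (use G0 in auto)
  define d where "d = degree a"
  have form_ge: "form k = \<tau>" if "d \<le> k" for k using that by (simp add: form_def \<tau>_def polyn_coeff d_def)
  \<comment> \<open>The first d rows of A contain only truncations of \<open>a\<close>, whose forms
    may differ from the full one; their total contribution is a constant independent of n.\<close>
  define D where "D = exp s * (\<Sum>k<d. form k)"
  have D0: "D \<ge> 0" unfolding D_def by (intro mult_nonneg_nonneg sum_nonneg form0) auto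
  define T where "T = I + e0 + D"
  have T0: "T \<ge> 0" using I e0 D0 by (simp add: T_def)
  define \<eta> where "\<eta> = e / 6"
  have \<eta>: "\<eta> > 0" using e by (simp add: \<eta>_def)
  \<comment> \<open>Collects the constants of the Chebyshev bounds for \<open>E2\<close> and
    \<open>E3\<close>, so that one choice of \<open>\<delta>\<close> makes each at most e/3.\<close>
  define Z where "Z = 2 * \<kappa> * T + 4 * \<kappa>\<^sup>2 * P + 1"
  have Z: "Z > 0" "2 * \<kappa> * T \<le> Z" "4 * \<kappa>\<^sup>2 * P \<le> Z"
    using \<kappa> T0 P by (auto simp: Z_def intro!: add_nonneg_pos add_nonneg_nonneg)
  define \<delta> where "\<delta> = e * \<eta>\<^sup>2 / (3 * Z)"
  have \<delta>: "\<delta> > 0" "\<delta> * Z / \<eta>\<^sup>2 = e / 3" using e \<eta> Z by (auto simp: \<delta>_def)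
  obtain N1 where N1: "\<And>n L M c. n \<ge> N1 \<Longrightarrow> chol n (cv G) L M \<Longrightarrow> (\<Sum>j<n. (\<Sum>i<n. c i * L i j)\<^sup>2) \<le> \<delta> * real n * (\<Sum>i<n. (c i)\<^sup>2)"
    using chol_norm_small[OF G \<delta>(1)] by blast
  obtain N2 :: nat where N2: "6 / (e * \<eta>\<^sup>2) \<le> real N2" using real_arch_simple by blast
  obtain N3 :: nat where N3: "4 * D / e \<le> real N3" using real_arch_simple by blast
  show ?thesis
  proof (intro exI[of _ "Suc (N1 + N2 + N3)"] allI impI)
    fix n assume n: "Suc (N1 + N2 + N3) \<le> n"
    define R where "R = real n"
    have R: "R \<ge> 1" "6 / (e * \<eta>\<^sup>2) \<le> R" "4 * D / e \<le> R" using n N2 N3 by (auto simp: R_def)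
    have R0: "R > 0" using R by linarith
    obtain L M where C: "chol n (cv G) L M" using chol_ex by blast
    have dL: "\<And>i. i < n \<Longrightarrow> 0 < L i i" "\<And>i. i < n \<Longrightarrow> M i i = 1 / L i i" using C by (auto simp: chol_def)
    define A where "A k i = convm a k i" for k i
    define M' where "M' k i = exp (s / 2) * A k i" for k i
    have M'up: "M' i j = 0" if "i < j" for i j using that by (simp add: M'_def A_def convm_def)
    have M'dg: "0 < M' i i" "ln (M' i i) = s / 2" for i by (simp_all add: M'_def A_def convm_def a)
    define q where "q = gd n M'"
    define B where "B k j = (\<Sum>i<n. A k i * L i j)" for k j
    define SL where "SL = (\<Sum>i<n. ln (L i i))"
    define TB where "TB = (\<Sum>k<n. \<Sum>j<n. (B k j)\<^sup>2)"
    have An: "(\<Sum>k<n. (\<Sum>i<n. A k i * x i)\<^sup>2) \<le> \<kappa>0 * (\<Sum>i<n. (x i)\<^sup>2)" for x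
      unfolding A_def by (rule convm_norm[OF ev\<kappa>])
    define \<beta> where "\<beta> = \<delta> * R * \<kappa>0"
    have \<beta>: "(\<Sum>j<n. (\<Sum>k<n. c k * B k j)\<^sup>2) \<le> \<beta> * (\<Sum>k<n. (c k)\<^sup>2)" for c
    proof -
      have "(\<Sum>k<n. c k * B k j) = (\<Sum>i<n. (\<Sum>k<n. c k * A k i) * L i j)" for j
        unfolding B_def by (rule sum_mat_assoc[symmetric])
      then have "(\<Sum>j<n. (\<Sum>k<n. c k * B k j)\<^sup>2) \<le> \<delta> * R * (\<Sum>i<n. (\<Sum>k<n. c k * A k i)\<^sup>2)"
        using N1[OF _ C] n by (simp add: R_def)
      also have "\<dots> \<le> \<delta> * R * (\<kappa>0 * (\<Sum>k<n. (c k)\<^sup>2))"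
        using \<delta> R0 \<kappa> by (intro mult_left_mono transpose_norm An) auto
      finally show ?thesis by (simp add: \<beta>_def mult.assoc)
    qed
    have TB: "exp s * TB \<le> R * (I + e0) + D" "TB \<ge> 0"
    proof -
      show "TB \<ge> 0" unfolding TB_def by (intro sum_nonneg) auto
      have "TB = (\<Sum>k<n. form k)"
        unfolding TB_def B_def
      proof (intro sum.cong refl)
        fix k assume "k \<in> {..<n}"
        then show "(\<Sum>j<n. (\<Sum>i<n. A k i * L i j)\<^sup>2) = form k"
          unfolding form_def A_def by (subst chol_form[OF C]) (auto intro: convm_form[OF Gi])
      qed
      also have "\<dots> \<le> (\<Sum>k<n. \<tau> + (if k < d then form k else 0))"
        by (intro sum_mono) (use \<tau>0 form_ge in \<open>auto simp: not_less\<close>)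
      also have "\<dots> = R * \<tau> + (\<Sum>k\<in>{..<n} \<inter> {..<d}. form k)"
        by (simp only: sum.distrib) (subst sum.inter_restrict, auto simp: R_def)
      also have "(\<Sum>k\<in>{..<n} \<inter> {..<d}. form k) \<le> (\<Sum>k<d. form k)"
        by (intro sum_mono2) (use form0 in auto)
      finally have "TB \<le> R * \<tau> + (\<Sum>k<d. form k)" by simp
      then have "exp s * TB \<le> exp s * (R * \<tau> + (\<Sum>k<d. form k))" by (intro mult_left_mono) auto
      also have "\<dots> = R * (exp s * \<tau>) + D" by (simp add: D_def algebra_simps)
      also have "\<dots> \<le> R * (I + e0) + D" using a(3) R0 by (auto simp: \<tau>_def intro!: mult_left_mono)
      finally show "exp s * TB \<le> R * (I + e0) + D" .
    qed
    have TBT: "exp s * TB \<le> R * T"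
    proof -
      have "1 * D \<le> R * D" using R D0 by (intro mult_right_mono) auto
      then show ?thesis using TB by (simp add: T_def algebra_simps)
    qed
    have q: "q \<in> borel_measurable (Rn n)" "\<And>y. 0 \<le> q y" "(\<integral>\<^sup>+y. ennreal (q y) \<partial>Rn n) = 1"
      unfolding q_def by (auto intro: gd_nonneg gd_total M'up M'dg)
    note q(1)[measurable]
    have "measure (W \<gamma> n x) {y \<in> space (Rn n). exp (R * (cap + e)) * q y < gdens \<gamma> n (\<lambda>i. y i - x i)} \<le> e"
      if x: "x \<in> costset n P" for x
    proof -
      have xP: "(\<Sum>i<n. (x i)\<^sup>2) \<le> R * P" using x R0 by (simp add: costset_def R_def divide_le_eq mult.commute)
      define ax where "ax k = (\<Sum>i<n. A k i * x i)" for k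
      define AX where "AX = (\<Sum>k<n. (ax k)\<^sup>2)"
      have AX: "AX \<le> \<kappa>0 * (R * P)" "AX \<ge> 0"
      proof -
        have "AX \<le> \<kappa>0 * (\<Sum>i<n. (x i)\<^sup>2)" unfolding AX_def ax_def by (rule An)
        also have "\<dots> \<le> \<kappa>0 * (R * P)" using xP \<kappa> by (intro mult_left_mono) auto
        finally show "AX \<le> \<kappa>0 * (R * P)" .
        show "AX \<ge> 0" unfolding AX_def by (rule sum_nonneg) auto
      qed
      define t where "t = R * \<eta> * exp (- s)"
      have t: "t > 0" "exp s * t = R * \<eta>" using R0 \<eta> by (auto simp: t_def exp_minus)
      \<comment> \<open>Exceptional events for the white noise: its energy, the filtered energy, and
        the interaction of the filtered noise with the input. Only the third depends on
        \<open>x\<close>, and its bound uses nothing but the energy of \<open>x\<close>.\<close>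
      define E1 where "E1 = {u \<in> space (Rn n). R * \<eta> \<le> \<bar>(\<Sum>k<n. (u k)\<^sup>2) - real n\<bar>}"
      define E2 where "E2 = {u \<in> space (Rn n). t \<le> \<bar>(\<Sum>k<n. (\<Sum>j<n. B k j * u j)\<^sup>2) - TB\<bar>}"
      define E3 where "E3 = {u \<in> space (Rn n). t / 2 \<le> \<bar>\<Sum>k<n. ax k * (\<Sum>j<n. B k j * u j)\<bar>}"
      have Em[measurable]: "E1 \<in> sets (stdg n)" "E2 \<in> sets (stdg n)" "E3 \<in> sets (stdg n)"
        unfolding E1_def E2_def E3_def by (simp_all, measurable)
      have P1: "measure (stdg n) E1 \<le> e / 3"
      proof -
        have "measure (stdg n) E1 \<le> 2 * R / (R * \<eta>)\<^sup>2"
          unfolding E1_def R_def by (rule stdg_norm_deviation) (use R0 \<eta> in \<open>auto simp: R_def\<close>)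
        also have "\<dots> = 2 / (R * \<eta>\<^sup>2)" using R0 by (simp add: power2_eq_square)
        also have "\<dots> \<le> e / 3" using R(2) R0 e \<eta> by (simp add: field_simps)
        finally show ?thesis .
      qed
      have P2: "measure (stdg n) E2 \<le> e / 3"
      proof -
        have "measure (stdg n) E2 \<le> 2 * \<beta> * TB / t\<^sup>2"
          unfolding E2_def TB_def by (rule stdg_gram_deviation(1)[OF \<beta> t(1)])
        also have "\<dots> = 2 * \<delta> * \<kappa> * (exp s * TB) / (R * \<eta>\<^sup>2)"
          using R0 \<eta> by (simp add: \<beta>_def \<kappa>0_def t_def exp_minus power2_eq_square field_simps)
        also have "\<dots> \<le> 2 * \<delta> * \<kappa> * (R * T) / (R * \<eta>\<^sup>2)"
          using TBT \<delta> \<kappa> R0 \<eta> by (intro divide_right_mono mult_left_mono) auto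
        also have "\<dots> = \<delta> * (2 * \<kappa> * T) / \<eta>\<^sup>2" using R0 by simp
        also have "\<dots> \<le> \<delta> * Z / \<eta>\<^sup>2" using Z \<delta> by (intro divide_right_mono mult_left_mono) auto
        finally show ?thesis using \<delta> by simp
      qed
      have P3: "measure (stdg n) E3 \<le> e / 3"
      proof -
        have "measure (stdg n) E3 \<le> \<beta> * AX / (t / 2)\<^sup>2"
          unfolding E3_def AX_def by (rule stdg_gram_deviation(2)[OF \<beta>]) (use t in auto)
        also have "\<dots> \<le> \<beta> * (\<kappa>0 * (R * P)) / (t / 2)\<^sup>2"
          using AX \<delta> \<kappa> R0 by (intro divide_right_mono mult_left_mono) (auto simp: \<beta>_def)
        also have "\<dots> = \<delta> * (4 * \<kappa>\<^sup>2 * P) / \<eta>\<^sup>2"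
          using R0 \<eta> by (simp add: \<beta>_def \<kappa>0_def t_def exp_minus power2_eq_square field_simps)
        also have "\<dots> \<le> \<delta> * Z / \<eta>\<^sup>2" using Z \<delta> by (intro divide_right_mono mult_left_mono) auto
        finally show ?thesis using \<delta> by simp
      qed
      let ?E = "{y \<in> space (Rn n). exp (R * (cap + e)) * q y < gdens \<gamma> n (\<lambda>i. y i - x i)}"
      have Esets: "?E \<in> sets (Rn n)" unfolding gdens_eq[OF C] by measurable
      have sub: "{u \<in> space (Rn n). aff n L x u \<in> ?E} \<subseteq> E1 \<union> E2 \<union> E3"
      proof (rule subsetI, rule ccontr)
        fix u assume u: "u \<in> {u \<in> space (Rn n). aff n L x u \<in> ?E}" and nE: "u \<notin> E1 \<union> E2 \<union> E3"
        define y where "y = aff n L x u"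
        define u2 where "u2 = (\<Sum>k<n. (u k)\<^sup>2)"
        define bu where "bu k = (\<Sum>j<n. B k j * u j)" for k
        define BU where "BU = (\<Sum>k<n. (bu k)\<^sup>2)"
        define cr where "cr = (\<Sum>k<n. ax k * bu k)"
        have sp: "u \<in> space (Rn n)" using u by simp
        have b1: "u2 \<ge> R - R * \<eta>" using nE sp by (auto simp: E1_def u2_def R_def)
        have b2: "BU \<le> TB + t" using nE sp by (auto simp: E2_def BU_def bu_def)
        have b3: "cr \<le> t / 2" using nE sp by (auto simp: E3_def cr_def bu_def)
        have w: "gdens \<gamma> n (\<lambda>i. y i - x i) = exp (- SL - 1/2 * u2) / sqrt ((2 * pi) ^ n)"
          unfolding gdens_eq[OF C] gd_exp_chol[OF C] SL_def u2_def y_def by (simp add: chol_whiten[OF C])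
        have Ay: "(\<Sum>j<n. M' k j * y j) = exp (s / 2) * (ax k + bu k)" for k
        proof -
          have "(\<Sum>j<n. M' k j * y j) = exp (s / 2) * (\<Sum>i<n. A k i * (x i + (\<Sum>j<n. L i j * u j)))"
            unfolding M'_def y_def sum_distrib_left by (intro sum.cong) (auto simp: aff_def)
          also have "(\<Sum>i<n. A k i * (x i + (\<Sum>j<n. L i j * u j))) = ax k + (\<Sum>i<n. A k i * (\<Sum>j<n. L i j * u j))"
            by (simp add: ax_def distrib_left sum.distrib)
          also have "(\<Sum>i<n. A k i * (\<Sum>j<n. L i j * u j)) = bu k"
            unfolding bu_def B_def by (rule sum_mat_assoc[symmetric])
          finally show ?thesis .
        qed
        have "(\<Sum>k<n. (\<Sum>j<n. M' k j * y j)\<^sup>2) = exp s * (AX + 2 * cr + BU)"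
        proof -
          have ex: "exp (s / 2) * exp (s / 2) = exp s" by (simp flip: exp_add)
          have "(exp (s / 2) * (ax k + bu k))\<^sup>2 = exp s * ((ax k)\<^sup>2 + 2 * (ax k * bu k) + (bu k)\<^sup>2)" for k
            unfolding ex[symmetric] by (simp add: power2_eq_square algebra_simps)
          then show ?thesis
            unfolding Ay AX_def cr_def BU_def by (simp add: sum_distrib_left sum.distrib distrib_left)
        qed
        then have qy: "q y = exp (R * (s / 2) - 1/2 * (exp s * (AX + 2 * cr + BU))) / sqrt ((2 * pi) ^ n)"
          unfolding q_def using gd_exp[of n M' y] M'dg by (simp add: R_def)
        have lt: "exp (R * (cap + e)) * q y < gdens \<gamma> n (\<lambda>i. y i - x i)" using u by (simp add: y_def)
        have sq: "sqrt ((2 * pi) ^ n) > 0" by simp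
        have lt': "exp (R * (cap + e)) * exp (R * (s / 2) - 1/2 * (exp s * (AX + 2 * cr + BU))) < exp (- SL - 1/2 * u2)"
          using lt sq unfolding w qy by (simp add: divide_less_cancel)
        \<comment> \<open>All estimates are linear in products with R, so they are abstracted to
          plain reals; the leading terms cancel and the errors sum to less than R e.\<close>
        have arith: False
          if "Rce + (Rs2 - 1/2 * X) < - S - 1/2 * v" "X \<le> RP + Rp + Rh + (RI + Rd + D' + Rh)" "Rm \<le> 2 * S"
            "RI + RP = r" "- Rs \<le> RH + Rd" "Rc = 1 / 2 * (RH - Rm)" "2 * Rd + Rp = Re / 4" "Rh = Re / 6"
            "4 * D' \<le> Re" "Re > 0" "Rce = Rc + Re" "Rs2 = Rs / 2" "r - Rh \<le> v"
          for Rce Rs2 X S v RP Rp Rh RI Rd D' Rm r Rs RH Rc Re :: real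
          using that by argo
        from lt' have "R * (cap + e) + (R * (s / 2) - 1/2 * (exp s * (AX + 2 * cr + BU))) < - SL - 1/2 * u2"
          by (simp only: exp_add[symmetric] exp_less_cancel_iff)
        moreover have "exp s * (AX + 2 * cr + BU) \<le> R * (P / \<theta>) + R * (e0 * P) + R * \<eta> + (R * I + R * e0 + D + R * \<eta>)"
        proof -
          have "exp s * AX \<le> exp s * (\<kappa>0 * (R * P))" using AX by (intro mult_left_mono) auto
          also have "\<dots> = R * (P / \<theta>) + R * (e0 * P)" using \<kappa>(3) by (simp add: mult.assoc[symmetric]) (simp add: \<kappa>_def algebra_simps)
          finally have 1: "exp s * AX \<le> R * (P / \<theta>) + R * (e0 * P)" .
          have "exp s * (2 * cr) \<le> exp s * t" using b3 by (intro mult_left_mono) auto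
          then have 2: "exp s * (2 * cr) \<le> R * \<eta>" using t by simp
          have "exp s * BU \<le> exp s * (TB + t)" using b2 by (intro mult_left_mono) auto
          then have 3: "exp s * BU \<le> R * I + R * e0 + D + R * \<eta>" using t TB by (simp add: distrib_left)
          show ?thesis using 1 2 3 by (simp add: distrib_left)
        qed
        moreover have "R * m \<le> 2 * SL" unfolding R_def m_def SL_def by (rule chol_lndet_lower[OF G C])
        moreover have "R * I + R * (P / \<theta>) = R" using I(1) by (metis distrib_left mult.right_neutral)
        moreover have "- (R * s) \<le> R * H + R * e0" using mult_left_mono[OF a(4), of R] R0 by (simp add: distrib_left)
        moreover have "R * cap = 1 / 2 * (R * H - R * m)" by (simp add: cap right_diff_distrib)
        moreover have "2 * (R * e0) + R * (e0 * P) = R * e / 4"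
        proof -
          have "R * (2 * e0 + e0 * P) = R * (e / 4)" using e0(2) by simp
          then show ?thesis by (simp add: distrib_left mult.left_commute)
        qed
        moreover have "R * \<eta> = R * e / 6" by (simp add: \<eta>_def)
        moreover have "4 * D \<le> R * e" using R(3) e by (simp add: pos_divide_le_eq)
        moreover have "R * e > 0" using R0 e by simp
        moreover have "R * (cap + e) = R * cap + R * e" by (simp add: distrib_left)
        moreover have "R * (s / 2) = R * s / 2" by simp
        moreover note b1
        ultimately show False by (rule arith)
      qed
      have "measure (W \<gamma> n x) ?E = measure (stdg n) {u \<in> space (Rn n). aff n L x u \<in> ?E}"
        by (rule measure_W[OF C Esets])
      also have "\<dots> \<le> measure (stdg n) (E1 \<union> E2 \<union> E3)"
        by (rule stdg.finite_measure_mono[OF sub]) measurable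
      also have "\<dots> \<le> measure (stdg n) E1 + measure (stdg n) E2 + measure (stdg n) E3"
        using measure_Un_le[of "E1 \<union> E2" "stdg n" E3] measure_Un_le[of E1 "stdg n" E2] Em by simp
      finally show ?thesis using P1 P2 P3 by linarith
    qed
    then show "\<exists>q. q \<in> borel_measurable (Rn n) \<and> (\<forall>y. 0 \<le> q y) \<and> (\<integral>\<^sup>+y. ennreal (q y) \<partial>Rn n) = 1 \<and>
      (\<forall>x\<in>costset n P. measure (W \<gamma> n x)
        {y \<in> space (Rn n). exp (real n * (cap + e)) * q y < gdens \<gamma> n (\<lambda>i. y i - x i)} \<le> e)"
      using q by (intro exI[of _ q]) (auto simp: R_def)
  qed
qed

end

section \<open>Convolution of Gaussian densities\<close>

lemma sigma_finite_Rn: "sigma_finite_measure (Rn n)"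
  unfolding Rn_def by (rule lb.sigma_finite) simp

interpretation Rns: sigma_finite_measure "Rn n" for n by (rule sigma_finite_Rn)

interpretation Rnp: pair_sigma_finite "Rn n" "Rn n" for n ..

lemma gd_pair_measurable[measurable]:
  "(\<lambda>p. gd n M (\<lambda>i. snd p i - fst p i)) \<in> borel_measurable (Rn n \<Otimes>\<^sub>M Rn n)"
  unfolding gd_def by measurable

lemma nn_integral_Rn_shift:
  assumes [measurable]: "F \<in> borel_measurable (Rn n)"
  shows "(\<integral>\<^sup>+x. F (\<lambda>i\<in>{..<n}. b i + x i) \<partial>Rn n) = (\<integral>\<^sup>+x. F x \<partial>Rn n)"
proof -
  define I :: "nat \<Rightarrow> nat \<Rightarrow> real" where "I i j = (if i = j then 1 else 0)" for i j
  have "aff n I b x = (\<lambda>i\<in>{..<n}. b i + x i)" for x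
  proof
    fix k
    have "k < n \<Longrightarrow> (\<Sum>j<n. I k j * x j) = x k" unfolding I_def by (rule sum_delta_mult(1))
    then show "aff n I b x k = (\<lambda>i\<in>{..<n}. b i + x i) k" by (simp add: aff_def)
  qed
  moreover have "(\<integral>\<^sup>+z. F (aff n I b z) \<partial>Rn n) * ennreal (\<Prod>i<n. I i i) = (\<integral>\<^sup>+u. F u \<partial>Rn n)"
    by (rule nn_integral_aff) (auto simp: I_def)
  ultimately show ?thesis by (simp add: I_def)
qed

lemma chol_transpose_whiten:
  assumes C: "chol n v L M" and k: "k < n"
  shows "(\<Sum>i<n. L i k * (\<Sum>m<n. M m i * y m)) = y k" "(\<Sum>j<n. M k j * (\<Sum>i<n. v j i * w i)) = (\<Sum>i<n. L i k * w i)"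
proof -
  have "(\<Sum>i<n. (\<Sum>m<n. y m * M m i) * L i k) = (\<Sum>m<n. y m * (\<Sum>i<n. M m i * L i k))"
    by (rule sum_mat_assoc)
  also have "\<dots> = (\<Sum>m<n. y m * (if m = k then 1 else 0))"
    using C k by (intro sum.cong) (auto simp: chol_def)
  also have "\<dots> = y k" by (rule sum_delta_mult(2)[OF k])
  finally show "(\<Sum>i<n. L i k * (\<Sum>m<n. M m i * y m)) = y k" by (simp add: mult.commute)
  have "(\<Sum>i<n. v j i * w i) = (\<Sum>m<n. L j m * (\<Sum>i<n. L i m * w i))" if j: "j < n" for j
  proof -
    have "(\<Sum>i<n. v j i * w i) = (\<Sum>i<n. \<Sum>m<n. L j m * (L i m * w i))"
    proof (intro sum.cong refl)
      fix i assume "i \<in> {..<n}"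
      then have "v j i = (\<Sum>m<n. L j m * L i m)" using C j by (simp add: chol_def)
      then show "v j i * w i = (\<Sum>m<n. L j m * (L i m * w i))" by (simp add: sum_distrib_right mult.assoc)
    qed
    also have "\<dots> = (\<Sum>m<n. \<Sum>i<n. L j m * (L i m * w i))" by (rule sum.swap)
    finally show ?thesis by (simp add: sum_distrib_left)
  qed
  then have "(\<Sum>j<n. M k j * (\<Sum>i<n. v j i * w i)) = (\<Sum>j<n. M k j * (\<Sum>m<n. L j m * (\<Sum>i<n. L i m * w i)))"
    by (intro sum.cong) auto
  also have "\<dots> = (\<Sum>i<n. L i k * w i)" by (rule chol_trans(1)[OF C k k])
  finally show "(\<Sum>j<n. M k j * (\<Sum>i<n. v j i * w i)) = (\<Sum>i<n. L i k * w i)" .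
qed

text \<open>At a point a = v w the cross term with the inverse covariance reduces to the plain
  pairing of w and d. As this pairing is free of \<open>v\<close>, the cross terms for two
  covariances and opposite displacements cancel.\<close>

lemma gauss_square_shift:
  assumes C: "chol n v L M" and a: "\<And>j. j < n \<Longrightarrow> a j = (\<Sum>i<n. v j i * w i)"
  shows "(\<Sum>k<n. (\<Sum>j<n. M k j * (a j + d j))\<^sup>2)
     = (\<Sum>i<n. \<Sum>j<n. w i * w j * v i j) + 2 * (\<Sum>i<n. w i * d i) + (\<Sum>k<n. (\<Sum>j<n. M k j * d j)\<^sup>2)"
proof -
  define p where "p k = (\<Sum>i<n. L i k * w i)" for k
  define D where "D k = (\<Sum>j<n. M k j * d j)" for k
  have "(\<Sum>j<n. M k j * (a j + d j)) = p k + D k" if "k < n" for k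
  proof -
    have "(\<Sum>j<n. M k j * a j) = (\<Sum>j<n. M k j * (\<Sum>i<n. v j i * w i))" by (intro sum.cong) (auto simp: a)
    then show ?thesis using chol_transpose_whiten(2)[OF C that, of w] by (simp add: p_def D_def distrib_left sum.distrib)
  qed
  then have "(\<Sum>k<n. (\<Sum>j<n. M k j * (a j + d j))\<^sup>2) = (\<Sum>k<n. (p k)\<^sup>2 + 2 * (p k * D k) + (D k)\<^sup>2)"
    by (intro sum.cong) (auto simp: power2_eq_square algebra_simps)
  also have "\<dots> = (\<Sum>k<n. (p k)\<^sup>2) + 2 * (\<Sum>k<n. p k * D k) + (\<Sum>k<n. (D k)\<^sup>2)"
    by (simp add: sum.distrib sum_distrib_left)
  also have "(\<Sum>k<n. (p k)\<^sup>2) = (\<Sum>i<n. \<Sum>j<n. w i * w j * v i j)"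
    unfolding chol_form[OF C, symmetric] p_def by (simp add: mult.commute)
  also have "(\<Sum>k<n. p k * D k) = (\<Sum>i<n. w i * d i)"
  proof -
    have "(\<Sum>k<n. p k * D k) = (\<Sum>k<n. (\<Sum>i<n. w i * L i k) * D k)" by (simp add: p_def mult.commute)
    also have "\<dots> = (\<Sum>i<n. w i * (\<Sum>k<n. L i k * D k))" by (rule sum_mat_assoc)
    also have "\<dots> = (\<Sum>i<n. w i * d i)"
      unfolding D_def using chol_trans(2)[OF C] by (intro sum.cong) auto
    finally show ?thesis .
  qed
  finally show ?thesis by (simp add: D_def)
qed

text \<open>Completing the square shows that the convolution is a multiple of the Gaussian density with
  the summed covariance; the factor is 1 since both have total mass 1.\<close>

lemma gd_convolution:
  assumes C1: "chol n v1 L1 M1" and C2: "chol n v2 L2 M2" and C: "chol n (\<lambda>i j. v1 i j + v2 i j) L M"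
    and y: "y \<in> space (Rn n)"
  shows "(\<integral>\<^sup>+x. ennreal (gd n M1 x) * ennreal (gd n M2 (\<lambda>i. y i - x i)) \<partial>Rn n) = ennreal (gd n M y)"
proof -
  have dg: "\<And>i. i < n \<Longrightarrow> 0 < M1 i i" "\<And>i. i < n \<Longrightarrow> 0 < M2 i i" "\<And>i. i < n \<Longrightarrow> 0 < M i i"
    and up: "\<And>i j. i < j \<Longrightarrow> M1 i j = 0" "\<And>i j. i < j \<Longrightarrow> M i j = 0"
    using C1 C2 C by (auto simp: chol_def)
  define S where "S L = (\<Sum>i<n. ln (L i i))" for L :: "nat \<Rightarrow> nat \<Rightarrow> real"
  define r where "r = sqrt ((2 * pi) ^ n)"
  define E where "E d = exp (- (1/2) * ((\<Sum>k<n. (\<Sum>j<n. M1 k j * d j)\<^sup>2) + (\<Sum>k<n. (\<Sum>j<n. M2 k j * d j)\<^sup>2)))" for d :: "nat \<Rightarrow> real"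
  have Em[measurable]: "E \<in> borel_measurable (Rn n)" unfolding E_def by measurable
  define c where "c = exp (S L - S L1 - S L2) / r"
  have c0: "c > 0" by (simp add: c_def r_def)
  have r0: "r > 0" by (simp add: r_def)
  define \<kappa> where "\<kappa> = ennreal c * (\<integral>\<^sup>+d. ennreal (E d) \<partial>Rn n)"
  have main: "(\<integral>\<^sup>+x. ennreal (gd n M1 x) * ennreal (gd n M2 (\<lambda>i. y i - x i)) \<partial>Rn n) = ennreal (gd n M y) * \<kappa>" for y
  proof -
    \<comment> \<open>\<open>w\<close> will be the inverse of the summed covariance applied to
      \<open>y\<close>; then y = a + b with a = v1 w and b = v2 w, and \<open>a\<close> is the
      conditional mean of the input given the output \<open>y\<close>.\<close>
    define u where "u m = (\<Sum>j<n. M m j * y j)" for m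
    define w where "w i = (\<Sum>m<n. M m i * u m)" for i
    define a where "a j = (\<Sum>i<n. v1 j i * w i)" for j
    define b where "b j = (\<Sum>i<n. v2 j i * w i)" for j
    have Lw: "(\<Sum>i<n. L i k * w i) = u k" if "k < n" for k
      unfolding w_def by (rule chol_transpose_whiten(1)[OF C that])
    have ab: "a j + b j = y j" if j: "j < n" for j
    proof -
      have "(\<Sum>m<n. L j m * (\<Sum>k<n. M m k * (\<Sum>i<n. (v1 k i + v2 k i) * w i))) = (\<Sum>i<n. (v1 j i + v2 j i) * w i)"
        by (rule chol_trans(2)[OF C j j])
      moreover have "(\<Sum>m<n. L j m * (\<Sum>k<n. M m k * (\<Sum>i<n. (v1 k i + v2 k i) * w i))) = (\<Sum>m<n. L j m * u m)"
        using chol_transpose_whiten(2)[OF C] Lw by (intro sum.cong) auto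
      moreover have "(\<Sum>m<n. L j m * u m) = y j" unfolding u_def by (rule chol_trans(2)[OF C j j])
      ultimately show ?thesis by (simp add: a_def b_def distrib_right sum.distrib)
    qed
    have wvw: "(\<Sum>i<n. \<Sum>j<n. w i * w j * v1 i j) + (\<Sum>i<n. \<Sum>j<n. w i * w j * v2 i j) = (\<Sum>k<n. (u k)\<^sup>2)"
    proof -
      have "(\<Sum>k<n. (u k)\<^sup>2) = (\<Sum>k<n. (\<Sum>i<n. w i * L i k)\<^sup>2)"
        by (intro sum.cong) (auto simp: Lw[symmetric] mult.commute)
      also have "\<dots> = (\<Sum>i<n. \<Sum>j<n. w i * w j * (v1 i j + v2 i j))" by (rule chol_form[OF C])
      finally show ?thesis by (simp add: distrib_left sum.distrib)
    qed
    have pw: "gd n M1 (\<lambda>i\<in>{..<n}. a i + d i) * gd n M2 (\<lambda>i. y i - (\<lambda>i\<in>{..<n}. a i + d i) i) = gd n M y * (c * E d)" for d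
    proof -
      have s1: "(\<Sum>k<n. (\<Sum>j<n. M1 k j * (\<lambda>i\<in>{..<n}. a i + d i) j)\<^sup>2) = (\<Sum>k<n. (\<Sum>j<n. M1 k j * (a j + d j))\<^sup>2)"
        by simp
      have s2: "(\<Sum>k<n. (\<Sum>j<n. M2 k j * (y j - (\<lambda>i\<in>{..<n}. a i + d i) j))\<^sup>2) = (\<Sum>k<n. (\<Sum>j<n. M2 k j * (b j + - d j))\<^sup>2)"
        by (intro sum.cong arg_cong[where f="\<lambda>x. x\<^sup>2"] arg_cong2[where f="(*)"] refl) (auto simp: ab[symmetric])
      have neg: "(\<Sum>k<n. (\<Sum>j<n. M2 k j * - d j)\<^sup>2) = (\<Sum>k<n. (\<Sum>j<n. M2 k j * d j)\<^sup>2)"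
        by (simp add: sum_negf)
      define A where "A = (\<Sum>k<n. (\<Sum>j<n. M1 k j * d j)\<^sup>2)"
      define B where "B = (\<Sum>k<n. (\<Sum>j<n. M2 k j * d j)\<^sup>2)"
      define V where "V = (\<Sum>k<n. (u k)\<^sup>2)"
      define w1 where "w1 = (\<Sum>i<n. \<Sum>j<n. w i * w j * v1 i j)"
      define w2 where "w2 = (\<Sum>i<n. \<Sum>j<n. w i * w j * v2 i j)"
      define D where "D = (\<Sum>i<n. w i * d i)"
      have 1: "gd n M1 (\<lambda>i\<in>{..<n}. a i + d i) = exp (- S L1 - 1/2 * (w1 + 2 * D + A)) / r"
        unfolding gd_exp_chol[OF C1] s1 gauss_square_shift[OF C1 a_def] S_def r_def w1_def D_def A_def ..
      have 2: "gd n M2 (\<lambda>i. y i - (\<lambda>i\<in>{..<n}. a i + d i) i) = exp (- S L2 - 1/2 * (w2 - 2 * D + B)) / r"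
        unfolding gd_exp_chol[OF C2] s2 gauss_square_shift[OF C2 b_def] neg S_def r_def w2_def D_def B_def
        by (simp add: sum_negf)
      have 3: "gd n M y = exp (- S L - 1/2 * (w1 + w2)) / r"
        unfolding gd_exp_chol[OF C] S_def r_def w1_def w2_def wvw u_def ..
      have 4: "E d = exp (- (1/2) * (A + B))" by (simp add: E_def A_def B_def)
      have ex: "exp x * exp y = exp z * exp t" if "x + y = z + t" for x y z t :: real
        using that by (simp flip: exp_add)
      have "exp (- S L1 - 1/2 * (w1 + 2 * D + A)) * exp (- S L2 - 1/2 * (w2 - 2 * D + B))
        = exp (- S L - 1/2 * (w1 + w2)) * exp ((S L - S L1 - S L2) + - (1/2) * (A + B))"
        by (rule ex) (simp add: algebra_simps add_divide_distrib)
      then show ?thesis unfolding 1 2 3 4 c_def exp_add by simp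
    qed
    have nn: "0 \<le> gd n M1 z" "0 \<le> gd n M2 z" "0 \<le> gd n M z" for z by (intro gd_nonneg dg; assumption)+
    have "(\<integral>\<^sup>+x. ennreal (gd n M1 x) * ennreal (gd n M2 (\<lambda>i. y i - x i)) \<partial>Rn n)
      = (\<integral>\<^sup>+d. ennreal (gd n M1 (\<lambda>i\<in>{..<n}. a i + d i)) * ennreal (gd n M2 (\<lambda>i. y i - (\<lambda>i\<in>{..<n}. a i + d i) i)) \<partial>Rn n)"
    proof (rule nn_integral_Rn_shift[of "\<lambda>x. ennreal (gd n M1 x) * ennreal (gd n M2 (\<lambda>i. y i - x i))", symmetric])
      have "(\<lambda>x. gd n M2 (\<lambda>i. y i - x i)) \<in> borel_measurable (Rn n)" unfolding gd_def by measurable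
      then show "(\<lambda>x. ennreal (gd n M1 x) * ennreal (gd n M2 (\<lambda>i. y i - x i))) \<in> borel_measurable (Rn n)" by measurable
    qed
    also have "\<dots> = (\<integral>\<^sup>+d. ennreal (gd n M y) * ennreal c * ennreal (E d) \<partial>Rn n)"
    proof (rule nn_integral_cong)
      fix d
      have "ennreal (gd n M1 (\<lambda>i\<in>{..<n}. a i + d i)) * ennreal (gd n M2 (\<lambda>i. y i - (\<lambda>i\<in>{..<n}. a i + d i) i))
        = ennreal (gd n M y * (c * E d))"
        unfolding pw[symmetric] by (rule ennreal_mult[symmetric]) (rule nn)+
      also have "\<dots> = ennreal (gd n M y) * (ennreal c * ennreal (E d))"
        using c0 nn(3)[of y] by (simp add: ennreal_mult E_def)
      finally show "ennreal (gd n M1 (\<lambda>i\<in>{..<n}. a i + d i)) * ennreal (gd n M2 (\<lambda>i. y i - (\<lambda>i\<in>{..<n}. a i + d i) i))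
        = ennreal (gd n M y) * ennreal c * ennreal (E d)" by (simp add: mult.assoc)
    qed
    also have "\<dots> = ennreal (gd n M y) * \<kappa>"
      by (subst nn_integral_cmult) (auto simp: \<kappa>_def mult.assoc)
    finally show ?thesis .
  qed
  \<comment> \<open>Integrating \<open>main\<close> over y and exchanging the integrals: all
    Gaussian factors have mass 1, so \<kappa> = 1.\<close>
  have "\<kappa> = (\<integral>\<^sup>+y. ennreal (gd n M y) \<partial>Rn n) * \<kappa>" using gd_total[of M n, OF up(2) dg(3)] by simp
  also have "\<dots> = (\<integral>\<^sup>+y. ennreal (gd n M y) * \<kappa> \<partial>Rn n)" by (rule nn_integral_multc[symmetric]) measurable
  also have "\<dots> = (\<integral>\<^sup>+y. \<integral>\<^sup>+x. ennreal (gd n M1 x) * ennreal (gd n M2 (\<lambda>i. y i - x i)) \<partial>Rn n \<partial>Rn n)"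
    by (simp only: main)
  also have "\<dots> = (\<integral>\<^sup>+x. \<integral>\<^sup>+y. ennreal (gd n M1 x) * ennreal (gd n M2 (\<lambda>i. y i - x i)) \<partial>Rn n \<partial>Rn n)"
    by (rule Rnp.Fubini') (simp add: case_prod_beta', measurable)
  also have "\<dots> = (\<integral>\<^sup>+x. ennreal (gd n M1 x) \<partial>Rn n)"
  proof (rule nn_integral_cong)
    fix x
    have "(\<integral>\<^sup>+y. ennreal (gd n M1 x) * ennreal (gd n M2 (\<lambda>i. y i - x i)) \<partial>Rn n)
      = ennreal (gd n M1 x) * (\<integral>\<^sup>+y. ennreal (gd n M2 (\<lambda>i. y i - x i)) * 1 \<partial>Rn n)"
      by (subst nn_integral_cmult) auto
    also have "(\<integral>\<^sup>+y. ennreal (gd n M2 (\<lambda>i. y i - x i)) * 1 \<partial>Rn n) = (\<integral>\<^sup>+u. 1 \<partial>stdg n)"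
      by (rule nn_integral_gd[OF C2]) auto
    also have "\<dots> = 1" using stdg.emeasure_space_1[of n] by simp
    finally show "(\<integral>\<^sup>+y. ennreal (gd n M1 x) * ennreal (gd n M2 (\<lambda>i. y i - x i)) \<partial>Rn n) = ennreal (gd n M1 x)" by simp
  qed
  also have "\<dots> = 1" by (rule gd_total[of M1 n, OF up(1) dg(1)])
  finally show ?thesis using main by simp
qed

section \<open>Output laws and Feinstein's lemma\<close>

context anwgn
begin

lemma gdens_pair_measurable[measurable]:
  "(\<lambda>p. gdens \<gamma> n (\<lambda>i. snd p i - fst p i)) \<in> borel_measurable (Rn n \<Otimes>\<^sub>M Rn n)"
proof -
  obtain L M where "chol n (cv G) L M" using chol_ex by blast
  then show ?thesis by (simp only: gdens_eq gd_pair_measurable)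
qed

lemma gdens_measurable[measurable]: "(\<lambda>y. gdens \<gamma> n (\<lambda>i. y i - x i)) \<in> borel_measurable (Rn n)"
proof -
  obtain L M where "chol n (cv G) L M" using chol_ex by blast
  then show ?thesis by (simp only: gdens_eq gd_shift_measurable)
qed

lemma gdens_nonneg: "0 \<le> gdens \<gamma> n z"
proof -
  obtain L M where C: "chol n (cv G) L M" using chol_ex by blast
  then show ?thesis by (simp only: gdens_eq) (rule gd_nonneg, simp add: chol_def)
qed

lemma emeasure_W: "A \<in> sets (Rn n) \<Longrightarrow>
  emeasure (W \<gamma> n x) A = (\<integral>\<^sup>+y. ennreal (gdens \<gamma> n (\<lambda>i. y i - x i)) * indicator A y \<partial>Rn n)"
  unfolding W_def by (rule emeasure_density) auto

lemma emeasure_W_measurable: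
  assumes A: "A \<in> sets (Rn n \<Otimes>\<^sub>M Rn n)"
  shows "(\<lambda>x. emeasure (W \<gamma> n x) (Pair x -` A)) \<in> borel_measurable (Rn n)"
proof -
  have "(\<lambda>x. \<integral>\<^sup>+y. ennreal (gdens \<gamma> n (\<lambda>i. y i - x i)) * indicator A (x, y) \<partial>Rn n) \<in> borel_measurable (Rn n)"
  proof (rule Rns.borel_measurable_nn_integral)
    have "(\<lambda>p. ennreal (gdens \<gamma> n (\<lambda>i. snd p i - fst p i)) * indicator A p) \<in> borel_measurable (Rn n \<Otimes>\<^sub>M Rn n)"
      using A by measurable
    then show "(\<lambda>(x, y). ennreal (gdens \<gamma> n (\<lambda>i. y i - x i)) * indicator A (x, y)) \<in> borel_measurable (Rn n \<Otimes>\<^sub>M Rn n)"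
      by (simp add: case_prod_beta')
  qed
  also have "(\<lambda>x. \<integral>\<^sup>+y. ennreal (gdens \<gamma> n (\<lambda>i. y i - x i)) * indicator A (x, y) \<partial>Rn n) = (\<lambda>x. emeasure (W \<gamma> n x) (Pair x -` A))"
    using sets_Pair1[OF A] by (intro ext) (subst emeasure_W, auto intro!: nn_integral_cong simp: indicator_def)
  finally show ?thesis .
qed

lemma emeasure_W_measurable':
  assumes A: "A \<in> sets (Rn n)"
  shows "(\<lambda>x. emeasure (W \<gamma> n x) A) \<in> borel_measurable (Rn n)"
proof -
  have "(\<lambda>x. emeasure (W \<gamma> n x) (Pair x -` (space (Rn n) \<times> A))) \<in> borel_measurable (Rn n)"
    by (rule emeasure_W_measurable) (use A in auto)
  moreover have "Pair x -` (space (Rn n) \<times> A) = A" if "x \<in> space (Rn n)" for x using that by auto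
  ultimately show ?thesis by (simp cong: measurable_cong)
qed

lemma output_density:
  assumes Q: "prob_space Q" "sets Q = sets (Rn n)"
    and out: "\<And>y. y \<in> space (Rn n) \<Longrightarrow> (\<integral>\<^sup>+x. ennreal (gdens \<gamma> n (\<lambda>i. y i - x i)) \<partial>Q) = ennreal (q y)"
    and D: "D \<in> sets (Rn n)"
  shows "(\<integral>\<^sup>+x. emeasure (W \<gamma> n x) D \<partial>Q) = (\<integral>\<^sup>+y. ennreal (q y) * indicator D y \<partial>Rn n)"
proof -
  interpret Q: prob_space Q by fact
  note Q(2)[measurable_cong, simp] D[measurable]
  interpret QR: pair_sigma_finite Q "Rn n" ..
  have m: "(\<lambda>p. ennreal (gdens \<gamma> n (\<lambda>i. snd p i - fst p i)) * indicator D (snd p)) \<in> borel_measurable (Q \<Otimes>\<^sub>M Rn n)"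
  proof -
    have "(\<lambda>p. ennreal (gdens \<gamma> n (\<lambda>i. snd p i - fst p i)) * indicator D (snd p)) \<in> borel_measurable (Rn n \<Otimes>\<^sub>M Rn n)"
      by measurable
    also have "borel_measurable (Rn n \<Otimes>\<^sub>M Rn n) = borel_measurable (Q \<Otimes>\<^sub>M Rn n)"
      by (intro measurable_cong_sets sets_pair_measure_cong) auto
    finally show ?thesis .
  qed
  have "(\<integral>\<^sup>+x. emeasure (W \<gamma> n x) D \<partial>Q) = (\<integral>\<^sup>+x. \<integral>\<^sup>+y. ennreal (gdens \<gamma> n (\<lambda>i. y i - x i)) * indicator D y \<partial>Rn n \<partial>Q)"
    using D by (simp add: emeasure_W)
  also have "\<dots> = (\<integral>\<^sup>+y. \<integral>\<^sup>+x. ennreal (gdens \<gamma> n (\<lambda>i. y i - x i)) * indicator D y \<partial>Q \<partial>Rn n)"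
    by (rule QR.Fubini'[symmetric]) (use m in \<open>simp add: case_prod_beta'\<close>)
  also have "\<dots> = (\<integral>\<^sup>+y. ennreal (q y) * indicator D y \<partial>Rn n)"
  proof (rule nn_integral_cong)
    fix y assume y: "y \<in> space (Rn n)"
    have "(\<lambda>x. ennreal (gdens \<gamma> n (\<lambda>i. y i - x i))) \<in> borel_measurable Q"
    proof -
      have "(\<lambda>x. ennreal (gdens \<gamma> n (\<lambda>i. snd (x, y) i - fst (x, y) i))) \<in> borel_measurable (Rn n)"
        using y by measurable
      then show ?thesis by simp
    qed
    then have "(\<integral>\<^sup>+x. ennreal (gdens \<gamma> n (\<lambda>i. y i - x i)) * indicator D y \<partial>Q) = (\<integral>\<^sup>+x. ennreal (gdens \<gamma> n (\<lambda>i. y i - x i)) \<partial>Q) * indicator D y"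
      by (rule nn_integral_multc)
    then show "(\<integral>\<^sup>+x. ennreal (gdens \<gamma> n (\<lambda>i. y i - x i)) * indicator D y \<partial>Q) = ennreal (q y) * indicator D y"
      using out[OF y] by simp
  qed
  finally show ?thesis .
qed

text \<open>Codewords are added greedily. On a decoding set inside \<open>Gd\<close> the output
  density is at most the channel density over a, so each set has output probability at most 1/a and
  m sets together at most m/a. While this is below \<epsilon>/2, averaging over inputs leaves some
  codeword whose section of \<open>Gd\<close> outside the used region still has probability 1 -
  \<epsilon>.\<close>

lemma feinstein:
  assumes Q: "prob_space Q" "sets Q = sets (Rn n)"
    and q: "q \<in> borel_measurable (Rn n)" "\<And>y. 0 \<le> q y"
    and out: "\<And>y. y \<in> space (Rn n) \<Longrightarrow> (\<integral>\<^sup>+x. ennreal (gdens \<gamma> n (\<lambda>i. y i - x i)) \<partial>Q) = ennreal (q y)"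
    and S: "S \<in> sets (Rn n)" and Gd: "Gd \<in> sets (Rn n \<Otimes>\<^sub>M Rn n)" and a: "a > 0"
    and ratio: "\<And>x y. (x, y) \<in> Gd \<Longrightarrow> a * q y \<le> gdens \<gamma> n (\<lambda>i. y i - x i)"
    and \<epsilon>: "0 < \<epsilon>" "\<epsilon> < 1"
    and J: "ennreal (1 - \<epsilon> / 2) \<le> (\<integral>\<^sup>+x. emeasure (W \<gamma> n x) (Pair x -` Gd) * indicator S x \<partial>Q)"
  shows "real m \<le> a * \<epsilon> / 2 \<Longrightarrow> \<exists>x D. (\<forall>i<m. x i \<in> S \<and> D i \<in> sets (Rn n) \<and> D i \<subseteq> Pair (x i) -` Gd
     \<and> 1 - \<epsilon> \<le> measure (W \<gamma> n (x i)) (D i)) \<and> disjoint_family_on D {..<m}"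
proof (induction m)
  case 0 then show ?case by (auto simp: disjoint_family_on_def)
next
  case (Suc m)
  have "real m \<le> a * \<epsilon> / 2" using Suc.prems by simp
  from Suc.IH[OF this] obtain x D where xD0: "\<forall>i<m. x i \<in> S \<and> D i \<in> sets (Rn n) \<and> D i \<subseteq> Pair (x i) -` Gd
     \<and> 1 - \<epsilon> \<le> measure (W \<gamma> n (x i)) (D i)" and dis: "disjoint_family_on D {..<m}" by blast
  then have xD: "\<And>i. i < m \<Longrightarrow> x i \<in> S" "\<And>i. i < m \<Longrightarrow> D i \<in> sets (Rn n)"
    "\<And>i. i < m \<Longrightarrow> D i \<subseteq> Pair (x i) -` Gd" "\<And>i. i < m \<Longrightarrow> 1 - \<epsilon> \<le> measure (W \<gamma> n (x i)) (D i)" by auto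
  interpret Q: prob_space Q by fact
  note Q(2)[measurable_cong, simp]
  define V where "V = (\<Union>i<m. D i)"
  have V[measurable]: "V \<in> sets (Rn n)" unfolding V_def using xD(2) by auto
  have qD: "(\<integral>\<^sup>+y. ennreal (q y) * indicator (D i) y \<partial>Rn n) \<le> ennreal (1 / a)" if i: "i < m" for i
  proof -
    have "(\<integral>\<^sup>+y. ennreal (q y) * indicator (D i) y \<partial>Rn n)
      \<le> (\<integral>\<^sup>+y. ennreal (1 / a) * (ennreal (gdens \<gamma> n (\<lambda>k. y k - x i k)) * indicator (D i) y) \<partial>Rn n)"
    proof (rule nn_integral_mono)
      fix y
      show "ennreal (q y) * indicator (D i) y \<le> ennreal (1 / a) * (ennreal (gdens \<gamma> n (\<lambda>k. y k - x i k)) * indicator (D i) y)"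
      proof (cases "y \<in> D i")
        case True
        then have "a * q y \<le> gdens \<gamma> n (\<lambda>k. y k - x i k)" using xD(3)[OF i] by (intro ratio) auto
        then have "q y \<le> (1 / a) * gdens \<gamma> n (\<lambda>k. y k - x i k)" using a by (simp add: field_simps)
        then have "ennreal (q y) \<le> ennreal (1 / a) * ennreal (gdens \<gamma> n (\<lambda>k. y k - x i k))"
          using a gdens_nonneg by (subst ennreal_mult[symmetric]) (auto intro: ennreal_leI)
        then show ?thesis using True by simp
      qed simp
    qed
    also have "\<dots> = ennreal (1 / a) * emeasure (W \<gamma> n (x i)) (D i)"
      using xD(2)[OF i] by (subst nn_integral_cmult) (auto simp: emeasure_W)
    also have "\<dots> \<le> ennreal (1 / a) * 1"
      by (intro mult_left_mono prob_space.emeasure_le_1 prob_W) auto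
    finally show ?thesis by simp
  qed
  have qV: "(\<integral>\<^sup>+x. emeasure (W \<gamma> n x) V \<partial>Q) \<le> ennreal (real m / a)"
  proof -
    have "(\<integral>\<^sup>+x. emeasure (W \<gamma> n x) V \<partial>Q) = (\<integral>\<^sup>+y. ennreal (q y) * indicator V y \<partial>Rn n)"
      by (rule output_density[OF Q out V])
    also have "\<dots> \<le> (\<integral>\<^sup>+y. (\<Sum>i<m. ennreal (q y) * indicator (D i) y) \<partial>Rn n)"
    proof (rule nn_integral_mono)
      fix y
      show "ennreal (q y) * indicator V y \<le> (\<Sum>i<m. ennreal (q y) * indicator (D i) y)"
      proof (cases "y \<in> V")
        case True
        then obtain i where i: "i < m" "y \<in> D i" by (auto simp: V_def)
        then have "ennreal (q y) * indicator (D i) y \<le> (\<Sum>i<m. ennreal (q y) * indicator (D i) y)"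
          by (intro member_le_sum) auto
        then show ?thesis using True i by simp
      qed simp
    qed
    also have "\<dots> = (\<Sum>i<m. \<integral>\<^sup>+y. ennreal (q y) * indicator (D i) y \<partial>Rn n)"
      using q(1) xD(2) by (intro nn_integral_sum) auto
    also have "\<dots> \<le> (\<Sum>i<m. ennreal (1 / a))" by (rule sum_mono) (use qD in auto)
    also have "\<dots> = ennreal (real m / a)" using a by (simp add: ennreal_of_nat_eq_real_of_nat ennreal_mult[symmetric])
    finally show ?thesis .
  qed
  \<comment> \<open>Without such a codeword, splitting each section of \<open>Gd\<close> along
    \<open>V\<close> bounds the joint probability by 1 - \<epsilon> + m/a, which contradicts
    \<open>J\<close> since m + 1 is at most a \<epsilon>/2.\<close>
  have "\<exists>x'\<in>S. 1 - \<epsilon> \<le> measure (W \<gamma> n x') (Pair x' -` Gd - V)"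
  proof (rule ccontr)
    assume "\<not> ?thesis"
    then have no: "measure (W \<gamma> n x') (Pair x' -` Gd - V) < 1 - \<epsilon>" if "x' \<in> S" for x' using that by auto
    have "(\<integral>\<^sup>+x. emeasure (W \<gamma> n x) (Pair x -` Gd) * indicator S x \<partial>Q)
      \<le> (\<integral>\<^sup>+x. ennreal (1 - \<epsilon>) + emeasure (W \<gamma> n x) V \<partial>Q)"
    proof (rule nn_integral_mono)
      fix x' assume x': "x' \<in> space Q"
      show "emeasure (W \<gamma> n x') (Pair x' -` Gd) * indicator S x' \<le> ennreal (1 - \<epsilon>) + emeasure (W \<gamma> n x') V"
      proof (cases "x' \<in> S")
        case True
        interpret Wx: prob_space "W \<gamma> n x'" by (rule prob_W)
        have Gs: "Pair x' -` Gd \<in> sets (Rn n)" by (rule sets_Pair1[OF Gd])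
        have "emeasure (W \<gamma> n x') (Pair x' -` Gd) \<le> emeasure (W \<gamma> n x') ((Pair x' -` Gd - V) \<union> V)"
          using Gs V by (intro emeasure_mono) auto
        also have "\<dots> \<le> emeasure (W \<gamma> n x') (Pair x' -` Gd - V) + emeasure (W \<gamma> n x') V"
          using Gs V by (intro emeasure_subadditive) auto
        also have "emeasure (W \<gamma> n x') (Pair x' -` Gd - V) \<le> ennreal (1 - \<epsilon>)"
          unfolding Wx.emeasure_eq_measure using no[OF True] by (intro ennreal_leI) simp
        finally show ?thesis using True by (simp add: add_right_mono)
      qed simp
    qed
    also have "\<dots> = ennreal (1 - \<epsilon>) + (\<integral>\<^sup>+x. emeasure (W \<gamma> n x) V \<partial>Q)"
    proof -
      have "(\<lambda>x. emeasure (W \<gamma> n x) V) \<in> borel_measurable Q"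
        using emeasure_W_measurable'[OF V] by (simp cong: measurable_cong_sets)
      then show ?thesis by (subst nn_integral_add) (auto simp: Q.emeasure_space_1)
    qed
    also have "\<dots> \<le> ennreal (1 - \<epsilon>) + ennreal (real m / a)" by (intro add_left_mono qV)
    also have "\<dots> = ennreal (1 - \<epsilon> + real m / a)" using \<epsilon> a by (intro ennreal_plus[symmetric]) auto
    finally have "ennreal (1 - \<epsilon> / 2) \<le> ennreal (1 - \<epsilon> + real m / a)" using J by (rule order_trans[rotated])
    moreover have "0 \<le> 1 - \<epsilon> + real m / a" using \<epsilon> a by auto
    ultimately have "1 - \<epsilon> / 2 \<le> 1 - \<epsilon> + real m / a" by (simp add: ennreal_le_iff)
    then have "a * \<epsilon> / 2 \<le> real m" using a by (simp add: field_simps)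
    with Suc.prems show False by simp
  qed
  then obtain x' where x': "x' \<in> S" "1 - \<epsilon> \<le> measure (W \<gamma> n x') (Pair x' -` Gd - V)" by blast
  have Gs: "Pair x' -` Gd \<in> sets (Rn n)" by (rule sets_Pair1[OF Gd])
  show ?case
  proof (intro exI conjI allI impI)
    fix i assume "i < Suc m"
    show "(x(m := x')) i \<in> S" using xD x' \<open>i < Suc m\<close> by (auto simp: less_Suc_eq)
    show "(D(m := Pair x' -` Gd - V)) i \<in> sets (Rn n)" using xD(2) Gs V \<open>i < Suc m\<close> by (auto simp: less_Suc_eq)
    show "(D(m := Pair x' -` Gd - V)) i \<subseteq> Pair ((x(m := x')) i) -` Gd" using xD(3) \<open>i < Suc m\<close> by (auto simp: less_Suc_eq)
    show "1 - \<epsilon> \<le> measure (W \<gamma> n ((x(m := x')) i)) ((D(m := Pair x' -` Gd - V)) i)"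
      using xD(4) x' \<open>i < Suc m\<close> by (auto simp: less_Suc_eq)
  next
    have d1: "D i \<inter> (Pair x' -` Gd - V) = {}" if "i < m" for i using that by (auto simp: V_def)
    have d2: "D i \<inter> D j = {}" if "i < m" "j < m" "i \<noteq> j" for i j
      using dis that unfolding disjoint_family_on_def by blast
    show "disjoint_family_on (D(m := Pair x' -` Gd - V)) {..<Suc m}"
      unfolding disjoint_family_on_def
    proof (intro ballI impI)
      fix i j assume "i \<in> {..<Suc m}" "j \<in> {..<Suc m}" "i \<noteq> j"
      then consider "i < m" "j < m" "i \<noteq> j" | "i = m" "j < m" | "i < m" "j = m" by (auto simp: less_Suc_eq)
      then show "(D(m := Pair x' -` Gd - V)) i \<inter> (D(m := Pair x' -` Gd - V)) j = {}"
        using d1[of i] d1[of j] d2[of i j] by cases auto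
    qed
  qed
qed

end

section \<open>Achievability\<close>

lemma emeasure_gd:
  assumes C: "chol n v L M" and A: "A \<in> sets (Rn n)"
  shows "emeasure (density (Rn n) (\<lambda>y. ennreal (gd n M y))) A
    = ennreal (measure (stdg n) {u \<in> space (Rn n). aff n L (\<lambda>_. 0) u \<in> A})"
proof -
  have "density (Rn n) (\<lambda>y. ennreal (gd n M y)) = distr (stdg n) (Rn n) (aff n L (\<lambda>_. 0))"
    using gd_distr[OF C, of "\<lambda>_. 0"] by simp
  then have "emeasure (density (Rn n) (\<lambda>y. ennreal (gd n M y))) A = emeasure (stdg n) (aff n L (\<lambda>_. 0) -` A \<inter> space (stdg n))"
    using A by (simp only:) (intro emeasure_distr, auto)
  also have "aff n L (\<lambda>_. 0) -` A \<inter> space (stdg n) = {u \<in> space (Rn n). aff n L (\<lambda>_. 0) u \<in> A}" by auto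
  finally show ?thesis by (simp add: stdg.emeasure_eq_measure)
qed

lemma prob_space_gd:
  assumes C: "chol n v L M"
  shows "prob_space (density (Rn n) (\<lambda>y. ennreal (gd n M y)))"
proof -
  have "density (Rn n) (\<lambda>y. ennreal (gd n M y)) = distr (stdg n) (Rn n) (aff n L (\<lambda>_. 0))"
    using gd_distr[OF C, of "\<lambda>_. 0"] by simp
  then show ?thesis by (simp add: stdg.prob_space_distr)
qed

lemma cv_add:
  assumes "integrable U F" "integrable U G"
  shows "cv (\<lambda>l. F l + G l) i j = cv F i j + cv G i j"
proof -
  have "integrable U (\<lambda>l. cos (real_of_int (int j - int i) * l) * H l)" if "integrable U H" for H
    by (rule U_integrable_mult_bounded[where B=1]) (use that in auto)
  from this[OF assms(1)] this[OF assms(2)] show ?thesis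
    unfolding cv_def distrib_left by (rule Bochner_Integration.integral_add)
qed

text \<open>Concavity of the logarithm, obtained from its tangent at the weighted mean.\<close>

lemma ln_weighted_mean:
  fixes a b c t :: real
  assumes "0 < a" "0 < b" "0 \<le> t" "t \<le> 1" and c: "(1 - t) * a + t * b \<le> c"
  shows "(1 - t) * ln a + t * ln b \<le> ln c"
proof -
  define d where "d = (1 - t) * a + t * b"
  have d: "d > 0"
    using assms by (cases "t = 1") (auto simp: d_def intro!: add_pos_nonneg)
  have "ln (a / d) \<le> a / d - 1" "ln (b / d) \<le> b / d - 1"
    using assms d by (auto intro!: ln_le_minus_one)
  then have "(1 - t) * ln (a / d) + t * ln (b / d) \<le> (1 - t) * (a / d - 1) + t * (b / d - 1)"
    using assms by (intro add_mono mult_left_mono) auto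
  also have "\<dots> = ((1 - t) * a + t * b) / d - 1"
    by (simp add: diff_divide_distrib add_divide_distrib algebra_simps)
  also have "\<dots> = d / d - 1" by (simp only: d_def)
  also have "\<dots> = 0" using d by simp
  finally have "(1 - t) * (ln a - ln d) + t * (ln b - ln d) \<le> 0" using assms d by (simp add: ln_div)
  then have "(1 - t) * ln a + t * ln b \<le> ln d" by (simp add: algebra_simps)
  also have "\<dots> \<le> ln c" using c d by (simp add: d_def)
  finally show ?thesis .
qed

lemma costset_sets[measurable]: "costset n P \<in> sets (Rn n)"
  unfolding costset_def by measurable

context anwgn
begin

lemma cap_nonneg: "0 \<le> cap"
proof -
  have "(\<integral>l. ln (G l) \<partial>U) \<le> (\<integral>l. ln (max (G l) \<theta>) \<partial>U)"
  proof (rule integral_mono_AE[OF Gln])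
    show "integrable U (\<lambda>l. ln (max (G l) \<theta>))"
      by (rule integrable_ln_shift[of _ \<theta>]) (use Gi \<theta> in auto)
    show "AE l in U. ln (G l) \<le> ln (max (G l) \<theta>)"
      using Gpos by eventually_elim (auto simp: max_def)
  qed
  then show ?thesis by (simp add: cap_def)
qed

text \<open>The input spectrum is the water-filling one shrunk by 1 - \<eta> plus a small constant.
  Its power falls short of P by \<eta> P/2, so the Gaussian input rarely violates the cost, and the
  constant makes its logarithm integrable, so that the input covariance has a Cholesky factor.
  Typicality is imposed only on two whitened energies, since both exponents depend on nothing
  else.\<close>

lemma achievability:
  assumes e: "0 < e" "e < 1"
  shows "\<exists>N. \<forall>n\<ge>N. \<forall>m. real m \<le> exp (real n * (cap - e)) \<longrightarrow>
    (\<exists>x D. (\<forall>i<m. x i \<in> costset n P \<and> D i \<in> sets (Rn n) \<and> 1 - e \<le> measure (W \<gamma> n (x i)) (D i))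
      \<and> disjoint_family_on D {..<m})"
proof -
  note Gm[measurable]
  \<comment> \<open>The information density loses at most \<eta> (cap + 2) per letter: shrinking
    costs \<eta> \<open>cap\<close> by concavity, the rest pays for the energy deviations and the
    determinant of the noise.\<close>
  define \<eta> where "\<eta> = min (1/2) (e / (2 * (cap + 2)))"
  have \<eta>: "\<eta> > 0" "\<eta> \<le> 1/2" "\<eta> * (cap + 2) \<le> e / 2"
  proof -
    show "\<eta> > 0" "\<eta> \<le> 1/2" using e cap_nonneg by (auto simp: \<eta>_def)
    have "\<eta> * (cap + 2) \<le> e / (2 * (cap + 2)) * (cap + 2)"
      using cap_nonneg by (intro mult_right_mono) (auto simp: \<eta>_def)
    moreover have "e / (2 * x) * x = e / 2" if "x \<noteq> 0" for x using that by simp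
    from this[of "cap + 2"] have "e / (2 * (cap + 2)) * (cap + 2) = e / 2" using cap_nonneg by simp
    ultimately show "\<eta> * (cap + 2) \<le> e / 2" by (simp only:)
  qed
  define F where "F l = (1 - \<eta>) * max (\<theta> - G l) 0 + \<eta> * P / 2" for l
  define S where "S l = F l + G l" for l
  have Flb: "\<eta> * P / 2 \<le> F l" for l using \<eta> by (auto simp: F_def)
  have \<eta>P: "\<eta> * P / 2 > 0" using \<eta> P by simp
  have i2: "integrable U (\<lambda>l. max (\<theta> - G l) 0)"
    by (rule U_integrable_bounded[where B=\<theta>]) (use G0 \<theta> in \<open>auto simp: max_def\<close>)
  have iF: "integrable U F" unfolding F_def using i2 by auto
  have iS: "integrable U S" unfolding S_def using iF Gi by auto
  have Slb: "\<eta> * P / 2 \<le> S l" for l using Flb[of l] G0[of l] by (simp add: S_def)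
  have intF: "(\<integral>l. F l \<partial>U) = P - \<eta> * P / 2"
    unfolding F_def using i2 by (simp add: level algebra_simps)
  have Fpos: "0 < F l" and Spos: "0 < S l" for l using Flb[of l] Slb[of l] \<eta>P by linarith+
  have nF: "nice F" unfolding nice_def
    using iF Fpos integrable_ln_shift[OF iF Flb \<eta>P] by (auto intro: less_imp_le)
  have nS: "nice S" unfolding nice_def
    using iS Spos integrable_ln_shift[OF iS Slb \<eta>P] by (auto intro: less_imp_le)
  define m where "m = (\<integral>l. ln (G l) \<partial>U)"
  define H where "H = (\<integral>l. ln (max (G l) \<theta>) \<partial>U)"
  define K where "K = (\<integral>l. ln (S l) \<partial>U)"
  have cap: "cap = 1/2 * (H - m)" by (simp add: cap_def H_def m_def)
  \<comment> \<open>\<open>S\<close> is at least (1 - \<eta>) max(G, \<theta>) + \<eta> G, and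
    concavity reduces the mean of its logarithm to the two known means.\<close>
  have K: "(1 - \<eta>) * H + \<eta> * m \<le> K"
  proof -
    have iH: "integrable U (\<lambda>l. ln (max (G l) \<theta>))"
      by (rule integrable_ln_shift[of _ \<theta>]) (use Gi \<theta> in auto)
    have "(1 - \<eta>) * H + \<eta> * m = (\<integral>l. (1 - \<eta>) * ln (max (G l) \<theta>) + \<eta> * ln (G l) \<partial>U)"
      unfolding H_def m_def using iH Gln by simp
    also have "\<dots> \<le> K"
      unfolding K_def
    proof (rule integral_mono_AE)
      show "integrable U (\<lambda>l. ln (S l))" using nS by (simp add: nice_def)
      show "AE l in U. (1 - \<eta>) * ln (max (G l) \<theta>) + \<eta> * ln (G l) \<le> ln (S l)"
        using Gpos
      proof eventually_elim
        case (elim l)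
        have "(1 - \<eta>) * max (G l) \<theta> + \<eta> * G l = (1 - \<eta>) * max (\<theta> - G l) 0 + G l"
          by (simp add: max_def algebra_simps)
        also have "\<dots> \<le> S l" using \<eta>P by (simp add: S_def F_def)
        finally show ?case using elim \<theta> \<eta> by (intro ln_weighted_mean) auto
      qed
    qed (use iH Gln in auto)
    finally show ?thesis .
  qed
  \<comment> \<open>Chosen so that Chebyshev for the input energy with margin R \<eta> P/2 gives
    e/8.\<close>
  define \<delta> where "\<delta> = e * \<eta>\<^sup>2 * P / 64"
  have \<delta>: "\<delta> > 0" using e \<eta> P by (simp add: \<delta>_def)
  obtain N1 where N1: "\<And>n L M c. n \<ge> N1 \<Longrightarrow> chol n (cv F) L M \<Longrightarrow> (\<Sum>j<n. (\<Sum>i<n. c i * L i j)\<^sup>2) \<le> \<delta> * real n * (\<Sum>i<n. (c i)\<^sup>2)"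
    using chol_norm_small[OF nF \<delta>] by blast
  obtain N2 :: nat where N2: "16 / (e * \<eta>\<^sup>2) \<le> real N2" using real_arch_simple by blast
  obtain N3 :: nat where N3: "4 / (e * e) \<le> real N3" using real_arch_simple by blast
  obtain N4 where N4: "\<And>n L M. n \<ge> N4 \<Longrightarrow> chol n (cv G) L M \<Longrightarrow> 2 * (\<Sum>k<n. ln (L k k)) \<le> real n * ((\<integral>l. ln (G l) \<partial>U) + \<eta>)"
    using chol_lndet_upper[OF G \<eta>(1)] by blast
  show ?thesis
  proof (intro exI[of _ "Suc (N1 + N2 + N3 + N4)"] allI impI)
    fix n k assume n: "Suc (N1 + N2 + N3 + N4) \<le> n" and k: "real k \<le> exp (real n * (cap - e))"
    define R where "R = real n"
    have R: "R \<ge> 1" "16 / (e * \<eta>\<^sup>2) \<le> R" "4 / (e * e) \<le> R" using n N2 N3 by (auto simp: R_def)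
    have R0: "R > 0" using R by linarith
    obtain L M where C: "chol n (cv G) L M" using chol_ex by blast
    obtain LK MK where CK: "chol n (cv F) LK MK" using chol_exists[OF posdef_cv[OF nF]] by blast
    obtain LS MS where CS: "chol n (cv S) LS MS" using chol_exists[OF posdef_cv[OF nS]] by blast
    have CS': "chol n (\<lambda>i j. cv F i j + cv G i j) LS MS"
      using CS by (simp add: S_def[abs_def] cv_add[OF iF Gi] cong: chol_def)
    define SL where "SL = (\<Sum>k<n. ln (L k k))"
    define SS where "SS = (\<Sum>k<n. ln (LS k k))"
    define a where "a = exp (R * (cap - e / 2))"
    define Q where "Q = density (Rn n) (\<lambda>x. ennreal (gd n MK x))"
    define q where "q = gd n MS"
    have Qp: "prob_space Q" "sets Q = sets (Rn n)" unfolding Q_def by (rule prob_space_gd[OF CK]) simp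
    have q: "q \<in> borel_measurable (Rn n)" "\<And>y. 0 \<le> q y"
      unfolding q_def using CS by (auto intro!: gd_nonneg simp: chol_def)
    have out: "(\<integral>\<^sup>+x. ennreal (gdens \<gamma> n (\<lambda>i. y i - x i)) \<partial>Q) = ennreal (q y)" if y: "y \<in> space (Rn n)" for y
    proof -
      have m: "(\<lambda>x. ennreal (gd n M (\<lambda>i. y i - x i))) \<in> borel_measurable (Rn n)"
        unfolding gd_def by measurable
      have "(\<integral>\<^sup>+x. ennreal (gdens \<gamma> n (\<lambda>i. y i - x i)) \<partial>Q) = (\<integral>\<^sup>+x. ennreal (gd n MK x) * ennreal (gd n M (\<lambda>i. y i - x i)) \<partial>Rn n)"
        unfolding Q_def gdens_eq[OF C] by (rule nn_integral_density) (use m in auto)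
      also have "\<dots> = ennreal (q y)" unfolding q_def by (rule gd_convolution[OF CK C CS' y])
      finally show ?thesis .
    qed
    define Gd where "Gd = {p \<in> space (Rn n \<Otimes>\<^sub>M Rn n). (\<Sum>k<n. (\<Sum>j<n. M k j * (snd p j - fst p j))\<^sup>2) \<le> R * (1 + \<eta>) \<and>
       R * (1 - \<eta>) \<le> (\<Sum>k<n. (\<Sum>j<n. MS k j * snd p j)\<^sup>2)}"
    have Gd[measurable]: "Gd \<in> sets (Rn n \<Otimes>\<^sub>M Rn n)" unfolding Gd_def by measurable
    have ratio: "a * q y \<le> gdens \<gamma> n (\<lambda>i. y i - x i)" if "(x, y) \<in> Gd" for x y
    proof -
      define A where "A = (\<Sum>k<n. (\<Sum>j<n. M k j * (y j - x j))\<^sup>2)"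
      define B where "B = (\<Sum>k<n. (\<Sum>j<n. MS k j * y j)\<^sup>2)"
      have AB: "A \<le> R * (1 + \<eta>)" "R * (1 - \<eta>) \<le> B" using that by (auto simp: Gd_def A_def B_def)
      have "R * (cap - e / 2) + (- SS - 1/2 * B) \<le> - SL - 1/2 * A"
      proof -
        have 1: "2 * SL \<le> R * (m + \<eta>)" unfolding SL_def R_def m_def by (rule N4[OF _ C]) (use n in simp)
        have 2: "R * K \<le> 2 * SS" unfolding SS_def R_def K_def by (rule chol_lndet_lower[OF nS CS])
        have 3: "R * ((1 - \<eta>) * H + \<eta> * m) \<le> R * K" using K R0 by simp
        have 4: "(1 - \<eta>) * H + \<eta> * m = m + (1 - \<eta>) * (2 * cap)"
        proof -
          have "H = m + 2 * cap" using cap by simp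
          then show ?thesis by (simp only:) (simp add: algebra_simps)
        qed
        have 5: "R * (\<eta> * (cap + 2)) \<le> R * (e / 2)" by (rule mult_left_mono[OF \<eta>(3)]) (use R0 in simp)
        have "R * (m + (1 - \<eta>) * (2 * cap)) \<le> 2 * SS" using 2 3 4 by simp
        then have "R * m + 2 * (R * cap) - 2 * (R * (\<eta> * cap)) \<le> 2 * SS" by (simp add: algebra_simps)
        moreover have "2 * SL \<le> R * m + R * \<eta>" using 1 by (simp add: distrib_left)
        moreover have "R * (\<eta> * cap) + 2 * (R * \<eta>) \<le> R * e / 2" using 5 by (simp add: algebra_simps)
        moreover have "A \<le> R + R * \<eta>" "R - R * \<eta> \<le> B" using AB by (simp_all add: algebra_simps)
        moreover have "R * (cap - e / 2) = R * cap - R * e / 2" by (simp add: right_diff_distrib)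
        moreover have "R * \<eta> \<ge> 0" using R0 \<eta> by simp
        ultimately show ?thesis by argo
      qed
      then have "exp (R * (cap - e / 2)) * exp (- SS - 1/2 * B) \<le> exp (- SL - 1/2 * A)"
        by (simp only: exp_add[symmetric] exp_le_cancel_iff)
      then have "a * exp (- SS - 1/2 * B) / sqrt ((2 * pi) ^ n) \<le> exp (- SL - 1/2 * A) / sqrt ((2 * pi) ^ n)"
        unfolding a_def by (intro divide_right_mono) auto
      then show ?thesis
        unfolding q_def gdens_eq[OF C] gd_exp_chol[OF C] gd_exp_chol[OF CS] SL_def SS_def A_def B_def by simp
    qed
    have dev: "measure (stdg n) {u \<in> space (Rn n). R * \<eta> \<le> \<bar>(\<Sum>k<n. (u k)\<^sup>2) - real n\<bar>} \<le> e / 8"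
    proof -
      have "measure (stdg n) {u \<in> space (Rn n). R * \<eta> \<le> \<bar>(\<Sum>k<n. (u k)\<^sup>2) - real n\<bar>} \<le> 2 * R / (R * \<eta>)\<^sup>2"
        unfolding R_def by (rule stdg_norm_deviation) (use R0 \<eta> in \<open>auto simp: R_def\<close>)
      also have "\<dots> = 2 / (R * \<eta>\<^sup>2)" using R0 by (simp add: power2_eq_square)
      also have "\<dots> \<le> e / 8" using R(2) R0 e \<eta> by (simp add: field_simps)
      finally show ?thesis .
    qed
    have devm: "{u \<in> space (Rn n). R * \<eta> \<le> \<bar>(\<Sum>k<n. (u k)\<^sup>2) - real n\<bar>} \<in> sets (stdg n)" by (simp, measurable)
    \<comment> \<open>The two ways of leaving \<open>Gd\<close>: too much noise energy or too little
      whitened output energy. Each, like a violation of the cost, has probability at most e/8, and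
      3e/8 is below the e/2 that Feinstein's lemma tolerates.\<close>
    define Zb where "Zb x = {y \<in> space (Rn n). R * (1 + \<eta>) < (\<Sum>k<n. (\<Sum>j<n. M k j * (y j - x j))\<^sup>2)}" for x
    define Yb where "Yb = {y \<in> space (Rn n). (\<Sum>k<n. (\<Sum>j<n. MS k j * y j)\<^sup>2) < R * (1 - \<eta>)}"
    have Zbm[measurable]: "Zb x \<in> sets (Rn n)" for x unfolding Zb_def by measurable
    have Ybm[measurable]: "Yb \<in> sets (Rn n)" unfolding Yb_def by measurable
    have Zb: "emeasure (W \<gamma> n x) (Zb x) \<le> ennreal (e / 8)" for x
    proof -
      interpret Wx: prob_space "W \<gamma> n x" by (rule prob_W)
      have "measure (W \<gamma> n x) (Zb x) = measure (stdg n) {u \<in> space (Rn n). aff n L x u \<in> Zb x}"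
        by (rule measure_W[OF C Zbm])
      also have "\<dots> \<le> measure (stdg n) {u \<in> space (Rn n). R * \<eta> \<le> \<bar>(\<Sum>k<n. (u k)\<^sup>2) - real n\<bar>}"
      proof (rule stdg.finite_measure_mono[OF _ devm])
        have "(\<Sum>k<n. (\<Sum>j<n. M k j * (aff n L x u j - x j))\<^sup>2) = (\<Sum>k<n. (u k)\<^sup>2)" for u
          by (simp add: chol_whiten[OF C])
        then show "{u \<in> space (Rn n). aff n L x u \<in> Zb x} \<subseteq> {u \<in> space (Rn n). R * \<eta> \<le> \<bar>(\<Sum>k<n. (u k)\<^sup>2) - real n\<bar>}"
          by (auto simp: Zb_def R_def distrib_left)
      qed
      finally show ?thesis using dev by (simp add: Wx.emeasure_eq_measure ennreal_leI)
    qed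
    have Yb: "(\<integral>\<^sup>+x. emeasure (W \<gamma> n x) Yb \<partial>Q) \<le> ennreal (e / 8)"
    proof -
      have "(\<integral>\<^sup>+x. emeasure (W \<gamma> n x) Yb \<partial>Q) = (\<integral>\<^sup>+y. ennreal (q y) * indicator Yb y \<partial>Rn n)"
        by (rule output_density[OF Qp out Ybm])
      also have "\<dots> = emeasure (density (Rn n) (\<lambda>y. ennreal (gd n MS y))) Yb"
        unfolding q_def by (rule emeasure_density[symmetric]) auto
      also have "\<dots> = ennreal (measure (stdg n) {u \<in> space (Rn n). aff n LS (\<lambda>_. 0) u \<in> Yb})"
        by (rule emeasure_gd[OF CS Ybm])
      also have "measure (stdg n) {u \<in> space (Rn n). aff n LS (\<lambda>_. 0) u \<in> Yb}
         \<le> measure (stdg n) {u \<in> space (Rn n). R * \<eta> \<le> \<bar>(\<Sum>k<n. (u k)\<^sup>2) - real n\<bar>}"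
      proof (rule stdg.finite_measure_mono[OF _ devm])
        have "(\<Sum>k<n. (\<Sum>j<n. MS k j * aff n LS (\<lambda>_. 0) u j)\<^sup>2) = (\<Sum>k<n. (u k)\<^sup>2)" for u
          using chol_whiten[OF CS, of _ "\<lambda>_. 0"] by simp
        then show "{u \<in> space (Rn n). aff n LS (\<lambda>_. 0) u \<in> Yb} \<subseteq> {u \<in> space (Rn n). R * \<eta> \<le> \<bar>(\<Sum>k<n. (u k)\<^sup>2) - real n\<bar>}"
          by (auto simp: Yb_def R_def right_diff_distrib)
      qed
      finally show ?thesis using dev by (meson ennreal_leI order_trans)
    qed
    have Sc: "emeasure Q (space (Rn n) - costset n P) \<le> ennreal (e / 8)"
    proof -
      define TB where "TB = (\<Sum>k<n. \<Sum>j<n. (LK k j)\<^sup>2)"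
      have TB: "TB = R * (P - \<eta> * P / 2)"
      proof -
        have "TB = (\<Sum>k<n. cv F k k)" unfolding TB_def using CK by (intro sum.cong) (auto simp: chol_def power2_eq_square)
        also have "\<dots> = (\<Sum>k<n. P - \<eta> * P / 2)" by (simp add: cv_def intF)
        finally show ?thesis by (simp add: R_def)
      qed
      define t where "t = R * (\<eta> * P / 2)"
      have t: "t > 0" using R0 \<eta>P by (simp add: t_def)
      have b: "(\<Sum>j<n. (\<Sum>k<n. c k * LK k j)\<^sup>2) \<le> (\<delta> * R) * (\<Sum>k<n. (c k)\<^sup>2)" for c
        unfolding R_def by (rule N1[OF _ CK]) (use n in simp)
      have Scm: "space (Rn n) - costset n P \<in> sets (Rn n)" by measurable
      have "measure (stdg n) {u \<in> space (Rn n). aff n LK (\<lambda>_. 0) u \<in> space (Rn n) - costset n P}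
        \<le> measure (stdg n) {u \<in> space (Rn n). t \<le> \<bar>(\<Sum>k<n. (\<Sum>j<n. LK k j * u j)\<^sup>2) - TB\<bar>}"
      proof (rule stdg.finite_measure_mono)
        show "{u \<in> space (Rn n). t \<le> \<bar>(\<Sum>k<n. (\<Sum>j<n. LK k j * u j)\<^sup>2) - TB\<bar>} \<in> sets (stdg n)" by (simp, measurable)
        show "{u \<in> space (Rn n). aff n LK (\<lambda>_. 0) u \<in> space (Rn n) - costset n P}
          \<subseteq> {u \<in> space (Rn n). t \<le> \<bar>(\<Sum>k<n. (\<Sum>j<n. LK k j * u j)\<^sup>2) - TB\<bar>}"
        proof
          fix u assume u: "u \<in> {u \<in> space (Rn n). aff n LK (\<lambda>_. 0) u \<in> space (Rn n) - costset n P}"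
          then have "\<not> (\<Sum>k<n. (aff n LK (\<lambda>_. 0) u k)\<^sup>2) / R \<le> P" by (auto simp: costset_def R_def)
          moreover have "(\<Sum>k<n. (aff n LK (\<lambda>_. 0) u k)\<^sup>2) = (\<Sum>k<n. (\<Sum>j<n. LK k j * u j)\<^sup>2)"
            by (intro sum.cong) (auto simp: aff_def)
          ultimately have "R * P < (\<Sum>k<n. (\<Sum>j<n. LK k j * u j)\<^sup>2)"
            using R0 by (simp add: not_le pos_less_divide_eq mult.commute)
          moreover have "R * P = TB + t" by (simp add: TB t_def algebra_simps)
          ultimately show "u \<in> {u \<in> space (Rn n). t \<le> \<bar>(\<Sum>k<n. (\<Sum>j<n. LK k j * u j)\<^sup>2) - TB\<bar>}" using u by auto
        qed
      qed
      also have "\<dots> \<le> 2 * (\<delta> * R) * TB / t\<^sup>2"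
        unfolding TB_def by (rule stdg_gram_deviation(1)[OF b t])
      also have "\<dots> \<le> 2 * (\<delta> * R) * (R * P) / t\<^sup>2"
        using \<delta> R0 \<eta>P by (intro divide_right_mono mult_left_mono) (auto simp: TB)
      also have "\<dots> = e / 8" using R0 \<eta> P by (simp add: \<delta>_def t_def power2_eq_square divide_simps)
      finally have "measure (stdg n) {u \<in> space (Rn n). aff n LK (\<lambda>_. 0) u \<in> space (Rn n) - costset n P} \<le> e / 8" .
      then show ?thesis unfolding Q_def emeasure_gd[OF CK Scm] by (rule ennreal_leI)
    qed
    define J where "J = (\<integral>\<^sup>+x. emeasure (W \<gamma> n x) (Pair x -` Gd) * indicator (costset n P) x \<partial>Q)"
    have J: "ennreal (1 - e / 2) \<le> J"
    proof -
      interpret Q: prob_space Q by (rule Qp)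
      note Qp(2)[measurable_cong, simp]
      have spQ: "space Q = space (Rn n)" by (rule sets_eq_imp_space_eq) simp
      have m1: "(\<lambda>x. emeasure (W \<gamma> n x) (Pair x -` Gd)) \<in> borel_measurable Q"
        using emeasure_W_measurable[OF Gd] by (simp cong: measurable_cong_sets)
      have m2: "(\<lambda>x. emeasure (W \<gamma> n x) Yb) \<in> borel_measurable Q"
        using emeasure_W_measurable'[OF Ybm] by (simp cong: measurable_cong_sets)
      have cm: "costset n P \<in> sets Q" by simp
      have "1 = (\<integral>\<^sup>+x. 1 \<partial>Q)" by (simp add: Q.emeasure_space_1)
      also have "\<dots> \<le> (\<integral>\<^sup>+x. emeasure (W \<gamma> n x) (Pair x -` Gd) * indicator (costset n P) x
          + (indicator (space (Rn n) - costset n P) x + (ennreal (e / 8) + emeasure (W \<gamma> n x) Yb)) \<partial>Q)"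
      proof (rule nn_integral_mono)
        fix x assume x: "x \<in> space Q"
        show "1 \<le> emeasure (W \<gamma> n x) (Pair x -` Gd) * indicator (costset n P) x
          + (indicator (space (Rn n) - costset n P) x + (ennreal (e / 8) + emeasure (W \<gamma> n x) Yb))"
        proof (cases "x \<in> costset n P")
          case True
          interpret Wx: prob_space "W \<gamma> n x" by (rule prob_W)
          have Gx: "Pair x -` Gd \<in> sets (Rn n)" by (rule sets_Pair1[OF Gd])
          have "1 = emeasure (W \<gamma> n x) (space (Rn n))" using Wx.emeasure_space_1 by simp
          also have "\<dots> \<le> emeasure (W \<gamma> n x) (Pair x -` Gd \<union> (Zb x \<union> Yb))"
            using x spQ Gx by (intro emeasure_mono) (auto simp: Gd_def Zb_def Yb_def space_pair_measure not_le)
          also have "\<dots> \<le> emeasure (W \<gamma> n x) (Pair x -` Gd) + emeasure (W \<gamma> n x) (Zb x \<union> Yb)"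
            using Gx by (intro emeasure_subadditive) auto
          also have "\<dots> \<le> emeasure (W \<gamma> n x) (Pair x -` Gd) + (emeasure (W \<gamma> n x) (Zb x) + emeasure (W \<gamma> n x) Yb)"
            by (intro add_left_mono emeasure_subadditive) auto
          also have "\<dots> \<le> emeasure (W \<gamma> n x) (Pair x -` Gd) + (ennreal (e / 8) + emeasure (W \<gamma> n x) Yb)"
            by (intro add_left_mono add_right_mono Zb)
          finally show ?thesis using True by simp
        next
          case False
          then have "indicator (space (Rn n) - costset n P) x = (1 :: ennreal)" using x spQ by simp
          then show ?thesis by simp
        qed
      qed
      also have "\<dots> = J + (emeasure Q (space (Rn n) - costset n P) + (ennreal (e / 8) + (\<integral>\<^sup>+x. emeasure (W \<gamma> n x) Yb \<partial>Q)))"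
      proof -
        have "(\<integral>\<^sup>+x. emeasure (W \<gamma> n x) (Pair x -` Gd) * indicator (costset n P) x
          + (indicator (space (Rn n) - costset n P) x + (ennreal (e / 8) + emeasure (W \<gamma> n x) Yb)) \<partial>Q)
          = J + (\<integral>\<^sup>+x. indicator (space (Rn n) - costset n P) x + (ennreal (e / 8) + emeasure (W \<gamma> n x) Yb) \<partial>Q)"
          unfolding J_def using m1 m2 cm by (intro nn_integral_add) auto
        also have "(\<integral>\<^sup>+x. indicator (space (Rn n) - costset n P) x + (ennreal (e / 8) + emeasure (W \<gamma> n x) Yb) \<partial>Q)
          = emeasure Q (space (Rn n) - costset n P) + (\<integral>\<^sup>+x. ennreal (e / 8) + emeasure (W \<gamma> n x) Yb \<partial>Q)"
          using m2 cm spQ by (subst nn_integral_add) auto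
        also have "(\<integral>\<^sup>+x. ennreal (e / 8) + emeasure (W \<gamma> n x) Yb \<partial>Q) = ennreal (e / 8) + (\<integral>\<^sup>+x. emeasure (W \<gamma> n x) Yb \<partial>Q)"
          using m2 by (subst nn_integral_add) (auto simp: Q.emeasure_space_1)
        finally show ?thesis .
      qed
      also have "\<dots> \<le> J + (ennreal (e / 8) + (ennreal (e / 8) + ennreal (e / 8)))"
        by (intro add_left_mono add_mono Sc Yb order_refl)
      also have "ennreal (e / 8) + (ennreal (e / 8) + ennreal (e / 8)) = ennreal (3 * e / 8)"
        using e by (simp flip: ennreal_plus)
      finally have one: "1 \<le> J + ennreal (3 * e / 8)" .
      show ?thesis
      proof (cases J)
        case (real r)
        then have "ennreal 1 \<le> ennreal (r + 3 * e / 8)" using one e by (simp add: ennreal_plus[symmetric] del: ennreal_plus)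
        then have "1 \<le> r + 3 * e / 8" using real e by (subst (asm) ennreal_le_iff) auto
        then show ?thesis using real e by (auto intro!: ennreal_leI)
      qed auto
    qed
    \<comment> \<open>Giving up a further e/2 of rate gains the factor exp(R e/2), which outweighs
      the factor e/2 demanded by Feinstein's lemma.\<close>
    have ka: "real k \<le> a * e / 2"
    proof -
      have "1 \<le> exp (R * e / 2) * (e / 2)"
      proof -
        have "1 = 4 / (e * e) * e / 2 * (e / 2)" using e by simp
        also have "\<dots> \<le> R * e / 2 * (e / 2)" using R(3) e by (intro mult_right_mono divide_right_mono) auto
        also have "\<dots> \<le> exp (R * e / 2) * (e / 2)"
          using e exp_ge_add_one_self[of "R * e / 2"] by (intro mult_right_mono) linarith+
        finally show ?thesis .
      qed
      then have "exp (R * (cap - e)) * 1 \<le> exp (R * (cap - e)) * (exp (R * e / 2) * (e / 2))"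
        by (intro mult_left_mono) auto
      also have "\<dots> = a * e / 2"
      proof -
        have "exp (R * (cap - e)) * exp (R * e / 2) = a"
          unfolding a_def exp_add[symmetric] by (rule arg_cong[where f=exp]) (simp add: algebra_simps)
        then show ?thesis by (simp add: mult.assoc[symmetric])
      qed
      finally show ?thesis using k by (simp add: R_def)
    qed
    have "a > 0" by (simp add: a_def)
    from feinstein[OF Qp q out costset_sets Gd this ratio e J[unfolded J_def] ka]
    show "\<exists>x D. (\<forall>i<k. x i \<in> costset n P \<and> D i \<in> sets (Rn n) \<and> 1 - e \<le> measure (W \<gamma> n (x i)) (D i))
      \<and> disjoint_family_on D {..<k}"
      by blast
  qed
qed

end

section \<open>Resolvability\<close>

text \<open>First-moment argument: otherwise f - c would be positive almost everywhere and yet have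
  nonpositive mean.\<close>

lemma exists_le_integral:
  fixes f :: "'a \<Rightarrow> real"
  assumes Q: "prob_space Q" and f: "integrable Q f" and S: "AE x in Q. x \<in> S" and le: "(\<integral>x. f x \<partial>Q) \<le> c"
  shows "\<exists>x\<in>S. f x \<le> c"
proof (rule ccontr)
  interpret Q: prob_space Q by fact
  assume "\<not> ?thesis"
  then have gt: "AE x in Q. c < f x" using S by (auto elim!: eventually_mono simp: not_le)
  have i: "integrable Q (\<lambda>x. f x - c)" using f by auto
  have "(\<integral>x. f x - c \<partial>Q) \<le> 0" using f le by (simp add: Q.prob_space)
  moreover have "(\<integral>x. f x - c \<partial>Q) \<ge> 0" by (rule integral_nonneg_AE) (use gt in \<open>auto elim: eventually_mono\<close>)
  ultimately have "(\<integral>x. f x - c \<partial>Q) = 0" by linarith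
  then have "AE x in Q. f x - c = 0"
    by (subst (asm) integral_nonneg_eq_0_iff_AE[OF i]) (use gt in \<open>auto elim: eventually_mono\<close>)
  with gt have "AE x in Q. False" by eventually_elim auto
  then show False by simp
qed

lemma square_integral_le:
  fixes f :: "'a \<Rightarrow> real"
  assumes M: "prob_space M" and f: "integrable M f" "integrable M (\<lambda>x. (f x)\<^sup>2)"
  shows "(\<integral>x. f x \<partial>M)\<^sup>2 \<le> (\<integral>x. (f x)\<^sup>2 \<partial>M)"
proof -
  interpret prob_space M by fact
  define c where "c = (\<integral>x. f x \<partial>M)"
  have "0 \<le> (\<integral>x. (f x - c)\<^sup>2 \<partial>M)" by simp
  also have "\<dots> = (\<integral>x. (f x)\<^sup>2 - 2 * c * f x + c\<^sup>2 \<partial>M)"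
    by (intro Bochner_Integration.integral_cong) (auto simp: power2_eq_square algebra_simps)
  also have "\<dots> = (\<integral>x. (f x)\<^sup>2 \<partial>M) - c\<^sup>2"
    using f by (simp add: prob_space c_def power2_eq_square)
  finally show ?thesis by (simp add: c_def)
qed

text \<open>Choosing the codewords one after the other such that the weighted quadratic deviation grows
  by at most its mean increment replaces the usual random coding argument.\<close>

lemma greedy_cover:
  fixes r :: "'a \<Rightarrow> 'b \<Rightarrow> real"
  assumes Q: "prob_space Q" and \<mu>: "prob_space \<mu>"
    and r[measurable]: "(\<lambda>p. r (fst p) (snd p)) \<in> borel_measurable (Q \<Otimes>\<^sub>M \<mu>)"
    and rb: "\<And>x y. 0 \<le> r x y" "\<And>x y. r x y \<le> a"
    and S: "AE x in Q. x \<in> S" "S \<subseteq> space Q" and r1: "\<And>x. x \<in> S \<Longrightarrow> (\<integral>y. r x y \<partial>\<mu>) \<le> 1"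
  defines "p \<equiv> \<lambda>y. (\<integral>x. r x y \<partial>Q)"
  shows "\<exists>x. (\<forall>i<k. x i \<in> S) \<and> (\<integral>y. ((\<Sum>i<k. r (x i) y) - real k * p y)\<^sup>2 \<partial>\<mu>) \<le> real k * a"
proof (induction k)
  case 0 show ?case by simp
next
  case (Suc k)
  then obtain x where xS: "\<And>i. i < k \<Longrightarrow> x i \<in> S"
    and x: "(\<integral>y. ((\<Sum>i<k. r (x i) y) - real k * p y)\<^sup>2 \<partial>\<mu>) \<le> real k * a" by auto
  interpret Q: prob_space Q by fact
  interpret M: prob_space \<mu> by fact
  interpret PP: pair_prob_space Q \<mu> ..
  have a0: "0 \<le> a" using order_trans[OF rb] .
  have rswap[measurable]: "(\<lambda>q. r (snd q) (fst q)) \<in> borel_measurable (\<mu> \<Otimes>\<^sub>M Q)"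
  proof -
    have "(\<lambda>q. (snd q, fst q)) \<in> measurable (\<mu> \<Otimes>\<^sub>M Q) (Q \<Otimes>\<^sub>M \<mu>)" by measurable
    from measurable_compose[OF this r] show ?thesis by simp
  qed
  have ry[measurable]: "(\<lambda>y. r x y) \<in> borel_measurable \<mu>" if "x \<in> space Q" for x
    using measurable_compose[OF measurable_Pair1'[OF that] r] by simp
  have rx[measurable]: "(\<lambda>x. r x y) \<in> borel_measurable Q" if "y \<in> space \<mu>" for y
    using measurable_compose[OF measurable_Pair1'[OF that] rswap] by simp
  have pm[measurable]: "p \<in> borel_measurable \<mu>"
    unfolding p_def by (rule Q.borel_measurable_lebesgue_integral) (simp add: case_prod_beta')
  have irx: "integrable Q (\<lambda>x. r x y)" if "y \<in> space \<mu>" for y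
    by (rule Q.integrable_const_bound[where B=a]) (use rb that in auto)
  have pb: "0 \<le> p y" "p y \<le> a" if y: "y \<in> space \<mu>" for y
  proof -
    show "0 \<le> p y" unfolding p_def using rb by simp
    have "p y \<le> (\<integral>x. a \<partial>Q)" unfolding p_def by (rule integral_mono[OF irx[OF y]]) (use rb in auto)
    then show "p y \<le> a" by (simp add: Q.prob_space)
  qed
  define D where "D y = (\<Sum>i<k. r (x i) y) - real k * p y" for y
  have Dm[measurable]: "D \<in> borel_measurable \<mu>"
    unfolding D_def using xS S(2) by (intro borel_measurable_diff borel_measurable_sum borel_measurable_times ry pm) auto
  have Db: "\<bar>D y\<bar> \<le> real k * a" if "y \<in> space \<mu>" for y
  proof -
    have "(\<Sum>i<k. r (x i) y) \<le> (\<Sum>i<k. a)" "0 \<le> (\<Sum>i<k. r (x i) y)" by (auto simp del: sum_constant intro!: sum_mono sum_nonneg rb)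
    moreover have "0 \<le> real k * p y" "real k * p y \<le> real k * a" using pb[OF that] by (auto intro: mult_left_mono)
    ultimately show ?thesis unfolding D_def by simp
  qed
  define f where "f x y = (D y + r x y - p y)\<^sup>2" for x y
  define Bd where "Bd = (real k * a + 2 * a)\<^sup>2"
  have fb: "\<bar>f x y\<bar> \<le> Bd" if "y \<in> space \<mu>" for x y
  proof -
    have "\<bar>D y + r x y - p y\<bar> \<le> real k * a + 2 * a"
      using Db[OF that] pb[OF that] rb[of x y] by linarith
    then have "\<bar>D y + r x y - p y\<bar>\<^sup>2 \<le> (real k * a + 2 * a)\<^sup>2" by (rule power_mono) simp
    then show ?thesis by (simp add: f_def Bd_def)
  qed
  have fm[measurable]: "(\<lambda>q. f (fst q) (snd q)) \<in> borel_measurable (Q \<Otimes>\<^sub>M \<mu>)"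
    unfolding f_def by measurable
  have fi: "integrable (Q \<Otimes>\<^sub>M \<mu>) (\<lambda>q. f (fst q) (snd q))"
    by (rule PP.P.integrable_const_bound[where B=Bd]) (auto intro!: AE_I2 fb simp: space_pair_measure)
  have r2i: "integrable (Q \<Otimes>\<^sub>M \<mu>) (\<lambda>q. (r (fst q) (snd q))\<^sup>2)"
  proof (rule PP.P.integrable_const_bound[where B="a\<^sup>2"])
    show "AE q in Q \<Otimes>\<^sub>M \<mu>. norm ((r (fst q) (snd q))\<^sup>2) \<le> a\<^sup>2"
      by (auto intro!: AE_I2 power_mono rb)
  qed measurable
  have Fub: "(\<integral>x. (\<integral>y. f x y \<partial>\<mu>) \<partial>Q) = (\<integral>y. (\<integral>x. f x y \<partial>Q) \<partial>\<mu>)"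
    using fi by (intro PP.Fubini_integral[symmetric]) (simp add: case_prod_beta')
  have Fub2: "(\<integral>x. (\<integral>y. (r x y)\<^sup>2 \<partial>\<mu>) \<partial>Q) = (\<integral>y. (\<integral>x. (r x y)\<^sup>2 \<partial>Q) \<partial>\<mu>)"
    using r2i by (intro PP.Fubini_integral[symmetric]) (simp add: case_prod_beta')
  have D2i: "integrable \<mu> (\<lambda>y. (D y)\<^sup>2)"
  proof (rule M.integrable_const_bound[where B="(real k * a)\<^sup>2"])
    show "AE y in \<mu>. norm ((D y)\<^sup>2) \<le> (real k * a)\<^sup>2"
      using power_mono[OF Db abs_ge_zero, of _ 2] by (auto intro!: AE_I2)
  qed measurable
  have r2iy: "integrable \<mu> (\<lambda>y. \<integral>x. (r x y)\<^sup>2 \<partial>Q)"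
    using PP.integrable_snd[of "\<lambda>x y. (r x y)\<^sup>2"] r2i by (simp add: case_prod_beta')
  \<comment> \<open>The mean of \<open>r x y\<close> over x is \<open>p y\<close>, so the mixed
    terms combine to a negative square: on average a new codeword adds at most the second moment of
    \<open>r\<close>.\<close>
  have inner: "(\<integral>x. f x y \<partial>Q) \<le> (D y)\<^sup>2 + (\<integral>x. (r x y)\<^sup>2 \<partial>Q)" if y: "y \<in> space \<mu>" for y
  proof -
    have i1: "integrable Q (\<lambda>x. r x y)" by (rule irx[OF y])
    have i2: "integrable Q (\<lambda>x. (r x y)\<^sup>2)"
    proof (rule Q.integrable_const_bound[where B="a\<^sup>2"])
      show "AE x in Q. norm ((r x y)\<^sup>2) \<le> a\<^sup>2" by (auto intro!: AE_I2 power_mono rb)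
      show "(\<lambda>x. (r x y)\<^sup>2) \<in> borel_measurable Q" using rx[OF y] by measurable
    qed
    have "(\<integral>x. f x y \<partial>Q) = (\<integral>x. (D y - p y)\<^sup>2 + 2 * (D y - p y) * r x y + (r x y)\<^sup>2 \<partial>Q)"
      unfolding f_def by (intro Bochner_Integration.integral_cong) (auto simp: power2_eq_square algebra_simps)
    also have "\<dots> = (D y - p y)\<^sup>2 + 2 * (D y - p y) * p y + (\<integral>x. (r x y)\<^sup>2 \<partial>Q)"
      using i1 i2 by (simp add: Q.prob_space p_def)
    also have "\<dots> = (D y)\<^sup>2 - (p y)\<^sup>2 + (\<integral>x. (r x y)\<^sup>2 \<partial>Q)" by (simp add: power2_eq_square algebra_simps)
    finally show ?thesis by simp
  qed
  \<comment> \<open>As \<open>r\<close> lies between 0 and a, its square is at most a r, and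
    \<open>r\<close> has mean at most 1 over y.\<close>
  have "(\<integral>x. (\<integral>y. (r x y)\<^sup>2 \<partial>\<mu>) \<partial>Q) \<le> (\<integral>x. a \<partial>Q)"
  proof (rule integral_mono_AE)
    show "integrable Q (\<lambda>x. \<integral>y. (r x y)\<^sup>2 \<partial>\<mu>)"
      using PP.integrable_fst[of "\<lambda>x y. (r x y)\<^sup>2"] r2i by (simp add: case_prod_beta')
    show "AE x in Q. (\<integral>y. (r x y)\<^sup>2 \<partial>\<mu>) \<le> a"
      using S(1)
    proof eventually_elim
      case (elim x)
      then have xs: "x \<in> space Q" using S(2) by auto
      have i1: "integrable \<mu> (\<lambda>y. r x y)"
        by (rule M.integrable_const_bound[where B=a]) (use rb ry[OF xs] in auto)
      have "(\<integral>y. (r x y)\<^sup>2 \<partial>\<mu>) \<le> (\<integral>y. a * r x y \<partial>\<mu>)"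
      proof (rule integral_mono)
        show "integrable \<mu> (\<lambda>y. (r x y)\<^sup>2)"
        proof (rule M.integrable_const_bound[where B="a\<^sup>2"])
          show "AE y in \<mu>. norm ((r x y)\<^sup>2) \<le> a\<^sup>2" by (auto intro!: AE_I2 power_mono rb)
          show "(\<lambda>y. (r x y)\<^sup>2) \<in> borel_measurable \<mu>" using ry[OF xs] by measurable
        qed
        show "(r x y)\<^sup>2 \<le> a * r x y" for y using rb[of x y] by (simp add: power2_eq_square mult_right_mono)
      qed (use i1 in auto)
      also have "\<dots> = a * (\<integral>y. r x y \<partial>\<mu>)" by simp
      also have "\<dots> \<le> a * 1" using r1[OF elim] a0 by (rule mult_left_mono)
      finally show ?case by simp
    qed
  qed auto
  then have r2: "(\<integral>y. (\<integral>x. (r x y)\<^sup>2 \<partial>Q) \<partial>\<mu>) \<le> a" using Fub2 by (simp add: Q.prob_space)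
  have "(\<integral>x. (\<integral>y. f x y \<partial>\<mu>) \<partial>Q) \<le> (\<integral>y. (D y)\<^sup>2 + (\<integral>x. (r x y)\<^sup>2 \<partial>Q) \<partial>\<mu>)"
    unfolding Fub
  proof (rule integral_mono)
    show "integrable \<mu> (\<lambda>y. \<integral>x. f x y \<partial>Q)"
      using PP.integrable_snd[of f] fi by (simp add: case_prod_beta')
  qed (use D2i r2iy inner in auto)
  also have "\<dots> = (\<integral>y. (D y)\<^sup>2 \<partial>\<mu>) + (\<integral>y. (\<integral>x. (r x y)\<^sup>2 \<partial>Q) \<partial>\<mu>)" using D2i r2iy by simp
  also have "\<dots> \<le> real k * a + a" using x r2 by (simp add: D_def)
  finally have "(\<integral>x. (\<integral>y. f x y \<partial>\<mu>) \<partial>Q) \<le> real (Suc k) * a" by (simp add: distrib_right)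
  moreover have "integrable Q (\<lambda>x. \<integral>y. f x y \<partial>\<mu>)"
    using PP.integrable_fst[of f] fi by (simp add: case_prod_beta')
  ultimately obtain x' where x': "x' \<in> S" "(\<integral>y. f x' y \<partial>\<mu>) \<le> real (Suc k) * a"
    using exists_le_integral[OF Q _ S(1)] by blast
  have "(\<Sum>i<Suc k. r ((x(k := x')) i) y) - real (Suc k) * p y = D y + r x' y - p y" for y
  proof -
    have "(\<Sum>i<k. r ((x(k := x')) i) y) = (\<Sum>i<k. r (x i) y)" by (intro sum.cong) auto
    then show ?thesis by (simp add: D_def algebra_simps)
  qed
  then have "(\<integral>y. ((\<Sum>i<Suc k. r ((x(k := x')) i) y) - real (Suc k) * p y)\<^sup>2 \<partial>\<mu>) \<le> real (Suc k) * a"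
    using x'(2) by (simp only: f_def)
  moreover have "\<forall>i<Suc k. (x(k := x')) i \<in> S" using xS x'(1) by (auto simp: less_Suc_eq)
  ultimately show ?case by blast
qed

context anwgn
begin

lemma measure_W_measurable:
  assumes "A \<in> sets (Rn n)"
  shows "(\<lambda>x. measure (W \<gamma> n x) A) \<in> borel_measurable (Rn n)"
  using emeasure_W_measurable'[OF assms] unfolding measure_def by measurable

text \<open>The likelihood ratio of W(.|x) to q is cut off at a, which costs mass at most \<epsilon>
  for every admissible input, hence for the true output as well as for the code average. For the
  bounded remainder \<open>greedy_cover\<close> gives squared deviation m a, and Cauchy-Schwarz
  turns it into an event-wise bound sqrt(a/m).\<close>

lemma soft_covering:
  assumes ad: "admissible_input n P Q"
    and q[measurable]: "q \<in> borel_measurable (Rn n)" and q0: "\<And>y. 0 \<le> q y" and q1: "(\<integral>\<^sup>+y. ennreal (q y) \<partial>Rn n) = 1"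
    and a: "a > 0" and m: "m \<ge> 1"
    and tail: "\<And>x. x \<in> costset n P \<Longrightarrow> measure (W \<gamma> n x) {y \<in> space (Rn n). a * q y < gdens \<gamma> n (\<lambda>i. y i - x i)} \<le> \<epsilon>"
  shows "\<exists>\<phi>. (\<forall>i\<in>{1..m}. \<phi> i \<in> costset n P) \<and> res_dist \<gamma> n Q m \<phi> \<le> 2 * (sqrt (a / real m) + \<epsilon>)"
proof -
  have Qp: "prob_space Q" "sets Q = sets (Rn n)" "emeasure Q (costset n P) = 1"
    using ad by (auto simp: admissible_input_def)
  interpret Q: prob_space Q by fact
  note Qp(2)[measurable_cong, simp]
  have spQ[simp]: "space Q = space (Rn n)" by (rule sets_eq_imp_space_eq) simp
  define \<mu> where "\<mu> = density (Rn n) (\<lambda>y. ennreal (q y))"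
  have s\<mu>[simp, measurable_cong]: "sets \<mu> = sets (Rn n)" by (simp add: \<mu>_def)
  have sp\<mu>[simp]: "space \<mu> = space (Rn n)" by (simp add: \<mu>_def)
  have \<mu>p: "prob_space \<mu>"
  proof
    show "emeasure \<mu> (space \<mu>) = 1"
      unfolding \<mu>_def by (subst emeasure_density) (auto simp: q1[symmetric] intro!: nn_integral_cong)
  qed
  interpret M: prob_space \<mu> by fact
  define w where "w x y = gdens \<gamma> n (\<lambda>i. y i - x i)" for x y
  have w0: "0 \<le> w x y" for x y by (simp add: w_def gdens_nonneg)
  have wy[measurable]: "w x \<in> borel_measurable (Rn n)" for x unfolding w_def by measurable
  \<comment> \<open>Where q vanishes, the condition forces w = 0 and the quotient takes the value 0,
    so q r = w holds on the whole region where w is at most a q.\<close>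
  define r where "r x y = (if w x y \<le> a * q y then w x y / q y else 0)" for x y
  have rb: "0 \<le> r x y" "r x y \<le> a" for x y
    using w0[of x y] q0[of y] a by (auto simp: r_def divide_le_eq)
  have rpair: "(\<lambda>p. r (fst p) (snd p)) \<in> borel_measurable (Rn n \<Otimes>\<^sub>M Rn n)"
    unfolding r_def w_def by measurable
  have rm[measurable]: "(\<lambda>p. r (fst p) (snd p)) \<in> borel_measurable (Q \<Otimes>\<^sub>M \<mu>)"
  proof -
    have "borel_measurable (Q \<Otimes>\<^sub>M \<mu>) = borel_measurable (Rn n \<Otimes>\<^sub>M Rn n)"
      by (intro measurable_cong_sets sets_pair_measure_cong) auto
    then show ?thesis using rpair by simp
  qed
  have ry[measurable]: "r x \<in> borel_measurable (Rn n)" for x unfolding r_def by measurable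
  have AES: "AE x in Q. x \<in> costset n P"
    using Qp(3) by (intro Q.AE_prob_1) (simp add: Q.emeasure_eq_measure)
  define b where "b B x = (\<integral>y. r x y * indicator B y \<partial>\<mu>)" for B x
  have rqw: "ennreal (q y) * ennreal (r x y) = ennreal (w x y) * indicator {y \<in> space (Rn n). w x y \<le> a * q y} y" if "y \<in> space (Rn n)" for x y
  proof (cases "w x y \<le> a * q y")
    case True
    then have "q y * r x y = w x y" using q0[of y] w0[of x y] by (cases "q y = 0") (auto simp: r_def)
    then show ?thesis using True that q0[of y] rb(1)[of x y] by (simp add: ennreal_mult[symmetric])
  next
    case False then show ?thesis by (simp add: r_def)
  qed
  have ib: "integrable \<mu> (\<lambda>y. r x y * indicator B y)" if [measurable]: "B \<in> sets (Rn n)" for x B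
  proof (rule M.integrable_const_bound[where B=a])
    show "AE y in \<mu>. norm (r x y * indicator B y) \<le> a"
      using rb a by (auto simp: indicator_def)
  qed measurable
  have b_eq: "ennreal (b B x) = (\<integral>\<^sup>+y. ennreal (w x y) * indicator {y \<in> B. w x y \<le> a * q y} y \<partial>Rn n)"
    if B[measurable]: "B \<in> sets (Rn n)" for B x
  proof -
    have "ennreal (b B x) = (\<integral>\<^sup>+y. ennreal (r x y * indicator B y) \<partial>\<mu>)"
      unfolding b_def by (rule nn_integral_eq_integral[symmetric, OF ib[OF B]]) (use rb in auto)
    also have "\<dots> = (\<integral>\<^sup>+y. ennreal (q y) * ennreal (r x y * indicator B y) \<partial>Rn n)"
      unfolding \<mu>_def by (rule nn_integral_density) measurable
    also have "\<dots> = (\<integral>\<^sup>+y. ennreal (w x y) * indicator {y \<in> B. w x y \<le> a * q y} y \<partial>Rn n)"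
    proof (rule nn_integral_cong)
      fix y assume "y \<in> space (Rn n)"
      from rqw[OF this, of x] show "ennreal (q y) * ennreal (r x y * indicator B y) = ennreal (w x y) * indicator {y \<in> B. w x y \<le> a * q y} y"
        using \<open>y \<in> space (Rn n)\<close> by (auto simp: indicator_def)
    qed
    finally show ?thesis .
  qed
  have b0: "0 \<le> b B x" for B x unfolding b_def using rb by simp
  have split: "b B x \<le> measure (W \<gamma> n x) B \<and> measure (W \<gamma> n x) B \<le> b B x + \<epsilon>"
    if x: "x \<in> costset n P" and B[measurable]: "B \<in> sets (Rn n)" for x B
  proof -
    interpret Wx: prob_space "W \<gamma> n x" by (rule prob_W)
    let ?E = "{y \<in> space (Rn n). a * q y < w x y}"
    have Em[measurable]: "?E \<in> sets (Rn n)" by measurable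
    have Bm: "{y \<in> B. w x y \<le> a * q y} \<in> sets (Rn n)"
    proof -
      have "{y \<in> B. w x y \<le> a * q y} = B - ?E" using sets.sets_into_space[OF B] by auto
      then show ?thesis by simp
    qed
    have bW: "ennreal (b B x) = emeasure (W \<gamma> n x) {y \<in> B. w x y \<le> a * q y}"
      unfolding b_eq[OF B] emeasure_W[OF Bm] by (simp add: w_def)
    then have bW': "b B x = measure (W \<gamma> n x) {y \<in> B. w x y \<le> a * q y}"
      by (simp add: Wx.emeasure_eq_measure b0)
    have 1: "measure (W \<gamma> n x) {y \<in> B. w x y \<le> a * q y} \<le> measure (W \<gamma> n x) B"
      by (rule Wx.finite_measure_mono) auto
    have "measure (W \<gamma> n x) B \<le> measure (W \<gamma> n x) ({y \<in> B. w x y \<le> a * q y} \<union> ?E)"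
      using sets.sets_into_space[OF B] Bm by (intro Wx.finite_measure_mono) auto
    also have "\<dots> \<le> measure (W \<gamma> n x) {y \<in> B. w x y \<le> a * q y} + measure (W \<gamma> n x) ?E"
      using Bm by (intro measure_Un_le) auto
    finally show ?thesis using 1 tail[OF x] by (simp add: bW' w_def)
  qed
  have r1: "(\<integral>y. r x y \<partial>\<mu>) \<le> 1" if x: "x \<in> costset n P" for x
  proof -
    interpret Wx: prob_space "W \<gamma> n x" by (rule prob_W)
    have "(\<integral>y. r x y \<partial>\<mu>) = b (space (Rn n)) x"
      unfolding b_def by (rule Bochner_Integration.integral_cong) auto
    also have "\<dots> \<le> measure (W \<gamma> n x) (space (Rn n))" using split[OF x, of "space (Rn n)"] by simp
    also have "\<dots> \<le> 1" by (rule Wx.prob_le_1)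
    finally show ?thesis .
  qed
  define p where "p y = (\<integral>x. r x y \<partial>Q)" for y
  have cS: "costset n P \<subseteq> space Q" by (auto simp: costset_def)
  obtain x where xS: "\<And>i. i < m \<Longrightarrow> x i \<in> costset n P"
    and x: "(\<integral>y. ((\<Sum>i<m. r (x i) y) - real m * p y)\<^sup>2 \<partial>\<mu>) \<le> real m * a"
    using greedy_cover[OF Qp(1) \<mu>p rm rb AES cS r1, of m] unfolding p_def by blast
  \<comment> \<open>Codebooks are indexed from 1, the greedy sequence from 0.\<close>
  define \<phi> where "\<phi> i = x (i - 1)" for i
  have \<phi>: "\<forall>i\<in>{1..m}. \<phi> i \<in> costset n P" using xS by (auto simp: \<phi>_def)
  define D where "D y = (\<Sum>i<m. r (x i) y) - real m * p y" for y
  interpret PP: pair_prob_space Q \<mu> ..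
  have pm[measurable]: "p \<in> borel_measurable \<mu>"
  proof -
    have "(\<lambda>q. (snd q, fst q)) \<in> measurable (\<mu> \<Otimes>\<^sub>M Q) (Q \<Otimes>\<^sub>M \<mu>)" by measurable
    from measurable_compose[OF this rm] show ?thesis
      unfolding p_def by (intro Q.borel_measurable_lebesgue_integral) (simp add: case_prod_beta')
  qed
  have pb: "0 \<le> p y" "p y \<le> a" if "y \<in> space \<mu>" for y
  proof -
    show "0 \<le> p y" unfolding p_def using rb by simp
    have "(\<lambda>x. r x y) \<in> borel_measurable Q"
    proof -
      have "(\<lambda>x. r (fst (x, y)) (snd (x, y))) \<in> borel_measurable (Rn n)"
        by (rule measurable_compose[OF measurable_Pair2' rpair]) (use that in simp)
      then show ?thesis by simp
    qed
    then have "integrable Q (\<lambda>x. r x y)" by (intro Q.integrable_const_bound[where B=a]) (use rb in auto)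
    then have "p y \<le> (\<integral>x. a \<partial>Q)" unfolding p_def by (rule integral_mono) (use rb in auto)
    then show "p y \<le> a" by (simp add: Q.prob_space[unfolded spQ])
  qed
  have Dm[measurable]: "D \<in> borel_measurable \<mu>" unfolding D_def by measurable
  have Db: "\<bar>D y\<bar> \<le> real m * a" if "y \<in> space \<mu>" for y
  proof -
    have "(\<Sum>i<m. r (x i) y) \<le> (\<Sum>i<m. a)" "0 \<le> (\<Sum>i<m. r (x i) y)" by (auto simp del: sum_constant intro!: sum_mono sum_nonneg rb)
    moreover have "0 \<le> real m * p y" "real m * p y \<le> real m * a" using pb[OF that] by (auto intro: mult_left_mono)
    ultimately show ?thesis unfolding D_def by simp
  qed
  have iD: "integrable \<mu> (\<lambda>y. \<bar>D y\<bar>)"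
    by (rule M.integrable_const_bound[where B="real m * a"]) (auto intro!: AE_I2 Db[unfolded sp\<mu>])
  have iD2: "integrable \<mu> (\<lambda>y. \<bar>D y\<bar>\<^sup>2)"
  proof (rule M.integrable_const_bound[where B="(real m * a)\<^sup>2"])
    show "AE y in \<mu>. norm (\<bar>D y\<bar>\<^sup>2) \<le> (real m * a)\<^sup>2"
      using power_mono[OF Db abs_ge_zero, of _ 2] by (auto intro!: AE_I2)
  qed measurable
  have D1: "(\<integral>y. \<bar>D y\<bar> \<partial>\<mu>) \<le> sqrt (real m * a)"
    using square_integral_le[OF \<mu>p iD iD2] x by (intro real_le_rsqrt) (simp add: D_def)
  have Bd: "\<bar>outp \<gamma> n Q B - (\<Sum>i\<in>{1..m}. measure (W \<gamma> n (\<phi> i)) B) / real m\<bar> \<le> sqrt (a / real m) + \<epsilon>"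
    if B[measurable]: "B \<in> sets (Rn n)" for B
  proof -
    have m0: "real m > 0" using m by simp
    have rBm: "(\<lambda>q. r (fst q) (snd q) * indicator B (snd q)) \<in> borel_measurable (Q \<Otimes>\<^sub>M \<mu>)" by measurable
    have irB: "integrable (Q \<Otimes>\<^sub>M \<mu>) (\<lambda>q. r (fst q) (snd q) * indicator B (snd q))"
      by (rule PP.P.integrable_const_bound[OF _ rBm, where B=a]) (use rb a in \<open>auto simp: indicator_def\<close>)
    have ibQ: "integrable Q (b B)"
      unfolding b_def using PP.integrable_fst[of "\<lambda>x y. r x y * indicator B y"] irB by (simp add: case_prod_beta')
    have mW: "(\<lambda>x. measure (W \<gamma> n x) B) \<in> borel_measurable Q"
      using measure_W_measurable[OF B] by (simp cong: measurable_cong_sets)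
    have iW: "integrable Q (\<lambda>x. measure (W \<gamma> n x) B)"
    proof (rule Q.integrable_const_bound[where B=1])
      show "AE x in Q. norm (measure (W \<gamma> n x) B) \<le> 1"
        using prob_space.prob_le_1[OF prob_W] by simp
    qed (rule mW)
    have lo: "(\<integral>x. b B x \<partial>Q) \<le> outp \<gamma> n Q B"
      unfolding outp_def using AES split[OF _ B] by (intro integral_mono_AE ibQ iW) (auto elim!: eventually_mono)
    have "outp \<gamma> n Q B \<le> (\<integral>x. b B x + \<epsilon> \<partial>Q)"
      unfolding outp_def using AES split[OF _ B] ibQ by (intro integral_mono_AE iW) (auto elim!: eventually_mono)
    then have hi: "outp \<gamma> n Q B \<le> (\<integral>x. b B x \<partial>Q) + \<epsilon>" using ibQ by (simp add: Q.prob_space[unfolded spQ])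
    have re: "(\<Sum>i\<in>{1..m}. h (\<phi> i)) = (\<Sum>i<m. h (x i))" for h :: "_ \<Rightarrow> real"
      unfolding \<phi>_def by (rule sum.reindex_bij_witness[of _ Suc "\<lambda>i. i - 1"]) auto
    have lo2: "(\<Sum>i<m. b B (x i)) \<le> (\<Sum>i<m. measure (W \<gamma> n (x i)) B)"
      by (rule sum_mono) (use split[OF xS B] in auto)
    have "(\<Sum>i<m. measure (W \<gamma> n (x i)) B) \<le> (\<Sum>i<m. b B (x i) + \<epsilon>)"
      by (rule sum_mono) (use split[OF xS B] in auto)
    then have hi2: "(\<Sum>i<m. measure (W \<gamma> n (x i)) B) \<le> (\<Sum>i<m. b B (x i)) + real m * \<epsilon>" by (simp add: sum.distrib)
    have "real m * (\<integral>x. b B x \<partial>Q) - (\<Sum>i<m. b B (x i)) = - (\<integral>y. D y * indicator B y \<partial>\<mu>)"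
    proof -
      have "(\<integral>x. b B x \<partial>Q) = (\<integral>y. (\<integral>x. r x y * indicator B y \<partial>Q) \<partial>\<mu>)"
        unfolding b_def using irB by (intro PP.Fubini_integral[symmetric]) (simp add: case_prod_beta')
      also have "\<dots> = (\<integral>y. p y * indicator B y \<partial>\<mu>)" by (simp add: p_def)
      finally have 1: "(\<integral>x. b B x \<partial>Q) = (\<integral>y. p y * indicator B y \<partial>\<mu>)" .
      have ip: "integrable \<mu> (\<lambda>y. p y * indicator B y)"
      proof (rule M.integrable_const_bound[where B=a])
        show "AE y in \<mu>. norm (p y * indicator B y) \<le> a"
          using pb a by (auto intro!: AE_I2 simp: indicator_def)
      qed measurable
      have "(\<integral>y. D y * indicator B y \<partial>\<mu>) = (\<integral>y. (\<Sum>i<m. r (x i) y * indicator B y) - real m * (p y * indicator B y) \<partial>\<mu>)"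
        by (intro Bochner_Integration.integral_cong) (auto simp: D_def left_diff_distrib sum_distrib_right)
      also have "\<dots> = (\<Sum>i<m. b B (x i)) - real m * (\<integral>y. p y * indicator B y \<partial>\<mu>)"
      proof -
        have "(\<integral>y. (\<Sum>i<m. r (x i) y * indicator B y) - real m * (p y * indicator B y) \<partial>\<mu>)
          = (\<integral>y. (\<Sum>i<m. r (x i) y * indicator B y) \<partial>\<mu>) - (\<integral>y. real m * (p y * indicator B y) \<partial>\<mu>)"
          by (intro Bochner_Integration.integral_diff Bochner_Integration.integrable_sum integrable_mult_right ip ib[OF B])
        also have "(\<integral>y. (\<Sum>i<m. r (x i) y * indicator B y) \<partial>\<mu>) = (\<Sum>i<m. b B (x i))"
          unfolding b_def by (rule Bochner_Integration.integral_sum) (rule ib[OF B])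
        finally show ?thesis by simp
      qed
      finally show ?thesis using 1 by simp
    qed
    then have "\<bar>real m * (\<integral>x. b B x \<partial>Q) - (\<Sum>i<m. b B (x i))\<bar> = \<bar>\<integral>y. D y * indicator B y \<partial>\<mu>\<bar>" by simp
    also have "\<dots> \<le> (\<integral>y. \<bar>D y * indicator B y\<bar> \<partial>\<mu>)" by (rule integral_abs_bound)
    also have "\<dots> \<le> (\<integral>y. \<bar>D y\<bar> \<partial>\<mu>)"
    proof (rule integral_mono[OF _ iD])
      show "integrable \<mu> (\<lambda>y. \<bar>D y * indicator B y\<bar>)"
        by (rule Bochner_Integration.integrable_bound[OF iD]) (auto simp: indicator_def)
      show "\<bar>D y * indicator B y\<bar> \<le> \<bar>D y\<bar>" for y by (auto simp: indicator_def)
    qed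
    also have "\<dots> \<le> sqrt (real m * a)" by (rule D1)
    finally have core: "\<bar>real m * (\<integral>x. b B x \<partial>Q) - (\<Sum>i<m. b B (x i))\<bar> \<le> sqrt (real m * a)" .
    have sq: "sqrt (real m * a) = real m * sqrt (a / real m)"
      using m0 a by (simp add: real_sqrt_mult real_sqrt_divide) (simp add: real_div_sqrt field_simps)
    have o1: "real m * (\<integral>x. b B x \<partial>Q) \<le> real m * outp \<gamma> n Q B" using lo m0 by simp
    have o2: "real m * outp \<gamma> n Q B \<le> real m * (\<integral>x. b B x \<partial>Q) + real m * \<epsilon>"
      using mult_left_mono[OF hi, of "real m"] m0 by (simp add: distrib_left)
    have "\<bar>real m * outp \<gamma> n Q B - (\<Sum>i<m. measure (W \<gamma> n (x i)) B)\<bar> \<le> real m * sqrt (a / real m) + real m * \<epsilon>"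
      using core lo2 hi2 o1 o2 unfolding sq by linarith
    moreover have "outp \<gamma> n Q B - (\<Sum>i\<in>{1..m}. measure (W \<gamma> n (\<phi> i)) B) / real m
      = (real m * outp \<gamma> n Q B - (\<Sum>i<m. measure (W \<gamma> n (x i)) B)) / real m"
      using m0 unfolding re[of "\<lambda>z. measure (W \<gamma> n z) B"] by (simp add: diff_divide_distrib)
    moreover have "\<bar>X / c\<bar> \<le> s + t" if "\<bar>X\<bar> \<le> c * s + c * t" "c > 0" for X c s t :: real
      using that by (simp add: pos_divide_le_eq algebra_simps)
    ultimately show ?thesis using m0 by presburger
  qed
  have "(SUP B\<in>sets (Rn n). \<bar>outp \<gamma> n Q B - (\<Sum>i\<in>{1..m}. measure (W \<gamma> n (\<phi> i)) B) / real m\<bar>) \<le> sqrt (a / real m) + \<epsilon>"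
    by (rule cSUP_least) (use Bd in auto)
  then have "res_dist \<gamma> n Q m \<phi> \<le> 2 * (sqrt (a / real m) + \<epsilon>)" by (simp add: res_dist_def)
  with \<phi> show ?thesis by blast
qed

text \<open>With d = e/4 the tail and the square root contribute at most d each, doubled by the
  factor 2 in the distance. The threshold is common to all input laws because the comparison density
  is.\<close>

lemma resolvability_uniform:
  assumes e: "e > 0"
  shows "\<exists>N. \<forall>n\<ge>N. \<forall>Q m. admissible_input n P Q \<longrightarrow> exp (real n * (cap + e)) \<le> real m \<longrightarrow>
    (\<exists>\<phi>. (\<forall>i\<in>{1..m}. \<phi> i \<in> costset n P) \<and> res_dist \<gamma> n Q m \<phi> \<le> e)"
proof -
  define d where "d = e / 4"
  have d: "d > 0" using e by (simp add: d_def)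
  obtain N1 where N1: "\<And>n. n \<ge> N1 \<Longrightarrow> \<exists>q. q \<in> borel_measurable (Rn n) \<and> (\<forall>y. 0 \<le> q y) \<and> (\<integral>\<^sup>+y. ennreal (q y) \<partial>Rn n) = 1 \<and>
    (\<forall>x\<in>costset n P. measure (W \<gamma> n x)
       {y \<in> space (Rn n). exp (real n * (cap + d)) * q y < gdens \<gamma> n (\<lambda>i. y i - x i)} \<le> d)"
    using converse_density[OF d] by blast
  obtain N2 :: nat where N2: "1 / (d\<^sup>2 * (e - d)) \<le> real N2" using real_arch_simple by blast
  show ?thesis
  proof (intro exI[of _ "Suc (N1 + N2)"] allI impI)
    fix n Q m assume n: "Suc (N1 + N2) \<le> n" and ad: "admissible_input n P Q" and m: "exp (real n * (cap + e)) \<le> real m"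
    have m1: "m \<ge> 1" using m exp_gt_zero[of "real n * (cap + e)"] by (cases m) auto
    have "N1 \<le> n" using n by simp
    from N1[OF this] obtain q where q: "q \<in> borel_measurable (Rn n)" "\<And>y. 0 \<le> q y" "(\<integral>\<^sup>+y. ennreal (q y) \<partial>Rn n) = 1"
      "\<And>x. x \<in> costset n P \<Longrightarrow> measure (W \<gamma> n x)
       {y \<in> space (Rn n). exp (real n * (cap + d)) * q y < gdens \<gamma> n (\<lambda>i. y i - x i)} \<le> d" by blast
    obtain \<phi> where \<phi>: "\<forall>i\<in>{1..m}. \<phi> i \<in> costset n P" "res_dist \<gamma> n Q m \<phi> \<le> 2 * (sqrt (exp (real n * (cap + d)) / real m) + d)"
      using soft_covering[OF ad q(1,2,3) exp_gt_zero m1 q(4)] by blast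
    have ed: "e - d > 0" using e by (simp add: d_def)
    have "exp (real n * (cap + d)) / real m \<le> exp (real n * (cap + d)) / exp (real n * (cap + e))"
      using m by (intro divide_left_mono) (auto intro!: mult_pos_pos less_le_trans[OF exp_gt_zero m])
    also have "\<dots> = exp (- (real n * (e - d)))" by (simp add: exp_diff[symmetric] algebra_simps)
    also have "\<dots> \<le> d\<^sup>2"
    proof -
      have "1 / d\<^sup>2 \<le> real n * (e - d)"
      proof -
        have "1 / d\<^sup>2 = 1 / (d\<^sup>2 * (e - d)) * (e - d)" using ed by simp
        also have "\<dots> \<le> real n * (e - d)" using N2 n ed by (intro mult_right_mono) auto
        finally show ?thesis .
      qed
      also have "\<dots> \<le> exp (real n * (e - d))" using exp_ge_add_one_self[of "real n * (e - d)"] by linarith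
      finally have "1 \<le> d\<^sup>2 * exp (real n * (e - d))" using d by (simp add: field_simps)
      moreover have "exp (- x) \<le> c" if "1 \<le> c * exp x" for c x :: real
        using that by (simp add: exp_minus inverse_eq_divide pos_divide_le_eq[OF exp_gt_zero])
      ultimately show ?thesis by blast
    qed
    finally have "sqrt (exp (real n * (cap + d)) / real m) \<le> sqrt (d\<^sup>2)" by (rule real_sqrt_le_mono)
    then have "sqrt (exp (real n * (cap + d)) / real m) \<le> d" using d by simp
    then have "res_dist \<gamma> n Q m \<phi> \<le> e" using \<phi>(2) by (simp add: d_def)
    with \<phi>(1) show "\<exists>\<phi>. (\<forall>i\<in>{1..m}. \<phi> i \<in> costset n P) \<and> res_dist \<gamma> n Q m \<phi> \<le> e" by blast
  qed
qed

end

section \<open>Transmission\<close>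

text \<open>Taking for \<open>\<kappa> n\<close> the largest k up to n whose threshold has been
  passed makes k grow as slowly as necessary. Vanishing error is obtained in this way from
  arbitrarily small fixed errors.\<close>

lemma diagonal_sequence:
  assumes "\<And>k::nat. \<exists>N::nat. \<forall>n\<ge>N. Pr n k"
  obtains \<kappa> N where "filterlim \<kappa> at_top sequentially" "\<And>n. n \<ge> N \<Longrightarrow> Pr n (\<kappa> n :: nat)"
proof -
  from assms obtain N where N: "\<And>k n. n \<ge> N k \<Longrightarrow> Pr n k" by metis
  define A where "A n = {k. k \<le> n \<and> N k \<le> n}" for n
  have fin: "finite (A n)" for n by (rule finite_subset[of _ "{..n}"]) (auto simp: A_def)
  define \<kappa> where "\<kappa> n = Max (A n)" for n
  have ne: "A n \<noteq> {}" if "n \<ge> N 0" for n using that by (auto simp: A_def)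
  show ?thesis
  proof (rule that[of \<kappa> "N 0"])
    show "filterlim \<kappa> at_top sequentially"
      unfolding filterlim_at_top eventually_sequentially
    proof (intro allI)
      fix K :: nat
      show "\<exists>N'. \<forall>n\<ge>N'. K \<le> \<kappa> n"
        by (intro exI[of _ "max K (N K)"] allI impI) (auto simp: \<kappa>_def A_def intro!: Max_ge fin[unfolded A_def])
    qed
    fix n assume "n \<ge> N 0"
    then have "\<kappa> n \<in> A n" unfolding \<kappa>_def by (intro Max_in fin ne)
    then show "Pr n (\<kappa> n)" by (intro N) (simp add: A_def)
  qed
qed

lemma limsup_ereal_le_zero:
  fixes f :: "nat \<Rightarrow> real"
  assumes "filterlim \<kappa> at_top sequentially" and "\<And>n. n \<ge> N \<Longrightarrow> f n \<le> c / real (Suc (\<kappa> n))"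
  shows "limsup (\<lambda>n. ereal (f n)) \<le> 0"
proof -
  have "(\<lambda>k. c / real (Suc k)) \<longlonglongrightarrow> 0" using LIMSEQ_Suc[OF lim_const_over_n[of c]] by simp
  then have "(\<lambda>n. c / real (Suc (\<kappa> n))) \<longlonglongrightarrow> 0" using assms(1) by (rule filterlim_compose)
  then have l: "(\<lambda>n. ereal (c / real (Suc (\<kappa> n)))) \<longlonglongrightarrow> ereal 0" by (intro tendsto_intros)
  have "limsup (\<lambda>n. ereal (f n)) \<le> limsup (\<lambda>n. ereal (c / real (Suc (\<kappa> n))))"
    by (rule Limsup_mono) (use assms(2) in \<open>auto simp: eventually_sequentially\<close>)
  also have "\<dots> = ereal 0" by (rule lim_imp_Limsup[OF _ l]) simp
  finally show ?thesis by (simp add: zero_ereal_def)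
qed

lemma liminf_ereal_ge:
  fixes f :: "nat \<Rightarrow> real"
  assumes "\<And>n. n \<ge> N \<Longrightarrow> R \<le> f n"
  shows "ereal R \<le> liminf (\<lambda>n. ereal (f n))"
  by (rule Liminf_bounded) (use assms in \<open>auto simp: eventually_sequentially\<close>)

lemma zero_in_costset:
  assumes "P > 0" shows "(\<lambda>i\<in>{..<n}. 0) \<in> costset n P"
proof -
  have "(\<Sum>i<n. ((\<lambda>i\<in>{..<n}. 0 :: real) i)\<^sup>2) = 0" by (intro sum.neutral) auto
  then show ?thesis using assms by (auto simp: costset_def space_Rn)
qed

context anwgn
begin

lemma trivial_tcode: "tcode n 1 P (\<lambda>_. \<lambda>i\<in>{..<n}. 0) (\<lambda>_. 1)" "terr \<gamma> n 1 (\<lambda>_. \<lambda>i\<in>{..<n}. 0) (\<lambda>_. 1) = 0"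
  using zero_in_costset[OF P] by (auto simp: tcode_def terr_def)

lemma tcode_of_family:
  assumes m: "m \<ge> 1" and x: "\<And>i. i < m \<Longrightarrow> x i \<in> costset n P" and D: "\<And>i. i < m \<Longrightarrow> D i \<in> sets (Rn n)"
    and W: "\<And>i. i < m \<Longrightarrow> 1 - e \<le> measure (W \<gamma> n (x i)) (D i)" and dis: "disjoint_family_on D {..<m}"
  shows "\<exists>\<phi> \<psi>. tcode n m P \<phi> \<psi> \<and> terr \<gamma> n m \<phi> \<psi> \<le> e"
proof -
  have uniq: "i = j" if "i < m" "j < m" "y \<in> D i" "y \<in> D j" for i j y
    using dis that unfolding disjoint_family_on_def by blast
  define V where "V = (\<Union>i<m. D i)"
  have V: "V \<in> sets (Rn n)" unfolding V_def using D by auto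
  define \<phi> where "\<phi> i = x (i - 1)" for i
  \<comment> \<open>Messages are numbered from 1, the family from 0. Outputs outside all decoding
    sets go to message 1 because a decoder must be total; this can only enlarge its decoding
    region.\<close>
  define \<psi> where "\<psi> y = (if y \<in> V then Suc (THE i. i < m \<and> y \<in> D i) else 1)" for y
  have \<psi>D: "\<psi> y = Suc i" if "i < m" "y \<in> D i" for i y
  proof -
    have "(THE i. i < m \<and> y \<in> D i) = i" by (rule the_equality) (use that uniq in auto)
    then show ?thesis using that by (auto simp: \<psi>_def V_def)
  qed
  have \<psi>N: "\<psi> y = 1" if "y \<notin> V" for y using that by (simp add: \<psi>_def)
  have range: "\<psi> y \<in> {1..m}" for y
  proof (cases "y \<in> V")
    case True
    then obtain i where "i < m" "y \<in> D i" by (auto simp: V_def)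
    then show ?thesis using \<psi>D by auto
  qed (use \<psi>N m in auto)
  have pre: "\<psi> -` {Suc i} \<inter> space (Rn n) = (if i = 0 then D 0 \<union> (space (Rn n) - V) else D i)" if i: "i < m" for i
  proof -
    have DV: "D j \<subseteq> V" "D j \<subseteq> space (Rn n)" if "j < m" for j
      using that sets.sets_into_space[OF D[OF that]] by (auto simp: V_def)
    have "\<psi> y = Suc i \<longleftrightarrow> y \<in> D i \<or> (i = 0 \<and> y \<notin> V)" for y
    proof (cases "y \<in> V")
      case True
      then obtain j where j: "j < m" "y \<in> D j" by (auto simp: V_def)
      then show ?thesis using \<psi>D[OF j] True uniq[of i j y] i by auto
    next
      case False
      then show ?thesis using \<psi>N[OF False] DV(1)[OF i] by auto
    qed
    then show ?thesis using DV(2)[OF i] by auto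
  qed
  have ps: "\<psi> -` {Suc i} \<inter> space (Rn n) \<in> sets (Rn n)" if "i < m" for i
    unfolding pre[OF that] using that D V m by auto
  have "tcode n m P \<phi> \<psi>"
    unfolding tcode_def
  proof (intro conjI ballI)
    fix i assume i: "i \<in> {1..m}"
    then show "\<phi> i \<in> costset n P" using x[of "i - 1"] by (auto simp: \<phi>_def)
    show "\<psi> -` {i} \<inter> space (Rn n) \<in> sets (Rn n)" using ps[of "i - 1"] i by auto
  qed (use m range in auto)
  moreover have "terr \<gamma> n m \<phi> \<psi> \<le> e"
  proof -
    have "measure (W \<gamma> n (\<phi> i)) (space (Rn n) - \<psi> -` {i}) \<le> e" if i: "i \<in> {1..m}" for i
    proof -
      interpret Wx: prob_space "W \<gamma> n (\<phi> i)" by (rule prob_W)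
      have j: "i - 1 < m" "Suc (i - 1) = i" using i by auto
      have "D (i - 1) \<subseteq> space (Rn n)" by (rule sets.sets_into_space[OF D[OF j(1)]])
      then have "space (Rn n) - \<psi> -` {i} \<subseteq> space (Rn n) - D (i - 1)"
        using \<psi>D[OF j(1)] j(2) by auto
      then have "measure (W \<gamma> n (\<phi> i)) (space (Rn n) - \<psi> -` {i}) \<le> measure (W \<gamma> n (\<phi> i)) (space (Rn n) - D (i - 1))"
        using D[OF j(1)] by (intro Wx.finite_measure_mono) auto
      also have "\<dots> = 1 - measure (W \<gamma> n (\<phi> i)) (D (i - 1))"
        using Wx.prob_compl[of "D (i - 1)"] D[OF j(1)] by simp
      also have "\<dots> \<le> e" using W[OF j(1)] by (simp add: \<phi>_def)
      finally show ?thesis .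
    qed
    then have "(\<Sum>i\<in>{1..m}. measure (W \<gamma> n (\<phi> i)) (space (Rn n) - \<psi> -` {i})) \<le> (\<Sum>i\<in>{1..m}. e)"
      by (rule sum_mono)
    then show ?thesis using m by (simp add: terr_def divide_le_eq mult.commute)
  qed
  ultimately show ?thesis by blast
qed

text \<open>If \<open>cap\<close> were 0, max(G, \<theta>) would equal G almost everywhere and the
  area below the water level would be 0, although it is P. Positivity makes room for the rates cap -
  2e with 2e < cap used in the direct parts.\<close>

lemma cap_pos: "0 < cap"
proof (rule ccontr)
  assume "\<not> 0 < cap"
  then have c: "cap = 0" using cap_nonneg by simp
  note Gm[measurable]
  have iH: "integrable U (\<lambda>l. ln (max (G l) \<theta>))"
    by (rule integrable_ln_shift[of _ \<theta>]) (use Gi \<theta> in auto)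
  have i: "integrable U (\<lambda>l. ln (max (G l) \<theta>) - ln (G l))" using iH Gln by auto
  have "(\<integral>l. ln (max (G l) \<theta>) - ln (G l) \<partial>U) = 0" using c iH Gln by (simp add: cap_def)
  then have "AE l in U. ln (max (G l) \<theta>) - ln (G l) = 0"
    by (subst (asm) integral_nonneg_eq_0_iff_AE[OF i]) (use Gpos in \<open>auto elim!: eventually_mono simp: max_def\<close>)
  with Gpos have "AE l in U. max (\<theta> - G l) 0 = 0"
    by eventually_elim (use \<theta> in \<open>auto simp: max_def split: if_splits\<close>)
  then have "(\<integral>l. max (\<theta> - G l) 0 \<partial>U) = (\<integral>l. 0 \<partial>U)"
  proof -
    assume A: "AE l in U. max (\<theta> - G l) 0 = 0"
    have m: "(\<lambda>l. max (\<theta> - G l) 0) \<in> borel_measurable U"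
      by (intro borel_measurable_max borel_measurable_diff borel_measurable_const borel_measurable_integrable[OF Gi])
    show ?thesis by (rule integral_cong_AE[OF m _ A]) simp
  qed
  then show False using level P by simp
qed

lemma floor_half: "1 \<le> x \<Longrightarrow> x / 2 \<le> real (nat \<lfloor>x\<rfloor>)" for x :: real
proof -
  assume "1 \<le> x"
  then have "1 \<le> \<lfloor>x\<rfloor>" by (simp add: le_floor_iff)
  then have "real (nat \<lfloor>x\<rfloor>) = real_of_int \<lfloor>x\<rfloor>" "1 \<le> real_of_int \<lfloor>x\<rfloor>" by simp_all
  moreover have "x < real_of_int \<lfloor>x\<rfloor> + 1" by linarith
  ultimately show ?thesis by linarith
qed

text \<open>One half of the loss 2e is the rate given up in \<open>achievability\<close>, the other
  absorbs the factor 2 lost by rounding the number of messages down. A one-message code fills the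
  sequence before the threshold of \<open>diagonal_sequence\<close>.\<close>

lemma t_achievable_cap:
  assumes e: "0 < e" "e < 1" "e < cap"
  shows "t_achievable \<gamma> 0 P (cap - 2 * e)"
proof -
  define m where "m n = nat \<lfloor>exp (real n * (cap - e))\<rfloor>" for n
  have ex1: "1 \<le> exp (real n * (cap - e))" for n using e by simp
  have m1: "m n \<ge> 1" for n using ex1[of n] unfolding m_def by linarith
  have mle: "real (m n) \<le> exp (real n * (cap - e))" for n using ex1[of n] unfolding m_def by linarith
  have mge: "exp (real n * (cap - e)) / 2 \<le> real (m n)" for n unfolding m_def by (rule floor_half[OF ex1])
  have "\<exists>N. \<forall>n\<ge>N. \<exists>\<phi> \<psi>. tcode n (m n) P \<phi> \<psi> \<and> terr \<gamma> n (m n) \<phi> \<psi> \<le> 1 / real (Suc k)" for k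
  proof -
    define d where "d = min e (1 / real (Suc k))"
    have d: "0 < d" "d < 1" "d \<le> e" "d \<le> 1 / real (Suc k)" using e by (auto simp: d_def)
    obtain N where N: "\<And>n m. n \<ge> N \<Longrightarrow> real m \<le> exp (real n * (cap - d)) \<Longrightarrow>
      (\<exists>x D. (\<forall>i<m. x i \<in> costset n P \<and> D i \<in> sets (Rn n) \<and> 1 - d \<le> measure (W \<gamma> n (x i)) (D i))
        \<and> disjoint_family_on D {..<m})"
      using achievability[OF d(1,2)] by blast
    show ?thesis
    proof (intro exI[of _ N] allI impI)
      fix n assume n: "N \<le> n"
      have "real (m n) \<le> exp (real n * (cap - d))"
        using d by (intro order_trans[OF mle]) (simp add: mult_left_mono)
      from N[OF n this] obtain x D where "\<And>i. i < m n \<Longrightarrow> x i \<in> costset n P" "\<And>i. i < m n \<Longrightarrow> D i \<in> sets (Rn n)"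
        "\<And>i. i < m n \<Longrightarrow> 1 - d \<le> measure (W \<gamma> n (x i)) (D i)" "disjoint_family_on D {..<m n}" by blast
      from tcode_of_family[OF m1 this] show "\<exists>\<phi> \<psi>. tcode n (m n) P \<phi> \<psi> \<and> terr \<gamma> n (m n) \<phi> \<psi> \<le> 1 / real (Suc k)"
        using d(4) by (meson order_trans)
    qed
  qed
  then obtain \<kappa> N where \<kappa>: "filterlim \<kappa> at_top sequentially"
    and N: "\<And>n. n \<ge> N \<Longrightarrow> \<exists>\<phi> \<psi>. tcode n (m n) P \<phi> \<psi> \<and> terr \<gamma> n (m n) \<phi> \<psi> \<le> 1 / real (Suc (\<kappa> n))"
    using diagonal_sequence[of "\<lambda>n k. \<exists>\<phi> \<psi>. tcode n (m n) P \<phi> \<psi> \<and> terr \<gamma> n (m n) \<phi> \<psi> \<le> 1 / real (Suc k)"] by blast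
  define Ms where "Ms n = (if n \<ge> N then m n else 1)" for n
  have "\<forall>n. \<exists>\<phi> \<psi>. tcode n (Ms n) P \<phi> \<psi> \<and> (n \<ge> N \<longrightarrow> terr \<gamma> n (Ms n) \<phi> \<psi> \<le> 1 / real (Suc (\<kappa> n)))"
  proof
    fix n
    show "\<exists>\<phi> \<psi>. tcode n (Ms n) P \<phi> \<psi> \<and> (n \<ge> N \<longrightarrow> terr \<gamma> n (Ms n) \<phi> \<psi> \<le> 1 / real (Suc (\<kappa> n)))"
    proof (cases "n \<ge> N")
      case True then show ?thesis using N[OF True] by (simp add: Ms_def)
    next
      case False then show ?thesis using trivial_tcode(1)[of n] by (auto simp: Ms_def)
    qed
  qed
  then obtain \<phi> \<psi> where code: "\<And>n. tcode n (Ms n) P (\<phi> n) (\<psi> n)"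
    and err: "\<And>n. n \<ge> N \<Longrightarrow> terr \<gamma> n (Ms n) (\<phi> n) (\<psi> n) \<le> 1 / real (Suc (\<kappa> n))" by metis
  have "limsup (\<lambda>n. ereal (terr \<gamma> n (Ms n) (\<phi> n) (\<psi> n))) \<le> 0"
    by (rule limsup_ereal_le_zero[OF \<kappa> err])
  moreover have "ereal (cap - 2 * e) \<le> liminf (\<lambda>n. ereal (ln (real (Ms n)) / real n))"
  proof -
    obtain K :: nat where K: "ln 2 / e \<le> real K" using real_arch_simple by blast
    show ?thesis
    proof (rule liminf_ereal_ge[of "Suc (N + K)"])
      fix n assume n: "Suc (N + K) \<le> n"
      have n0: "real n > 0" using n by simp
      have "ln (exp (real n * (cap - e)) / 2) \<le> ln (real (m n))"
        using mge[of n] m1[of n] by (subst ln_le_cancel_iff) auto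
      then have "real n * (cap - e) - ln 2 \<le> ln (real (m n))" by (simp add: ln_div)
      moreover have "ln 2 \<le> real n * e"
      proof -
        have "ln 2 \<le> real K * e" using K e by (simp add: pos_divide_le_eq)
        also have "\<dots> \<le> real n * e" using n e by (intro mult_right_mono) auto
        finally show ?thesis .
      qed
      ultimately have "real n * (cap - 2 * e) \<le> ln (real (m n))" by (simp add: algebra_simps)
      then show "cap - 2 * e \<le> ln (real (Ms n)) / real n"
        using n n0 by (simp add: Ms_def pos_le_divide_eq mult.commute)
    qed
  qed
  ultimately show ?thesis
    unfolding t_achievable_def using code by (intro exI[of _ Ms] exI[of _ \<phi>] exI[of _ \<psi>]) (simp add: zero_ereal_def)
qed

text \<open>Outside the tail event the channel density is at most a q. Decoding sets are disjoint,
  so their masses under q sum to at most 1, and the success probabilities sum to at most m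
  \<epsilon> + a.\<close>

lemma tcode_converse_bound:
  assumes code: "tcode n m P \<phi> \<psi>" and q[measurable]: "q \<in> borel_measurable (Rn n)" and q0: "\<And>y. 0 \<le> q y"
    and q1: "(\<integral>\<^sup>+y. ennreal (q y) \<partial>Rn n) = 1" and a: "a > 0"
    and tail: "\<And>x. x \<in> costset n P \<Longrightarrow> measure (W \<gamma> n x) {y \<in> space (Rn n). a * q y < gdens \<gamma> n (\<lambda>i. y i - x i)} \<le> \<epsilon>"
  shows "1 - terr \<gamma> n m \<phi> \<psi> \<le> \<epsilon> + a / real m"
proof -
  have m: "m \<ge> 1" using code by (simp add: tcode_def)
  define D where "D i = \<psi> -` {i} \<inter> space (Rn n)" for i
  have D[measurable]: "D i \<in> sets (Rn n)" if "i \<in> {1..m}" for i using code that by (auto simp: tcode_def D_def)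
  define \<mu> where "\<mu> = density (Rn n) (\<lambda>y. ennreal (q y))"
  have s\<mu>[simp]: "sets \<mu> = sets (Rn n)" by (simp add: \<mu>_def)
  interpret M: prob_space \<mu>
  proof
    show "emeasure \<mu> (space \<mu>) = 1"
      unfolding \<mu>_def by (subst emeasure_density) (auto simp: q1[symmetric] intro!: nn_integral_cong)
  qed
  have one: "measure (W \<gamma> n (\<phi> i)) (D i) \<le> \<epsilon> + a * measure \<mu> (D i)" if i: "i \<in> {1..m}" for i
  proof -
    interpret Wx: prob_space "W \<gamma> n (\<phi> i)" by (rule prob_W)
    let ?E = "{y \<in> space (Rn n). a * q y < gdens \<gamma> n (\<lambda>k. y k - \<phi> i k)}"
    have Em[measurable]: "?E \<in> sets (Rn n)" by measurable
    note D[OF i, measurable]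
    have c: "\<phi> i \<in> costset n P" using code i by (auto simp: tcode_def)
    have "measure (W \<gamma> n (\<phi> i)) (D i) \<le> measure (W \<gamma> n (\<phi> i)) (?E \<union> (D i - ?E))"
      by (rule Wx.finite_measure_mono) auto
    also have "\<dots> \<le> measure (W \<gamma> n (\<phi> i)) ?E + measure (W \<gamma> n (\<phi> i)) (D i - ?E)"
      by (rule measure_Un_le) auto
    also have "measure (W \<gamma> n (\<phi> i)) (D i - ?E) \<le> a * measure \<mu> (D i)"
    proof -
      have "emeasure (W \<gamma> n (\<phi> i)) (D i - ?E) \<le> (\<integral>\<^sup>+y. ennreal a * (ennreal (q y) * indicator (D i) y) \<partial>Rn n)"
        unfolding emeasure_W[OF sets.Diff[OF D[OF i] Em]]
      proof (rule nn_integral_mono)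
        fix y assume "y \<in> space (Rn n)"
        then have "y \<in> D i - ?E \<Longrightarrow> gdens \<gamma> n (\<lambda>k. y k - \<phi> i k) \<le> a * q y" by auto
        then have "y \<in> D i - ?E \<Longrightarrow> ennreal (gdens \<gamma> n (\<lambda>k. y k - \<phi> i k)) \<le> ennreal a * ennreal (q y)"
          using a q0 by (subst ennreal_mult[symmetric]) (auto intro: ennreal_leI)
        then show "ennreal (gdens \<gamma> n (\<lambda>k. y k - \<phi> i k)) * indicator (D i - ?E) y \<le> ennreal a * (ennreal (q y) * indicator (D i) y)"
          by (auto simp: indicator_def)
      qed
      also have "\<dots> = ennreal a * emeasure \<mu> (D i)"
        unfolding \<mu>_def by (subst nn_integral_cmult) (auto simp: emeasure_density)
      finally have "ennreal (measure (W \<gamma> n (\<phi> i)) (D i - ?E)) \<le> ennreal (a * measure \<mu> (D i))"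
        using a by (simp add: Wx.emeasure_eq_measure M.emeasure_eq_measure ennreal_mult)
      then show ?thesis using a by (subst (asm) ennreal_le_iff) auto
    qed
    finally show ?thesis using tail[OF c] by linarith
  qed
  have terr: "1 - terr \<gamma> n m \<phi> \<psi> = (\<Sum>i\<in>{1..m}. measure (W \<gamma> n (\<phi> i)) (D i)) / real m"
  proof -
    have "measure (W \<gamma> n (\<phi> i)) (space (Rn n) - \<psi> -` {i}) = 1 - measure (W \<gamma> n (\<phi> i)) (D i)" if i: "i \<in> {1..m}" for i
    proof -
      interpret Wx: prob_space "W \<gamma> n (\<phi> i)" by (rule prob_W)
      have "space (Rn n) - \<psi> -` {i} = space (Rn n) - D i" by (auto simp: D_def)
      then show ?thesis using Wx.prob_compl[of "D i"] D[OF i] by simp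
    qed
    then have "terr \<gamma> n m \<phi> \<psi> = (\<Sum>i\<in>{1..m}. 1 - measure (W \<gamma> n (\<phi> i)) (D i)) / real m"
      by (simp add: terr_def)
    also have "\<dots> = 1 - (\<Sum>i\<in>{1..m}. measure (W \<gamma> n (\<phi> i)) (D i)) / real m"
      using m by (simp add: sum_subtractf diff_divide_distrib)
    finally show ?thesis by simp
  qed
  have "(\<Sum>i\<in>{1..m}. measure \<mu> (D i)) \<le> 1"
  proof -
    have "(\<Sum>i\<in>{1..m}. measure \<mu> (D i)) = measure \<mu> (\<Union>i\<in>{1..m}. D i)"
      by (rule M.finite_measure_finite_Union[symmetric]) (use D in \<open>auto simp: disjoint_family_on_def D_def\<close>)
    then show ?thesis by simp
  qed
  then have "a * (\<Sum>i\<in>{1..m}. measure \<mu> (D i)) \<le> a * 1"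
    by (rule mult_left_mono) (use a in simp)
  moreover have "(\<Sum>i\<in>{1..m}. measure (W \<gamma> n (\<phi> i)) (D i)) \<le> (\<Sum>i\<in>{1..m}. \<epsilon> + a * measure \<mu> (D i))"
    by (rule sum_mono) (rule one)
  moreover have "(\<Sum>i\<in>{1..m}. \<epsilon> + a * measure \<mu> (D i)) = real m * \<epsilon> + a * (\<Sum>i\<in>{1..m}. measure \<mu> (D i))"
    by (simp add: sum.distrib sum_distrib_left)
  ultimately have "(\<Sum>i\<in>{1..m}. measure (W \<gamma> n (\<phi> i)) (D i)) \<le> real m * \<epsilon> + a * 1"
    by linarith
  then have "(\<Sum>i\<in>{1..m}. measure (W \<gamma> n (\<phi> i)) (D i)) / real m \<le> (real m * \<epsilon> + a * 1) / real m"
    by (intro divide_right_mono) auto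
  also have "\<dots> = \<epsilon> + a / real m" using m by (simp add: add_divide_distrib)
  finally show ?thesis by (simp add: terr)
qed

lemma strong_converse:
  assumes ach: "t_achievable \<gamma> \<epsilon> P R" and \<epsilon>: "\<epsilon> < 1"
  shows "R \<le> cap"
proof (rule ccontr)
  assume "\<not> R \<le> cap"
  \<comment> \<open>A rate above cap + 2d makes exp(n (cap + d)) over the number of messages at most
    exp(-n d), eventually below d. Then 1 - \<epsilon> - d would be below 2d, against 4d \<le> 1 -
    \<epsilon>.\<close>
  define d where "d = min ((R - cap) / 3) ((1 - \<epsilon>) / 4)"
  have "d \<le> (R - cap) / 3" "d \<le> (1 - \<epsilon>) / 4" unfolding d_def by (rule min.cobounded1, rule min.cobounded2)
  moreover have "d > 0" using \<open>\<not> R \<le> cap\<close> \<epsilon> by (simp add: d_def)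
  ultimately have d: "d > 0" "3 * d \<le> R - cap" "4 * d \<le> 1 - \<epsilon>"
    using mult_left_mono[of d "(R - cap) / 3" 3] mult_left_mono[of d "(1 - \<epsilon>) / 4" 4] by simp_all
  obtain Ms \<phi> \<psi> where code: "\<And>n. tcode n (Ms n) P (\<phi> n) (\<psi> n)"
    and err: "limsup (\<lambda>n. ereal (terr \<gamma> n (Ms n) (\<phi> n) (\<psi> n))) \<le> ereal \<epsilon>"
    and rate: "ereal R \<le> liminf (\<lambda>n. ereal (ln (real (Ms n)) / real n))"
    using ach unfolding t_achievable_def by blast
  have "limsup (\<lambda>n. ereal (terr \<gamma> n (Ms n) (\<phi> n) (\<psi> n))) < ereal (\<epsilon> + d)"
    using err d(1) by (intro le_less_trans[OF err]) simp
  then have E1: "eventually (\<lambda>n. terr \<gamma> n (Ms n) (\<phi> n) (\<psi> n) < \<epsilon> + d) sequentially"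
    by (drule_tac Limsup_lessD) simp
  have "ereal (R - d) < liminf (\<lambda>n. ereal (ln (real (Ms n)) / real n))"
    using d(1) by (intro less_le_trans[OF _ rate]) simp
  then have E2: "eventually (\<lambda>n. R - d < ln (real (Ms n)) / real n) sequentially"
    by (drule_tac less_LiminfD) simp
  obtain N where N: "\<And>n. n \<ge> N \<Longrightarrow> \<exists>q. q \<in> borel_measurable (Rn n) \<and> (\<forall>y. 0 \<le> q y) \<and> (\<integral>\<^sup>+y. ennreal (q y) \<partial>Rn n) = 1 \<and>
    (\<forall>x\<in>costset n P. measure (W \<gamma> n x)
       {y \<in> space (Rn n). exp (real n * (cap + d)) * q y < gdens \<gamma> n (\<lambda>i. y i - x i)} \<le> d)"
    using converse_density[OF d(1)] by blast
  obtain K :: nat where K: "1 / (d * d) \<le> real K" using real_arch_simple by blast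
  have "eventually (\<lambda>n. n \<ge> Suc (N + K)) sequentially" by (rule eventually_ge_at_top)
  with E1 E2 have "eventually (\<lambda>n. terr \<gamma> n (Ms n) (\<phi> n) (\<psi> n) < \<epsilon> + d \<and> R - d < ln (real (Ms n)) / real n \<and> n \<ge> Suc (N + K)) sequentially"
    by (intro eventually_conj)
  then obtain n where n: "terr \<gamma> n (Ms n) (\<phi> n) (\<psi> n) < \<epsilon> + d" "R - d < ln (real (Ms n)) / real n" "n \<ge> Suc (N + K)"
    unfolding eventually_sequentially by blast
  have "N \<le> n" using n(3) by simp
  from N[OF this] obtain q where q: "q \<in> borel_measurable (Rn n)" "\<And>y. 0 \<le> q y" "(\<integral>\<^sup>+y. ennreal (q y) \<partial>Rn n) = 1"
    "\<And>x. x \<in> costset n P \<Longrightarrow> measure (W \<gamma> n x)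
       {y \<in> space (Rn n). exp (real n * (cap + d)) * q y < gdens \<gamma> n (\<lambda>i. y i - x i)} \<le> d" by blast
  have 1: "1 - terr \<gamma> n (Ms n) (\<phi> n) (\<psi> n) \<le> d + exp (real n * (cap + d)) / real (Ms n)"
    by (rule tcode_converse_bound[OF code q(1,2,3) exp_gt_zero q(4)])
  have n0: "real n > 0" using n(3) by simp
  have M1: "real (Ms n) \<ge> 1" using code[of n] by (simp add: tcode_def)
  have "real n * (cap + 2 * d) \<le> real n * (R - d)" using d(2) n0 by (intro mult_left_mono) auto
  also have "\<dots> < ln (real (Ms n))" using n(2) n0 by (simp add: pos_less_divide_eq mult.commute)
  finally have "exp (real n * (cap + 2 * d)) < exp (ln (real (Ms n)))" by simp
  then have "exp (real n * (cap + 2 * d)) < real (Ms n)" using M1 by simp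
  then have "exp (real n * (cap + d)) / real (Ms n) \<le> exp (real n * (cap + d)) / exp (real n * (cap + 2 * d))"
    using M1 by (intro divide_left_mono) auto
  also have "\<dots> = 1 / exp (real n * d)" by (simp add: exp_diff[symmetric] algebra_simps exp_minus inverse_eq_divide[symmetric])
  also have "\<dots> \<le> d"
  proof -
    have "1 / d = 1 / (d * d) * d" using d by simp
    also have "\<dots> \<le> real n * d" using K n(3) d by (intro mult_right_mono) auto
    also have "\<dots> \<le> exp (real n * d)" using exp_ge_add_one_self[of "real n * d"] by linarith
    finally have "1 / d \<le> exp (real n * d)" .
    then show ?thesis using d by (simp add: field_simps)
  qed
  finally show False using 1 n(1) d by linarith
qed

end

section \<open>Identification\<close>

text \<open>Union bound over the set T of agreement positions: there are at most 2^s such sets, and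
  prescribing the values on T leaves q^(s - |T|) words. Since |T| (k + 1) exceeds s and q = 4^(k+1),
  this is at most q^s / 4^s, and 2^s / 4^s = 1 / 2^s. Products replace the quotients to stay in the
  natural numbers.\<close>

lemma card_agreeing_words:
  fixes s k :: nat and f :: "nat \<Rightarrow> nat"
  defines "q \<equiv> 4 ^ Suc k"
  defines "X \<equiv> {..<s} \<rightarrow>\<^sub>E {..<q}"
  assumes f: "f \<in> X"
  shows "card {g \<in> X. s < card {t. t < s \<and> g t = f t} * Suc k} * 2 ^ s \<le> q ^ s"
proof -
  define B where "B T = {g \<in> X. \<forall>t\<in>T. g t = f t}" for T
  have finX: "finite X" unfolding X_def by (intro finite_PiE) auto
  have cB: "card (B T) = q ^ (s - card T)" if T: "T \<subseteq> {..<s}" for T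
  proof -
    have "B T = (\<Pi>\<^sub>E t\<in>{..<s}. if t \<in> T then {f t} else {..<q})"
    proof (rule subset_antisym; rule subsetI)
      fix g assume "g \<in> B T"
      then show "g \<in> (\<Pi>\<^sub>E t\<in>{..<s}. if t \<in> T then {f t} else {..<q})" by (auto simp: B_def X_def PiE_iff)
    next
      fix g assume g: "g \<in> (\<Pi>\<^sub>E t\<in>{..<s}. if t \<in> T then {f t} else {..<q})"
      have 1: "g t = f t" if "t \<in> T" for t using PiE_mem[OF g, of t] that T by auto
      have 2: "g t < q" if "t < s" for t
        using PiE_mem[OF g, of t] PiE_mem[OF f[unfolded X_def], of t] that by (auto split: if_splits)
      have "g \<in> X" unfolding X_def by (rule PiE_I) (use 2 PiE_arb[OF g] in auto)
      with 1 show "g \<in> B T" by (auto simp: B_def)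
    qed
    then have "card (B T) = (\<Prod>t<s. card (if t \<in> T then {f t} else {..<q}))" by (simp add: card_PiE)
    also have "\<dots> = (\<Prod>t<s. if t \<in> T then 1 else q)" by (intro prod.cong) auto
    also have "\<dots> = (\<Prod>t\<in>{..<s} - T. q)"
      using T by (subst prod.If_cases) (auto simp: Diff_eq)
    also have "\<dots> = q ^ (s - card T)" using T by (simp add: card_Diff_subset finite_subset[OF T])
    finally show ?thesis .
  qed
  define TT where "TT = {T. T \<subseteq> {..<s} \<and> s < card T * Suc k}"
  have finT: "finite TT" by (rule finite_subset[of _ "Pow {..<s}"]) (auto simp: TT_def)
  have cT: "card TT \<le> 2 ^ s"
    using card_mono[of "Pow {..<s}" TT] by (auto simp: TT_def card_Pow)
  have "{g \<in> X. s < card {t. t < s \<and> g t = f t} * Suc k} \<subseteq> (\<Union>T\<in>TT. B T)"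
  proof
    fix g assume g: "g \<in> {g \<in> X. s < card {t. t < s \<and> g t = f t} * Suc k}"
    then have "{t. t < s \<and> g t = f t} \<in> TT" by (auto simp: TT_def)
    moreover have "g \<in> B {t. t < s \<and> g t = f t}" using g by (auto simp: B_def)
    ultimately show "g \<in> (\<Union>T\<in>TT. B T)" by blast
  qed
  then have "card {g \<in> X. s < card {t. t < s \<and> g t = f t} * Suc k} \<le> card (\<Union>T\<in>TT. B T)"
    by (intro card_mono) (auto simp: finT B_def finX)
  also have "\<dots> \<le> (\<Sum>T\<in>TT. card (B T))" by (rule card_UN_le[OF finT])
  finally have "card {g \<in> X. s < card {t. t < s \<and> g t = f t} * Suc k} * 4 ^ s \<le> (\<Sum>T\<in>TT. card (B T)) * 4 ^ s"
    by (intro mult_right_mono) auto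
  also have "\<dots> \<le> (\<Sum>T\<in>TT. q ^ s)"
    unfolding sum_distrib_right
  proof (rule sum_mono)
    fix T assume T: "T \<in> TT"
    then have Ts: "T \<subseteq> {..<s}" "s \<le> card T * Suc k" by (auto simp: TT_def)
    have cs: "card T \<le> s" using card_mono[OF _ Ts(1)] by simp
    have "(4::nat) ^ s \<le> 4 ^ (card T * Suc k)" using Ts(2) by (intro power_increasing) auto
    also have "\<dots> = q ^ card T" by (simp only: q_def power_mult[symmetric] mult.commute)
    finally have "card (B T) * 4 ^ s \<le> q ^ (s - card T) * q ^ card T" using cB[OF Ts(1)] by (simp add: mult_left_mono)
    also have "\<dots> = q ^ s" using cs by (simp flip: power_add)
    finally show "card (B T) * 4 ^ s \<le> q ^ s" .
  qed
  also have "\<dots> \<le> 2 ^ s * q ^ s" using cT by simp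
  finally have h: "card {g \<in> X. s < card {t. t < s \<and> g t = f t} * Suc k} * 4 ^ s \<le> 2 ^ s * q ^ s" .
  have p: "(4::nat) ^ s = 2 ^ s * 2 ^ s" by (simp flip: power_mult_distrib)
  from h have "(card {g \<in> X. s < card {t. t < s \<and> g t = f t} * Suc k} * 2 ^ s) * 2 ^ s \<le> q ^ s * 2 ^ s"
    unfolding p by (simp only: mult.assoc mult.commute[of "q ^ s" "2 ^ s"])
  then show ?thesis by (rule mult_right_le_imp_le) simp
qed

text \<open>Each word already chosen excludes at most a fraction 1/2^s of all words, so greedy
  choice continues while there are fewer than 2^s of them.\<close>

lemma gilbert_code:
  fixes s k :: nat
  assumes s: "s \<ge> 1"
  shows "i \<le> 2 ^ s \<Longrightarrow> \<exists>F :: nat \<Rightarrow> nat \<Rightarrow> nat. (\<forall>a<i. \<forall>t<s. F a t < 4 ^ Suc k) \<and>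
    (\<forall>a<i. \<forall>b<i. a \<noteq> b \<longrightarrow> card {t. t < s \<and> F a t = F b t} * Suc k \<le> s)"
proof -
  define X :: "(nat \<Rightarrow> nat) set" where "X = {..<s} \<rightarrow>\<^sub>E {..<4 ^ Suc k}"
  define bad where "bad f = {g \<in> X. s < card {t. t < s \<and> g t = f t} * Suc k}" for f
  have finX: "finite X" unfolding X_def by (intro finite_PiE) auto
  have cX: "card X = (4 ^ Suc k) ^ s" by (simp add: X_def card_PiE)
  have bad: "card (bad f) * 2 ^ s \<le> card X" if "f \<in> X" for f
    using card_agreeing_words[of f s k] that unfolding bad_def X_def cX[unfolded X_def] by simp
  have "i \<le> 2 ^ s \<Longrightarrow> \<exists>F. (\<forall>a<i. F a \<in> X) \<and> (\<forall>a<i. \<forall>b<i. a \<noteq> b \<longrightarrow> card {t. t < s \<and> F a t = F b t} * Suc k \<le> s)" for i :: nat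
  proof (induction i)
    case 0 then show ?case by auto
  next
    case (Suc i)
    then obtain F where F: "\<And>a. a < i \<Longrightarrow> F a \<in> X"
      "\<And>a b. a < i \<Longrightarrow> b < i \<Longrightarrow> a \<noteq> b \<Longrightarrow> card {t. t < s \<and> F a t = F b t} * Suc k \<le> s" by auto
    have "\<exists>g\<in>X. g \<notin> (\<Union>a<i. bad (F a))"
    proof (rule ccontr)
      assume "\<not> ?thesis"
      then have "X \<subseteq> (\<Union>a<i. bad (F a))" by blast
      then have "card X \<le> card (\<Union>a<i. bad (F a))"
        by (rule card_mono[rotated]) (auto simp: bad_def finX)
      also have "\<dots> \<le> (\<Sum>a<i. card (bad (F a)))" by (rule card_UN_le) simp
      finally have "card X * 2 ^ s \<le> (\<Sum>a<i. card (bad (F a)) * 2 ^ s)"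
        unfolding sum_distrib_right[symmetric] by (rule mult_right_mono) simp
      also have "\<dots> \<le> (\<Sum>a<i. card X)" by (rule sum_mono) (use F bad in auto)
      finally have "card X * 2 ^ s \<le> card X * i" by (simp add: mult.commute)
      moreover have "card X > 0" by (simp add: cX)
      ultimately have "2 ^ s \<le> i" by simp
      then show False using Suc.prems by simp
    qed
    then obtain g where g: "g \<in> X" "\<And>a. a < i \<Longrightarrow> g \<notin> bad (F a)" by blast
    have g1: "card {t. t < s \<and> g t = F a t} * Suc k \<le> s" if "a < i" for a
      using g(2)[OF that] g(1) unfolding bad_def by (simp add: not_less del: mult_Suc_right)
    have g2: "card {t. t < s \<and> F a t = g t} * Suc k \<le> s" if "a < i" for a
    proof -
      have "{t. t < s \<and> F a t = g t} = {t. t < s \<and> g t = F a t}" by auto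
      then show ?thesis using g1[OF that] by simp
    qed
    show ?case
    proof (intro exI[of _ "F(i := g)"] conjI allI impI)
      fix a assume "a < Suc i" then show "(F(i := g)) a \<in> X" using F g by (auto simp: less_Suc_eq)
    next
      fix a b assume ab: "a < Suc i" "b < Suc i" "a \<noteq> b"
      then consider "a < i" "b < i" | "a = i" "b < i" | "a < i" "b = i" by (auto simp: less_Suc_eq)
      then show "card {t. t < s \<and> (F(i := g)) a t = (F(i := g)) b t} * Suc k \<le> s"
        using F(2)[of a b] g1[of b] g2[of a] ab(3) by cases (simp_all del: mult_Suc_right)
    qed
  qed
  moreover assume "i \<le> 2 ^ s"
  ultimately obtain F where F: "\<forall>a<i. F a \<in> X"
    "\<forall>a<i. \<forall>b<i. a \<noteq> b \<longrightarrow> card {t. t < s \<and> F a t = F b t} * Suc k \<le> s" by blast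
  have "\<forall>a<i. \<forall>t<s. F a t < 4 ^ Suc k" using F(1) unfolding X_def PiE_iff by blast
  with F(2) show "\<exists>F :: nat \<Rightarrow> nat \<Rightarrow> nat. (\<forall>a<i. \<forall>t<s. F a t < 4 ^ Suc k) \<and>
    (\<forall>a<i. \<forall>b<i. a \<noteq> b \<longrightarrow> card {t. t < s \<and> F a t = F b t} * Suc k \<le> s)" by blast
qed

text \<open>The input law of one identification message: uniform on a list of s points, counted with
  multiplicity.\<close>

definition mixture :: "nat \<Rightarrow> nat \<Rightarrow> (nat \<Rightarrow> nat \<Rightarrow> real) \<Rightarrow> (nat \<Rightarrow> real) measure" where
  "mixture n s z = distr (uniform_count_measure {..<s}) (Rn n) z"

section \<open>Identification codes built from transmission codes\<close>

context anwgn
begin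

lemma mixture_admissible:
  assumes s: "s \<ge> 1" and z: "\<And>t. t < s \<Longrightarrow> z t \<in> costset n P"
  shows "admissible_input n P (mixture n s z)"
proof -
  interpret C: prob_space "uniform_count_measure {..<s}"
    by (rule prob_space_uniform_count_measure) (use s in \<open>auto simp: set_eq_iff intro!: exI[of _ 0]\<close>)
  have zs: "z t \<in> space (Rn n)" if "t < s" for t using z[OF that] by (simp add: costset_def)
  have m: "z \<in> measurable (uniform_count_measure {..<s}) (Rn n)"
    by (auto simp: uniform_count_measure_def point_measure_def measurable_def zs)
  have "emeasure (mixture n s z) (costset n P) = emeasure (uniform_count_measure {..<s}) (z -` costset n P \<inter> {..<s})"
    unfolding mixture_def by (subst emeasure_distr[OF m]) (auto simp: space_uniform_count_measure)
  also have "z -` costset n P \<inter> {..<s} = space (uniform_count_measure {..<s})"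
    using z by (auto simp: space_uniform_count_measure)
  also have "emeasure (uniform_count_measure {..<s}) (space (uniform_count_measure {..<s})) = 1" by (rule C.emeasure_space_1)
  finally show ?thesis
    unfolding admissible_input_def using C.prob_space_distr[OF m] by (simp add: mixture_def)
qed

lemma outp_mixture:
  assumes s: "s \<ge> 1" and z: "\<And>t. t < s \<Longrightarrow> z t \<in> costset n P" and B: "B \<in> sets (Rn n)"
  shows "outp \<gamma> n (mixture n s z) B = (\<Sum>t<s. measure (W \<gamma> n (z t)) B) / real s"
proof -
  have zs: "z t \<in> space (Rn n)" if "t < s" for t using z[OF that] by (simp add: costset_def)
  have m: "z \<in> measurable (uniform_count_measure {..<s}) (Rn n)"
    by (auto simp: uniform_count_measure_def point_measure_def measurable_def zs)
  have "outp \<gamma> n (mixture n s z) B = (\<integral>t. measure (W \<gamma> n (z t)) B \<partial>uniform_count_measure {..<s})"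
    unfolding outp_def mixture_def by (rule integral_distr[OF m measure_W_measurable[OF B]])
  also have "\<dots> = (\<Sum>t<s. measure (W \<gamma> n (z t)) B) / real s"
    unfolding uniform_count_measure_def
    by (subst lebesgue_integral_point_measure_finite) (auto simp: sum_divide_distrib)
  finally show ?thesis .
qed

text \<open>The codewords are arranged in s blocks of q = 4^(k+1). A message picks one codeword from
  each block according to its Gilbert word, transmits a random one of them, and is identified by the
  union of their decoding sets. A foreign message is accepted only through a transmission error or a
  common codeword, and common ones have frequency at most 1/(k+1).\<close>

lemma idcode_of_family:
  assumes s: "s \<ge> 1" and m: "s * 4 ^ Suc k \<le> m"
    and x: "\<And>i. i < m \<Longrightarrow> x i \<in> costset n P" and D: "\<And>i. i < m \<Longrightarrow> D i \<in> sets (Rn n)"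
    and W: "\<And>i. i < m \<Longrightarrow> 1 - e \<le> measure (W \<gamma> n (x i)) (D i)" and dis: "disjoint_family_on D {..<m}" and e: "0 \<le> e"
  shows "\<exists>Q D. idcode n (2 ^ s) P Q D \<and> id_mu \<gamma> n (2 ^ s) Q D \<le> e \<and> id_lam \<gamma> n (2 ^ s) Q D \<le> e + 1 / real (Suc k)"
proof -
  define q :: nat where "q = 4 ^ Suc k"
  have q0: "q > 0" by (simp add: q_def)
  obtain F :: "nat \<Rightarrow> nat \<Rightarrow> nat" where FF: "(\<forall>a<2 ^ s. \<forall>t<s. F a t < q) \<and>
    (\<forall>a<2 ^ s. \<forall>b<2 ^ s. a \<noteq> b \<longrightarrow> card {t. t < s \<and> F a t = F b t} * Suc k \<le> s)"
    using gilbert_code[OF s order_refl, of k, folded q_def] by (elim exE)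
  note F = FF[THEN conjunct1, rule_format] FF[THEN conjunct2, rule_format]
  \<comment> \<open>Block number and symbol are quotient and remainder modulo q, so equal indices
    force the same position and the same symbol.\<close>
  define ix where "ix a t = t * q + F a t" for a t
  have ixm: "ix a t < m" if "a < 2 ^ s" "t < s" for a t
  proof -
    have "ix a t < t * q + q" using F(1)[OF that] by (simp add: ix_def)
    also have "\<dots> = Suc t * q" by simp
    also have "\<dots> \<le> s * q" using that by (intro mult_right_mono) auto
    also have "\<dots> \<le> m" using m by (simp add: q_def)
    finally show ?thesis .
  qed
  have ixinj: "t = t' \<and> F a t = F b t'" if "a < 2 ^ s" "b < 2 ^ s" "t < s" "t' < s" "ix a t = ix b t'" for a b t t'
  proof -
    have dm: "ix c r div q = r" "ix c r mod q = F c r" if "c < 2 ^ s" "r < s" for c r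
      using F(1)[OF that] by (simp_all add: ix_def)
    have "t = t'" using dm(1)[OF that(1,3)] dm(1)[OF that(2,4)] unfolding that(5) by (rule trans[OF sym])
    moreover have "F a t = F b t'" using dm(2)[OF that(1,3)] dm(2)[OF that(2,4)] unfolding that(5) by (rule trans[OF sym])
    ultimately show ?thesis ..
  qed
  define E where "E a = (\<Union>t<s. D (ix a t))" for a
  have Em: "E a \<in> sets (Rn n)" if "a < 2 ^ s" for a
    unfolding E_def using ixm[OF that] D by auto
  \<comment> \<open>Identification messages are numbered from 1, Gilbert words from 0.\<close>
  define Q where "Q a = mixture n s (\<lambda>t. x (ix (a - 1) t))" for a
  define E' where "E' a = E (a - 1)" for a :: nat
  have xc: "x (ix a t) \<in> costset n P" if "a < 2 ^ s" "t < s" for a t using x[OF ixm[OF that]] .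
  have out: "outp \<gamma> n (Q a) B = (\<Sum>t<s. measure (W \<gamma> n (x (ix (a - 1) t))) B) / real s"
    if "a \<in> {1..2 ^ s}" "B \<in> sets (Rn n)" for a B
  proof -
    have "a - 1 < 2 ^ s" using that by auto
    then show ?thesis unfolding Q_def by (intro outp_mixture s xc that)
  qed
  have avg: "(\<Sum>t<s. f t) / real s \<le> c" if "\<And>t. t < s \<Longrightarrow> f t \<le> c" for f :: "nat \<Rightarrow> real" and c
  proof -
    have "(\<Sum>t<s. f t) \<le> (\<Sum>t<s. c)" by (rule sum_mono) (use that in auto)
    then show ?thesis using s by (simp add: divide_le_eq mult.commute)
  qed
  have miss: "measure (W \<gamma> n (x i)) (space (Rn n) - D i) \<le> e" if i: "i < m" for i
  proof -
    interpret Wx: prob_space "W \<gamma> n (x i)" by (rule prob_W)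
    have "measure (W \<gamma> n (x i)) (space (Rn n) - D i) = 1 - measure (W \<gamma> n (x i)) (D i)"
      using Wx.prob_compl[of "D i"] D[OF i] by simp
    then show ?thesis using W[OF i] by simp
  qed
  have "idcode n (2 ^ s) P Q E'"
    unfolding idcode_def
  proof (intro conjI ballI)
    fix i assume i: "i \<in> {1..2 ^ s :: nat}"
    then have "i - 1 < 2 ^ s" by auto
    then show "admissible_input n P (Q i)" "E' i \<in> sets (Rn n)"
      unfolding Q_def E'_def by (auto intro!: mixture_admissible s xc Em)
  qed simp
  moreover have "id_mu \<gamma> n (2 ^ s) Q E' \<le> e"
    unfolding id_mu_def
  proof (subst Max_le_iff)
    show "\<forall>r\<in>(\<lambda>i. outp \<gamma> n (Q i) (space (Rn n) - E' i)) ` {1..2 ^ s}. r \<le> e"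
    proof
      fix r assume "r \<in> (\<lambda>i. outp \<gamma> n (Q i) (space (Rn n) - E' i)) ` {1..2 ^ s}"
      then obtain i where i: "i \<in> {1..2 ^ s}" "r = outp \<gamma> n (Q i) (space (Rn n) - E' i)" by auto
      have i1: "i - 1 < 2 ^ s" using i by auto
      have "outp \<gamma> n (Q i) (space (Rn n) - E' i) = (\<Sum>t<s. measure (W \<gamma> n (x (ix (i - 1) t))) (space (Rn n) - E' i)) / real s"
        by (rule out[OF i(1)]) (use Em[OF i1] in \<open>auto simp: E'_def\<close>)
      also have "\<dots> \<le> e"
      proof (rule avg)
        fix t assume t: "t < s"
        interpret Wx: prob_space "W \<gamma> n (x (ix (i - 1) t))" by (rule prob_W)
        have "measure (W \<gamma> n (x (ix (i - 1) t))) (space (Rn n) - E' i) \<le> measure (W \<gamma> n (x (ix (i - 1) t))) (space (Rn n) - D (ix (i - 1) t))"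
          using t D[OF ixm[OF i1 t]] by (intro Wx.finite_measure_mono) (auto simp: E'_def E_def)
        also have "\<dots> \<le> e" by (rule miss[OF ixm[OF i1 t]])
        finally show "measure (W \<gamma> n (x (ix (i - 1) t))) (space (Rn n) - E' i) \<le> e" .
      qed
      finally show "r \<le> e" using i by simp
    qed
  qed auto
  moreover have "id_lam \<gamma> n (2 ^ s) Q E' \<le> e + 1 / real (Suc k)"
    unfolding id_lam_def
  proof (subst Max_le_iff)
    let ?S = "{(i, j). i \<in> {1..2 ^ s :: nat} \<and> j \<in> {1..2 ^ s} \<and> i \<noteq> j}"
    have "?S \<subseteq> {1..2 ^ s} \<times> {1..2 ^ s}" by auto
    then have "finite ?S" by (rule finite_subset) auto
    then show "finite (insert 0 ((\<lambda>(i, j). outp \<gamma> n (Q j) (E' i)) ` ?S))" by auto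
    show "\<forall>r\<in>insert 0 ((\<lambda>(i, j). outp \<gamma> n (Q j) (E' i)) ` ?S). r \<le> e + 1 / real (Suc k)"
    proof
      fix r assume "r \<in> insert 0 ((\<lambda>(i, j). outp \<gamma> n (Q j) (E' i)) ` ?S)"
      then consider "r = 0" | i j where "i \<in> {1..2 ^ s}" "j \<in> {1..2 ^ s}" "i \<noteq> j" "r = outp \<gamma> n (Q j) (E' i)" by auto
      then show "r \<le> e + 1 / real (Suc k)"
      proof cases
        case 1 then show ?thesis using e by simp
      next
        case 2
        have i1: "i - 1 < 2 ^ s" "j - 1 < 2 ^ s" "i - 1 \<noteq> j - 1" using 2 by auto
        define A where "A = {t. t < s \<and> F (i - 1) t = F (j - 1) t}"
        have "r = (\<Sum>t<s. measure (W \<gamma> n (x (ix (j - 1) t))) (E' i)) / real s"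
          unfolding 2(4) by (rule out[OF 2(2)]) (use Em[OF i1(1)] in \<open>auto simp: E'_def\<close>)
        \<comment> \<open>Where the two words agree the trivial bound 1 is used; elsewhere
          \<open>E' i\<close> misses the decoding set of the transmitted codeword, and only the
          transmission error remains.\<close>
        also have "(\<Sum>t<s. measure (W \<gamma> n (x (ix (j - 1) t))) (E' i)) \<le> (\<Sum>t<s. e + (if t \<in> A then 1 else 0))"
        proof (rule sum_mono)
          fix t assume "t \<in> {..<s}"
          then have t: "t < s" by simp
          interpret Wx: prob_space "W \<gamma> n (x (ix (j - 1) t))" by (rule prob_W)
          show "measure (W \<gamma> n (x (ix (j - 1) t))) (E' i) \<le> e + (if t \<in> A then 1 else 0)"
          proof (cases "t \<in> A")
            case True then show ?thesis using e Wx.prob_le_1[of "E' i"] by (simp add: add_increasing)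
          next
            case False
            have "E' i \<subseteq> space (Rn n) - D (ix (j - 1) t)"
            proof
              fix y assume "y \<in> E' i"
              then obtain t' where t': "t' < s" "y \<in> D (ix (i - 1) t')" by (auto simp: E'_def E_def)
              have "ix (i - 1) t' \<noteq> ix (j - 1) t"
                using ixinj[OF i1(1,2) t'(1) t] False t by (auto simp: A_def)
              then have "D (ix (i - 1) t') \<inter> D (ix (j - 1) t) = {}"
                using dis ixm[OF i1(1) t'(1)] ixm[OF i1(2) t] unfolding disjoint_family_on_def by auto
              moreover have "y \<in> space (Rn n)" using t' sets.sets_into_space[OF D[OF ixm[OF i1(1) t'(1)]]] by auto
              ultimately show "y \<in> space (Rn n) - D (ix (j - 1) t)" using t' by auto
            qed
            then have "measure (W \<gamma> n (x (ix (j - 1) t))) (E' i) \<le> measure (W \<gamma> n (x (ix (j - 1) t))) (space (Rn n) - D (ix (j - 1) t))"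
              using D[OF ixm[OF i1(2) t]] by (intro Wx.finite_measure_mono) auto
            also have "\<dots> \<le> e" by (rule miss[OF ixm[OF i1(2) t]])
            finally show ?thesis using False by simp
          qed
        qed
        also have "\<dots> = real s * e + real (card A)"
        proof -
          have "(\<Sum>t<s. if t \<in> A then 1 else 0 :: real) = real (card ({..<s} \<inter> A))"
            by (subst sum.inter_restrict[symmetric]) auto
          also have "{..<s} \<inter> A = A" by (auto simp: A_def)
          finally show ?thesis by (simp add: sum.distrib)
        qed
        finally have "r \<le> (real s * e + real (card A)) / real s" by (simp add: divide_right_mono)
        also have "\<dots> = e + real (card A) / real s" using s by (simp add: add_divide_distrib)
        also have "real (card A) / real s \<le> 1 / real (Suc k)"
        proof -
          have "card A * Suc k \<le> s" unfolding A_def by (rule F(2)[OF i1])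
          then have "real (card A) * real (Suc k) \<le> real s" by (metis of_nat_le_iff of_nat_mult)
          then show ?thesis using s by (simp add: divide_simps del: of_nat_Suc)
        qed
        finally show ?thesis by simp
      qed
    qed
  qed auto
  ultimately show ?thesis by blast
qed

lemma trivial_idcode: "\<exists>Q D. idcode n 1 P Q D"
proof -
  have "admissible_input n P (mixture n 1 (\<lambda>_. \<lambda>i\<in>{..<n}. 0))"
    by (rule mixture_admissible) (use zero_in_costset[OF P] in auto)
  then show ?thesis
    by (intro exI[of _ "\<lambda>_. mixture n 1 (\<lambda>_. \<lambda>i\<in>{..<n}. 0)"] exI[of _ "\<lambda>_. {}"]) (simp add: idcode_def)
qed

text \<open>ln ln of 2^s is essentially ln s, and s close to E/q with q independent of n keeps the
  exponent of the transmission code. The factor 4 in ln(4 q) \<le> n e pays for rounding down and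
  for replacing ln 2 by 1/2.\<close>

lemma id_achievable_cap:
  assumes e: "0 < e" "e < 1" "2 * e < cap"
  shows "id_achievable \<gamma> 0 0 P (cap - 2 * e)"
proof -
  define Pr where "Pr n k = (\<exists>N Q D. idcode n N P Q D \<and> id_mu \<gamma> n N Q D \<le> 2 / real (Suc k) \<and> id_lam \<gamma> n N Q D \<le> 2 / real (Suc k)
     \<and> cap - 2 * e \<le> ln (ln (real N)) / real n)" for n k
  have "\<exists>N. \<forall>n\<ge>N. Pr n k" for k
  proof -
    define d where "d = min e (1 / real (Suc k))"
    have d: "0 < d" "d < 1" "d \<le> e" "d \<le> 1 / real (Suc k)" using e by (auto simp: d_def)
    obtain N where N: "\<And>n m. n \<ge> N \<Longrightarrow> real m \<le> exp (real n * (cap - d)) \<Longrightarrow>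
      (\<exists>x D. (\<forall>i<m. x i \<in> costset n P \<and> D i \<in> sets (Rn n) \<and> 1 - d \<le> measure (W \<gamma> n (x i)) (D i))
        \<and> disjoint_family_on D {..<m})"
      using achievability[OF d(1,2)] by blast
    define q :: nat where "q = 4 ^ Suc k"
    have q1: "real q \<ge> 1" unfolding q_def of_nat_power by (rule one_le_power) simp
    obtain K :: nat where K: "ln (4 * real q) / e \<le> real K" using real_arch_simple by blast
    have "Pr n k" if n: "n \<ge> Suc (N + K)" for n
    proof -
      have n0: "real n > 0" using n by simp
      have ke: "ln (4 * real q) \<le> real n * e"
      proof -
        have "ln (4 * real q) \<le> real K * e" using K e by (simp add: pos_divide_le_eq)
        also have "\<dots> \<le> real n * e" using n e by (intro mult_right_mono) auto
        finally show ?thesis .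
      qed
      define E where "E = exp (real n * (cap - e))"
      define s where "s = nat \<lfloor>E / real q\<rfloor>"
      have qE: "4 * real q \<le> E"
      proof -
        have "real n * e \<le> real n * (cap - e)" using e n0 by (intro mult_left_mono) auto
        then have "exp (ln (4 * real q)) \<le> E" using ke unfolding E_def by (subst exp_le_cancel_iff) linarith
        then show ?thesis using q1 by simp
      qed
      have Eq: "1 \<le> E / real q" using qE q1 by (simp add: pos_le_divide_eq)
      have s2: "E / real q / 2 \<le> real s" unfolding s_def by (rule floor_half[OF Eq])
      have sle: "real s \<le> E / real q" using Eq unfolding s_def by linarith
      have s1: "s \<ge> 1" using Eq unfolding s_def by linarith
      define m where "m = s * q"
      have "real m \<le> E" using sle q1 by (simp add: m_def pos_le_divide_eq)
      also have "E \<le> exp (real n * (cap - d))" unfolding E_def using d by (simp add: mult_left_mono)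
      finally have mE: "real m \<le> exp (real n * (cap - d))" .
      have "N \<le> n" using n by simp
      from N[OF this mE] obtain x D where xD: "\<And>i. i < m \<Longrightarrow> x i \<in> costset n P" "\<And>i. i < m \<Longrightarrow> D i \<in> sets (Rn n)"
        "\<And>i. i < m \<Longrightarrow> 1 - d \<le> measure (W \<gamma> n (x i)) (D i)" "disjoint_family_on D {..<m}" by blast
      have "s * 4 ^ Suc k \<le> m" by (simp only: m_def q_def order_refl)
      then have "\<exists>Q D. idcode n (2 ^ s) P Q D \<and> id_mu \<gamma> n (2 ^ s) Q D \<le> d \<and> id_lam \<gamma> n (2 ^ s) Q D \<le> d + 1 / real (Suc k)"
        by (rule idcode_of_family[OF s1, where x=x and D=D]) (use xD d(1) in simp_all)
      then obtain Q D' where id: "idcode n (2 ^ s) P Q D'" "id_mu \<gamma> n (2 ^ s) Q D' \<le> d" "id_lam \<gamma> n (2 ^ s) Q D' \<le> d + 1 / real (Suc k)"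
        by (elim exE conjE)
      have "real n * (cap - 2 * e) \<le> ln (ln (real (2 ^ s)))"
      proof -
        have "E / (4 * real q) \<le> real s * ln 2"
        proof -
          have "E / (4 * real q) = E / real q / 2 * (1/2)" by simp
          also have "\<dots> \<le> real s * ln 2" using s2 Eq ln2_ge_two_thirds by (intro mult_mono) auto
          finally show ?thesis .
        qed
        moreover have "E / (4 * real q) > 0" using q1 by (simp add: E_def)
        ultimately have "ln (E / (4 * real q)) \<le> ln (real s * ln 2)" by (subst ln_le_cancel_iff) auto
        moreover have "ln (E / (4 * real q)) = real n * (cap - e) - ln (4 * real q)"
          using q1 by (simp add: ln_div E_def)
        moreover have "real n * (cap - 2 * e) = real n * (cap - e) - real n * e" by (simp add: algebra_simps)
        moreover have "ln (real (2 ^ s)) = real s * ln 2" by (simp add: ln_realpow)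
        ultimately show ?thesis using ke by simp
      qed
      then have "cap - 2 * e \<le> ln (ln (real (2 ^ s))) / real n" using n0 by (simp add: pos_le_divide_eq mult.commute)
      moreover have "d \<le> 2 / real (Suc k)" "d + 1 / real (Suc k) \<le> 2 / real (Suc k)"
      proof -
        have "(2::real) / real (Suc k) = 1 / real (Suc k) + 1 / real (Suc k)" by simp
        moreover have "0 \<le> 1 / real (Suc k)" by simp
        ultimately show "d \<le> 2 / real (Suc k)" "d + 1 / real (Suc k) \<le> 2 / real (Suc k)" using d(4) by linarith+
      qed
      ultimately show ?thesis unfolding Pr_def using id by (meson order_trans)
    qed
    then show ?thesis by blast
  qed
  then obtain \<kappa> N where \<kappa>: "filterlim \<kappa> at_top sequentially" and N: "\<And>n. n \<ge> N \<Longrightarrow> Pr n (\<kappa> n)"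
    using diagonal_sequence[of Pr] by blast
  have "\<forall>n. \<exists>M Q D. idcode n M P Q D \<and> (n \<ge> N \<longrightarrow> id_mu \<gamma> n M Q D \<le> 2 / real (Suc (\<kappa> n)) \<and> id_lam \<gamma> n M Q D \<le> 2 / real (Suc (\<kappa> n))
     \<and> cap - 2 * e \<le> ln (ln (real M)) / real n)"
  proof
    fix n
    show "\<exists>M Q D. idcode n M P Q D \<and> (n \<ge> N \<longrightarrow> id_mu \<gamma> n M Q D \<le> 2 / real (Suc (\<kappa> n)) \<and> id_lam \<gamma> n M Q D \<le> 2 / real (Suc (\<kappa> n))
       \<and> cap - 2 * e \<le> ln (ln (real M)) / real n)"
    proof (cases "n \<ge> N")
      case True then show ?thesis using N[OF True] unfolding Pr_def by blast
    next
      case False then show ?thesis using trivial_idcode[of n] by blast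
    qed
  qed
  then obtain Ms Q D where id: "\<And>n. idcode n (Ms n) P (Q n) (D n)"
    and mu: "\<And>n. n \<ge> N \<Longrightarrow> id_mu \<gamma> n (Ms n) (Q n) (D n) \<le> 2 / real (Suc (\<kappa> n))"
    and la: "\<And>n. n \<ge> N \<Longrightarrow> id_lam \<gamma> n (Ms n) (Q n) (D n) \<le> 2 / real (Suc (\<kappa> n))"
    and ra: "\<And>n. n \<ge> N \<Longrightarrow> cap - 2 * e \<le> ln (ln (real (Ms n))) / real n"
    unfolding choice_iff by blast
  have "limsup (\<lambda>n. ereal (id_mu \<gamma> n (Ms n) (Q n) (D n))) \<le> 0" by (rule limsup_ereal_le_zero[OF \<kappa> mu])
  moreover have "limsup (\<lambda>n. ereal (id_lam \<gamma> n (Ms n) (Q n) (D n))) \<le> 0" by (rule limsup_ereal_le_zero[OF \<kappa> la])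
  moreover have "ereal (cap - 2 * e) \<le> liminf (\<lambda>n. ereal (ln (ln (real (Ms n))) / real n))" by (rule liminf_ereal_ge[OF ra])
  ultimately show ?thesis
    unfolding id_achievable_def using id by (intro exI[of _ Ms] exI[of _ Q] exI[of _ D]) (simp add: zero_ereal_def)
qed

end

section \<open>Exponential bounds for whitened inputs and quantisation of the input space\<close>

lemma gronwall_sum:
  fixes v :: "nat \<Rightarrow> real"
  assumes v: "\<And>k. k < n \<Longrightarrow> v k \<le> a + r * (\<Sum>j<k. v j)" and r: "0 \<le> r"
  shows "k < n \<Longrightarrow> v k \<le> a * (1 + r) ^ k"
proof (induction k rule: less_induct)
  case (less k)
  have s: "r * (\<Sum>j<i. (1 + r) ^ j) = (1 + r) ^ i - 1" for i
    by (induction i) (auto simp: algebra_simps)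
  have "v k \<le> a + r * (\<Sum>j<k. v j)" by (rule v[OF less.prems])
  also have "\<dots> \<le> a + r * (\<Sum>j<k. a * (1 + r) ^ j)"
    by (intro add_left_mono mult_left_mono sum_mono r less.IH) (use less.prems in auto)
  also have "\<dots> = a + a * (r * (\<Sum>j<k. (1 + r) ^ j))" by (simp add: sum_distrib_left[symmetric] mult.left_commute)
  also have "\<dots> = a * (1 + r) ^ k" unfolding s by (simp add: algebra_simps)
  finally show ?case .
qed

text \<open>Forward substitution in L u = x bounds each u_k by a linear recursion in the earlier
  ones, and the discrete Gronwall inequality makes this exponential in k. So crude a bound is enough
  because it enters only through an iterated logarithm.\<close>

lemma chol_coordinate_bound:
  assumes C: "chol n v L M" and s: "s > 0" "\<And>k. k < n \<Longrightarrow> s \<le> L k k"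
    and b: "\<And>i j. i < n \<Longrightarrow> j < n \<Longrightarrow> \<bar>L i j\<bar> \<le> b" "0 \<le> b" and x: "\<And>k. k < n \<Longrightarrow> \<bar>x k\<bar> \<le> c" and k: "k < n"
  shows "\<bar>\<Sum>j<n. M k j * x j\<bar> \<le> c / s * (1 + b / s) ^ k"
proof -
  define u where "u k = (\<Sum>j<n. M k j * x j)" for k
  have rec: "\<bar>u k\<bar> \<le> c / s + b / s * (\<Sum>j<k. \<bar>u j\<bar>)" if k: "k < n" for k
  proof -
    have "x k = (\<Sum>j<n. L k j * u j)" unfolding u_def by (rule chol_trans(2)[OF C k k, symmetric])
    also have "\<dots> = (\<Sum>j<Suc k. L k j * u j)" by (rule sum.mono_neutral_right) (use C k in \<open>auto simp: chol_def\<close>)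
    finally have e: "L k k * u k = x k - (\<Sum>j<k. L k j * u j)" by simp
    have "s * \<bar>u k\<bar> \<le> L k k * \<bar>u k\<bar>" using s(2)[OF k] by (rule mult_right_mono) simp
    also have "\<dots> = \<bar>L k k * u k\<bar>" using s(1) s(2)[OF k] by (simp add: abs_mult)
    also have "\<dots> \<le> c + b * (\<Sum>j<k. \<bar>u j\<bar>)"
    proof -
      have "\<bar>\<Sum>j<k. L k j * u j\<bar> \<le> (\<Sum>j<k. \<bar>L k j * u j\<bar>)" by (rule sum_abs)
      also have "\<dots> \<le> (\<Sum>j<k. b * \<bar>u j\<bar>)"
        by (rule sum_mono) (use b k in \<open>auto simp: abs_mult intro!: mult_right_mono\<close>)
      finally show ?thesis unfolding e sum_distrib_left[symmetric] using x[OF k] by linarith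
    qed
    finally have "\<bar>u k\<bar> \<le> (c + b * (\<Sum>j<k. \<bar>u j\<bar>)) / s" using s(1) by (simp add: pos_le_divide_eq mult.commute)
    then show ?thesis by (simp add: add_divide_distrib)
  qed
  have "\<bar>u k\<bar> \<le> c / s * (1 + b / s) ^ k"
    by (rule gronwall_sum[of n "\<lambda>k. \<bar>u k\<bar>", OF rec _ k]) (use s b in auto)
  then show ?thesis by (simp add: u_def)
qed

lemma ln_quadratic_le_linear:
  fixes D e :: real
  assumes D: "D \<ge> 0" and e: "e > 0"
  shows "\<exists>N. \<forall>n\<ge>N. ln (1 + D * (real n)\<^sup>2) \<le> real n * e"
proof -
  have "(\<lambda>n. ln (1 + D) / real n + 2 * (ln (real n) / real n)) \<longlonglongrightarrow> 0 + 2 * 0"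
    by (intro tendsto_add tendsto_mult tendsto_const lim_const_over_n lim_ln_over_n)
  then have "eventually (\<lambda>n. ln (1 + D) / real n + 2 * (ln (real n) / real n) < e) sequentially"
    using e by (intro order_tendstoD(2)) auto
  then obtain N where N: "\<And>n. n \<ge> N \<Longrightarrow> ln (1 + D) / real n + 2 * (ln (real n) / real n) < e"
    by (auto simp: eventually_sequentially)
  have "ln (1 + D * (real n)\<^sup>2) \<le> real n * e" if n: "n \<ge> Suc N" for n
  proof -
    have n1: "real n \<ge> 1" using n by simp
    have sq: "(real n)\<^sup>2 \<ge> 1" using n1 by simp
    have "1 + D * (real n)\<^sup>2 \<le> (1 + D) * (real n)\<^sup>2" using sq by (simp add: algebra_simps)
    moreover have "0 < 1 + D * (real n)\<^sup>2" using D by (intro add_pos_nonneg) auto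
    ultimately have "ln (1 + D * (real n)\<^sup>2) \<le> ln ((1 + D) * (real n)\<^sup>2)" by (subst ln_le_cancel_iff) auto
    also have "\<dots> = ln (1 + D) + 2 * ln (real n)" using D n1 by (simp add: ln_mult ln_realpow)
    also have "\<dots> = real n * (ln (1 + D) / real n + 2 * (ln (real n) / real n))" using n1 by (simp add: field_simps)
    also have "\<dots> \<le> real n * e" using N[of n] n by (intro mult_left_mono) auto
    finally show ?thesis .
  qed
  then show ?thesis by blast
qed

context anwgn
begin

text \<open>In whitened coordinates, with displacement d and noise v, the log likelihood ratio is
  the pairing of d and v plus |d|^2/2. As |d|^2 is at most \<eta>^3, it exceeds \<eta> only if the
  pairing is at least \<eta>/2 in absolute value, which by Chebyshev has probability at most 4
  \<eta>; elsewhere the ratio is at most exp(\<eta>) \<le> 1 + 2 \<eta>. Hence the cube and the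
  constant 6.\<close>

lemma W_close:
  fixes \<eta> :: real
  assumes C: "chol n (cv G) L M" and d: "(\<Sum>k<n. (\<Sum>j<n. M k j * (x j - x' j))\<^sup>2) \<le> \<eta> ^ 3" and \<eta>: "0 < \<eta>" "\<eta> \<le> 1"
    and B[measurable]: "B \<in> sets (Rn n)"
  shows "measure (W \<gamma> n x) B \<le> measure (W \<gamma> n x') B + 6 * \<eta>"
proof -
  define d where "d k = (\<Sum>j<n. M k j * (x j - x' j))" for k
  define w where "w z y = gd n M (\<lambda>i. y i - z i)" for z y
  have w[measurable]: "w z \<in> borel_measurable (Rn n)" for z unfolding w_def[abs_def] by measurable
  have w0: "0 \<le> w z y" for z y unfolding w_def by (rule gd_nonneg) (use C in \<open>auto simp: chol_def\<close>)
  define T where "T = {y \<in> space (Rn n). exp \<eta> * w x' y < w x y}"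
  have T[measurable]: "T \<in> sets (Rn n)" unfolding T_def by measurable
  interpret X: prob_space "W \<gamma> n x" by (rule prob_W)
  interpret X': prob_space "W \<gamma> n x'" by (rule prob_W)
  have em: "emeasure (W \<gamma> n z) A = (\<integral>\<^sup>+y. ennreal (w z y) * indicator A y \<partial>Rn n)" if "A \<in> sets (Rn n)" for z A
    unfolding W_def gdens_eq[OF C] w_def[symmetric] using that by (intro emeasure_density) auto
  have "emeasure (W \<gamma> n x) B \<le> (\<integral>\<^sup>+y. ennreal (exp \<eta>) * (ennreal (w x' y) * indicator B y) + ennreal (w x y) * indicator T y \<partial>Rn n)"
    unfolding em[OF B]
  proof (rule nn_integral_mono)
    fix y assume y: "y \<in> space (Rn n)"
    show "ennreal (w x y) * indicator B y \<le> ennreal (exp \<eta>) * (ennreal (w x' y) * indicator B y) + ennreal (w x y) * indicator T y"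
    proof (cases "y \<in> T")
      case True then show ?thesis by (auto simp: indicator_def)
    next
      case False
      then have "ennreal (w x y) \<le> ennreal (exp \<eta> * w x' y)" using y by (intro ennreal_leI) (auto simp: T_def)
      then show ?thesis using False w0 by (auto simp: indicator_def ennreal_mult)
    qed
  qed
  also have "\<dots> = ennreal (exp \<eta>) * emeasure (W \<gamma> n x') B + emeasure (W \<gamma> n x) T"
    unfolding em[OF B] em[OF T] by (subst nn_integral_add; (subst nn_integral_cmult)?; simp?)
  also have "\<dots> = ennreal (exp \<eta> * measure (W \<gamma> n x') B + measure (W \<gamma> n x) T)"
    by (simp add: X.emeasure_eq_measure X'.emeasure_eq_measure ennreal_mult)
  finally have 1: "measure (W \<gamma> n x) B \<le> exp \<eta> * measure (W \<gamma> n x') B + measure (W \<gamma> n x) T"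
    unfolding X.emeasure_eq_measure by (subst (asm) ennreal_le_iff) auto
  have "exp \<eta> \<le> 1 + 2 * \<eta>"
  proof -
    have "exp \<eta> \<le> 1 + \<eta> + \<eta>\<^sup>2" using \<eta> by (intro exp_bound) auto
    moreover have "\<eta> * \<eta> \<le> \<eta> * 1" using \<eta> by (intro mult_left_mono) auto
    ultimately show ?thesis by (simp add: power2_eq_square)
  qed
  then have "exp \<eta> * measure (W \<gamma> n x') B \<le> (1 + 2 * \<eta>) * measure (W \<gamma> n x') B" by (rule mult_right_mono) simp
  also have "\<dots> = measure (W \<gamma> n x') B + 2 * \<eta> * measure (W \<gamma> n x') B" by (simp add: algebra_simps)
  also have "\<dots> \<le> measure (W \<gamma> n x') B + 2 * \<eta>"
    using mult_left_mono[OF X'.prob_le_1[of B], of "2 * \<eta>"] \<eta> by simp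
  finally have 2: "exp \<eta> * measure (W \<gamma> n x') B \<le> measure (W \<gamma> n x') B + 2 * \<eta>" .
  have 3: "measure (W \<gamma> n x) T \<le> 4 * \<eta>"
  proof -
    have "measure (W \<gamma> n x) T \<le> measure (stdg n) {v \<in> space (Rn n). \<eta> / 2 \<le> \<bar>\<Sum>k<n. d k * v k\<bar>}"
      unfolding measure_W[OF C T]
    proof (rule stdg.finite_measure_mono)
      show "{v \<in> space (Rn n). aff n L x v \<in> T} \<subseteq> {v \<in> space (Rn n). \<eta> / 2 \<le> \<bar>\<Sum>k<n. d k * v k\<bar>}"
      proof safe
        fix v assume "v \<in> space (Rn n)" "aff n L x v \<in> T"
        define y where "y = aff n L x v"
        have "y \<in> T" using \<open>aff n L x v \<in> T\<close> by (simp add: y_def)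
        have a: "(\<Sum>j<n. M k j * (y j - x j)) = v k" if "k < n" for k
          unfolding y_def by (rule chol_whiten[OF C that])
        have b: "(\<Sum>j<n. M k j * (y j - x' j)) = v k + d k" if "k < n" for k
        proof -
          have "(\<Sum>j<n. M k j * (y j - x' j)) = (\<Sum>j<n. M k j * (y j - x j)) + d k"
            unfolding d_def sum.distrib[symmetric] by (intro sum.cong) (auto simp: algebra_simps)
          then show ?thesis using a[OF that] by simp
        qed
        define l where "l = - (\<Sum>i<n. ln (L i i))"
        define c where "c = sqrt ((2 * pi) ^ n)"
        have c0: "c > 0" by (simp add: c_def)
        have wx: "w x y = exp (l - (1/2) * (\<Sum>k<n. (v k)\<^sup>2)) / c"
          unfolding w_def gd_exp_chol[OF C] l_def[symmetric] c_def[symmetric] using a by simp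
        have wx': "w x' y = exp (l - (1/2) * (\<Sum>k<n. (v k + d k)\<^sup>2)) / c"
          unfolding w_def gd_exp_chol[OF C] l_def[symmetric] c_def[symmetric] using b by simp
        have "exp (\<eta> + (l - (1/2) * (\<Sum>k<n. (v k + d k)\<^sup>2))) < exp (l - (1/2) * (\<Sum>k<n. (v k)\<^sup>2))"
          using \<open>y \<in> T\<close> c0 unfolding T_def mem_Collect_eq wx wx' exp_add times_divide_eq_right
          by (simp add: divide_less_cancel)
        then have lt: "\<eta> + (l - (1/2) * (\<Sum>k<n. (v k + d k)\<^sup>2)) < l - (1/2) * (\<Sum>k<n. (v k)\<^sup>2)" by simp
        have "(\<Sum>k<n. (v k + d k)\<^sup>2) = (\<Sum>k<n. (v k)\<^sup>2 + 2 * (d k * v k) + (d k)\<^sup>2)"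
          by (intro sum.cong) (auto simp: power2_eq_square algebra_simps)
        then have "(\<Sum>k<n. (v k + d k)\<^sup>2) = (\<Sum>k<n. (v k)\<^sup>2) + 2 * (\<Sum>k<n. d k * v k) + (\<Sum>k<n. (d k)\<^sup>2)"
          by (simp add: sum.distrib sum_distrib_left)
        moreover have "(\<Sum>k<n. (d k)\<^sup>2) \<le> \<eta>"
        proof -
          have "\<eta> ^ 3 \<le> \<eta> ^ 1" using \<eta> by (intro power_decreasing) auto
          then show ?thesis using d by (simp add: d_def)
        qed
        ultimately show "\<eta> / 2 \<le> \<bar>\<Sum>k<n. d k * v k\<bar>" using lt by argo
      qed
    qed measurable
    also have "\<dots> \<le> (\<integral>v. (\<Sum>k<n. d k * v k)\<^sup>2 \<partial>stdg n) / (\<eta> / 2)\<^sup>2"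
      by (rule stdg_chebyshev) (use \<eta> stdg_linear(1)[of n d] in \<open>auto cong: measurable_cong_sets\<close>)
    also have "\<dots> = (\<Sum>k<n. (d k)\<^sup>2) / (\<eta> / 2)\<^sup>2" by (simp only: stdg_linear(2))
    also have "\<dots> \<le> \<eta> ^ 3 / (\<eta> / 2)\<^sup>2" using d by (intro divide_right_mono) (auto simp: d_def)
    also have "\<dots> = 4 * \<eta>" using \<eta> by (simp add: power2_eq_square power3_eq_cube field_simps)
    finally show ?thesis .
  qed
  show ?thesis using 1 2 3 by linarith
qed

lemma chol_entry_bound:
  assumes C: "chol n (cv G) L M" and i: "i < n" "j < n"
  shows "\<bar>L i j\<bar> \<le> sqrt (cv G 0 0)"
proof -
  have "(L i j)\<^sup>2 \<le> (\<Sum>k<n. (L i k)\<^sup>2)" using i by (intro member_le_sum) auto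
  also have "\<dots> = cv G i i" using C i by (simp add: chol_def power2_eq_square)
  also have "\<dots> = cv G 0 0" by (simp add: cv_def)
  finally have "sqrt ((L i j)\<^sup>2) \<le> sqrt (cv G 0 0)" by (rule real_sqrt_le_mono)
  then show ?thesis by simp
qed

text \<open>The channel law depends continuously on the whitened input, whose coordinates are at most exponential
  in n on the cost ball; a grid of doubly logarithmic size o(n) therefore resolves the inputs.\<close>

lemma input_cells:
  assumes e: "e > 0" and e3: "e3 > 0"
  shows "\<exists>N. \<forall>n\<ge>N. \<exists>(A :: (nat \<Rightarrow> int) set) \<kappa>. finite A \<and> A \<noteq> {} \<and> (\<forall>x\<in>costset n P. \<kappa> x \<in> A) \<and>
    (\<forall>x\<in>costset n P. \<forall>x'\<in>costset n P. \<kappa> x = \<kappa> x' \<longrightarrow> (\<forall>B\<in>sets (Rn n). measure (W \<gamma> n x) B \<le> measure (W \<gamma> n x') B + e3)) \<and>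
    ln (1 + ln (real (card A))) \<le> real n * e"
proof -
  define \<eta> where "\<eta> = min 1 (e3 / 6)"
  have \<eta>: "0 < \<eta>" "\<eta> \<le> 1" "6 * \<eta> \<le> e3" using e3 by (auto simp: \<eta>_def min_def)
  define s where "s = sqrt (exp (\<integral>l. ln (G l) \<partial>U))"
  have s: "s > 0" by (simp add: s_def)
  define b where "b = sqrt (cv G 0 0)"
  have b: "b \<ge> 0" unfolding b_def by (auto simp: cv_def intro!: integral_nonneg_AE G0)
  define \<beta> where "\<beta> = 1 + b / s"
  have \<beta>: "\<beta> \<ge> 1" using b s by (simp add: \<beta>_def)
  define c where "c = sqrt (P / \<eta> ^ 3) / s"
  have c: "c \<ge> 0" using P \<eta> s by (simp add: c_def)
  define D where "D = 2 * c + \<beta> + 5"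
  have D: "D \<ge> 0" using c \<beta> by (simp add: D_def)
  obtain N where N: "\<And>n. n \<ge> N \<Longrightarrow> ln (1 + D * (real n)\<^sup>2) \<le> real n * e"
    using ln_quadratic_le_linear[OF D e] by blast
  have "\<exists>(A :: (nat \<Rightarrow> int) set) \<kappa>. finite A \<and> A \<noteq> {} \<and> (\<forall>x\<in>costset n P. \<kappa> x \<in> A) \<and>
    (\<forall>x\<in>costset n P. \<forall>x'\<in>costset n P. \<kappa> x = \<kappa> x' \<longrightarrow> (\<forall>B\<in>sets (Rn n). measure (W \<gamma> n x) B \<le> measure (W \<gamma> n x') B + e3)) \<and>
    ln (1 + ln (real (card A))) \<le> real n * e" if n: "n \<ge> Suc N" for n
  proof -
    have n1: "real n \<ge> 1" using n by simp
    obtain L M where C: "chol n (cv G) L M" using chol_ex by blast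
    \<comment> \<open>Scale of the grid: inputs in one cell have whitened coordinates within 1/t,
      and n/t^2 = \<eta>^3 is what \<open>W_close\<close> requires. On the cost ball the scaled
      coordinates are at most \<open>R\<close>, since t sqrt(n P) = n sqrt(P/\<eta>^3).\<close>
    define t where "t = sqrt (real n / \<eta> ^ 3)"
    define R where "R = real n * c * \<beta> ^ n"
    have R0: "R \<ge> 0" using c \<beta> by (simp add: R_def)
    define K where "K = nat \<lceil>R\<rceil> + 1"
    define u where "u x k = t * (\<Sum>j<n. M k j * x j)" for x k
    define \<kappa> where "\<kappa> x = (\<lambda>k\<in>{..<n}. \<lfloor>u x k\<rfloor>)" for x
    define A where "A = {..<n} \<rightarrow>\<^sub>E {- int K..int K}"
    have t0: "t > 0" using n1 \<eta> by (simp add: t_def)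
    have t2: "t\<^sup>2 = real n / \<eta> ^ 3" using n1 \<eta> by (simp add: t_def)
    have diag: "s \<le> L k k" if k: "k < n" for k
    proof -
      have "s \<le> sqrt ((L k k)\<^sup>2)" unfolding s_def by (rule real_sqrt_le_mono[OF chol_diag_lower[OF G C k]])
      then show ?thesis using C k by (simp add: chol_def less_imp_le)
    qed
    have ub: "\<bar>u x k\<bar> \<le> R" if x: "x \<in> costset n P" and k: "k < n" for x k
    proof -
      have xb: "\<bar>x i\<bar> \<le> sqrt (real n * P)" if "i < n" for i
      proof -
        have "(x i)\<^sup>2 \<le> (\<Sum>i<n. (x i)\<^sup>2)" using that by (intro member_le_sum) auto
        also have "\<dots> \<le> real n * P" using x n1 by (simp add: costset_def pos_divide_le_eq mult.commute)
        finally have "sqrt ((x i)\<^sup>2) \<le> sqrt (real n * P)" by (rule real_sqrt_le_mono)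
        then show ?thesis by simp
      qed
      have "\<bar>\<Sum>j<n. M k j * x j\<bar> \<le> sqrt (real n * P) / s * (1 + b / s) ^ k"
        by (rule chol_coordinate_bound[OF C s diag _ b xb k]) (use chol_entry_bound[OF C] in \<open>simp_all add: b_def\<close>)
      also have "\<dots> \<le> sqrt (real n * P) / s * \<beta> ^ n"
        unfolding \<beta>_def[symmetric] using \<beta> s P k by (intro mult_left_mono power_increasing) auto
      finally have "t * \<bar>\<Sum>j<n. M k j * x j\<bar> \<le> t * (sqrt (real n * P) / s * \<beta> ^ n)" using t0 by (intro mult_left_mono) auto
      also have "\<dots> = (t * sqrt (real n * P)) / s * \<beta> ^ n" by simp
      also have "t * sqrt (real n * P) = real n * sqrt (P / \<eta> ^ 3)"
        unfolding t_def by (simp add: real_sqrt_mult real_sqrt_divide)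
      finally show ?thesis using t0 by (simp add: u_def R_def c_def abs_mult algebra_simps)
    qed
    have kA: "\<kappa> x \<in> A" if x: "x \<in> costset n P" for x
    proof -
      have "\<lfloor>u x k\<rfloor> \<in> {- int K..int K}" if k: "k < n" for k
        using ub[OF x k] R0 unfolding K_def by (simp add: le_floor_iff floor_le_iff) linarith
      then show ?thesis by (auto simp: \<kappa>_def A_def)
    qed
    have close: "measure (W \<gamma> n x) B \<le> measure (W \<gamma> n x') B + e3" if k: "\<kappa> x = \<kappa> x'" and B: "B \<in> sets (Rn n)" for x x' B
    proof -
      have "(\<Sum>j<n. M k j * (x j - x' j))\<^sup>2 \<le> \<eta> ^ 3 / real n" if "k < n" for k
      proof -
        have "\<lfloor>u x k\<rfloor> = \<lfloor>u x' k\<rfloor>" using fun_cong[OF k, of k] that by (simp add: \<kappa>_def)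
        then have "\<bar>u x k - u x' k\<bar> \<le> 1" by linarith
        moreover have "u x k - u x' k = t * (\<Sum>j<n. M k j * (x j - x' j))"
          by (simp add: u_def right_diff_distrib sum_subtractf)
        ultimately have "(t * (\<Sum>j<n. M k j * (x j - x' j)))\<^sup>2 \<le> 1" by (simp add: abs_square_le_1)
        then show ?thesis using n1 \<eta> by (simp add: power_mult_distrib t2 field_simps)
      qed
      then have "(\<Sum>k<n. (\<Sum>j<n. M k j * (x j - x' j))\<^sup>2) \<le> (\<Sum>k<n. \<eta> ^ 3 / real n)" by (intro sum_mono) auto
      also have "\<dots> = \<eta> ^ 3" using n1 by simp
      finally show ?thesis using W_close[OF C _ \<eta>(1,2) B, of x x'] \<eta>(3) by simp
    qed
    have card: "real (card A) = real (2 * K + 1) ^ n" by (simp add: A_def card_PiE nat_add_distrib)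
    \<comment> \<open>Each coordinate has exp(O(n)) cells and the whole grid exp(O(n^2)), so the
      iterated logarithm is O(ln n) and eventually below n e.\<close>
    have "ln (real (2 * K + 1)) \<le> real n * D"
    proof -
      have "real K \<le> R + 2" unfolding K_def using R0 by linarith
      then have "real (2 * K + 1) \<le> 2 * R + 5" by simp
      also have "\<dots> \<le> 6 * exp (real n * (2 * c + \<beta>))"
      proof -
        have "2 * (real n * c) \<le> exp (real n * (2 * c))"
          unfolding mult.left_commute[of "real n" 2 c] using exp_ge_add_one_self[of "2 * (real n * c)"] by linarith
        moreover have "\<beta> \<le> exp \<beta>" using exp_ge_add_one_self[of \<beta>] by linarith
        then have "\<beta> ^ n \<le> exp \<beta> ^ n" using \<beta> by (intro power_mono) auto
        ultimately have "2 * (real n * c) * \<beta> ^ n \<le> exp (real n * (2 * c)) * exp (real n * \<beta>)"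
          unfolding exp_of_nat_mult[of n \<beta>] using \<beta> by (intro mult_mono) auto
        then have "2 * R \<le> exp (real n * (2 * c + \<beta>))" by (simp add: R_def exp_add[symmetric] algebra_simps)
        moreover have "1 \<le> exp (real n * (2 * c + \<beta>))" using c \<beta> by simp
        ultimately show ?thesis by linarith
      qed
      also have "\<dots> \<le> exp (real n * 5) * exp (real n * (2 * c + \<beta>))"
      proof (rule mult_right_mono)
        show "6 \<le> exp (real n * 5)" using exp_ge_add_one_self[of "real n * 5"] n1 by linarith
      qed simp
      also have "\<dots> = exp (real n * D)" by (simp add: D_def exp_add[symmetric] algebra_simps)
      finally have "ln (real (2 * K + 1)) \<le> ln (exp (real n * D))" by (subst ln_le_cancel_iff) auto
      then show ?thesis by simp
    qed
    then have "real n * ln (real (2 * K + 1)) \<le> real n * (real n * D)" by (rule mult_left_mono) simp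
    then have lc: "ln (real (card A)) \<le> D * (real n)\<^sup>2"
      unfolding card by (subst ln_realpow) (auto simp: power2_eq_square algebra_simps)
    have "real (card A) \<ge> 1" unfolding card by (rule one_le_power) simp
    then have "ln (real (card A)) \<ge> 0" by simp
    then have "ln (1 + ln (real (card A))) \<le> ln (1 + D * (real n)\<^sup>2)" using lc by (subst ln_le_cancel_iff) auto
    also have "\<dots> \<le> real n * e" using N[of n] n by simp
    finally have "ln (1 + ln (real (card A))) \<le> real n * e" .
    moreover have "finite A" unfolding A_def by (intro finite_PiE) auto
    moreover have "A \<noteq> {}" using \<open>real (card A) \<ge> 1\<close> by auto
    ultimately show ?thesis using kA close by (intro exI[of _ A] exI[of _ \<kappa>]) blast
  qed
  then show ?thesis by blast
qed

end

text \<open>A message is determined by the length of its codebook and the word of cells it runs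
  through; there are at most K lengths and at most |A|^K words for each.\<close>

lemma message_count:
  fixes A :: "'b set" and m :: "nat \<Rightarrow> nat"
  assumes A: "finite A" "A \<noteq> {}" and m: "\<And>i. i \<in> {1..N} \<Longrightarrow> 1 \<le> m i \<and> m i \<le> K"
    and k: "\<And>i r. i \<in> {1..N} \<Longrightarrow> r \<in> {1..m i} \<Longrightarrow> k i r \<in> A"
    and inj: "\<And>i j. i \<in> {1..N} \<Longrightarrow> j \<in> {1..N} \<Longrightarrow> m i = m j \<Longrightarrow> (\<And>r. r \<in> {1..m i} \<Longrightarrow> k i r = k j r) \<Longrightarrow> i = j"
  shows "N \<le> K * card A ^ K"
proof -
  define f where "f i = (m i, restrict (k i) {1..m i})" for i
  define S where "S = Sigma {1..K} (\<lambda>m. {1..m} \<rightarrow>\<^sub>E A)"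
  have finS: "finite S" unfolding S_def by (intro finite_SigmaI finite_PiE A(1)) auto
  have "inj_on f {1..N}"
  proof (rule inj_onI)
    fix i j assume ij: "i \<in> {1..N}" "j \<in> {1..N}" and f: "f i = f j"
    then have mm: "m i = m j" and r: "restrict (k i) {1..m i} = restrict (k j) {1..m i}" by (auto simp: f_def)
    show "i = j"
    proof (rule inj[OF ij mm])
      fix t assume "t \<in> {1..m i}"
      with fun_cong[OF r, of t] show "k i t = k j t" by simp
    qed
  qed
  then have "card (f ` {1..N}) = N" by (simp add: card_image)
  moreover have "f ` {1..N} \<subseteq> S"
  proof
    fix p assume "p \<in> f ` {1..N}"
    then obtain i where i: "i \<in> {1..N}" "p = f i" by blast
    have "restrict (k i) {1..m i} \<in> {1..m i} \<rightarrow>\<^sub>E A" by (rule restrict_PiE_iff[THEN iffD2]) (use k[OF i(1)] in blast)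
    then show "p \<in> S" using m[OF i(1)] i(2) by (simp add: S_def f_def)
  qed
  ultimately have "N \<le> card S" using card_mono[OF finS, of "f ` {1..N}"] by simp
  also have "card S = (\<Sum>m\<in>{1..K}. card ({1..m} \<rightarrow>\<^sub>E A))"
    unfolding S_def by (intro card_SigmaI) (auto intro!: finite_PiE A(1))
  also have "\<dots> = (\<Sum>m\<in>{1..K}. card A ^ m)" by (simp add: card_PiE)
  also have "\<dots> \<le> (\<Sum>m\<in>{1..K}. card A ^ K)"
    by (intro sum_mono power_increasing) (use A in \<open>auto simp: Suc_le_eq card_gt_0_iff\<close>)
  also have "\<dots> = K * card A ^ K" by simp
  finally show ?thesis .
qed

section \<open>Identification rates are at most resolvability rates\<close>

context anwgn
begin

lemma outp_bounds:
  assumes ad: "admissible_input n P Q" and B: "B \<in> sets (Rn n)"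
  shows "0 \<le> outp \<gamma> n Q B" "outp \<gamma> n Q B \<le> 1" "outp \<gamma> n Q (space (Rn n) - B) = 1 - outp \<gamma> n Q B"
proof -
  interpret Q: prob_space Q using ad by (simp add: admissible_input_def)
  have sQ: "sets Q = sets (Rn n)" using ad by (simp add: admissible_input_def)
  have m: "(\<lambda>x. measure (W \<gamma> n x) B) \<in> borel_measurable Q"
    using measure_W_measurable[OF B] sQ by (simp cong: measurable_cong_sets)
  have p: "measure (W \<gamma> n x) B \<le> 1" for x by (rule prob_space.prob_le_1[OF prob_W])
  have i: "integrable Q (\<lambda>x. measure (W \<gamma> n x) B)"
    by (rule Q.integrable_const_bound[of _ 1]) (use m p in auto)
  show "0 \<le> outp \<gamma> n Q B" unfolding outp_def by (rule integral_nonneg_AE) simp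
  show "outp \<gamma> n Q B \<le> 1" unfolding outp_def by (rule Q.integral_le_const[OF i]) (simp add: p)
  have c: "measure (W \<gamma> n x) (space (Rn n) - B) = 1 - measure (W \<gamma> n x) B" for x
    using prob_space.prob_compl[OF prob_W, of B n x] B by simp
  show "outp \<gamma> n Q (space (Rn n) - B) = 1 - outp \<gamma> n Q B"
    unfolding outp_def c by (subst Bochner_Integration.integral_diff[OF _ i]) (auto simp: Q.prob_space)
qed

text \<open>The supremum in \<open>res_dist\<close> runs over a family bounded by 1, so it dominates
  each member; its factor 2 is the reason for r/2.\<close>

lemma res_dist_bound:
  assumes ad: "admissible_input n P Q" and B: "B \<in> sets (Rn n)" and m: "m \<ge> 1" and r: "res_dist \<gamma> n Q m \<phi> \<le> r"
  shows "\<bar>outp \<gamma> n Q B - (\<Sum>i\<in>{1..m}. measure (W \<gamma> n (\<phi> i)) B) / real m\<bar> \<le> r / 2"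
proof -
  define h where "h B = \<bar>outp \<gamma> n Q B - (\<Sum>i\<in>{1..m}. measure (W \<gamma> n (\<phi> i)) B) / real m\<bar>" for B
  have h1: "h A \<le> 1" if A: "A \<in> sets (Rn n)" for A
  proof -
    have "(\<Sum>i\<in>{1..m}. measure (W \<gamma> n (\<phi> i)) A) \<le> (\<Sum>i\<in>{1..m}. 1)"
      by (intro sum_mono prob_space.prob_le_1[OF prob_W])
    then have "(\<Sum>i\<in>{1..m}. measure (W \<gamma> n (\<phi> i)) A) / real m \<le> 1" using m by (simp add: divide_le_eq)
    moreover have "0 \<le> (\<Sum>i\<in>{1..m}. measure (W \<gamma> n (\<phi> i)) A) / real m" by (intro divide_nonneg_nonneg sum_nonneg) auto
    ultimately show ?thesis using outp_bounds[OF ad A] unfolding h_def by linarith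
  qed
  have "bdd_above (h ` sets (Rn n))" by (auto intro!: bdd_aboveI[of _ 1] h1)
  then have "h B \<le> (SUP B\<in>sets (Rn n). h B)" by (intro cSUP_upper B)
  moreover have "2 * (SUP B\<in>sets (Rn n). h B) \<le> r" using r unfolding res_dist_def h_def .
  ultimately have "h B \<le> r / 2" by linarith
  then show ?thesis by (simp only: h_def)
qed

text \<open>Achievability is given for each input process with its own threshold. A process that has
  at every n a law violating the bound, if there is one, is itself covered by the hypothesis, and
  its threshold works for all laws.\<close>

lemma res_uniform:
  assumes res: "\<forall>X\<in>S_P P. res_achievable_for \<gamma> \<delta> P X R" and e: "e > 0"
  shows "\<exists>N. \<forall>n\<ge>N. \<forall>Q. admissible_input n P Q \<longrightarrow>
    (\<exists>m \<phi>. 1 \<le> m \<and> (\<forall>i\<in>{1..m}. \<phi> i \<in> costset n P) \<and> res_dist \<gamma> n Q m \<phi> \<le> \<delta> + e \<and> ln (real m) / real n \<le> R + e)"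
proof -
  define good where "good n Q = (\<exists>m \<phi>. 1 \<le> m \<and> (\<forall>i\<in>{1..m}. \<phi> i \<in> costset n P) \<and>
    res_dist \<gamma> n Q m \<phi> \<le> \<delta> + e \<and> ln (real m) / real n \<le> R + e)" for n Q
  have ex: "\<exists>Q. admissible_input n P Q \<and> ((\<exists>Q'. admissible_input n P Q' \<and> \<not> good n Q') \<longrightarrow> \<not> good n Q)" for n
  proof (cases "\<exists>Q'. admissible_input n P Q' \<and> \<not> good n Q'")
    case True then show ?thesis by blast
  next
    case False
    have "admissible_input n P (mixture n 1 (\<lambda>_. \<lambda>i\<in>{..<n}. 0))"
      by (rule mixture_admissible) (use zero_in_costset[OF P] in auto)
    with False show ?thesis by blast
  qed
  obtain X where X: "\<And>n. admissible_input n P (X n)"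
    and bad: "\<And>n. (\<exists>Q'. admissible_input n P Q' \<and> \<not> good n Q') \<Longrightarrow> \<not> good n (X n)"
    using choice[of "\<lambda>n Q. admissible_input n P Q \<and> ((\<exists>Q'. admissible_input n P Q' \<and> \<not> good n Q') \<longrightarrow> \<not> good n Q)"] ex by blast
  have "X \<in> S_P P" using X by (simp add: S_P_def)
  with res have "res_achievable_for \<gamma> \<delta> P X R" by blast
  then obtain Ms \<phi> where c: "\<And>n. 1 \<le> Ms n" "\<And>n. \<forall>i\<in>{1..Ms n}. \<phi> n i \<in> costset n P"
    and d: "limsup (\<lambda>n. ereal (res_dist \<gamma> n (X n) (Ms n) (\<phi> n))) \<le> ereal \<delta>"
    and r: "limsup (\<lambda>n. ereal (ln (real (Ms n)) / real n)) \<le> ereal R"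
    unfolding res_achievable_for_def by blast
  have "limsup (\<lambda>n. ereal (res_dist \<gamma> n (X n) (Ms n) (\<phi> n))) < ereal (\<delta> + e)"
    using e by (intro le_less_trans[OF d]) simp
  then have E1: "eventually (\<lambda>n. res_dist \<gamma> n (X n) (Ms n) (\<phi> n) < \<delta> + e) sequentially"
    by (drule_tac Limsup_lessD) simp
  have "limsup (\<lambda>n. ereal (ln (real (Ms n)) / real n)) < ereal (R + e)"
    using e by (intro le_less_trans[OF r]) simp
  then have E2: "eventually (\<lambda>n. ln (real (Ms n)) / real n < R + e) sequentially"
    by (drule_tac Limsup_lessD) simp
  from E1 E2 have "eventually (\<lambda>n. good n (X n)) sequentially"
  proof eventually_elim
    case (elim n)
    then show ?case unfolding good_def using c[of n] by (intro exI[of _ "Ms n"] exI[of _ "\<phi> n"]) simp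
  qed
  then obtain N where "\<And>n. n \<ge> N \<Longrightarrow> good n (X n)" by (auto simp: eventually_sequentially)
  then have "\<forall>n\<ge>N. \<forall>Q. admissible_input n P Q \<longrightarrow> good n Q" using bad by blast
  then show ?thesis unfolding good_def by blast
qed

text \<open>Two messages whose resolving codebooks run through the same cells have nearly the same output law,
  so an identification code has at most as many messages as there are cell words.\<close>

lemma id_le_res:
  assumes id: "id_achievable \<gamma> \<mu> lam P R'" and res: "\<forall>X\<in>S_P P. res_achievable_for \<gamma> \<delta> P X R" and s: "\<delta> + \<mu> + lam < 1"
  shows "R' \<le> R"
proof (rule ccontr)
  assume R: "\<not> R' \<le> R"
  \<comment> \<open>Two messages with the same cell word would give 1 - \<mu> - lam - \<delta> < 4e,
    and the counting bound gives a rate at most R + 2e; both are excluded by this choice.\<close>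
  define e where "e = min ((R' - R) / 4) ((1 - \<delta> - \<mu> - lam) / 6)"
  have "e \<le> (R' - R) / 4" "e \<le> (1 - \<delta> - \<mu> - lam) / 6" unfolding e_def by (rule min.cobounded1, rule min.cobounded2)
  moreover have "e > 0" using R s by (simp add: e_def)
  ultimately have e: "e > 0" "4 * e \<le> R' - R" "6 * e \<le> 1 - \<delta> - \<mu> - lam"
    using mult_left_mono[of e "(R' - R) / 4" 4] mult_left_mono[of e "(1 - \<delta> - \<mu> - lam) / 6" 6] by simp_all
  obtain Ns Q D where code: "\<And>n. idcode n (Ns n) P (Q n) (D n)"
    and mu: "limsup (\<lambda>n. ereal (id_mu \<gamma> n (Ns n) (Q n) (D n))) \<le> ereal \<mu>"
    and la: "limsup (\<lambda>n. ereal (id_lam \<gamma> n (Ns n) (Q n) (D n))) \<le> ereal lam"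
    and ra: "ereal R' \<le> liminf (\<lambda>n. ereal (ln (ln (real (Ns n))) / real n))"
    using id unfolding id_achievable_def by blast
  have "limsup (\<lambda>n. ereal (id_mu \<gamma> n (Ns n) (Q n) (D n))) < ereal (\<mu> + e)"
    using e(1) by (intro le_less_trans[OF mu]) simp
  then have E1: "eventually (\<lambda>n. id_mu \<gamma> n (Ns n) (Q n) (D n) < \<mu> + e) sequentially"
    by (drule_tac Limsup_lessD) simp
  have "limsup (\<lambda>n. ereal (id_lam \<gamma> n (Ns n) (Q n) (D n))) < ereal (lam + e)"
    using e(1) by (intro le_less_trans[OF la]) simp
  then have E2: "eventually (\<lambda>n. id_lam \<gamma> n (Ns n) (Q n) (D n) < lam + e) sequentially"
    by (drule_tac Limsup_lessD) simp
  have "ereal (R' - e) < liminf (\<lambda>n. ereal (ln (ln (real (Ns n))) / real n))"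
    using e(1) by (intro less_le_trans[OF _ ra]) simp
  then have E3: "eventually (\<lambda>n. R' - e < ln (ln (real (Ns n))) / real n) sequentially"
    by (drule_tac less_LiminfD) simp
  obtain N1 where N1: "\<And>n. n \<ge> N1 \<Longrightarrow> \<forall>Q. admissible_input n P Q \<longrightarrow>
    (\<exists>m \<phi>. 1 \<le> m \<and> (\<forall>i\<in>{1..m}. \<phi> i \<in> costset n P) \<and> res_dist \<gamma> n Q m \<phi> \<le> \<delta> + e \<and> ln (real m) / real n \<le> R + e)"
    using res_uniform[OF res e(1)] by blast
  obtain N2 where N2: "\<And>n. n \<ge> N2 \<Longrightarrow> \<exists>(A :: (nat \<Rightarrow> int) set) \<kappa>. finite A \<and> A \<noteq> {} \<and> (\<forall>x\<in>costset n P. \<kappa> x \<in> A) \<and>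
    (\<forall>x\<in>costset n P. \<forall>x'\<in>costset n P. \<kappa> x = \<kappa> x' \<longrightarrow> (\<forall>B\<in>sets (Rn n). measure (W \<gamma> n x) B \<le> measure (W \<gamma> n x') B + e)) \<and>
    ln (1 + ln (real (card A))) \<le> real n * e"
    using input_cells[OF e(1) e(1)] by blast
  have "eventually (\<lambda>n. n \<ge> Suc (N1 + N2)) sequentially" by (rule eventually_ge_at_top)
  with E1 E2 E3 have "eventually (\<lambda>n. id_mu \<gamma> n (Ns n) (Q n) (D n) < \<mu> + e \<and> id_lam \<gamma> n (Ns n) (Q n) (D n) < lam + e
      \<and> R' - e < ln (ln (real (Ns n))) / real n \<and> n \<ge> Suc (N1 + N2)) sequentially"
    by (intro eventually_conj)
  then obtain n where n: "id_mu \<gamma> n (Ns n) (Q n) (D n) < \<mu> + e" "id_lam \<gamma> n (Ns n) (Q n) (D n) < lam + e"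
    "R' - e < ln (ln (real (Ns n))) / real n" "n \<ge> Suc (N1 + N2)"
    unfolding eventually_sequentially by blast
  define N where "N = Ns n"
  have N: "N \<ge> 1" and ad: "\<And>i. i \<in> {1..N} \<Longrightarrow> admissible_input n P (Q n i)" and Dm: "\<And>i. i \<in> {1..N} \<Longrightarrow> D n i \<in> sets (Rn n)"
    using code[of n] unfolding idcode_def N_def by blast+
  have n0: "real n > 0" using n(4) by simp
  have "N2 \<le> n" using n(4) by simp
  from N2[OF this] obtain A :: "(nat \<Rightarrow> int) set" and \<kappa> where A: "finite A" "A \<noteq> {}" and \<kappa>: "\<And>x. x \<in> costset n P \<Longrightarrow> \<kappa> x \<in> A"
    and cell: "\<And>x x' B. x \<in> costset n P \<Longrightarrow> x' \<in> costset n P \<Longrightarrow> \<kappa> x = \<kappa> x' \<Longrightarrow> B \<in> sets (Rn n) \<Longrightarrow>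
      measure (W \<gamma> n x) B \<le> measure (W \<gamma> n x') B + e"
    and lnA: "ln (1 + ln (real (card A))) \<le> real n * e" by blast
  have "\<forall>i\<in>{1..N}. \<exists>m \<phi>. 1 \<le> m \<and> (\<forall>r\<in>{1..m}. \<phi> r \<in> costset n P) \<and> res_dist \<gamma> n (Q n i) m \<phi> \<le> \<delta> + e \<and> ln (real m) / real n \<le> R + e"
    using N1[of n] n(4) ad by simp
  then obtain m \<phi> where m1: "\<And>i. i \<in> {1..N} \<Longrightarrow> 1 \<le> m i"
    and \<phi>: "\<And>i r. i \<in> {1..N} \<Longrightarrow> r \<in> {1..m i} \<Longrightarrow> \<phi> i r \<in> costset n P"
    and rd: "\<And>i. i \<in> {1..N} \<Longrightarrow> res_dist \<gamma> n (Q n i) (m i) (\<phi> i) \<le> \<delta> + e"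
    and mr: "\<And>i. i \<in> {1..N} \<Longrightarrow> ln (real (m i)) / real n \<le> R + e"
    unfolding bchoice_iff by blast
  define E where "E = exp (real n * (R + e))"
  define K where "K = nat \<lfloor>E\<rfloor>"
  have mE: "real (m i) \<le> E" if "i \<in> {1..N}" for i
  proof -
    have "ln (real (m i)) \<le> real n * (R + e)" using mr[OF that] n0 by (simp add: pos_divide_le_eq mult.commute)
    then have "exp (ln (real (m i))) \<le> E" unfolding E_def by (rule exp_le_cancel_iff[THEN iffD2])
    then show ?thesis using m1[OF that] by simp
  qed
  have mK: "1 \<le> m i \<and> m i \<le> K" if "i \<in> {1..N}" for i
    using m1[OF that] mE[OF that] unfolding K_def by (simp add: le_nat_floor)
  have one: "1 \<in> {1..N}" using N by simp
  have E1': "E \<ge> 1" using mE[OF one] m1[OF one] by linarith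
  have KE: "real K \<le> E" using E1' unfolding K_def by linarith
  have K1: "K \<ge> 1" using mK[OF one] by linarith
  have "N \<le> K * card A ^ K"
  proof (rule message_count[OF A mK, where k = "\<lambda>i r. \<kappa> (\<phi> i r)"])
    fix i r assume "i \<in> {1..N}" "r \<in> {1..m i}"
    then show "\<kappa> (\<phi> i r) \<in> A" by (intro \<kappa> \<phi>)
  next
    fix i j assume i: "i \<in> {1..N}" and j: "j \<in> {1..N}" and mm: "m i = m j"
      and k: "\<And>r. r \<in> {1..m i} \<Longrightarrow> \<kappa> (\<phi> i r) = \<kappa> (\<phi> j r)"
    show "i = j"
    proof (rule ccontr)
      assume ij: "i \<noteq> j"
      define B where "B = D n i"
      have B: "B \<in> sets (Rn n)" unfolding B_def by (rule Dm[OF i])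
      define S where "S l = (\<Sum>r\<in>{1..m i}. measure (W \<gamma> n (\<phi> l r)) B)" for l
      have bi: "\<bar>outp \<gamma> n (Q n i) B - S i / real (m i)\<bar> \<le> (\<delta> + e) / 2"
        unfolding S_def by (rule res_dist_bound[OF ad[OF i] B m1[OF i] rd[OF i]])
      have bj: "\<bar>outp \<gamma> n (Q n j) B - S j / real (m i)\<bar> \<le> (\<delta> + e) / 2"
        unfolding S_def mm by (rule res_dist_bound[OF ad[OF j] B m1[OF j] rd[OF j]])
      \<comment> \<open>The codebooks have the same length and cellwise equal entries, so their
        average probabilities of \<open>B\<close> compare within e.\<close>
      have "S i \<le> (\<Sum>r\<in>{1..m i}. measure (W \<gamma> n (\<phi> j r)) B + e)"
        unfolding S_def
      proof (rule sum_mono)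
        fix r assume r: "r \<in> {1..m i}"
        show "measure (W \<gamma> n (\<phi> i r)) B \<le> measure (W \<gamma> n (\<phi> j r)) B + e"
          by (rule cell[OF \<phi>[OF i r] \<phi>[OF j r[unfolded mm]] k[OF r] B])
      qed
      also have "\<dots> = S j + real (m i) * e" by (simp add: S_def sum.distrib)
      finally have "S i / real (m i) \<le> (S j + real (m i) * e) / real (m i)" by (rule divide_right_mono) simp
      also have "\<dots> = S j / real (m i) + e" using m1[OF i] by (simp add: add_divide_distrib)
      finally have sij: "S i / real (m i) \<le> S j / real (m i) + e" .
      have "outp \<gamma> n (Q n i) (space (Rn n) - B) \<le> id_mu \<gamma> n N (Q n) (D n)"
        unfolding id_mu_def B_def using i by (intro Max_ge) auto
      then have "1 - outp \<gamma> n (Q n i) B < \<mu> + e"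
        using n(1) outp_bounds(3)[OF ad[OF i] B] unfolding N_def[symmetric] by linarith
      moreover have "outp \<gamma> n (Q n j) B \<le> id_lam \<gamma> n N (Q n) (D n)"
      proof -
        have "finite {(i, j). i \<in> {1..N} \<and> j \<in> {1..N} \<and> i \<noteq> j}"
          by (rule finite_subset[of _ "{1..N} \<times> {1..N}"]) auto
        then show ?thesis
          unfolding id_lam_def B_def using i j ij
          by (intro Max_ge finite.insertI finite_imageI insertI2 image_eqI[of _ _ "(i, j)"]) auto
      qed
      moreover note n(2)[folded N_def]
      moreover have "\<not> (1 - a < \<mu> + e \<and> b \<le> l \<and> l < lam + e \<and> a - c \<le> (\<delta> + e) / 2 \<and> - (b - d) \<le> (\<delta> + e) / 2 \<and> c \<le> d + e)"
        for a b c d l using e(1,3) by argo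
      ultimately show False using abs_le_D1[OF bi] abs_le_D2[OF bj] sij by blast
    qed
  qed
  then have "real N \<le> real (K * card A ^ K)" by (simp only: of_nat_le_iff)
  then have NK: "real N \<le> real K * real (card A) ^ K" by simp
  have A1: "real (card A) \<ge> 1" using A by (simp add: Suc_le_eq card_gt_0_iff)
  have lA0: "ln (real (card A)) \<ge> 0" using A1 by simp
  have "ln (ln (real N)) / real n \<le> R + 2 * e"
  \<comment> \<open>For a single message the left side is ln 0 / n with the value ln 0 = 0, so the
    right side must be shown nonnegative, which follows from codebooks having at least one
    entry.\<close>
  proof (cases "N = 1")
    case True
    have "0 \<le> ln (real (m 1)) / real n" using m1[OF one] by simp
    then have "0 \<le> R + e" using mr[OF one] by linarith
    then show ?thesis using True e(1) by simp
  next
    case False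
    then have N2: "real N > 1" using N by simp
    have "ln (real N) \<le> ln (real K * real (card A) ^ K)" using NK N2 by (subst ln_le_cancel_iff) auto
    also have "\<dots> = ln (real K) + real K * ln (real (card A))" using K1 A1 by (simp add: ln_mult ln_realpow)
    also have "\<dots> \<le> real K + real K * ln (real (card A))" using K1 ln_le_minus_one[of "real K"] by simp
    also have "\<dots> = real K * (1 + ln (real (card A)))" by (simp add: algebra_simps)
    also have "\<dots> \<le> E * (1 + ln (real (card A)))" using KE lA0 by (intro mult_right_mono) auto
    finally have lnN: "ln (real N) \<le> E * (1 + ln (real (card A)))" .
    have "0 < E * (1 + ln (real (card A)))" using E1' lA0 by (intro mult_pos_pos) linarith+
    with lnN have "ln (ln (real N)) \<le> ln (E * (1 + ln (real (card A))))" using N2 by (subst ln_le_cancel_iff) auto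
    also have "ln (E * (1 + ln (real (card A)))) = real n * (R + e) + ln (1 + ln (real (card A)))"
      unfolding E_def using lA0 by (subst ln_mult) auto
    also have "\<dots> \<le> real n * (R + e) + real n * e" using lnA by simp
    also have "\<dots> = (R + 2 * e) * real n" by (simp add: algebra_simps)
    finally show ?thesis using n0 by (simp add: pos_divide_le_eq)
  qed
  then show False using n(3) e unfolding N_def by linarith
qed

lemma res_achievable_cap:
  assumes e: "0 < e" and X: "X \<in> S_P P" and \<delta>: "0 \<le> \<delta>"
  shows "res_achievable_for \<gamma> \<delta> P X (cap + 2 * e)"
proof -
  have X: "admissible_input n P (X n)" for n using X by (simp add: S_P_def)
  \<comment> \<open>Rounding up meets the size condition of \<open>resolvability_uniform\<close> and
    at most doubles the codebook.\<close>
  define m where "m n = nat \<lceil>exp (real n * (cap + e))\<rceil>" for n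
  have ex1: "1 \<le> exp (real n * (cap + e))" for n using e cap_pos by simp
  have mge: "exp (real n * (cap + e)) \<le> real (m n)" for n unfolding m_def by linarith
  have mle: "real (m n) \<le> 2 * exp (real n * (cap + e))" for n using ex1[of n] unfolding m_def by linarith
  have m1: "m n \<ge> 1" for n using mge[of n] ex1[of n] by linarith
  define Pr where "Pr n k = (\<exists>\<phi>. (\<forall>i\<in>{1..m n}. \<phi> i \<in> costset n P) \<and> res_dist \<gamma> n (X n) (m n) \<phi> \<le> 1 / real (Suc k))" for n k
  have "\<exists>N. \<forall>n\<ge>N. Pr n k" for k
  proof -
    define d where "d = min e (1 / real (Suc k))"
    have d: "d > 0" "d \<le> e" "d \<le> 1 / real (Suc k)" using e by (auto simp: d_def)
    obtain N where N: "\<And>n. n \<ge> N \<Longrightarrow> \<forall>Q m. admissible_input n P Q \<longrightarrow> exp (real n * (cap + d)) \<le> real m \<longrightarrow>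
      (\<exists>\<phi>. (\<forall>i\<in>{1..m}. \<phi> i \<in> costset n P) \<and> res_dist \<gamma> n Q m \<phi> \<le> d)"
      using resolvability_uniform[OF d(1)] by blast
    have "Pr n k" if n: "n \<ge> N" for n
    proof -
      have "real n * (cap + d) \<le> real n * (cap + e)" using d(2) by (intro mult_left_mono) auto
      then have "exp (real n * (cap + d)) \<le> real (m n)" using mge[of n] by (meson exp_le_cancel_iff order_trans)
      with N[OF n] X[of n] obtain \<phi> where "\<forall>i\<in>{1..m n}. \<phi> i \<in> costset n P" "res_dist \<gamma> n (X n) (m n) \<phi> \<le> d" by blast
      then show ?thesis unfolding Pr_def using d(3) by (intro exI[of _ \<phi>]) linarith
    qed
    then show ?thesis by blast
  qed
  then obtain \<kappa> N where \<kappa>: "filterlim \<kappa> at_top sequentially" and N: "\<And>n. n \<ge> N \<Longrightarrow> Pr n (\<kappa> n)"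
    using diagonal_sequence[of Pr] by blast
  have "\<forall>n. \<exists>\<phi>. (\<forall>i\<in>{1..m n}. \<phi> i \<in> costset n P) \<and> (n \<ge> N \<longrightarrow> res_dist \<gamma> n (X n) (m n) \<phi> \<le> 1 / real (Suc (\<kappa> n)))"
  proof
    fix n
    show "\<exists>\<phi>. (\<forall>i\<in>{1..m n}. \<phi> i \<in> costset n P) \<and> (n \<ge> N \<longrightarrow> res_dist \<gamma> n (X n) (m n) \<phi> \<le> 1 / real (Suc (\<kappa> n)))"
    proof (cases "n \<ge> N")
      case True then show ?thesis using N[OF True] unfolding Pr_def by blast
    next
      case False then show ?thesis by (intro exI[of _ "\<lambda>_. \<lambda>i\<in>{..<n}. 0"]) (simp add: zero_in_costset[OF P])
    qed
  qed
  then obtain \<phi> where \<phi>: "\<And>n. \<forall>i\<in>{1..m n}. \<phi> n i \<in> costset n P"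
    and rd: "\<And>n. n \<ge> N \<Longrightarrow> res_dist \<gamma> n (X n) (m n) (\<phi> n) \<le> 1 / real (Suc (\<kappa> n))"
    unfolding choice_iff by blast
  have "limsup (\<lambda>n. ereal (res_dist \<gamma> n (X n) (m n) (\<phi> n))) \<le> 0" by (rule limsup_ereal_le_zero[OF \<kappa> rd])
  also have "0 \<le> ereal \<delta>" using \<delta> by simp
  finally have 1: "limsup (\<lambda>n. ereal (res_dist \<gamma> n (X n) (m n) (\<phi> n))) \<le> ereal \<delta>" .
  have 2: "limsup (\<lambda>n. ereal (ln (real (m n)) / real n)) \<le> ereal (cap + 2 * e)"
  proof (rule Limsup_bounded)
    obtain K :: nat where K: "ln 2 / e \<le> real K" using real_arch_simple by blast
    have "ln (real (m n)) / real n \<le> cap + 2 * e" if n: "n \<ge> Suc K" for n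
    proof -
      have n0: "real n > 0" using n by simp
      have "ln (real (m n)) \<le> ln (2 * exp (real n * (cap + e)))" using mle[of n] m1[of n] by (subst ln_le_cancel_iff) auto
      also have "\<dots> = ln 2 + real n * (cap + e)" by (simp add: ln_mult)
      also have "ln 2 \<le> real n * e"
      proof -
        have "ln 2 \<le> real K * e" using K e by (simp add: pos_divide_le_eq)
        also have "\<dots> \<le> real n * e" using n e by (intro mult_right_mono) auto
        finally show ?thesis .
      qed
      finally have "ln (real (m n)) \<le> (cap + 2 * e) * real n" by (simp add: algebra_simps)
      then show ?thesis using n0 by (simp add: pos_divide_le_eq)
    qed
    then show "eventually (\<lambda>n. ereal (ln (real (m n)) / real n) \<le> ereal (cap + 2 * e)) sequentially"
      unfolding eventually_sequentially by (intro exI[of _ "Suc K"]) simp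
  qed
  show ?thesis unfolding res_achievable_for_def using m1 \<phi> 1 2 by (intro exI[of _ m] exI[of _ \<phi>]) blast
qed

text \<open>\<open>id_le_res\<close> is used twice. With resolvability distance 0 at rates just
  above \<open>cap\<close> it bounds every identification rate with \<mu> + lam < 1; with
  identification errors 0 at rates just below \<open>cap\<close> it bounds every resolvability rate
  with \<delta> < 1.\<close>

lemma coding_theorem:
  assumes "0 \<le> \<epsilon>" "\<epsilon> < 1" "0 \<le> \<mu>" "0 \<le> lam" "\<mu> + lam < 1" "0 \<le> \<delta>" "\<delta> < 1"
  shows "Cs \<gamma> \<epsilon> P = ereal cap" "Did \<gamma> \<mu> lam P = ereal cap" "Sres \<gamma> \<delta> P = ereal cap"
proof -
  \<comment> \<open>The direct parts deliver the rates cap - 2e only for small e; a lower bound at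
    these rates is enough.\<close>
  have small: "ereal cap \<le> x" if "\<And>e. 0 < e \<Longrightarrow> e < 1 \<Longrightarrow> 2 * e < cap \<Longrightarrow> ereal (cap - 2 * e) \<le> x" for x
  proof (rule ereal_le_epsilon2)
    fix r :: real assume r: "0 < r"
    define e where "e = min (1/2) (min (cap / 4) (r / 2))"
    have e: "0 < e" "e < 1" "2 * e < cap" "2 * e \<le> r" using r cap_pos by (auto simp: e_def min_def)
    have "ereal cap \<le> ereal (cap - 2 * e) + ereal r" using e(4) by simp
    also have "\<dots> \<le> x + ereal r" by (intro add_right_mono that e(1-3))
    finally show "ereal cap \<le> x + ereal r" .
  qed
  have tmono: "t_achievable \<gamma> \<epsilon> P R" if "t_achievable \<gamma> 0 P R" for R
    using that assms(1) unfolding t_achievable_def by (meson ereal_less_eq(3) order_trans)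
  show "Cs \<gamma> \<epsilon> P = ereal cap"
  proof (rule antisym)
    show "Cs \<gamma> \<epsilon> P \<le> ereal cap" unfolding Cs_def by (rule SUP_least) (use strong_converse assms(2) in auto)
    show "ereal cap \<le> Cs \<gamma> \<epsilon> P"
    proof (rule small)
      fix e :: real assume "0 < e" "e < 1" "2 * e < cap"
      then have "t_achievable \<gamma> \<epsilon> P (cap - 2 * e)" by (intro tmono t_achievable_cap) auto
      then show "ereal (cap - 2 * e) \<le> Cs \<gamma> \<epsilon> P" unfolding Cs_def by (intro SUP_upper) simp
    qed
  qed
  have imono: "id_achievable \<gamma> \<mu> lam P R" if "id_achievable \<gamma> 0 0 P R" for R
    using that assms(3,4) unfolding id_achievable_def by (meson ereal_less_eq(3) order_trans)
  have res: "\<forall>X\<in>S_P P. res_achievable_for \<gamma> d P X (cap + 2 * e)" if "0 \<le> d" "0 < e" for d e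
    using res_achievable_cap[OF that(2) _ that(1)] by blast
  show "Did \<gamma> \<mu> lam P = ereal cap"
  proof (rule antisym)
    show "Did \<gamma> \<mu> lam P \<le> ereal cap" unfolding Did_def
    proof (rule SUP_least)
      fix R assume "R \<in> {R. id_achievable \<gamma> \<mu> lam P R}"
      then have *: "R \<le> cap + 2 * e" if "0 < e" for e
        using id_le_res[OF _ res[OF order_refl that]] assms(5) by simp
      then have "R \<le> cap + e" if "0 < e" for e using *[of "e / 2"] that by simp
      then show "ereal R \<le> ereal cap" using field_le_epsilon[of R cap] by simp
    qed
    show "ereal cap \<le> Did \<gamma> \<mu> lam P"
    proof (rule small)
      fix e :: real assume "0 < e" "e < 1" "2 * e < cap"
      then have "id_achievable \<gamma> \<mu> lam P (cap - 2 * e)" by (intro imono id_achievable_cap)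
      then show "ereal (cap - 2 * e) \<le> Did \<gamma> \<mu> lam P" unfolding Did_def by (intro SUP_upper) simp
    qed
  qed
  show "Sres \<gamma> \<delta> P = ereal cap"
  proof (rule antisym)
    show "Sres \<gamma> \<delta> P \<le> ereal cap"
    proof (rule ereal_le_epsilon2)
      fix r :: real assume r: "0 < r"
      have "\<forall>X\<in>S_P P. res_achievable_for \<gamma> \<delta> P X (cap + r)" using res[OF assms(6), of "r / 2"] r by simp
      then have "Sres \<gamma> \<delta> P \<le> ereal (cap + r)" unfolding Sres_def by (intro INF_lower) simp
      then show "Sres \<gamma> \<delta> P \<le> ereal cap + ereal r" by simp
    qed
    show "ereal cap \<le> Sres \<gamma> \<delta> P" unfolding Sres_def
    proof (rule INF_greatest)
      fix R assume "R \<in> {R. \<forall>X\<in>S_P P. res_achievable_for \<gamma> \<delta> P X R}"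
      then have R: "\<forall>X\<in>S_P P. res_achievable_for \<gamma> \<delta> P X R" by simp
      show "ereal cap \<le> ereal R"
      proof (rule small)
        fix e :: real assume "0 < e" "e < 1" "2 * e < cap"
        then have "id_achievable \<gamma> 0 0 P (cap - 2 * e)" by (rule id_achievable_cap)
        from id_le_res[OF this R] show "ereal (cap - 2 * e) \<le> ereal R" using assms(7) by simp
      qed
    qed
  qed
qed

end

text \<open>\<open>nondeg\<close> excludes the zero process, which satisfies
  \<open>ANWGN_noise\<close> but has singular covariances and no density. Regularity enters through
  the positive lower bound for prediction errors, which makes the folded weight
  \<open>nice\<close>.\<close>

theorem theorem6p4:
  fixes M :: "'a measure" and Z :: "nat \<Rightarrow> 'a \<Rightarrow> real" and \<gamma> :: "int \<Rightarrow> real"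
    and g :: "real \<Rightarrow> real" and P \<epsilon> \<delta> \<mu> lam :: real
  assumes noise: "ANWGN_noise M Z \<gamma>" and nondeg: "\<gamma> 0 > 0"
    and spec: "spectral_density \<gamma> g" and P: "P > 0"
    and "0 \<le> \<epsilon>" "\<epsilon> < 1" "0 \<le> \<mu>" "0 \<le> lam" "\<mu> + lam < 1" "0 \<le> \<delta>" "\<delta> < 1"
  shows "Cs \<gamma> \<epsilon> P = Did \<gamma> \<mu> lam P \<and> Did \<gamma> \<mu> lam P = Sres \<gamma> \<delta> P \<and>
         Sres \<gamma> \<delta> P = Cs \<gamma> 0 P \<and>
         Cs \<gamma> 0 P = ereal (1 / (4 * pi) * (LBINT l=-pi..pi. ln (1 + wf g P l / g l)))"
proof -
  obtain S where S: "S > 0" "\<And>p. coeff p 0 = 1 \<Longrightarrow> S \<le> (\<integral>l. (cmod (ev p l))\<^sup>2 * Gs g l \<partial>U)"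
    using regular_prediction_bound[OF noise nondeg spec] by blast
  note ln_int = ln_integrable_of_prediction_bound[OF Gs_integrable[OF spec] Gs_nonneg[OF spec] S]
  interpret anwgn \<gamma> "Gs g" P "2 * pi * alpha_P g P"
  proof
    show "nice (Gs g)" unfolding nice_def using Gs_integrable[OF spec] Gs_nonneg[OF spec] ln_int by blast
    show "\<gamma> (int j - int i) = cv (Gs g) i j" for i j unfolding cv_def by (rule gamma_Gs[OF spec])
    show "P > 0" by fact
    show "2 * pi * alpha_P g P > 0" using alpha_P_Gs(1)[OF spec P] by simp
    show "(\<integral>l. max (2 * pi * alpha_P g P - Gs g l) 0 \<partial>U) = P" by (rule alpha_P_Gs(2)[OF spec P])
  qed
  have "1 / (4 * pi) * (LBINT l=-pi..pi. ln (1 + wf g P l / g l)) = cap"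
    unfolding cap_def by (rule capacity_Gs[OF spec P ln_int])
  then show ?thesis using coding_theorem assms(5-11) by simp
qed

end
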